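(* Let $k$ be an algebraically closed field of characteristic zero, and let $m\geq 0$ and $r\geq 1$ be integers. Let $T:\mathbb A^m_k\to\mathbb A^m_k$ be an affine-linear endomorphism, and choose $N\geq 0$ such that $S=T^N(\mathbb A^m)=T^{N+1}(\mathbb A^m)$. Let $M(u)\in\operatorname{GL}_r(k[u_1,\ldots,u_m])$, let $d\geq 2$ be an integer, and let $$0\neq\rho(u,\boldsymbol z)\in (z_1,\ldots,z_r)^{d-1}\,k[u_1,\ldots,u_m,z_1,\ldots,z_r].$$ Define $F:\mathbb A^{m+r}_k\to\mathbb A^{m+r}_k$ by $$F(u,\boldsymbol z)=\bigl(T(u),\ \rho(u,\boldsymbol z)M(u)\boldsymbol z\bigr).$$ On $S\times\mathbb A^r$ put $Z=S\times\{0\}$ and $$C=V\bigl(\det D_{\boldsymbol z}\bigl(\rho(u,\boldsymbol z)M(u)\boldsymbol z\bigr)\bigr)\subseteq S\times\mathbb A^r .$$ Suppose that for some $\ell\geq 1$ one has the set-theoretic inclusion $\bigl(F|_{S\times\mathbb A^r}\bigr)^\ell(C)\subseteq Z$. Then for every point $x\in\mathbb A^{m+r}(k)$ and every closed subvariety $V\subseteq\mathbb A^{m+r}_k$, the set $\{n\in\mathbb N_0: F^n(x)\in V\}$ is a finite union of arithmetic progressions.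
   Context: $\mathbb N_0=\{0,1,2,\ldots\}$. An arithmetic progression is a set $a+b\mathbb N_0=\{a+bn:n\in\mathbb N_0\}$ with $a,b\in\mathbb N_0$; $b=0$ is allowed and gives a singleton. $F^n$ is the $n$-th iterate, $F^0=\mathrm{id}$. Coordinates: $u=(u_1,\ldots,u_m)$ on the base $\mathbb A^m$ and $\boldsymbol z=(z_1,\ldots,z_r)$ (a column vector) on the fiber $\mathbb A^r$. $M(u)\in\operatorname{GL}_r(k[u_1,\ldots,u_m])$ means that $M$ and $M^{-1}$ both have polynomial entries. The ideal power $(z_1,\ldots,z_r)^{d-1}$ consists of the polynomials all of whose monomials have total degree at least $d-1$ in $z_1,\ldots,z_r$. $D_{\boldsymbol z}$ denotes the Jacobian matrix with respect to $z_1,\ldots,z_r$ with $u$ held fixed, and $V(h)$ denotes the zero set of $h$. The descending chain of affine subspaces $T^n(\mathbb A^m)$ stabilizes, so such an $N$ exists; $S$ is an affine subspace with $T(S)=S$ and $F$ maps $S\times\mathbb A^r$ into itself. *)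

theory Defs
  imports
    "HOL-Library.Poly_Mapping"
    "HOL-Computational_Algebra.Polynomial"
    "Jordan_Normal_Form.Determinant"
begin

text \<open>
  Polynomials in variables \<open>X\<^sub>0, X\<^sub>1, \<dots>\<close> are finitely supported functions from exponent vectors
  to coefficients, with the ring structure of \<open>Poly_Mapping\<close>. The coordinates are indexed
  consecutively: \<open>u\<^sub>1, \<dots>, u\<^sub>m\<close> are \<open>X\<^sub>0, \<dots>, X\<^bsub>m-1\<^esub>\<close> and \<open>z\<^sub>1, \<dots>, z\<^sub>r\<close> are
  \<open>X\<^sub>m, \<dots>, X\<^bsub>m+r-1\<^esub>\<close>. Accordingly a \<open>k\<close>-point \<open>(u, z)\<close> of affine \<open>(m+r)\<close>-space is the
  concatenated vector \<open>u @\<^sub>v z\<close>.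
\<close>

type_synonym 'k mpoly = "(nat \<Rightarrow>\<^sub>0 nat) \<Rightarrow>\<^sub>0 'k"

text \<open>The subring \<open>k[X\<^sub>0, \<dots>, X\<^bsub>n-1\<^esub>]\<close>.\<close>

definition polys :: "nat \<Rightarrow> 'k::comm_ring_1 mpoly set" where
  "polys n = {p. \<forall>a \<in> Poly_Mapping.keys p. Poly_Mapping.keys a \<subseteq> {..<n}}"

definition mvar :: "nat \<Rightarrow> 'k::comm_ring_1 mpoly" where
  "mvar i = Poly_Mapping.single (Poly_Mapping.single i 1) 1"

definition mpoly_eval :: "'k::comm_ring_1 vec \<Rightarrow> 'k mpoly \<Rightarrow> 'k" where
  "mpoly_eval x p =
     (\<Sum>a \<in> Poly_Mapping.keys p. Poly_Mapping.lookup p a *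
        (\<Prod>i \<in> Poly_Mapping.keys a. (x $ i) ^ Poly_Mapping.lookup a i))"

text \<open>
  The truncated subtraction of exponents is harmless: if \<open>X\<^sub>i\<close> does not occur in the monomial \<open>a\<close>,
  then the new coefficient is \<open>0\<close>.
\<close>

definition mpoly_deriv :: "nat \<Rightarrow> 'k::comm_ring_1 mpoly \<Rightarrow> 'k mpoly" where
  "mpoly_deriv i p =
     (\<Sum>a \<in> Poly_Mapping.keys p.
        Poly_Mapping.single (a - Poly_Mapping.single i 1)
          (of_nat (Poly_Mapping.lookup a i) * Poly_Mapping.lookup p a))"

text \<open>The ideal \<open>(z\<^sub>1, \<dots>, z\<^sub>r)\<^sup>e\<close> of \<open>k[u, z]\<close>.\<close>

definition z_ideal_power :: "nat \<Rightarrow> nat \<Rightarrow> nat \<Rightarrow> 'k::comm_ring_1 mpoly set" where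
  "z_ideal_power m r e =
     {p \<in> polys (m + r). \<forall>a \<in> Poly_Mapping.keys p. e \<le> (\<Sum>j<r. Poly_Mapping.lookup a (m + j))}"

text \<open>\<open>GL\<^sub>r(k[u\<^sub>1, \<dots>, u\<^sub>m])\<close>; the inverse is required to have entries in \<open>k[u]\<close> as well.\<close>

definition GL_polys :: "nat \<Rightarrow> nat \<Rightarrow> 'k::comm_ring_1 mpoly mat set" where
  "GL_polys r m =
     {M \<in> carrier_mat r r. elements_mat M \<subseteq> polys m \<and>
        (\<exists>M' \<in> carrier_mat r r. elements_mat M' \<subseteq> polys m \<and>
           inverts_mat M M' \<and> inverts_mat M' M)}"

definition affine_endo :: "nat \<Rightarrow> ('k::comm_ring_1 vec \<Rightarrow> 'k vec) \<Rightarrow> bool" where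
  "affine_endo m T \<longleftrightarrow>
     (\<exists>A \<in> carrier_mat m m. \<exists>b \<in> carrier_vec m. \<forall>u \<in> carrier_vec m. T u = A *\<^sub>v u + b)"

text \<open>The column \<open>\<rho>(u, z) M(u) z\<close> of polynomials and its Jacobian matrix with respect to \<open>z\<close>.\<close>

definition fiber_polys ::
    "nat \<Rightarrow> nat \<Rightarrow> 'k::comm_ring_1 mpoly \<Rightarrow> 'k mpoly mat \<Rightarrow> 'k mpoly vec" where
  "fiber_polys m r \<rho> M = \<rho> \<cdot>\<^sub>v (M *\<^sub>v vec r (\<lambda>j. mvar (m + j)))"

definition z_jacobian :: "nat \<Rightarrow> nat \<Rightarrow> 'k::comm_ring_1 mpoly vec \<Rightarrow> 'k mpoly mat" where
  "z_jacobian m r G = mat r r (\<lambda>(i, j). mpoly_deriv (m + j) (G $ i))"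

definition skew_map ::
    "nat \<Rightarrow> nat \<Rightarrow> ('k::comm_ring_1 vec \<Rightarrow> 'k vec) \<Rightarrow> 'k mpoly \<Rightarrow> 'k mpoly mat \<Rightarrow> 'k vec \<Rightarrow> 'k vec" where
  "skew_map m r T \<rho> M x =
     T (vec_first x m) @\<^sub>v map_vec (mpoly_eval x) (fiber_polys m r \<rho> M)"

text \<open>
  Closed subvarieties of affine \<open>n\<close>-space, as sets of \<open>k\<close>-points; they need not be irreducible.
\<close>

definition closed_subvariety :: "nat \<Rightarrow> 'k::comm_ring_1 vec set \<Rightarrow> bool" where
  "closed_subvariety n V \<longleftrightarrow>
     (\<exists>P \<subseteq> polys n. V = {x \<in> carrier_vec n. \<forall>p \<in> P. mpoly_eval x p = 0})"

definition arith_prog :: "nat set \<Rightarrow> bool" where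
  "arith_prog A \<longleftrightarrow> (\<exists>a b. A = {a + b * n | n. True})"

end

theory Submission
  imports Defs "HOL-Number_Theory.Cong"
begin

text \<open>
  Write a point over \<open>S\<close> as \<open>(u, \<lambda> w)\<close>. Then \<open>F\<close> lifts to \<open>(u, w, \<lambda>) \<mapsto> (T u, M(u) w, \<lambda> \<rho>(u, \<lambda> w))\<close>, where
  \<open>(u, w)\<close> moves by an automorphism because \<open>T\<close> is invertible on \<open>S\<close>. The derivative of the last
  component in \<open>\<lambda>\<close> is \<open>h = \<rho> + z \<cdot> \<nabla>\<^sub>z \<rho>\<close>, a factor of the Jacobian determinant, since \<open>z\<close> is a radial direction.
  If \<open>h\<close> vanishes at a point, the hypothesis forces \<open>\<rho>\<close> to vanish at one of its first \<open>l\<close> iterates, so by the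
  Nullstellensatz \<open>h\<close> divides a power of the product of the \<open>\<rho> \<circ> F\<^sup>i\<close> with \<open>i < l\<close>.

  Everything is defined over a finitely generated domain, whose elements are detected by homomorphisms to
  orders of number fields with good reduction at a fixed prime \<open>p\<close>. If \<open>\<lambda>\<close> stays a unit modulo \<open>p\<close> along the
  orbit, then so does \<open>h\<close>, the lifted map is etale modulo \<open>p\<close> along the orbit, and a fixed iterate of it can be
  interpolated \<open>p\<close>-adically, so that a polynomial with infinitely many zeros on a residue class of times
  vanishes on the whole class. Otherwise \<open>\<lambda>\<close> tends to \<open>0\<close> doubly exponentially in the \<open>p\<close>-adic absolute value,
  whereas the heights of \<open>(u, w)\<close> grow like \<open>exp (O n\<^sup>2)\<close>.
  Of a polynomial \<open>\<Sum>\<^sub>j \<lambda>\<^sup>j f\<^sub>j(u, w)\<close> that vanishes infinitely often on a class, the first \<open>f\<^sub>j\<close> which is not zero on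
  the class then vanishes infinitely often as well, and interpolating the automorphism gives a contradiction.
\<close>

section \<open>Subrings and polynomial functions\<close>

text \<open>One modulus must serve all equations of \<open>V\<close>, so the prime and the period
  are fixed before the equations are known; but a homomorphism that detects a given nonzero value
  has to be chosen for that value. Hence specializability fixes the rank and the prime first and
  lets only the homomorphism depend on the element to be detected. The period involves only
  \<open>p\<close>, the rank and the number of variables. Equations with coefficients outside the
  chosen ring are split into components over it. No completion and no number field is constructed:
  \<open>p\<close>-adic statements are congruences in \<open>Zloc p\<close>, a homomorphism is given
  by rational coordinates, and norms, which are determinants of rational matrices, turn vanishing
  into vanishing of rational numbers. The ideal condition on \<rho> enters as the absence of terms
  of z-degree 0: then \<lambda> divides \<rho>(u, \<lambda> w), and the exponent of \<lambda> at
  least doubles in each step. The critical locus is controlled only over \<open>S\<close>. As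
  \<open>S\<close> is the image of \<open>T ^^ N\<close>, composing with this iterate turns the
  implication on zeros into one on a full affine space, where the Nullstellensatz for one equation
  applies.\<close>

definition is_subring :: "'a::comm_ring_1 set \<Rightarrow> bool" where
  "is_subring R \<longleftrightarrow> 1 \<in> R \<and> (\<forall>x\<in>R. \<forall>y\<in>R. x - y \<in> R \<and> x * y \<in> R)"

lemma is_subring_UNIV: "is_subring UNIV"
  by (simp add: is_subring_def)

context
  fixes R :: "'a::comm_ring_1 set"
  assumes R: "is_subring R"
begin

lemma subring_one: "1 \<in> R" and subring_diff: "x \<in> R \<Longrightarrow> y \<in> R \<Longrightarrow> x - y \<in> R"
  and subring_mult: "x \<in> R \<Longrightarrow> y \<in> R \<Longrightarrow> x * y \<in> R"
  using R by (auto simp: is_subring_def)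

lemma subring_zero: "0 \<in> R"
  using subring_diff[OF subring_one subring_one] by simp

lemma subring_uminus: "x \<in> R \<Longrightarrow> - x \<in> R"
  using subring_diff[OF subring_zero] by fastforce

lemma subring_add: "x \<in> R \<Longrightarrow> y \<in> R \<Longrightarrow> x + y \<in> R"
  using subring_diff[of x "- y"] subring_uminus by fastforce

lemma subring_power: "x \<in> R \<Longrightarrow> x ^ n \<in> R"
  by (induction n) (auto intro: subring_one subring_mult)

lemma subring_sum: "(\<And>i. i \<in> I \<Longrightarrow> f i \<in> R) \<Longrightarrow> sum f I \<in> R"
  by (induction I rule: infinite_finite_induct) (auto intro: subring_zero subring_add)

lemma subring_prod: "(\<And>i. i \<in> I \<Longrightarrow> f i \<in> R) \<Longrightarrow> prod f I \<in> R"
  by (induction I rule: infinite_finite_induct) (auto intro: subring_one subring_mult)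

lemma subring_of_nat: "of_nat n \<in> R"
  by (induction n) (auto intro: subring_zero subring_one subring_add)

lemma subring_of_int: "of_int n \<in> R"
  by (cases n rule: int_cases2) (auto intro: subring_of_nat subring_uminus)

lemmas subring_intros = subring_one subring_diff subring_mult subring_zero subring_uminus
  subring_add subring_power subring_sum subring_prod subring_of_nat subring_of_int

end

text \<open>Polynomial functions instead of formal polynomials: congruences, Taylor expansions,
  heights and the passage to coordinates can then be proved by induction on how a function is built.
  The index type may be infinite; where finitely many variables matter, the others are kept at
  0.\<close>

inductive_set polyfun :: "'a::comm_ring_1 set \<Rightarrow> (('i \<Rightarrow> 'a) \<Rightarrow> 'a) set"
  for R :: "'a set" where
  polyfun_const: "c \<in> R \<Longrightarrow> (\<lambda>s. c) \<in> polyfun R"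
| polyfun_var: "(\<lambda>s. s i) \<in> polyfun R"
| polyfun_add: "f \<in> polyfun R \<Longrightarrow> g \<in> polyfun R \<Longrightarrow> (\<lambda>s. f s + g s) \<in> polyfun R"
| polyfun_mult: "f \<in> polyfun R \<Longrightarrow> g \<in> polyfun R \<Longrightarrow> (\<lambda>s. f s * g s) \<in> polyfun R"

lemma polyfun_mono: "R \<subseteq> R' \<Longrightarrow> f \<in> polyfun R \<Longrightarrow> f \<in> polyfun R'"
  by (rotate_tac, induction rule: polyfun.induct) (auto intro: polyfun.intros)

text \<open>Allows the certificate of the Nullstellensatz, a polynomial over all of
  \<open>k\<close>, to be moved into a subring that contains finitely many prescribed
  elements.\<close>

lemma polyfun_finite_consts:
  "f \<in> polyfun R \<Longrightarrow> \<exists>A. finite A \<and> A \<subseteq> R \<and> f \<in> polyfun A"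
proof (induction rule: polyfun.induct)
  case (polyfun_const c)
  then show ?case by (intro exI[of _ "{c}"]) (auto intro: polyfun.intros)
next
  case (polyfun_var i)
  then show ?case by (intro exI[of _ "{}"]) (auto intro: polyfun.intros)
next
  case (polyfun_add f g)
  then obtain A B where "finite A" "A \<subseteq> R" "f \<in> polyfun A" "finite B" "B \<subseteq> R" "g \<in> polyfun B" by blast
  then show ?case
    by (intro exI[of _ "A \<union> B"]) (auto intro!: polyfun.polyfun_add intro: polyfun_mono[of A] polyfun_mono[of B])
next
  case (polyfun_mult f g)
  then obtain A B where "finite A" "A \<subseteq> R" "f \<in> polyfun A" "finite B" "B \<subseteq> R" "g \<in> polyfun B" by blast
  then show ?case
    by (intro exI[of _ "A \<union> B"]) (auto intro!: polyfun.polyfun_mult intro: polyfun_mono[of A] polyfun_mono[of B])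
qed

lemma polyfun_compose:
  assumes "f \<in> polyfun R" and "\<And>i. g i \<in> polyfun R"
  shows "(\<lambda>s. f (\<lambda>i. g i s)) \<in> polyfun R"
  using assms(1) by induction (auto intro: polyfun.intros assms(2))

lemma polyfun_values:
  assumes "f \<in> polyfun R" and "is_subring R" and "\<And>i. s i \<in> R"
  shows "f s \<in> R"
  using assms(1) by induction (auto intro: subring_intros assms(2,3))

context
  fixes R :: "'a::comm_ring_1 set"
  assumes R: "is_subring R"
begin

lemma polyfun_uminus:
  assumes "f \<in> polyfun R" shows "(\<lambda>s. - f s) \<in> polyfun R"
  using polyfun_mult[OF polyfun_const[of "-1" R] assms] subring_uminus[OF R subring_one[OF R]] by simp

lemma polyfun_diff: "f \<in> polyfun R \<Longrightarrow> g \<in> polyfun R \<Longrightarrow> (\<lambda>s. f s - g s) \<in> polyfun R"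
  using polyfun_add[OF _ polyfun_uminus, of f g] by simp

lemma polyfun_sum:
  "(\<And>j. j \<in> I \<Longrightarrow> f j \<in> polyfun R) \<Longrightarrow> (\<lambda>s. \<Sum>j\<in>I. f j s) \<in> polyfun R"
  by (induction I rule: infinite_finite_induct)
    (auto intro: polyfun_add polyfun_const subring_zero[OF R])

lemma polyfun_prod:
  "(\<And>j. j \<in> I \<Longrightarrow> f j \<in> polyfun R) \<Longrightarrow> (\<lambda>s. \<Prod>j\<in>I. f j s) \<in> polyfun R"
  by (induction I rule: infinite_finite_induct)
    (auto intro: polyfun_mult polyfun_const subring_one[OF R])

lemma polyfun_power: "f \<in> polyfun R \<Longrightarrow> (\<lambda>s. f s ^ n) \<in> polyfun R"
  by (induction n) (auto intro: polyfun_mult polyfun_const subring_one[OF R])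

lemmas polyfun_intros = polyfun.intros polyfun_uminus polyfun_diff polyfun_sum polyfun_prod
  polyfun_power

end

section \<open>The localization of the integers at a prime\<close>

definition Zloc :: "nat \<Rightarrow> rat set" where
  "Zloc p = {x. \<exists>a b. x = of_int a / of_int b \<and> \<not> int p dvd b}"

text \<open>The ideal generated by \<open>p ^ e\<close> in \<open>Zloc p\<close>. Membership
  replaces the bound \<open>e\<close> on the \<open>p\<close>-adic valuation and needs no special
  value at 0.\<close>

definition Zpow :: "nat \<Rightarrow> nat \<Rightarrow> rat set" where
  "Zpow p e = {of_nat p ^ e * x | x. x \<in> Zloc p}"

lemma ZlocI: "\<not> int p dvd b \<Longrightarrow> of_int a / of_int b \<in> Zloc p"
  unfolding Zloc_def by blast

lemma ZlocE:
  assumes "x \<in> Zloc p"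
  obtains a b where "x = of_int a / of_int b" "\<not> int p dvd b"
  using assms unfolding Zloc_def by blast

lemma Zloc_of_int: "1 < p \<Longrightarrow> of_int a \<in> Zloc p"
  using ZlocI[of p 1 a] by simp

lemma is_subring_Zloc:
  assumes p: "prime p" shows "is_subring (Zloc p)"
proof -
  have "x - y \<in> Zloc p \<and> x * y \<in> Zloc p" if "x \<in> Zloc p" "y \<in> Zloc p" for x y
  proof -
    obtain a b where x: "x = of_int a / of_int b" "\<not> int p dvd b" using \<open>x \<in> Zloc p\<close> by (rule ZlocE)
    obtain c d where y: "y = of_int c / of_int d" "\<not> int p dvd d" using \<open>y \<in> Zloc p\<close> by (rule ZlocE)
    note * = x y
    then have "b \<noteq> 0" "d \<noteq> 0" by auto
    moreover have "\<not> int p dvd b * d" using * p by (simp add: prime_dvd_mult_iff)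
    moreover have "x - y = of_int (a * d - c * b) / of_int (b * d)"
      using \<open>b \<noteq> 0\<close> \<open>d \<noteq> 0\<close> x(1) y(1) by (simp add: diff_frac_eq)
    moreover have "x * y = of_int (a * c) / of_int (b * d)" using * by simp
    ultimately show ?thesis by (metis (mono_tags, lifting) Zloc_def mem_Collect_eq)
  qed
  moreover have "1 \<in> Zloc p" using Zloc_of_int[of p 1] p prime_gt_1_nat by simp
  ultimately show ?thesis by (auto simp: is_subring_def)
qed

context
  fixes p :: nat
  assumes p: "prime p"
begin

lemmas Zloc_intros = subring_intros[OF is_subring_Zloc[OF p]]

lemma Zpow_0: "Zpow p 0 = Zloc p"
  by (auto simp: Zpow_def)

lemma Zpow_zero: "0 \<in> Zpow p e"
  unfolding Zpow_def using Zloc_intros(4) by force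

lemma Zpow_diff: "x \<in> Zpow p e \<Longrightarrow> y \<in> Zpow p e \<Longrightarrow> x - y \<in> Zpow p e"
  unfolding Zpow_def by (auto simp flip: right_diff_distrib intro: Zloc_intros)

lemma Zpow_uminus: "x \<in> Zpow p e \<Longrightarrow> - x \<in> Zpow p e"
  using Zpow_diff[OF Zpow_zero] by fastforce

lemma Zpow_add: "x \<in> Zpow p e \<Longrightarrow> y \<in> Zpow p e \<Longrightarrow> x + y \<in> Zpow p e"
  using Zpow_diff[of x e "- y"] Zpow_uminus by fastforce

lemma Zpow_sum: "(\<And>i. i \<in> I \<Longrightarrow> f i \<in> Zpow p e) \<Longrightarrow> sum f I \<in> Zpow p e"
  by (induction I rule: infinite_finite_induct) (auto intro: Zpow_zero Zpow_add)

lemma Zpow_mult: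
  assumes "x \<in> Zpow p e" "y \<in> Zpow p e'" shows "x * y \<in> Zpow p (e + e')"
proof -
  obtain a b where "x = of_nat p ^ e * a" "y = of_nat p ^ e' * b" "a \<in> Zloc p" "b \<in> Zloc p"
    using assms by (auto simp: Zpow_def)
  then show ?thesis unfolding Zpow_def
    by (auto intro!: exI[of _ "a * b"] Zloc_intros simp: power_add)
qed

lemma Zpow_mult_left: "x \<in> Zloc p \<Longrightarrow> y \<in> Zpow p e \<Longrightarrow> x * y \<in> Zpow p e"
  using Zpow_mult[of x 0 y e] by (simp add: Zpow_0)

lemma Zpow_mult_right: "y \<in> Zpow p e \<Longrightarrow> x \<in> Zloc p \<Longrightarrow> y * x \<in> Zpow p e"
  using Zpow_mult_left by (simp add: mult.commute)

lemma Zpow_antimono: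
  assumes "e \<le> e'" "x \<in> Zpow p e'" shows "x \<in> Zpow p e"
proof -
  obtain a where "x = of_nat p ^ e' * a" "a \<in> Zloc p" using assms by (auto simp: Zpow_def)
  moreover have "(of_nat p :: rat) ^ e' = of_nat p ^ e * of_nat p ^ (e' - e)"
    using assms(1) by (simp flip: power_add)
  ultimately show ?thesis unfolding Zpow_def
    by (auto intro!: exI[of _ "of_nat p ^ (e' - e) * a"] Zloc_intros)
qed

lemma Zpow_p_mult: "x \<in> Zpow p e \<Longrightarrow> of_nat p * x \<in> Zpow p (Suc e)"
  unfolding Zpow_def by force

lemma Zpow_p_mult_iff: "of_nat p * x \<in> Zpow p (Suc e) \<longleftrightarrow> x \<in> Zpow p e"
  using p by (auto simp: Zpow_def prime_gt_0_nat)

lemma Zpow_of_int: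
  assumes "of_int a \<in> Zpow p e" shows "int p ^ e dvd a"
proof -
  obtain b c where "of_int a = (of_nat p :: rat) ^ e * (of_int b / of_int c)" and c: "\<not> int p dvd c"
    using assms by (auto simp: Zpow_def Zloc_def)
  then have "(of_int (a * c) :: rat) = of_int (int p ^ e * b)"
    by (auto simp: field_simps)
  then have "a * c = int p ^ e * b" by (simp only: of_int_eq_iff)
  then have "int p ^ e dvd a * c" by simp
  moreover have "coprime (int p ^ e) c" using p c prime_imp_coprime[of "int p" c] by auto
  ultimately show ?thesis using coprime_dvd_mult_left_iff by blast
qed

lemma Zpow_of_int_iff: "of_int a \<in> Zpow p e \<longleftrightarrow> int p ^ e dvd a"
proof
  assume "int p ^ e dvd a"
  then obtain b where "a = int p ^ e * b" by blast
  then show "of_int a \<in> Zpow p e"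
    unfolding Zpow_def using Zloc_intros(11)[of b] by auto
qed (rule Zpow_of_int)

lemma Zloc_residue:
  assumes "x \<in> Zloc p"
  obtains a where "a \<in> {0..<int p}" "x - of_int a \<in> Zpow p 1"
proof -
  obtain u v where uv: "x = of_int u / of_int v" "\<not> int p dvd v" using assms by (auto simp: Zloc_def)
  have "coprime v (int p)" using uv p by (metis coprime_commute prime_imp_coprime prime_nat_int_transfer)
  then obtain w where w: "[v * w = 1] (mod int p)" using cong_solve_coprime_int by blast
  define a where "a = (u * w) mod int p"
  have "[v * a = v * w * u] (mod int p)" unfolding a_def by (metis cong_def mod_mult_right_eq mult.assoc mult.commute)
  also have "[v * w * u = u] (mod int p)" using w by (metis cong_scalar_right mult_1)
  finally have "int p dvd u - v * a" by (metis cong_iff_dvd_diff cong_sym)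
  then obtain t where "u - v * a = int p * t" by blast
  then have "(of_int u - of_int v * of_int a :: rat) = of_nat p * of_int t" by (metis of_int_diff of_int_mult of_int_of_nat_eq)
  then have "x - of_int a = of_nat p ^ 1 * (of_int t / of_int v)"
    using uv by (cases "v = 0") (auto simp: field_simps)
  then have "x - of_int a \<in> Zpow p 1" using ZlocI[OF uv(2)] by (auto simp only: Zpow_def)
  moreover have "a \<in> {0..<int p}" using p by (simp add: a_def prime_gt_0_nat)
  ultimately show ?thesis using that by blast
qed

text \<open>A numerator \<open>u\<close> cannot be divisible by \<open>p ^ e\<close> with
  \<open>e = \<bar>u\<bar>\<close>, because \<open>e < p ^ e\<close>.\<close>

lemma Zpow_Inter:
  assumes "x \<in> Zloc p" "x \<noteq> 0" obtains e where "x \<notin> Zpow p e"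
proof -
  obtain u v where uv: "x = of_int u / of_int v" "\<not> int p dvd v" using assms by (auto simp: Zloc_def)
  then have u: "u \<noteq> 0" "v \<noteq> 0" using assms by auto
  define e where "e = nat \<bar>u\<bar>"
  have "x \<notin> Zpow p e"
  proof
    assume "x \<in> Zpow p e"
    then have "of_int v * x \<in> Zpow p e" by (intro Zpow_mult_left Zloc_of_int prime_gt_1_nat p)
    then have "int p ^ e dvd u" using uv u by (simp add: Zpow_of_int_iff)
    then have "int p ^ e \<le> \<bar>u\<bar>" using u dvd_imp_le_int[of u "int p ^ e"] by simp
    moreover have "e < p ^ e" using p by (intro power_gt_expt prime_gt_Suc_0_nat)
    then have "int e < int p ^ e" by (metis of_nat_less_iff of_nat_power)
    ultimately show False using u by (simp add: e_def)
  qed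
  then show ?thesis using that by blast
qed

end

subsection \<open>Strassmann's theorem for Mahler series\<close>

text \<open>Legendre's recursion: with \<open>q = j div p\<close>, the multiplicity in
  \<open>j!\<close> is \<open>q\<close> plus that in \<open>q!\<close>, and
  \<open>3 * q \<le> j\<close> closes the induction. For \<open>p = 2\<close> the bound fails at
  \<open>j = 4\<close>. It leaves about half of the \<open>j\<close> factors \<open>p\<close> in
  \<open>p ^ j / fact j\<close>, enough for convergence.\<close>

lemma multiplicity_fact_le:
  fixes p :: nat
  assumes p: "prime p" "p \<ge> 3"
  shows "multiplicity p (fact j :: nat) \<le> j div 2"
proof -
  have step: "multiplicity p (fact (Suc n) :: nat) = multiplicity p (Suc n) + multiplicity p (fact n :: nat)" for n
    using p by (simp add: prime_elem_multiplicity_mult_distrib del: mult_Suc)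
  have below: "multiplicity p (fact (p * q + r) :: nat) = multiplicity p (fact (p * q) :: nat)" if "r < p" for q r
    using that
  proof (induction r)
    case (Suc r)
    have "\<not> p dvd Suc (p * q + r)"
      using Suc.prems dvd_add_right_iff[of p "p * q" "Suc r"] nat_dvd_not_less by force
    then show ?case using Suc step[of "p * q + r"] by (simp add: not_dvd_imp_multiplicity_0 del: fact_Suc)
  qed simp
  have mult: "multiplicity p (fact (p * q) :: nat) = q + multiplicity p (fact q :: nat)" for q
  proof (induction q)
    case (Suc q)
    have "p * Suc q = Suc (p * q + (p - 1))" using p by (simp add: algebra_simps)
    then have "multiplicity p (fact (p * Suc q) :: nat) = multiplicity p (p * Suc q) + multiplicity p (fact (p * q) :: nat)"
      using step[of "p * q + (p - 1)"] below[of "p - 1" q] p by simp (simp add: add.commute)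
    also have "multiplicity p (p * Suc q) = 1 + multiplicity p (Suc q)"
      using p by (simp add: prime_elem_multiplicity_mult_distrib del: mult_Suc mult_Suc_right)
    finally show ?case using Suc step[of q] by simp
  qed simp
  show ?thesis
  proof (induction j rule: less_induct)
    case (less j)
    show ?case
    proof (cases "j < p")
      case True
      then have "\<not> p dvd (fact j :: nat)" using prime_dvd_fact_iff[OF p(1)] by simp
      then show ?thesis by (simp add: not_dvd_imp_multiplicity_0)
    next
      case False
      define q where "q = j div p"
      have j: "j = p * q + j mod p" "j mod p < p" using p by (simp_all add: q_def)
      have "3 * q \<le> p * q" using p by simp
      then have q: "3 * q \<le> j" using j by linarith
      moreover have "q \<noteq> 0" using False p by (simp add: q_def div_eq_0_iff)
      ultimately have "q < j" by simp
      have "multiplicity p (fact j :: nat) = q + multiplicity p (fact q :: nat)"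
        using mult below j by metis
      also have "\<dots> \<le> q + q div 2" using less.IH[OF \<open>q < j\<close>] by simp
      also have "\<dots> \<le> j div 2" using q by linarith
      finally show ?thesis .
    qed
  qed
qed

lemma prime_power_over_fact:
  assumes p: "prime p" "p \<ge> 3"
  shows "of_nat p ^ j / fact j \<in> Zpow p (j - j div 2)"
proof -
  define v where "v = multiplicity p (fact j :: nat)"
  have v: "v \<le> j div 2" using multiplicity_fact_le[OF p] by (simp add: v_def)
  obtain d where d: "(fact j :: nat) = p ^ v * d" "\<not> p dvd d"
    using multiplicity_decompose'[of "fact j" p] p by (auto simp: v_def)
  have "(fact j :: rat) = of_nat (fact j)" by simp
  also have "\<dots> = of_nat p ^ v * of_nat d" by (simp only: d of_nat_mult of_nat_power)
  finally have f: "(fact j :: rat) = of_nat p ^ v * of_nat d" .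
  have "(of_nat p :: rat) ^ j = of_nat p ^ v * of_nat p ^ (j - v)" using v by (simp flip: power_add)
  then have "(of_nat p :: rat) ^ j / fact j = of_nat p ^ (j - v) * (of_int 1 / of_int (int d))"
    using p by (simp add: f prime_gt_0_nat)
  moreover have "of_int 1 / of_int (int d) \<in> Zloc p" using d by (intro ZlocI) auto
  ultimately have "of_nat p ^ j / fact j \<in> Zpow p (j - v)" unfolding Zpow_def by blast
  then show ?thesis using v Zpow_antimono[OF p(1), of "j - j div 2" "j - v"] by simp
qed

text \<open>Synthetic division read from the top: each coefficient of \<open>Q\<close> is the next
  higher coefficient of the product plus \<open>a\<close> times the next higher coefficient of
  \<open>Q\<close>.\<close>

lemma Zpow_poly_cofactor:
  fixes Q :: "rat poly"
  assumes p: "prime p" and a: "a \<in> Zloc p"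
    and P: "\<forall>j\<ge>Suc k. coeff ([:-a, 1:] * Q) j \<in> Zpow p e"
  shows "\<forall>j\<ge>k. coeff Q j \<in> Zpow p e"
proof (intro allI impI)
  fix j assume "k \<le> j"
  then show "coeff Q j \<in> Zpow p e"
  proof (induction "degree Q + 1 - j" arbitrary: j)
    case 0
    then have "coeff Q j = 0" by (intro coeff_eq_0) simp
    then show ?case using Zpow_zero[OF p] by simp
  next
    case (Suc i)
    have "coeff ([:-a, 1:] * Q) (Suc j) = coeff Q j - a * coeff Q (Suc j)" by simp
    then have "coeff Q j = coeff ([:-a, 1:] * Q) (Suc j) + a * coeff Q (Suc j)" by simp
    moreover have "coeff Q (Suc j) \<in> Zpow p e" using Suc by (intro Suc(1)) auto
    moreover have "coeff ([:-a, 1:] * Q) (Suc j) \<in> Zpow p e" using P Suc.prems by blast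
    ultimately show ?case using a by (metis Zpow_add[OF p] Zpow_mult_left[OF p])
  qed
qed

text \<open>Finite form of Strassmann's theorem. Dividing by one root lowers by one the index from
  which all coefficients are divisible by \<open>p ^ e\<close>; after \<open>card A\<close> roots
  the whole cofactor is.\<close>

lemma Zpow_poly_roots:
  fixes P :: "rat poly"
  assumes p: "prime p" and A: "finite A" "\<And>a. a \<in> A \<Longrightarrow> poly P a = 0" "A \<subseteq> Zloc p"
    and P: "\<forall>j\<ge>card A. coeff P j \<in> Zpow p e" and x: "x \<in> Zloc p"
  shows "poly P x \<in> Zpow p e"
  using A P
proof (induction A arbitrary: P rule: finite_induct)
  case empty
  then show ?case
    unfolding poly_altdef by (auto intro!: Zpow_sum[OF p] Zpow_mult_right[OF p] Zloc_intros[OF p] x)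
next
  case (insert a A)
  obtain Q where Q: "P = [:-a, 1:] * Q" using insert.prems by (metis insertI1 poly_eq_0_iff_dvd dvdE)
  have "poly Q x \<in> Zpow p e"
  proof (rule insert.IH)
    show "poly Q b = 0" if "b \<in> A" for b
      using insert that Q by fastforce
    show "\<forall>j\<ge>card A. coeff Q j \<in> Zpow p e"
      using insert Q by (intro Zpow_poly_cofactor[OF p]) auto
  qed (use insert in auto)
  moreover have "poly P x = (x - a) * poly Q x" by (simp add: Q algebra_simps)
  ultimately show ?case using insert.prems x by (simp add: Zpow_mult_left[OF p] Zloc_intros[OF p])
qed

text \<open>The falling factorial has integral coefficients; the denominator \<open>fact j\<close>
  of the binomial polynomial is kept apart, to be absorbed by \<open>p ^ j\<close>.\<close>

lemma falling_poly:
  fixes n :: nat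
  assumes p: "prime p"
  defines "F \<equiv> \<lambda>j. \<Prod>i<j. [:- of_nat i, 1:] :: rat poly"
  shows "coeff (F j) i \<in> Zloc p" "i > j \<Longrightarrow> coeff (F j) i = 0"
    "poly (F j) (of_nat n) = fact j * of_nat (n choose j)"
proof -
  show "coeff (F j) i \<in> Zloc p"
  proof (induction j arbitrary: i)
    case 0
    then show ?case by (simp add: F_def Zloc_intros[OF p])
  next
    case (Suc j)
    have "F (Suc j) = [:- of_nat j, 1:] * F j" by (simp add: F_def mult.commute)
    then show ?case using Suc
      by (auto simp: coeff_pCons split: nat.splits intro!: Zloc_intros[OF p])
  qed
  have "degree (F j) = j"
    unfolding F_def by (subst degree_prod_eq_sum_degree) auto
  then show "i > j \<Longrightarrow> coeff (F j) i = 0" by (simp add: coeff_eq_0)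
  have "poly (F j) (of_nat n) = (\<Prod>i<j. of_nat n - of_nat i)"
    by (simp add: F_def poly_prod)
  also have "\<dots> = fact j * (of_nat n gchoose j)"
    by (simp add: gbinomial_prod_rev atLeast0LessThan)
  finally show "poly (F j) (of_nat n) = fact j * of_nat (n choose j)"
    by (simp add: binomial_gbinomial)
qed

text \<open>A nonzero value lies outside some \<open>Zpow p e\<close>. A long enough partial sum of
  the series is a polynomial with as many zeros as needed, and \<open>Zpow_poly_roots\<close> forces
  all its values into \<open>Zpow p e\<close>.\<close>

lemma mahler_strassmann:
  fixes c y :: "nat \<Rightarrow> rat"
  assumes p: "prime p" "p \<ge> 3" and c: "\<And>i. c i \<in> Zloc p"
    and y: "\<And>n. y n = (\<Sum>i\<le>n. of_nat (n choose i) * of_nat p ^ i * c i)"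
    and inf: "infinite {n. y n = 0}"
  shows "y n = 0"
proof (rule ccontr)
  assume n: "y n \<noteq> 0"
  have "y n \<in> Zloc p" unfolding y by (intro Zloc_intros[OF p(1)] c)
  then obtain e where e: "y n \<notin> Zpow p e" using Zpow_Inter[OF p(1)] n by blast
  obtain A where A: "finite A" "card A = 2 * e" "A \<subseteq> {n. y n = 0}"
    using infinite_arbitrarily_large[OF inf] by blast
  \<comment> \<open>Truncating at \<open>N\<close> changes nothing at \<open>n\<close> and at the
    chosen zeros, since \<open>m choose j\<close> vanishes for \<open>j > m\<close>. There are
    \<open>2 * e\<close> zeros because coefficients of index at least \<open>2 * e\<close> come only
    from terms with \<open>j \<ge> 2 * e\<close>, where \<open>p ^ j / fact j\<close> lies in
    \<open>Zpow p e\<close>.\<close>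
  define N where "N = Max (insert n A)"
  define F :: "nat \<Rightarrow> rat poly" where "F j = (\<Prod>i<j. [:- of_nat i, 1:])" for j
  define P where "P = (\<Sum>j\<le>N. smult (of_nat p ^ j / fact j * c j) (F j))"
  note F = falling_poly[OF p(1), folded F_def]
  have poly: "poly P (of_nat m) = y m" if "m \<le> N" for m
  proof -
    have "poly P (of_nat m) = (\<Sum>j\<le>N. of_nat (m choose j) * of_nat p ^ j * c j)"
      unfolding P_def poly_sum poly_smult F(3) by (simp add: mult_ac)
    also have "\<dots> = y m"
      unfolding y using that by (intro sum.mono_neutral_right) (auto simp: binomial_eq_0)
    finally show ?thesis .
  qed
  have "poly P (of_nat n) \<in> Zpow p e"
  proof (rule Zpow_poly_roots[OF p(1), of "of_nat ` A"])
    show "poly P a = 0" if "a \<in> of_nat ` A" for a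
      using that A poly by (auto simp: N_def)
    have "coeff (smult (of_nat p ^ j / fact j * c j) (F j)) i \<in> Zpow p e" if "2 * e \<le> i" for i j
    proof (cases "i > j")
      case True
      then show ?thesis using F(2) by (simp add: Zpow_zero p)
    next
      case False
      have "of_nat p ^ j / fact j \<in> Zpow p e"
        by (rule Zpow_antimono[OF p(1) _ prime_power_over_fact[OF p]]) (use that False in linarith)
      then have "of_nat p ^ j / fact j * (c j * coeff (F j) i) \<in> Zpow p e" using F(1) c
        by (intro Zpow_mult_right[OF p(1)] Zloc_intros[OF p(1)])
      then show ?thesis by (simp only: coeff_smult mult.assoc)
    qed
    then show "\<forall>i\<ge>card (of_nat ` A :: rat set). coeff P i \<in> Zpow p e"
      using A by (auto simp: P_def coeff_sum card_image inj_on_def intro!: Zpow_sum[OF p(1)])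
  qed (use A in \<open>auto intro: Zloc_intros[OF p(1)]\<close>)
  then show False using poly[of n] e A by (simp add: N_def)
qed

section \<open>Interpolation of orbits that are etale modulo \<open>p\<close>\<close>

text \<open>By pigeonhole a period of length at most \<open>P\<close> has begun by time
  \<open>P\<close>, and it divides \<open>fact P\<close>. So this period and this start work for
  every such sequence.\<close>

lemma eventually_periodic_fact:
  fixes \<tau> :: "nat \<Rightarrow> 'b"
  assumes \<Omega>: "finite \<Omega>" "card \<Omega> \<le> P" "\<And>n. \<tau> n \<in> \<Omega>"
    and det: "\<And>m n. \<tau> m = \<tau> n \<Longrightarrow> \<tau> (Suc m) = \<tau> (Suc n)"
    and a: "P \<le> a"
  shows "\<tau> (a + fact P) = \<tau> a"
proof -
  have "\<not> inj_on \<tau> {..P}"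
  proof
    assume "inj_on \<tau> {..P}"
    then have "card {..P} \<le> card \<Omega>" using \<Omega> by (intro card_inj_on_le[of \<tau>]) auto
    then show False using \<Omega> by simp
  qed
  then obtain i j where ij: "i < j" "j \<le> P" "\<tau> i = \<tau> j"
    unfolding inj_on_def by (metis atMost_iff linorder_neqE_nat)
  have shift: "\<tau> (i + k) = \<tau> (j + k)" for k
    using ij(3) by (induction k) (auto dest: det)
  have per: "\<tau> (n + (j - i)) = \<tau> n" if "i \<le> n" for n
    using shift[of "n - i"] that ij by (simp add: algebra_simps)
  have mult: "\<tau> (n + k * (j - i)) = \<tau> n" if "i \<le> n" for n k
  proof (induction k)
    case (Suc k)
    have "n + Suc k * (j - i) = n + k * (j - i) + (j - i)" by simp
    then show ?case using per[of "n + k * (j - i)"] that Suc by (metis trans_le_add1)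
  qed simp
  have "j - i dvd fact P" using ij by (intro dvd_fact) auto
  then obtain k where "fact P = k * (j - i)" by (metis dvd_def mult.commute)
  then show ?thesis using mult[of a k] a ij by simp
qed

text \<open>Injectivity cancels the preperiod left by
  \<open>eventually_periodic_fact\<close>.\<close>

lemma funpow_fact_eq_id:
  assumes "finite \<Omega>" "card \<Omega> \<le> P" "inj_on f \<Omega>" "f ` \<Omega> \<subseteq> \<Omega>" "x \<in> \<Omega>"
  shows "(f ^^ fact P) x = x"
proof -
  have stay: "(f ^^ n) y \<in> \<Omega>" if "y \<in> \<Omega>" for n y
    using assms(4) that by (induction n) auto
  have "(f ^^ (P + fact P)) x = (f ^^ P) x"
    by (rule eventually_periodic_fact[where \<Omega> = \<Omega>]) (use assms stay in auto)
  then have "(f ^^ P) ((f ^^ fact P) x) = (f ^^ P) x" by (simp add: funpow_add)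
  moreover have "inj_on (f ^^ n) \<Omega>" for n
  proof (induction n)
    case (Suc n)
    then show ?case using assms(3) stay by (auto simp: inj_on_def)
  qed (simp add: inj_on_def)
  ultimately show ?thesis using stay[OF assms(5)] assms(5) by (meson inj_onD)
qed

definition Zeq :: "nat \<Rightarrow> nat \<Rightarrow> ('i \<Rightarrow> rat) \<Rightarrow> ('i \<Rightarrow> rat) \<Rightarrow> bool" where
  "Zeq p e x y \<longleftrightarrow> (\<forall>i. x i - y i \<in> Zpow p e)"

context
  fixes p :: nat
  assumes p: "prime p"
begin

lemmas Zpow_closed = Zpow_zero[OF p] Zpow_diff[OF p] Zpow_uminus[OF p] Zpow_add[OF p] Zpow_sum[OF p]
  Zpow_mult_left[OF p] Zpow_mult_right[OF p]

lemma Zeq_sym: "Zeq p e x y \<Longrightarrow> Zeq p e y x"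
  unfolding Zeq_def using Zpow_closed(3) by fastforce

lemma Zeq_trans: "Zeq p e x y \<Longrightarrow> Zeq p e y z \<Longrightarrow> Zeq p e x z"
  unfolding Zeq_def using Zpow_add[OF p] by (metis diff_add_cancel add_diff_eq)

lemma polyfun_Zpow_cong:
  assumes "f \<in> polyfun (Zloc p)" and xy: "\<And>i. x i \<in> Zloc p" "\<And>i. y i \<in> Zloc p" "Zeq p e x y"
  shows "f x - f y \<in> Zpow p e"
  using assms(1)
proof induction
  case (polyfun_mult f g)
  have "f x * g x - f y * g y = f x * (g x - g y) + (f x - f y) * g y"
    by (simp add: algebra_simps)
  moreover have "f x \<in> Zloc p" "g y \<in> Zloc p"
    using polyfun_mult.hyps xy by (auto intro: polyfun_values[OF _ is_subring_Zloc[OF p]])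
  ultimately show ?case using polyfun_mult.IH
    by (simp add: Zpow_add[OF p] Zpow_mult_left[OF p] Zpow_mult_right[OF p])
next
  case (polyfun_add f g)
  then have "(f x - f y) + (g x - g y) \<in> Zpow p e" by (intro Zpow_add[OF p])
  then show ?case by (simp add: algebra_simps)
qed (use xy in \<open>auto simp: Zeq_def Zpow_closed\<close>)

text \<open>All terms of order at least two in the displacement carry \<open>p ^ 2\<close> and are
  collected in \<open>r\<close>. Displacements vanish outside the finite set \<open>X\<close>, so
  that the linear part is a finite sum.\<close>

lemma polyfun_taylor:
  assumes "f \<in> polyfun (Zloc p)" "finite X" and b: "\<And>i. b i \<in> Zloc p"
  shows "\<exists>B r. (\<forall>i. B i \<in> Zloc p) \<and> r \<in> polyfun (Zloc p) \<and>
    (\<forall>y. (\<forall>i. i \<notin> X \<longrightarrow> y i = 0) \<longrightarrow>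
      f (\<lambda>i. b i + of_nat p * y i) = f b + of_nat p * (\<Sum>i\<in>X. B i * y i) + of_nat p ^ 2 * r y)"
  using assms(1)
proof induction
  case (polyfun_const c)
  then show ?case
    by (intro exI[of _ "\<lambda>_. 0"]) (auto intro: polyfun.intros Zloc_intros[OF p])
next
  case (polyfun_var i)
  show ?case
    using assms(2)
    by (intro exI[of _ "\<lambda>j. if j = i then 1 else 0"] exI[of _ "\<lambda>_. 0"])
      (auto intro: polyfun.intros Zloc_intros[OF p] simp: if_distrib[of "\<lambda>x. x * _"] cong: if_cong)
next
  case (polyfun_add f g)
  from polyfun_add.IH(1) obtain B1 r1 where f:
    "\<forall>i. B1 i \<in> Zloc p" "r1 \<in> polyfun (Zloc p)"
    "\<forall>y. (\<forall>i. i \<notin> X \<longrightarrow> y i = 0) \<longrightarrow> f (\<lambda>i. b i + of_nat p * y i) = f b + of_nat p * (\<Sum>i\<in>X. B1 i * y i) + of_nat p ^ 2 * r1 y"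
    by (elim exE conjE)
  from polyfun_add.IH(2) obtain B2 r2 where g:
    "\<forall>i. B2 i \<in> Zloc p" "r2 \<in> polyfun (Zloc p)"
    "\<forall>y. (\<forall>i. i \<notin> X \<longrightarrow> y i = 0) \<longrightarrow> g (\<lambda>i. b i + of_nat p * y i) = g b + of_nat p * (\<Sum>i\<in>X. B2 i * y i) + of_nat p ^ 2 * r2 y"
    by (elim exE conjE)
  note * = f(1)[rule_format] f(2) f(3)[THEN spec, THEN mp] g(1)[rule_format] g(2) g(3)[THEN spec, THEN mp]
  have eq: "f (\<lambda>i. b i + of_nat p * y i) + g (\<lambda>i. b i + of_nat p * y i)
      = f b + g b + of_nat p * (\<Sum>i\<in>X. (B1 i + B2 i) * y i) + of_nat p ^ 2 * (r1 y + r2 y)"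
    if y: "\<forall>i. i \<notin> X \<longrightarrow> y i = 0" for y
    unfolding *(3)[OF y] *(6)[OF y] by (simp add: distrib_left distrib_right sum.distrib)
  show ?case
  proof (intro exI conjI allI impI)
    show "(\<lambda>y. r1 y + r2 y) \<in> polyfun (Zloc p)" using * by (intro polyfun.intros)
    show "B1 i + B2 i \<in> Zloc p" for i using * by (intro Zloc_intros[OF p])
  qed (rule eq)
next
  case (polyfun_mult f g)
  from polyfun_mult.IH(1) obtain B1 r1 where f:
    "\<forall>i. B1 i \<in> Zloc p" "r1 \<in> polyfun (Zloc p)"
    "\<forall>y. (\<forall>i. i \<notin> X \<longrightarrow> y i = 0) \<longrightarrow> f (\<lambda>i. b i + of_nat p * y i) = f b + of_nat p * (\<Sum>i\<in>X. B1 i * y i) + of_nat p ^ 2 * r1 y"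
    by (elim exE conjE)
  from polyfun_mult.IH(2) obtain B2 r2 where g:
    "\<forall>i. B2 i \<in> Zloc p" "r2 \<in> polyfun (Zloc p)"
    "\<forall>y. (\<forall>i. i \<notin> X \<longrightarrow> y i = 0) \<longrightarrow> g (\<lambda>i. b i + of_nat p * y i) = g b + of_nat p * (\<Sum>i\<in>X. B2 i * y i) + of_nat p ^ 2 * r2 y"
    by (elim exE conjE)
  note * = f(1)[rule_format] f(2) f(3)[THEN spec, THEN mp] g(1)[rule_format] g(2) g(3)[THEN spec, THEN mp]
  have fg: "f b \<in> Zloc p" "g b \<in> Zloc p"
    using polyfun_mult.hyps b by (auto intro: polyfun_values[OF _ is_subring_Zloc[OF p]])
  define L1 where "L1 = (\<lambda>y. \<Sum>i\<in>X. B1 i * y i)"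
  define L2 where "L2 = (\<lambda>y. \<Sum>i\<in>X. B2 i * y i)"
  have L: "L1 \<in> polyfun (Zloc p)" "L2 \<in> polyfun (Zloc p)"
    unfolding L1_def L2_def using * by (auto intro!: polyfun_intros[OF is_subring_Zloc[OF p]])
  define r where "r = (\<lambda>y. f b * r2 y + g b * r1 y + L1 y * L2 y + of_nat p * (L1 y * r2 y)
    + of_nat p * (r1 y * L2 y) + of_nat p ^ 2 * (r1 y * r2 y))"
  have "r \<in> polyfun (Zloc p)" unfolding r_def
    using * L fg by (intro polyfun_intros[OF is_subring_Zloc[OF p]] Zloc_intros[OF p])
  moreover have "\<forall>i. f b * B2 i + g b * B1 i \<in> Zloc p"
    using *(1,4) fg by (intro allI Zloc_intros[OF p])
  moreover have "f (\<lambda>i. b i + of_nat p * y i) * g (\<lambda>i. b i + of_nat p * y i)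
      = f b * g b + of_nat p * (\<Sum>i\<in>X. (f b * B2 i + g b * B1 i) * y i) + of_nat p ^ 2 * r y"
    if y: "\<forall>i. i \<notin> X \<longrightarrow> y i = 0" for y
  proof -
    have "(\<Sum>i\<in>X. (f b * B2 i + g b * B1 i) * y i) = f b * L2 y + g b * L1 y"
      by (simp add: L1_def L2_def algebra_simps sum.distrib sum_distrib_left)
    moreover have "f (\<lambda>i. b i + of_nat p * y i) = f b + of_nat p * L1 y + of_nat p ^ 2 * r1 y"
      "g (\<lambda>i. b i + of_nat p * y i) = g b + of_nat p * L2 y + of_nat p ^ 2 * r2 y"
      using *(3)[OF y] *(6)[OF y] by (simp_all add: L1_def L2_def)
    ultimately show ?thesis by (simp add: r_def algebra_simps power2_eq_square)
  qed
  ultimately show ?case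
    by (intro exI[of _ "\<lambda>i. f b * B2 i + g b * B1 i"] exI[of _ r]) simp
qed

end

text \<open>Injectivity modulo \<open>p\<^sup>2\<close> on the residue discs of the orbit stands in for the Jacobian being a
  unit modulo \<open>p\<close> along the orbit.\<close>

locale etale_orbit =
  fixes p :: nat and X :: "'i set" and F :: "('i \<Rightarrow> rat) \<Rightarrow> 'i \<Rightarrow> rat" and s0 :: "'i \<Rightarrow> rat" and P :: nat
  assumes p: "prime p" "p \<ge> 3" and X: "finite X" and P: "P = p ^ card X"
    and F_polyfun: "\<And>i. (\<lambda>s. F s i) \<in> polyfun (Zloc p)"
    and F_outside: "\<And>s i. i \<notin> X \<Longrightarrow> F s i = 0"
    and s0: "\<And>i. s0 i \<in> Zloc p" "\<And>i. i \<notin> X \<Longrightarrow> s0 i = 0"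
    and etale: "\<And>n y y'. (\<And>i. i \<notin> X \<Longrightarrow> y i = 0) \<Longrightarrow> (\<And>i. i \<notin> X \<Longrightarrow> y' i = 0) \<Longrightarrow>
      Zeq p 2 (F (\<lambda>i. (F ^^ n) s0 i + of_nat p * of_int (y i))) (F (\<lambda>i. (F ^^ n) s0 i + of_nat p * of_int (y' i))) \<Longrightarrow>
      Zeq p 1 (\<lambda>i. of_int (y i)) (\<lambda>i. of_int (y' i))"
begin

abbreviation s :: "nat \<Rightarrow> 'i \<Rightarrow> rat" where "s n \<equiv> (F ^^ n) s0"

definition pt :: "('i \<Rightarrow> rat) \<Rightarrow> bool" where
  "pt x \<longleftrightarrow> (\<forall>i. x i \<in> Zloc p) \<and> (\<forall>i. i \<notin> X \<longrightarrow> x i = 0)"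

lemmas p1 = p(1)
lemmas PF_intros = polyfun_intros[OF is_subring_Zloc[OF p1]]
lemmas PF_values = polyfun_values[OF _ is_subring_Zloc[OF p1]]

lemma pt_F: "pt x \<Longrightarrow> pt (F x)"
  using PF_values[OF F_polyfun] F_outside by (auto simp: pt_def)

lemma pt_funpow: "pt x \<Longrightarrow> pt ((F ^^ n) x)"
  by (induction n) (auto intro: pt_F)

lemma pt_s: "pt (s n)"
  by (rule pt_funpow) (use s0 in \<open>auto simp: pt_def\<close>)

lemma F_cong: "pt x \<Longrightarrow> pt y \<Longrightarrow> Zeq p e x y \<Longrightarrow> Zeq p e (F x) (F y)"
  using polyfun_Zpow_cong[OF p1 F_polyfun, of x y e] by (auto simp: pt_def Zeq_def)

lemma funpow_cong: "pt x \<Longrightarrow> pt y \<Longrightarrow> Zeq p e x y \<Longrightarrow> Zeq p e ((F ^^ n) x) ((F ^^ n) y)"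
  by (induction n) (auto intro!: F_cong pt_funpow)

text \<open>The locale assumes injectivity only for integer displacements. Modulo
  \<open>p ^ 2\<close> these reach every point of the residue disc, since a displacement divided by
  \<open>p\<close> matters only modulo \<open>p\<close>.\<close>

lemma disc_point:
  assumes "pt x" "Zeq p 1 x (s n)"
  obtains y :: "'i \<Rightarrow> int" where "\<And>i. i \<notin> X \<Longrightarrow> y i = 0"
    "Zeq p 2 x (\<lambda>i. s n i + of_nat p * of_int (y i))" "pt (\<lambda>i. s n i + of_nat p * of_int (y i))"
proof -
  have "\<exists>y. (i \<notin> X \<longrightarrow> y = 0) \<and> x i - (s n i + of_nat p * of_int y) \<in> Zpow p 2" for i
  proof (cases "i \<in> X")
    case True
    have "x i - s n i \<in> Zpow p 1" using assms(2) by (simp add: Zeq_def)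
    then obtain z where z: "x i - s n i = of_nat p * z" "z \<in> Zloc p" by (auto simp: Zpow_def)
    obtain a where "z - of_int a \<in> Zpow p 1" using Zloc_residue[OF p1 z(2)] by blast
    then have "of_nat p * (z - of_int a) \<in> Zpow p 2" using Zpow_p_mult[OF p1, of _ 1] by (simp add: numeral_2_eq_2)
    moreover have "of_nat p * (z - of_int a) = x i - (s n i + of_nat p * of_int a)"
      using z by (simp add: algebra_simps)
    ultimately show ?thesis using True by metis
  next
    case False
    then show ?thesis using assms(1) pt_s[of n] by (auto simp: pt_def Zpow_zero[OF p1])
  qed
  then obtain y where y: "\<And>i. i \<notin> X \<Longrightarrow> y i = 0" "\<And>i. x i - (s n i + of_nat p * of_int (y i)) \<in> Zpow p 2"
    by metis
  moreover have "pt (\<lambda>i. s n i + of_nat p * of_int (y i))"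
    using pt_s[of n] y(1) by (auto simp: pt_def intro!: Zloc_intros[OF p1])
  ultimately show ?thesis using that by (auto simp: Zeq_def)
qed

lemma F_inj:
  assumes x: "pt x" "Zeq p 1 x (s n)" and x': "pt x'" "Zeq p 1 x' (s n)" and eq: "Zeq p 2 (F x) (F x')"
  shows "Zeq p 2 x x'"
proof -
  obtain y where y: "\<And>i. i \<notin> X \<Longrightarrow> y i = 0" "Zeq p 2 x (\<lambda>i. s n i + of_nat p * of_int (y i))"
    "pt (\<lambda>i. s n i + of_nat p * of_int (y i))" using disc_point[OF x] by blast
  obtain y' where y': "\<And>i. i \<notin> X \<Longrightarrow> y' i = 0" "Zeq p 2 x' (\<lambda>i. s n i + of_nat p * of_int (y' i))"
    "pt (\<lambda>i. s n i + of_nat p * of_int (y' i))" using disc_point[OF x'] by blast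
  have "Zeq p 2 (F (\<lambda>i. s n i + of_nat p * of_int (y i))) (F (\<lambda>i. s n i + of_nat p * of_int (y' i)))"
    using eq F_cong[OF x(1) y(3,2)] F_cong[OF x'(1) y'(3,2)] Zeq_trans[OF p1] Zeq_sym[OF p1] by blast
  then have "Zeq p 1 (\<lambda>i. of_int (y i)) (\<lambda>i. of_int (y' i))"
    by (intro etale[of y y' n]) (use y y' in auto)
  then have "of_nat p * (of_int (y i) - of_int (y' i)) \<in> Zpow p 2" for i
    using Zpow_p_mult[OF p1, of _ 1] by (simp add: numeral_2_eq_2 Zeq_def)
  then have "Zeq p 2 (\<lambda>i. s n i + of_nat p * of_int (y i)) (\<lambda>i. s n i + of_nat p * of_int (y' i))"
    by (simp add: Zeq_def algebra_simps)
  then show ?thesis using y(2) y'(2) Zeq_trans[OF p1] Zeq_sym[OF p1] by blast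
qed

lemma funpow_inj:
  assumes x: "pt x" "Zeq p 1 x (s a)" and x': "pt x'" "Zeq p 1 x' (s a)"
    and eq: "Zeq p 2 ((F ^^ n) x) ((F ^^ n) x')"
  shows "Zeq p 2 x x'"
  using eq
proof (induction n)
  case (Suc n)
  have near: "Zeq p 1 ((F ^^ n) z) (s (n + a))" if "pt z" "Zeq p 1 z (s a)" for z
    using funpow_cong[OF that(1) pt_s that(2), of n] by (simp add: funpow_add)
  have "Zeq p 2 (F ((F ^^ n) x)) (F ((F ^^ n) x'))" using Suc.prems by simp
  then show ?case
    by (intro Suc.IH F_inj[OF pt_funpow[OF x(1)] near[OF x] pt_funpow[OF x'(1)] near[OF x']])
qed simp

definition res :: "rat \<Rightarrow> int" where
  "res x = (SOME a. a \<in> {0..<int p} \<and> x - of_int a \<in> Zpow p 1)"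

lemma res: "x \<in> Zloc p \<Longrightarrow> res x \<in> {0..<int p} \<and> x - of_int (res x) \<in> Zpow p 1"
  unfolding res_def by (rule someI_ex) (use Zloc_residue[OF p1] in blast)

lemma res_eq_iff:
  assumes "x \<in> Zloc p" "y \<in> Zloc p" shows "res x = res y \<longleftrightarrow> x - y \<in> Zpow p 1"
proof
  assume "res x = res y"
  then show "x - y \<in> Zpow p 1"
    using Zpow_diff[OF p1, of "x - of_int (res x)" 1 "y - of_int (res y)"] res[OF assms(1)] res[OF assms(2)]
    by simp
next
  assume "x - y \<in> Zpow p 1"
  moreover have "of_int (res x - res y) = (x - y) - (x - of_int (res x)) + (y - of_int (res y))"
    by simp
  ultimately have "of_int (res x - res y) \<in> Zpow p 1"
    using res assms by (metis Zpow_add[OF p1] Zpow_diff[OF p1])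
  then have "int p dvd res x - res y" by (simp only: Zpow_of_int_iff[OF p1] power_one_right)
  then show "res x = res y" using res[OF assms(1)] res[OF assms(2)]
    by (auto simp flip: mod_eq_dvd_iff)
qed

definition resv :: "('i \<Rightarrow> rat) \<Rightarrow> 'i \<Rightarrow> int" where "resv x = restrict (\<lambda>i. res (x i)) X"

definition \<Omega> :: "('i \<Rightarrow> int) set" where "\<Omega> = X \<rightarrow>\<^sub>E {0..<int p}"

lemma \<Omega>: "finite \<Omega>" "card \<Omega> = P"
  using X by (auto simp: \<Omega>_def P card_PiE intro: finite_PiE)

lemma resv_\<Omega>: "pt x \<Longrightarrow> resv x \<in> \<Omega>"
  using res by (auto simp: pt_def resv_def \<Omega>_def)

lemma resv_eq_iff: assumes "pt x" "pt y" shows "resv x = resv y \<longleftrightarrow> Zeq p 1 x y"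
proof -
  have "resv x = resv y \<longleftrightarrow> (\<forall>i\<in>X. res (x i) = res (y i))"
    by (auto simp: resv_def restrict_def fun_eq_iff)
  also have "\<dots> \<longleftrightarrow> (\<forall>i\<in>X. x i - y i \<in> Zpow p 1)"
    using assms by (simp add: pt_def res_eq_iff)
  also have "\<dots> \<longleftrightarrow> Zeq p 1 x y"
  proof -
    have "x i - y i \<in> Zpow p 1" if "i \<notin> X" for i
      using assms that Zpow_zero[OF p1] by (simp add: pt_def)
    then show ?thesis unfolding Zeq_def by blast
  qed
  finally show ?thesis .
qed

lemma orbit_periodic_mod_p:
  assumes "P \<le> a" shows "Zeq p 1 (s (a + fact P)) (s a)"
proof -
  have "resv (s (a + fact P)) = resv (s a)"
  proof (rule eventually_periodic_fact[where \<Omega> = \<Omega>])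
    show "resv (s (Suc m)) = resv (s (Suc n))" if "resv (s m) = resv (s n)" for m n
      using that F_cong[OF pt_s pt_s] by (simp add: resv_eq_iff pt_s pt_F)
  qed (use \<Omega> resv_\<Omega>[OF pt_s] assms in auto)
  then show ?thesis by (simp add: resv_eq_iff pt_s)
qed

end

section \<open>Return maps on residue discs and interpolation of the orbit\<close>

context etale_orbit
begin

text \<open>Affine modulo \<open>p\<close>, with the remainder an explicit polynomial multiple of
  \<open>p\<close>. Such a function is determined modulo \<open>p\<close>, as a polynomial, by its
  values at 0 and the unit vectors. For general polynomials this fails: \<open>y ^ p - y\<close>
  vanishes at all residues without being divisible by \<open>p\<close>.\<close>

definition affine_mod :: "(('i \<Rightarrow> rat) \<Rightarrow> rat) set" where
  "affine_mod = {\<phi>. \<exists>\<beta> B r. \<beta> \<in> Zloc p \<and> (\<forall>i. B i \<in> Zloc p) \<and> r \<in> polyfun (Zloc p) \<and>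
    (\<forall>y. \<phi> y = \<beta> + (\<Sum>i\<in>X. B i * y i) + of_nat p * r y)}"

lemma affine_mod_I:
  assumes "\<beta> \<in> Zloc p" "\<And>i. B i \<in> Zloc p" "r \<in> polyfun (Zloc p)"
    "\<And>y. \<phi> y = \<beta> + (\<Sum>i\<in>X. B i * y i) + of_nat p * r y"
  shows "\<phi> \<in> affine_mod"
  using assms unfolding affine_mod_def by blast

lemma affine_mod_E:
  assumes "\<phi> \<in> affine_mod"
  obtains \<beta> B r where "\<beta> \<in> Zloc p" "\<And>i. B i \<in> Zloc p" "r \<in> polyfun (Zloc p)"
    "\<And>y. \<phi> y = \<beta> + (\<Sum>i\<in>X. B i * y i) + of_nat p * r y"
  using assms unfolding affine_mod_def by blast

lemma affine_mod_polyfun: "\<phi> \<in> affine_mod \<Longrightarrow> \<phi> \<in> polyfun (Zloc p)"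
proof (elim affine_mod_E)
  fix \<beta> B r assume *: "\<beta> \<in> Zloc p" "\<And>i. B i \<in> Zloc p" "r \<in> polyfun (Zloc p)"
    "\<And>y. \<phi> y = \<beta> + (\<Sum>i\<in>X. B i * y i) + of_nat p * r y"
  have "(\<lambda>y. \<beta> + (\<Sum>i\<in>X. B i * y i) + of_nat p * r y) \<in> polyfun (Zloc p)"
    using *(1-3) by (intro PF_intros Zloc_intros[OF p1])
  then show "\<phi> \<in> polyfun (Zloc p)" by (simp add: *(4)[abs_def])
qed

lemma affine_mod_const: "c \<in> Zloc p \<Longrightarrow> (\<lambda>_. c) \<in> affine_mod"
  by (rule affine_mod_I[of c "\<lambda>_. 0" "\<lambda>_. 0"]) (auto intro: polyfun.intros Zloc_intros[OF p1])

lemma affine_mod_var: "i \<in> X \<Longrightarrow> (\<lambda>y. y i) \<in> affine_mod"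
  by (rule affine_mod_I[of 0 "\<lambda>j. if j = i then 1 else 0" "\<lambda>_. 0"])
    (use X in \<open>auto intro: polyfun.intros Zloc_intros[OF p1] simp: if_distrib[of "\<lambda>x. x * _"] cong: if_cong\<close>)

lemma affine_mod_add: assumes "\<phi> \<in> affine_mod" "\<psi> \<in> affine_mod" shows "(\<lambda>y. \<phi> y + \<psi> y) \<in> affine_mod"
proof -
  obtain \<beta> B r where 1: "\<beta> \<in> Zloc p" "\<And>i. B i \<in> Zloc p" "r \<in> polyfun (Zloc p)"
    "\<And>y. \<phi> y = \<beta> + (\<Sum>i\<in>X. B i * y i) + of_nat p * r y" using assms(1) by (rule affine_mod_E) blast
  obtain \<beta>' B' r' where 2: "\<beta>' \<in> Zloc p" "\<And>i. B' i \<in> Zloc p" "r' \<in> polyfun (Zloc p)"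
    "\<And>y. \<psi> y = \<beta>' + (\<Sum>i\<in>X. B' i * y i) + of_nat p * r' y" using assms(2) by (rule affine_mod_E) blast
  show ?thesis
  proof (rule affine_mod_I[of "\<beta> + \<beta>'" "\<lambda>i. B i + B' i" "\<lambda>y. r y + r' y"])
    show "\<phi> y + \<psi> y = \<beta> + \<beta>' + (\<Sum>i\<in>X. (B i + B' i) * y i) + of_nat p * (r y + r' y)" for y
      unfolding 1(4) 2(4) by (simp add: algebra_simps sum.distrib)
  qed (use 1(1-3) 2(1-3) in \<open>auto intro: polyfun.intros Zloc_intros[OF p1]\<close>)
qed

lemma affine_mod_cmult: assumes "\<phi> \<in> affine_mod" "c \<in> Zloc p" shows "(\<lambda>y. c * \<phi> y) \<in> affine_mod"
proof -
  obtain \<beta> B r where 1: "\<beta> \<in> Zloc p" "\<And>i. B i \<in> Zloc p" "r \<in> polyfun (Zloc p)"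
    "\<And>y. \<phi> y = \<beta> + (\<Sum>i\<in>X. B i * y i) + of_nat p * r y" using assms(1) by (rule affine_mod_E) blast
  show ?thesis
  proof (rule affine_mod_I[of "c * \<beta>" "\<lambda>i. c * B i" "\<lambda>y. c * r y"])
    show "c * \<phi> y = c * \<beta> + (\<Sum>i\<in>X. c * B i * y i) + of_nat p * (c * r y)" for y
      unfolding 1(4) by (simp add: algebra_simps sum_distrib_left)
  qed (use 1(1-3) assms(2) in \<open>auto intro: polyfun.intros Zloc_intros[OF p1]\<close>)
qed

lemma affine_mod_sum: "finite I \<Longrightarrow> (\<And>j. j \<in> I \<Longrightarrow> \<phi> j \<in> affine_mod) \<Longrightarrow> (\<lambda>y. \<Sum>j\<in>I. \<phi> j y) \<in> affine_mod"
  by (induction I rule: finite_induct) (auto intro: affine_mod_const affine_mod_add Zloc_intros[OF p1])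

lemma affine_mod_p_polyfun: "r \<in> polyfun (Zloc p) \<Longrightarrow> (\<lambda>y. of_nat p * r y) \<in> affine_mod"
  by (rule affine_mod_I[of 0 "\<lambda>_. 0" r]) (auto intro: Zloc_intros[OF p1])

lemma affine_mod_compose:
  assumes "\<phi> \<in> affine_mod" "\<And>i. i \<in> X \<Longrightarrow> (\<lambda>y. g y i) \<in> affine_mod" "\<And>i. (\<lambda>y. g y i) \<in> polyfun (Zloc p)"
  shows "(\<lambda>y. \<phi> (g y)) \<in> affine_mod"
proof -
  obtain \<beta> B r where 1: "\<beta> \<in> Zloc p" "\<And>i. B i \<in> Zloc p" "r \<in> polyfun (Zloc p)"
    "\<And>y. \<phi> y = \<beta> + (\<Sum>i\<in>X. B i * y i) + of_nat p * r y" using assms(1) by (rule affine_mod_E) blast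
  have "(\<lambda>y. r (\<lambda>i. g y i)) \<in> polyfun (Zloc p)" by (rule polyfun_compose[OF 1(3) assms(3)])
  then have "(\<lambda>y. \<beta> + (\<Sum>i\<in>X. B i * g y i) + of_nat p * r (g y)) \<in> affine_mod"
    using 1 X assms(2) by (intro affine_mod_add affine_mod_const affine_mod_sum affine_mod_cmult affine_mod_p_polyfun) auto
  then show ?thesis by (simp add: 1(4))
qed

text \<open>In the coordinate \<open>y\<close> of the disc around \<open>s a\<close>, periodicity
  modulo \<open>p\<close> makes the constant term of the iterate divisible by \<open>p\<close>.
  Dividing the Taylor expansion by \<open>p\<close> leaves an affine part and turns the remainder
  \<open>p ^ 2 * r\<close> into \<open>p * r\<close>.\<close>

lemma return_map:
  assumes a: "P \<le> a"
  obtains f where "\<And>i. (\<lambda>y. f y i) \<in> affine_mod" "\<And>i y. i \<notin> X \<Longrightarrow> f y i = 0"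
    "\<And>y. (\<And>i. i \<notin> X \<Longrightarrow> y i = 0) \<Longrightarrow>
      (F ^^ fact P) (\<lambda>i. s a i + of_nat p * y i) = (\<lambda>i. s a i + of_nat p * f y i)"
proof -
  have poly: "(\<lambda>x. (F ^^ n) x i) \<in> polyfun (Zloc p)" for n i
  proof (induction n arbitrary: i)
    case (Suc n)
    show ?case using polyfun_compose[OF F_polyfun Suc.IH] by simp
  qed (simp add: polyfun.intros)
  let ?\<Phi> = "F ^^ fact P"
  have "\<exists>\<phi>. \<phi> \<in> affine_mod \<and> (\<forall>y. (\<forall>i. i \<notin> X \<longrightarrow> y i = 0) \<longrightarrow> ?\<Phi> (\<lambda>i. s a i + of_nat p * y i) i = s a i + of_nat p * \<phi> y)"
    if "i \<in> X" for i
  proof -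
    obtain B r where B: "\<forall>i. B i \<in> Zloc p" "r \<in> polyfun (Zloc p)"
      "\<forall>y. (\<forall>i. i \<notin> X \<longrightarrow> y i = 0) \<longrightarrow>
        ?\<Phi> (\<lambda>i. s a i + of_nat p * y i) i = ?\<Phi> (s a) i + of_nat p * (\<Sum>i\<in>X. B i * y i) + of_nat p ^ 2 * r y"
      using polyfun_taylor[OF p1 poly[of "fact P" i] X, of "s a"] pt_s[of a] by (auto simp: pt_def)
    have "?\<Phi> (s a) i - s a i \<in> Zpow p 1"
      using orbit_periodic_mod_p[OF a] by (simp add: Zeq_def funpow_add add.commute[of a])
    then obtain \<beta> where \<beta>: "?\<Phi> (s a) i = s a i + of_nat p * \<beta>" "\<beta> \<in> Zloc p"
      by (auto simp: Zpow_def algebra_simps)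
    have "(\<lambda>y. \<beta> + (\<Sum>i\<in>X. B i * y i) + of_nat p * r y) \<in> affine_mod"
      by (rule affine_mod_I[OF \<beta>(2) _ B(2)]) (use B in auto)
    then show ?thesis using B(3) \<beta>(1)
      by (intro exI[of _ "\<lambda>y. \<beta> + (\<Sum>i\<in>X. B i * y i) + of_nat p * r y"])
        (simp add: algebra_simps power2_eq_square)
  qed
  then have "\<forall>i\<in>X. \<exists>\<phi>. \<phi> \<in> affine_mod \<and>
      (\<forall>y. (\<forall>i. i \<notin> X \<longrightarrow> y i = 0) \<longrightarrow> ?\<Phi> (\<lambda>i. s a i + of_nat p * y i) i = s a i + of_nat p * \<phi> y)" ..
  from bchoice[OF this] obtain \<phi> where "\<forall>i\<in>X. \<phi> i \<in> affine_mod \<and>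
      (\<forall>y. (\<forall>i. i \<notin> X \<longrightarrow> y i = 0) \<longrightarrow> ?\<Phi> (\<lambda>i. s a i + of_nat p * y i) i = s a i + of_nat p * \<phi> i y)" ..
  then have \<phi>: "\<And>i. i \<in> X \<Longrightarrow> \<phi> i \<in> affine_mod"
    "\<And>i y. i \<in> X \<Longrightarrow> (\<And>i. i \<notin> X \<Longrightarrow> y i = 0) \<Longrightarrow> ?\<Phi> (\<lambda>i. s a i + of_nat p * y i) i = s a i + of_nat p * \<phi> i y"
    by simp_all
  define f where "f y i = (if i \<in> X then \<phi> i y else 0)" for y i
  show ?thesis
  proof (rule that)
    show "(\<lambda>y. f y i) \<in> affine_mod" for i
      using \<phi>(1) affine_mod_const[of 0] by (cases "i \<in> X") (auto simp: f_def Zloc_intros[OF p1])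
    show "f y i = 0" if "i \<notin> X" for i y using that by (simp add: f_def)
    show "?\<Phi> (\<lambda>i. s a i + of_nat p * y i) = (\<lambda>i. s a i + of_nat p * f y i)"
      if y: "\<And>i. i \<notin> X \<Longrightarrow> y i = 0" for y
    proof
      fix i
      have "(F ^^ n) x i = 0" if "i \<notin> X" "x i = 0" for n x
        using that F_outside by (cases n) auto
      then show "?\<Phi> (\<lambda>i. s a i + of_nat p * y i) i = s a i + of_nat p * f y i"
        using \<phi>(2)[OF _ y] y[of i] pt_s[of a] by (cases "i \<in> X") (auto simp: f_def pt_def)
    qed
  qed
qed

text \<open>The return map permutes the finitely many residues of the disc, so a further iterate is
  congruent to the identity, as a polynomial map, because it is affine modulo \<open>p\<close>.\<close>

lemma return_map_near_id:
  assumes a: "P \<le> a"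
  obtains \<psi> E where "\<And>i. (\<lambda>y. \<psi> y i) \<in> polyfun (Zloc p)" "\<And>i. E i \<in> polyfun (Zloc p)"
    "\<And>i y. i \<in> X \<Longrightarrow> \<psi> y i = y i + of_nat p * E i y" "\<And>i y. i \<notin> X \<Longrightarrow> \<psi> y i = 0"
    "\<And>y. (\<And>i. i \<notin> X \<Longrightarrow> y i = 0) \<Longrightarrow>
      (F ^^ (fact P * fact P)) (\<lambda>i. s a i + of_nat p * y i) = (\<lambda>i. s a i + of_nat p * \<psi> y i)"
proof -
  obtain f where f: "\<And>i. (\<lambda>y. f y i) \<in> affine_mod" "\<And>i y. i \<notin> X \<Longrightarrow> f y i = 0"
    "\<And>y. (\<And>i. i \<notin> X \<Longrightarrow> y i = 0) \<Longrightarrow>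
      (F ^^ fact P) (\<lambda>i. s a i + of_nat p * y i) = (\<lambda>i. s a i + of_nat p * f y i)"
    using return_map[OF a] by blast
  define lift :: "('i \<Rightarrow> int) \<Rightarrow> 'i \<Rightarrow> rat" where "lift v i = (if i \<in> X then of_int (v i) else 0)" for v i
  have lift: "pt (lift v)" for v by (auto simp: pt_def lift_def Zloc_intros[OF p1])
  have pt_f: "pt (f y)" if "pt y" for y
    using that f(2) PF_values[OF affine_mod_polyfun[OF f(1)]] by (auto simp: pt_def)
  have pt_fn: "pt ((f ^^ n) y)" if "pt y" for n y
    using that by (induction n) (auto intro: pt_f)
  have f_cong: "Zeq p 1 (f y) (f y')" if "pt y" "pt y'" "Zeq p 1 y y'" for y y'
    using polyfun_Zpow_cong[OF p1 affine_mod_polyfun[OF f(1)], of y y' 1] that by (auto simp: pt_def Zeq_def)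
  have lift_resv: "Zeq p 1 (lift (resv y)) y" if "pt y" for y
  proof -
    have "y i - of_int (res (y i)) \<in> Zpow p 1" for i using res that by (simp add: pt_def)
    then have "- (y i - of_int (res (y i))) \<in> Zpow p 1" for i by (rule Zpow_uminus[OF p1])
    then show ?thesis using that
      by (auto simp: Zeq_def lift_def resv_def pt_def Zpow_zero[OF p1])
  qed
  have resv_lift: "resv (lift v) = v" if "v \<in> \<Omega>" for v
  proof -
    have "res (of_int (v i)) = v i" if "i \<in> X" for i
    proof -
      have vi: "v i \<in> {0..<int p}" using \<open>v \<in> \<Omega>\<close> that by (auto simp: \<Omega>_def)
      have "of_int (v i) - of_int (res (of_int (v i))) \<in> Zpow p 1" "res (of_int (v i)) \<in> {0..<int p}"
        using res[of "of_int (v i)"] by (auto simp: Zloc_intros[OF p1])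
      then have "of_int (v i - res (of_int (v i))) \<in> Zpow p 1" by simp
      then have "int p dvd v i - res (of_int (v i))"
        by (simp only: Zpow_of_int_iff[OF p1] power_one_right)
      then show ?thesis using vi \<open>res (of_int (v i)) \<in> {0..<int p}\<close> by (auto simp flip: mod_eq_dvd_iff)
    qed
    then show ?thesis using that
      by (auto simp: resv_def lift_def \<Omega>_def fun_eq_iff restrict_def PiE_def extensional_def)
  qed
  define fb where "fb v = resv (f (lift v))" for v
  have fb_iter: "(fb ^^ n) v = resv ((f ^^ n) (lift v))" if "v \<in> \<Omega>" for n v
  proof (induction n)
    case 0
    then show ?case using resv_lift that by simp
  next
    case (Suc n)
    have "Zeq p 1 (f (lift (resv ((f ^^ n) (lift v))))) (f ((f ^^ n) (lift v)))"
      by (intro f_cong lift lift_resv pt_fn)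
    then show ?case using Suc by (simp add: fb_def resv_eq_iff pt_f lift pt_fn)
  qed
  \<comment> \<open>Agreement of the values of \<open>f\<close> modulo \<open>p\<close> is agreement
    of the iterates of \<open>F\<close> modulo \<open>p ^ 2\<close>; \<open>funpow_inj\<close> pulls
    it back to the points, and dividing by \<open>p\<close> gives equal residues of the
    displacements.\<close>
  have inj: "inj_on fb \<Omega>"
  proof
    fix v v' assume v: "v \<in> \<Omega>" "v' \<in> \<Omega>" and "fb v = fb v'"
    then have eq: "Zeq p 1 (f (lift v)) (f (lift v'))"
      by (simp add: fb_def resv_eq_iff pt_f lift)
    define x where "x v i = s a i + of_nat p * lift v i" for v i
    have x: "pt (x v)" "Zeq p 1 (x v) (s a)" "(F ^^ fact P) (x v) = (\<lambda>i. s a i + of_nat p * f (lift v) i)" for v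
    proof -
      show "pt (x v)" using pt_s[of a] lift[of v] by (auto simp: pt_def x_def intro!: Zloc_intros[OF p1])
      show "Zeq p 1 (x v) (s a)" using lift[of v]
        by (auto simp: Zeq_def x_def pt_def Zpow_def)
      show "(F ^^ fact P) (x v) = (\<lambda>i. s a i + of_nat p * f (lift v) i)"
        unfolding x_def by (rule f(3)) (simp add: lift_def)
    qed
    have "Zeq p 2 ((F ^^ fact P) (x v)) ((F ^^ fact P) (x v'))"
      using eq Zpow_p_mult[OF p1, of _ 1]
      by (auto simp: x(3) Zeq_def numeral_2_eq_2 simp flip: right_diff_distrib)
    then have "Zeq p 2 (x v) (x v')" by (intro funpow_inj[OF x(1,2) x(1,2)])
    then have "Zeq p 1 (lift v) (lift v')"
      using Zpow_p_mult_iff[OF p1, of _ 1]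
      by (auto simp: x_def Zeq_def numeral_2_eq_2 simp flip: right_diff_distrib)
    then show "v = v'" using resv_lift v by (metis resv_eq_iff lift)
  qed
  define \<psi> where "\<psi> = f ^^ fact P"
  have id: "Zeq p 1 (\<psi> (lift v)) (lift v)" if "v \<in> \<Omega>" for v
  proof -
    have "(fb ^^ fact P) v = v"
      by (rule funpow_fact_eq_id[OF \<Omega>(1) _ inj _ that])
        (use \<Omega> resv_\<Omega> pt_f lift in \<open>auto simp: fb_def\<close>)
    then have "resv (\<psi> (lift v)) = resv (lift v)"
      using fb_iter[OF that] resv_lift[OF that] by (simp add: \<psi>_def)
    then show ?thesis using resv_eq_iff pt_fn lift by (simp add: \<psi>_def)
  qed
  have iter: "(\<lambda>y. (f ^^ n) y i) \<in> polyfun (Zloc p) \<and> (i \<in> X \<longrightarrow> (\<lambda>y. (f ^^ n) y i) \<in> affine_mod)" for n i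
  proof (induction n arbitrary: i)
    case (Suc n)
    have "(\<lambda>y. f ((f ^^ n) y) i) \<in> affine_mod" by (rule affine_mod_compose[OF f(1)]) (use Suc in auto)
    then show ?case by (auto intro: affine_mod_polyfun)
  qed (auto intro: polyfun.intros affine_mod_var)
  have "\<exists>E. E \<in> polyfun (Zloc p) \<and> (\<forall>y. \<psi> y i = y i + of_nat p * E y)" if i: "i \<in> X" for i
  proof -
    have "(\<lambda>y. \<psi> y i) \<in> affine_mod" using iter i by (simp add: \<psi>_def)
    then obtain \<beta> B r where B: "\<beta> \<in> Zloc p" "\<And>i. B i \<in> Zloc p" "r \<in> polyfun (Zloc p)"
      "\<And>y. \<psi> y i = \<beta> + (\<Sum>i\<in>X. B i * y i) + of_nat p * r y"
      by (rule affine_mod_E) blast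
    have r: "of_nat p * r (lift v) \<in> Zpow p 1" for v
      using PF_values[OF B(3), of "lift v"] lift[of v] by (auto simp: pt_def Zpow_def)
    \<comment> \<open>The zero vector and the unit vectors read off the constant and the linear part
      modulo \<open>p\<close>. Here it matters that the map is affine modulo
      \<open>p\<close>.\<close>
    define z where "z = restrict (\<lambda>_. 0 :: int) X"
    define u where "u j = restrict (\<lambda>i. if i = j then 1 else 0 :: int) X" for j
    have "z \<in> \<Omega>" "u j \<in> \<Omega>" for j using p by (auto simp: z_def u_def \<Omega>_def)
    have "\<psi> (lift z) i - lift z i \<in> Zpow p 1" using id[OF \<open>z \<in> \<Omega>\<close>] by (simp add: Zeq_def)
    moreover have "\<psi> (lift z) i - lift z i = \<beta> + of_nat p * r (lift z)"
      unfolding B(4) by (simp add: lift_def z_def i)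
    ultimately have \<beta>: "\<beta> \<in> Zpow p 1" using Zpow_diff[OF p1 _ r[of z]] by fastforce
    have unit: "B j - (if i = j then 1 else 0) \<in> Zpow p 1" if "j \<in> X" for j
    proof -
      have "\<psi> (lift (u j)) i - lift (u j) i \<in> Zpow p 1" using id[OF \<open>u j \<in> \<Omega>\<close>] by (simp add: Zeq_def)
      moreover have "\<psi> (lift (u j)) i - lift (u j) i = (B j - (if i = j then 1 else 0)) + (\<beta> + of_nat p * r (lift (u j)))"
      proof -
        have "(\<Sum>k\<in>X. B k * lift (u j) k) = (\<Sum>k\<in>X. if k = j then B k else 0)"
          by (intro sum.cong) (auto simp: lift_def u_def)
        also have "\<dots> = B j" using X that by simp
        finally show ?thesis unfolding B(4) using i by (simp add: lift_def u_def)
      qed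
      ultimately show ?thesis using Zpow_diff[OF p1 _ Zpow_add[OF p1 \<beta> r[of "u j"]]] by fastforce
    qed
    have "\<exists>C. C \<in> Zloc p \<and> (j \<in> X \<longrightarrow> B j = (if i = j then 1 else 0) + of_nat p * C)" for j
    proof (cases "j \<in> X")
      case True
      with unit obtain C where "B j - (if i = j then 1 else 0) = of_nat p * C" "C \<in> Zloc p"
        unfolding Zpow_def by auto
      then show ?thesis by (intro exI[of _ C]) (simp add: algebra_simps)
    qed (use Zloc_intros(4)[OF p1] in auto)
    then obtain C where C: "\<And>j. C j \<in> Zloc p" "\<And>j. j \<in> X \<Longrightarrow> B j = (if i = j then 1 else 0) + of_nat p * C j"
      by metis
    obtain \<beta>' where \<beta>': "\<beta>' \<in> Zloc p" "\<beta> = of_nat p * \<beta>'" using \<beta> by (auto simp: Zpow_def)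
    have "\<psi> y i = y i + of_nat p * (\<beta>' + (\<Sum>j\<in>X. C j * y j) + r y)" for y
    proof -
      have "(\<Sum>j\<in>X. B j * y j) = (\<Sum>j\<in>X. (if i = j then y j else 0) + of_nat p * (C j * y j))"
        by (intro sum.cong) (auto simp: C(2) algebra_simps)
      also have "\<dots> = y i + of_nat p * (\<Sum>j\<in>X. C j * y j)"
        using X i by (simp add: sum.distrib sum_distrib_left)
      finally show ?thesis unfolding B(4) \<beta>'(2) by (simp add: algebra_simps)
    qed
    moreover have "(\<lambda>y. \<beta>' + (\<Sum>j\<in>X. C j * y j) + r y) \<in> polyfun (Zloc p)"
      using \<beta>' C(1) B(3) by (intro PF_intros)
    ultimately show ?thesis by blast
  qed
  then obtain E0 where E0: "\<And>i. i \<in> X \<Longrightarrow> E0 i \<in> polyfun (Zloc p)" "\<And>i y. i \<in> X \<Longrightarrow> \<psi> y i = y i + of_nat p * E0 i y"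
    by metis
  define E where "E i = (if i \<in> X then E0 i else (\<lambda>_. 0))" for i
  show ?thesis
  proof (rule that[of \<psi> E])
    show "(\<lambda>y. \<psi> y i) \<in> polyfun (Zloc p)" for i using iter by (simp add: \<psi>_def)
    show "E i \<in> polyfun (Zloc p)" for i
      using E0 by (auto simp: E_def intro: polyfun.intros Zloc_intros[OF p1])
    show "\<psi> y i = y i + of_nat p * E i y" if "i \<in> X" for i y using E0 that by (simp add: E_def)
    show "\<psi> y i = 0" if "i \<notin> X" for i y
      using f(2)[OF that] by (cases "fact P :: nat") (auto simp: \<psi>_def)
    show "(F ^^ (fact P * fact P)) (\<lambda>i. s a i + of_nat p * y i) = (\<lambda>i. s a i + of_nat p * \<psi> y i)"
      if y: "\<And>i. i \<notin> X \<Longrightarrow> y i = 0" for y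
    proof -
      have "(F ^^ (n * fact P)) (\<lambda>i. s a i + of_nat p * y i) = (\<lambda>i. s a i + of_nat p * (f ^^ n) y i)" for n
      proof (induction n)
        case (Suc n)
        have "\<And>i. i \<notin> X \<Longrightarrow> (f ^^ n) y i = 0" using y f(2) by (cases n) auto
        from f(3)[OF this] Suc show ?case by (simp add: funpow_add)
      qed simp
      then show ?thesis by (simp add: \<psi>_def)
    qed
  qed
qed

text \<open>One factor \<open>fact P\<close> returns the orbit to its disc, the other makes the
  return map congruent to the identity. Composition with that map is then 1 plus \<open>p\<close>
  times an operator on polynomial functions, so iterated differences along the class are divisible
  by rising powers of \<open>p\<close>, as \<open>mahler_strassmann\<close> requires.\<close>

theorem zeros_on_class:
  assumes a: "P \<le> a" and g: "g \<in> polyfun (Zloc p)"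
    and inf: "infinite {n. g (s (a + n * (fact P * fact P))) = 0}"
  shows "g (s (a + n * (fact P * fact P))) = 0"
proof -
  let ?K = "fact P * fact P :: nat"
  obtain \<psi> E where \<psi>: "\<And>i. (\<lambda>y. \<psi> y i) \<in> polyfun (Zloc p)" "\<And>i. E i \<in> polyfun (Zloc p)"
    "\<And>i y. i \<in> X \<Longrightarrow> \<psi> y i = y i + of_nat p * E i y" "\<And>i y. i \<notin> X \<Longrightarrow> \<psi> y i = 0"
    "\<And>y. (\<And>i. i \<notin> X \<Longrightarrow> y i = 0) \<Longrightarrow>
      (F ^^ ?K) (\<lambda>i. s a i + of_nat p * y i) = (\<lambda>i. s a i + of_nat p * \<psi> y i)"
    using return_map_near_id[OF a] by blast
  define x where "x n = (\<psi> ^^ n) (\<lambda>_. 0)" for n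
  have x_out: "x n i = 0" if "i \<notin> X" for n i using \<psi>(4) that by (cases n) (auto simp: x_def)
  have x_pt: "x n i \<in> Zloc p" for n i
  proof (induction n arbitrary: i)
    case (Suc n)
    then show ?case using PF_values[OF \<psi>(1), of "x n"] by (simp add: x_def)
  qed (simp add: x_def Zloc_intros[OF p1])
  have orbit: "s (a + n * ?K) = (\<lambda>i. s a i + of_nat p * x n i)" for n
  proof (induction n)
    case (Suc n)
    have "a + Suc n * ?K = ?K + (a + n * ?K)" by simp
    then have "s (a + Suc n * ?K) = (F ^^ ?K) (s (a + n * ?K))" by (simp only: funpow_add comp_apply)
    then show ?case unfolding Suc using \<psi>(5)[OF x_out] by (simp add: x_def)
  qed (simp add: x_def)
  \<comment> \<open>The difference operator divided by \<open>p\<close> maps integral polynomial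
    functions to integral ones. It is built by induction, with the twisted product rule of
    differences.\<close>
  have "\<exists>q'\<in>polyfun (Zloc p). \<forall>y. (\<forall>i. i \<notin> X \<longrightarrow> y i = 0) \<longrightarrow> q (\<psi> y) = q y + of_nat p * q' y"
    if "q \<in> polyfun (Zloc p)" for q
    using that
  proof induction
    case (polyfun_const c)
    then show ?case by (intro bexI[of _ "\<lambda>_. 0"]) (auto intro: polyfun.intros Zloc_intros[OF p1])
  next
    case (polyfun_var i)
    show ?case
    proof (cases "i \<in> X")
      case True
      then show ?thesis using \<psi>(2,3) by (intro bexI[of _ "E i"]) auto
    next
      case False
      then show ?thesis using \<psi>(4)
        by (intro bexI[of _ "\<lambda>_. 0"]) (auto intro: polyfun.intros Zloc_intros[OF p1])
    qed
  next
    case (polyfun_add f g)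
    then obtain f' g' where *: "f' \<in> polyfun (Zloc p)" "g' \<in> polyfun (Zloc p)"
      "\<forall>y. (\<forall>i. i \<notin> X \<longrightarrow> y i = 0) \<longrightarrow> f (\<psi> y) = f y + of_nat p * f' y"
      "\<forall>y. (\<forall>i. i \<notin> X \<longrightarrow> y i = 0) \<longrightarrow> g (\<psi> y) = g y + of_nat p * g' y" by blast
    then show ?case
      by (intro bexI[of _ "\<lambda>y. f' y + g' y"]) (auto intro: polyfun.intros simp: algebra_simps)
  next
    case (polyfun_mult f g)
    then obtain f' g' where *: "f' \<in> polyfun (Zloc p)" "g' \<in> polyfun (Zloc p)"
      "\<forall>y. (\<forall>i. i \<notin> X \<longrightarrow> y i = 0) \<longrightarrow> f (\<psi> y) = f y + of_nat p * f' y"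
      "\<forall>y. (\<forall>i. i \<notin> X \<longrightarrow> y i = 0) \<longrightarrow> g (\<psi> y) = g y + of_nat p * g' y" by blast
    show ?case
    proof (rule bexI[of _ "\<lambda>y. f' y * g y + f y * g' y + of_nat p * (f' y * g' y)"])
      show "(\<lambda>y. f' y * g y + f y * g' y + of_nat p * (f' y * g' y)) \<in> polyfun (Zloc p)"
        using * polyfun_mult.hyps by (intro PF_intros Zloc_intros[OF p1])
    qed (use * in \<open>auto simp: algebra_simps\<close>)
  qed
  then obtain \<Delta> where \<Delta>: "\<And>q. q \<in> polyfun (Zloc p) \<Longrightarrow> \<Delta> q \<in> polyfun (Zloc p)"
    "\<And>q y. q \<in> polyfun (Zloc p) \<Longrightarrow> (\<And>i. i \<notin> X \<Longrightarrow> y i = 0) \<Longrightarrow> q (\<psi> y) = q y + of_nat p * \<Delta> q y"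
    by metis
  define q where "q j = (\<Delta> ^^ j) (\<lambda>y. g (\<lambda>i. s a i + of_nat p * y i))" for j
  have q: "q j \<in> polyfun (Zloc p)" for j
  proof (induction j)
    case 0
    have "(\<lambda>y. s a i + of_nat p * y i) \<in> polyfun (Zloc p)" for i
      using pt_s[of a] by (intro PF_intros) (auto simp: pt_def Zloc_intros[OF p1])
    then show ?case using polyfun_compose[OF g, of "\<lambda>i y. s a i + of_nat p * y i"] by (simp add: q_def)
  qed (use \<Delta> in \<open>auto simp: q_def\<close>)
  have step: "q j (x (Suc n)) = q j (x n) + of_nat p * q (Suc j) (x n)" for j n
    using \<Delta>(2)[OF q, of "x n" j] x_out by (simp add: x_def q_def)
  \<comment> \<open>The binomial expansion of the \<open>n\<close>-th power of 1 plus
    \<open>p\<close> times the difference operator, evaluated at the starting point.\<close>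
  have mahler: "q j (x n) = (\<Sum>i\<le>n. of_nat (n choose i) * of_nat p ^ i * q (j + i) (x 0))" for j n
  proof (induction n arbitrary: j)
    case (Suc n)
    let ?t = "\<lambda>n i. of_nat (n choose i) * of_nat p ^ i * q (j + i) (x 0) :: rat"
    have "q j (x (Suc n)) = (\<Sum>i\<le>n. ?t n i) + of_nat p * (\<Sum>i\<le>n. of_nat (n choose i) * of_nat p ^ i * q (Suc j + i) (x 0))"
      by (simp only: step Suc.IH)
    also have "(\<Sum>i\<le>n. ?t n i) = ?t n 0 + (\<Sum>i\<le>n. ?t n (Suc i))"
      using sum.atMost_Suc_shift[of "?t n" n] by (simp add: binomial_eq_0)
    also have "\<dots> + of_nat p * (\<Sum>i\<le>n. of_nat (n choose i) * of_nat p ^ i * q (Suc j + i) (x 0))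
        = ?t n 0 + (\<Sum>i\<le>n. ?t (Suc n) (Suc i))"
      by (simp add: sum_distrib_left algebra_simps flip: sum.distrib)
    also have "\<dots> = (\<Sum>i\<le>Suc n. ?t (Suc n) i)"
      by (subst sum.atMost_Suc_shift) simp
    finally show ?case .
  qed simp
  have "q 0 (x n) = 0"
  proof (rule mahler_strassmann[OF p, of "\<lambda>i. q i (x 0)"])
    show "q i (x 0) \<in> Zloc p" for i by (rule PF_values[OF q x_pt])
    show "q 0 (x n) = (\<Sum>i\<le>n. of_nat (n choose i) * of_nat p ^ i * q i (x 0))" for n
      using mahler[of 0] by simp
    show "infinite {n. q 0 (x n) = 0}" using inf by (simp add: q_def orbit)
  qed
  then show ?thesis by (simp add: q_def orbit)
qed

end

section \<open>Specialization of finitely generated domains\<close>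

definition Zinv :: "int \<Rightarrow> rat set" where
  "Zinv G = {of_int a / of_int G ^ k | a k. True}"

lemma Zinv_of_int: "of_int a \<in> Zinv G"
  unfolding Zinv_def by (metis (mono_tags, lifting) div_by_1 mem_Collect_eq power_0)

lemma Zinv_I: "of_int a / of_int G ^ k \<in> Zinv G"
  unfolding Zinv_def by blast

lemma Zinv_clear:
  assumes "x \<in> Zinv G" "G \<noteq> 0" shows "\<exists>k. \<forall>k'\<ge>k. of_int G ^ k' * x \<in> \<int>"
proof -
  obtain a k where x: "x = of_int a / of_int G ^ k" using assms by (auto simp: Zinv_def)
  have "of_int G ^ k' * x = of_int (G ^ (k' - k) * a)" if "k \<le> k'" for k'
  proof -
    have "G ^ k' = G ^ k * G ^ (k' - k)" using that by (simp flip: power_add)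
    then show ?thesis using assms(2) by (simp add: x flip: of_int_power)
  qed
  then show ?thesis by (intro exI[of _ k]) (metis Ints_of_int)
qed

lemma Zinv_Zloc:
  assumes "prime p" "\<not> int p dvd G" "x \<in> Zinv G" shows "x \<in> Zloc p"
proof -
  obtain a k where "x = of_int a / of_int (G ^ k)" using assms(3) by (auto simp: Zinv_def)
  moreover have "\<not> int p dvd G ^ k" using assms(1,2) prime_dvd_power[of "int p" G k] by auto
  ultimately show ?thesis using ZlocI by blast
qed

text \<open>A ring homomorphism given by coordinates only. The kernel of \<kappa> is an ideal, so
  the quotient of \<open>R\<close> by it is a ring, realized as a subset of the rational vectors of
  length \<open>n\<close> with denominators powers of \<open>G\<close>; the \<open>e j\<close> are
  preimages of the unit vectors. The target ring itself is never named.\<close>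

locale coord_sys =
  fixes R :: "'k::field_char_0 set" and n :: nat and G :: int
    and \<kappa> :: "'k \<Rightarrow> nat \<Rightarrow> rat" and e :: "nat \<Rightarrow> 'k"
  assumes R: "is_subring R" and n: "n \<ge> 1" and G: "G \<noteq> 0"
    and \<kappa>_add: "x \<in> R \<Longrightarrow> y \<in> R \<Longrightarrow> \<kappa> (x + y) i = \<kappa> x i + \<kappa> y i"
    and \<kappa>_Zinv: "x \<in> R \<Longrightarrow> \<kappa> x i \<in> Zinv G"
    and \<kappa>_outside: "x \<in> R \<Longrightarrow> i \<ge> n \<Longrightarrow> \<kappa> x i = 0"
    and e: "j < n \<Longrightarrow> e j \<in> R" and \<kappa>_e: "j < n \<Longrightarrow> \<kappa> (e j) i = (if i = j then 1 else 0)"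
    and \<kappa>_ideal: "x \<in> R \<Longrightarrow> y \<in> R \<Longrightarrow> (\<And>i. \<kappa> x i = 0) \<Longrightarrow> \<kappa> (x * y) i = 0"
begin

lemmas R_intros = subring_intros[OF R]

lemma \<kappa>_zero: "\<kappa> 0 i = 0"
  using \<kappa>_add[of 0 0 i] R_intros by simp

lemma \<kappa>_uminus: "x \<in> R \<Longrightarrow> \<kappa> (- x) i = - \<kappa> x i"
  using \<kappa>_add[of x "- x" i] R_intros by (simp add: \<kappa>_zero)

lemma \<kappa>_diff: "x \<in> R \<Longrightarrow> y \<in> R \<Longrightarrow> \<kappa> (x - y) i = \<kappa> x i - \<kappa> y i"
  using \<kappa>_add[of x "- y" i] R_intros \<kappa>_uminus by simp

lemma \<kappa>_sum: "(\<And>j. j \<in> I \<Longrightarrow> f j \<in> R) \<Longrightarrow> \<kappa> (sum f I) i = (\<Sum>j\<in>I. \<kappa> (f j) i)"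
  by (induction I rule: infinite_finite_induct) (auto simp: \<kappa>_zero \<kappa>_add R_intros)

lemma \<kappa>_of_nat: "x \<in> R \<Longrightarrow> \<kappa> (of_nat a * x) i = of_nat a * \<kappa> x i"
  by (induction a) (auto simp: \<kappa>_zero \<kappa>_add R_intros algebra_simps)

lemma \<kappa>_of_int: "x \<in> R \<Longrightarrow> \<kappa> (of_int a * x) i = of_int a * \<kappa> x i"
  by (cases a rule: int_cases2) (auto simp: \<kappa>_of_nat \<kappa>_uminus R_intros)

text \<open>After clearing denominators, a multiple of \<open>x\<close> differs from an integral
  combination of the \<open>e j\<close> by an element of the kernel, and the kernel absorbs
  multiplication by \<open>y\<close>.\<close>

lemma \<kappa>_mult:
  assumes x: "x \<in> R" and y: "y \<in> R"
  shows "\<kappa> (x * y) i = (\<Sum>j<n. \<kappa> x j * \<kappa> (e j * y) i)"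
proof -
  obtain k where k: "\<And>j k'. j < n \<Longrightarrow> k j \<le> k' \<Longrightarrow> of_int G ^ k' * \<kappa> x j \<in> \<int>"
    using Zinv_clear[OF \<kappa>_Zinv[OF x] G] by metis
  define K where "K = (\<Sum>j<n. k j)"
  have "k j \<le> K" if "j < n" for j
    unfolding K_def using that by (intro member_le_sum) auto
  then have "\<exists>m. of_int G ^ K * \<kappa> x j = of_int m" if "j < n" for j
    using k[OF that, of K] that by (auto elim: Ints_cases)
  then obtain m where m: "\<And>j. j < n \<Longrightarrow> of_int G ^ K * \<kappa> x j = of_int (m j)" by metis
  define z where "z = of_int (G ^ K) * x - (\<Sum>j<n. of_int (m j) * e j)"
  have zR: "z \<in> R" unfolding z_def using x e by (auto intro!: R_intros)
  have S: "(\<Sum>j<n. of_int (m j) * e j) \<in> R" using e by (auto intro!: R_intros)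
  have "\<kappa> z l = 0" for l
  proof -
    have "\<kappa> (\<Sum>j<n. of_int (m j) * e j) l = (\<Sum>j<n. \<kappa> (of_int (m j) * e j) l)"
      using e by (intro \<kappa>_sum R_intros) auto
    also have "\<dots> = (\<Sum>j<n. of_int (m j) * (if l = j then 1 else 0))"
      using e by (intro sum.cong) (auto simp: \<kappa>_of_int \<kappa>_e)
    finally have "\<kappa> z l = of_int (G ^ K) * \<kappa> x l - (\<Sum>j<n. of_int (m j) * (if l = j then 1 else 0))"
      unfolding z_def using x e S
      by (simp add: \<kappa>_diff \<kappa>_of_int R_intros del: of_int_power)
    also have "\<dots> = 0" using m[of l] \<kappa>_outside[OF x, of l]
      by (cases "l < n") (simp_all add: if_distrib[of "\<lambda>x. _ * x"] cong: if_cong)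
    finally show ?thesis .
  qed
  then have "\<kappa> (z * y) i = 0" by (rule \<kappa>_ideal[OF zR y])
  moreover have "z * y = of_int (G ^ K) * (x * y) - (\<Sum>j<n. of_int (m j) * (e j * y))"
    by (simp add: z_def left_diff_distrib sum_distrib_right mult.assoc)
  moreover have "(\<Sum>j<n. of_int (m j) * (e j * y)) \<in> R" using e y by (auto intro!: R_intros)
  moreover have "\<kappa> (\<Sum>j<n. of_int (m j) * (e j * y)) i = (\<Sum>j<n. \<kappa> (of_int (m j) * (e j * y)) i)"
    using e y by (intro \<kappa>_sum R_intros) auto
  moreover have "\<dots> = (\<Sum>j<n. of_int (m j) * \<kappa> (e j * y) i)"
    using e y by (intro sum.cong) (auto simp: \<kappa>_of_int R_intros)
  ultimately have "of_int (G ^ K) * \<kappa> (x * y) i = (\<Sum>j<n. of_int (m j) * \<kappa> (e j * y) i)"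
    using x y by (simp add: \<kappa>_diff \<kappa>_of_int R_intros del: of_int_power)
  also have "\<dots> = of_int (G ^ K) * (\<Sum>j<n. \<kappa> x j * \<kappa> (e j * y) i)"
    by (simp add: sum_distrib_left m flip: mult.assoc)
  finally show ?thesis using G by simp
qed

lemma \<kappa>_mult2:
  assumes x: "x \<in> R" and y: "y \<in> R"
  shows "\<kappa> (x * y) i = (\<Sum>j<n. \<Sum>l<n. \<kappa> x j * \<kappa> y l * \<kappa> (e j * e l) i)"
proof -
  have "\<kappa> (e j * y) i = (\<Sum>l<n. \<kappa> y l * \<kappa> (e j * e l) i)" if "j < n" for j
    using \<kappa>_mult[OF y e[OF that], of i] by (simp add: mult.commute)
  then show ?thesis unfolding \<kappa>_mult[OF x y] by (simp add: sum_distrib_left mult.assoc)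
qed

text \<open>The matrix of multiplication by the image of \<open>x\<close>; its determinant is the
  norm of that image. As the target may have zero divisors, a vanishing norm need not mean a
  vanishing image, and nonvanishing is certified by \<open>Norm_nonzero\<close>.\<close>

definition L :: "'k \<Rightarrow> rat mat" where "L x = mat n n (\<lambda>(i, j). \<kappa> (x * e j) i)"

definition Norm :: "'k \<Rightarrow> rat" where "Norm x = det (L x)"

lemma L_carrier: "L x \<in> carrier_mat n n"
  by (simp add: L_def)

lemma L_mult:
  assumes "x \<in> R" "y \<in> R" shows "L (x * y) = L x * L y"
proof (rule eq_matI)
  fix i j assume "i < dim_row (L x * L y)" "j < dim_col (L x * L y)"
  then have ij: "i < n" "j < n" by (auto simp: L_def)
  have "\<kappa> (x * y * e j) i = (\<Sum>l<n. \<kappa> (y * e j) l * \<kappa> (e l * x) i)"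
    using \<kappa>_mult[of "y * e j" x i] assms e[OF ij(2)] by (simp add: R_intros mult_ac)
  then show "L (x * y) $$ (i, j) = (L x * L y) $$ (i, j)"
    using ij by (simp add: L_def scalar_prod_def mult_ac atLeast0LessThan)
qed (auto simp: L_def)

lemma Norm_mult: "x \<in> R \<Longrightarrow> y \<in> R \<Longrightarrow> Norm (x * y) = Norm x * Norm y"
  unfolding Norm_def by (simp add: L_mult det_mult[OF L_carrier L_carrier])

lemma \<kappa>_scalar:
  assumes "x \<in> R" "\<And>i. \<kappa> x i = of_int M * \<kappa> 1 i" "z \<in> R"
  shows "\<kappa> (x * z) i = of_int M * \<kappa> z i"
proof -
  have "\<kappa> (x - of_int M * 1) i = 0" for i
    using assms by (simp only: \<kappa>_diff \<kappa>_of_int R_intros)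
  then have "\<kappa> ((x - of_int M * 1) * z) i = 0"
    by (intro \<kappa>_ideal R_intros assms)
  then show ?thesis using assms by (simp add: left_diff_distrib \<kappa>_diff \<kappa>_of_int R_intros)
qed

text \<open>The multiple \<open>x * y\<close> acts as the scalar \<open>M\<close>, so the norm of
  \<open>x\<close> divides \<open>M ^ n\<close>.\<close>

lemma Norm_nonzero:
  assumes "x \<in> R" "y \<in> R" "\<And>i. \<kappa> (x * y) i = of_int M * \<kappa> 1 i" "M \<noteq> 0"
  shows "Norm x \<noteq> 0"
proof
  assume "Norm x = 0"
  then have "Norm (x * y) = 0" using assms by (simp add: Norm_mult)
  moreover have "L (x * y) = of_int M \<cdot>\<^sub>m 1\<^sub>m n"
    using \<kappa>_scalar[OF R_intros(3)[OF assms(1,2)] assms(3)] e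
    by (intro eq_matI) (auto simp: L_def \<kappa>_e)
  ultimately show False using assms(4) by (simp add: Norm_def)
qed

lemma Norm_zero_coords:
  assumes "x \<in> R" "\<And>i. \<kappa> x i = 0" shows "Norm x = 0"
proof -
  have "L x = 0\<^sub>m n n" using \<kappa>_ideal[OF assms(1) _ assms(2)] e by (intro eq_matI) (auto simp: L_def)
  moreover have "det (0\<^sub>m n n :: rat mat) = 0"
    using n det_smult[of 0 "0\<^sub>m n n :: rat mat"] by simp
  ultimately show ?thesis by (simp add: Norm_def)
qed

end

section \<open>Divisibility and units modulo a prime of good reduction\<close>

locale coord_sys_prime = coord_sys +
  fixes p :: nat
  assumes p: "prime p" and pG: "\<not> int p dvd G"
begin

lemma \<kappa>_Zloc: "x \<in> R \<Longrightarrow> \<kappa> x i \<in> Zloc p"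
  using Zinv_Zloc[OF p pG \<kappa>_Zinv] .

definition pz :: "nat \<Rightarrow> 'a \<Rightarrow> bool" where "pz b x \<longleftrightarrow> x \<in> R \<and> (\<forall>i. \<kappa> x i \<in> Zpow p b)"

lemma pz_0: "x \<in> R \<Longrightarrow> pz 0 x" by (simp add: pz_def Zpow_0[OF p] \<kappa>_Zloc)

lemma pz_mult:
  assumes "pz a x" "pz b y" shows "pz (a + b) (x * y)"
proof -
  have "\<kappa> x j * \<kappa> y l * \<kappa> (e j * e l) i \<in> Zpow p (a + b)" if "j < n" "l < n" for i j l
    using assms that e
    by (intro Zpow_mult_right[OF p] Zpow_mult[OF p] \<kappa>_Zloc R_intros) (auto simp: pz_def)
  then show ?thesis using assms by (auto simp: pz_def \<kappa>_mult2 intro!: R_intros Zpow_sum[OF p])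
qed

lemma pz_mult_right: "pz b x \<Longrightarrow> y \<in> R \<Longrightarrow> pz b (x * y)"
  using pz_mult[of b x 0 y] pz_0 by simp

lemma pz_add: "pz b x \<Longrightarrow> pz b y \<Longrightarrow> pz b (x + y)"
  by (auto simp: pz_def \<kappa>_add intro: R_intros Zpow_add[OF p])

lemma pz_diff: "pz b x \<Longrightarrow> pz b y \<Longrightarrow> pz b (x - y)"
  by (auto simp: pz_def \<kappa>_diff intro: R_intros Zpow_diff[OF p])

definition unit_mod :: "'a \<Rightarrow> bool" where "unit_mod x \<longleftrightarrow> x \<in> R \<and> (\<exists>y\<in>R. pz 1 (x * y - 1))"

lemma unit_mod_factor:
  assumes "unit_mod (x * y)" "x \<in> R" "y \<in> R" shows "unit_mod x"
proof -
  obtain z where "z \<in> R" "pz 1 (x * y * z - 1)" using assms by (auto simp: unit_mod_def)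
  then have "pz 1 (x * (y * z) - 1)" by (simp add: mult.assoc)
  then show ?thesis using \<open>z \<in> R\<close> assms R_intros(3) unfolding unit_mod_def by blast
qed

lemma unit_mod_mult:
  assumes "unit_mod x" "unit_mod y" shows "unit_mod (x * y)"
proof -
  obtain u where u: "u \<in> R" "pz 1 (x * u - 1)" using assms by (auto simp: unit_mod_def)
  obtain v where v: "v \<in> R" "pz 1 (y * v - 1)" using assms by (auto simp: unit_mod_def)
  have "pz 1 ((x * u - 1) * (y * v) + (y * v - 1))"
    using assms u v by (intro pz_add pz_mult_right R_intros) (auto simp: unit_mod_def)
  also have "(x * u - 1) * (y * v) + (y * v - 1) = x * y * (u * v) - 1" by (simp add: algebra_simps)
  finally show ?thesis using assms u v unfolding unit_mod_def by (blast intro: R_intros)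
qed

lemma unit_mod_one: "unit_mod 1"
proof -
  have "pz 1 (1 * 1 - 1)" by (simp add: pz_def \<kappa>_zero Zpow_zero[OF p] R_intros)
  then show ?thesis unfolding unit_mod_def using R_intros by blast
qed

lemma unit_mod_prod: "(\<And>i. i \<in> I \<Longrightarrow> unit_mod (f i)) \<Longrightarrow> unit_mod (prod f I)"
  by (induction I rule: infinite_finite_induct) (auto intro: unit_mod_one unit_mod_mult)

lemma unit_mod_power: "unit_mod x \<Longrightarrow> unit_mod (x ^ k)"
  by (induction k) (auto intro: unit_mod_one unit_mod_mult)

lemma unit_mod_cong:
  assumes "unit_mod x" "pz 1 (x' - x)" "x' \<in> R" shows "unit_mod x'"
proof -
  obtain u where u: "u \<in> R" "pz 1 (x * u - 1)" using assms by (auto simp: unit_mod_def)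
  have "pz 1 ((x' - x) * u + (x * u - 1))" using assms u by (intro pz_add pz_mult_right)
  also have "(x' - x) * u + (x * u - 1) = x' * u - 1" by (simp add: algebra_simps)
  finally show ?thesis using assms u unfolding unit_mod_def by blast
qed

text \<open>The inverse \<open>u\<close> of \<open>y\<close> is valid only modulo \<open>p\<close>.
  The missing factor \<open>p\<close> in \<open>x * (y * u - 1)\<close> comes from \<open>x\<close>
  itself.\<close>

lemma pz_cancel_unit:
  assumes x: "pz 1 x" and "unit_mod y" and xy: "pz 2 (x * y)" shows "pz 2 x"
proof -
  obtain u where u: "u \<in> R" "pz 1 (y * u - 1)" using assms by (auto simp: unit_mod_def)
  have "pz 2 (x * y * u)" using pz_mult_right[OF xy u(1)] .
  moreover have "pz 2 (x * (y * u - 1))" using pz_mult[OF x u(2)] by (simp add: numeral_2_eq_2)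
  ultimately have "pz 2 (x * y * u - x * (y * u - 1))" by (rule pz_diff)
  moreover have "x * y * u - x * (y * u - 1) = x" by (simp add: algebra_simps)
  ultimately show ?thesis by simp
qed

text \<open>Contrapositive: if the norm is a unit of \<open>Zloc p\<close>, Cramer's rule inverts
  the multiplication matrix over \<open>Zloc p\<close> and yields an inverse modulo
  \<open>p\<close>.\<close>

lemma Norm_nonunit:
  assumes x: "x \<in> R" and "\<not> unit_mod x" shows "Norm x \<in> Zpow p 1"
proof (rule ccontr)
  assume N: "Norm x \<notin> Zpow p 1"
  have LZ: "L x $$ (i, j) \<in> Zloc p" if "i < n" "j < n" for i j
    using x e that by (auto simp: L_def intro!: \<kappa>_Zloc R_intros)
  have detZ: "det A \<in> Zloc p" if "A \<in> carrier_mat k k" "\<And>i j. i < k \<Longrightarrow> j < k \<Longrightarrow> A $$ (i, j) \<in> Zloc p" for A k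
    unfolding det_def'[OF that(1)]
    by (auto intro!: Zloc_intros[OF p] that(2) simp: sign_def simp: permutes_in_image[of _ "{0..<k}"])
  have NZ: "Norm x \<in> Zloc p" unfolding Norm_def by (rule detZ[OF L_carrier LZ])
  then obtain a b where ab: "Norm x = of_int a / of_int b" "\<not> int p dvd b" by (rule ZlocE)
  have "\<not> int p dvd a"
  proof
    assume "int p dvd a"
    then obtain c where "a = int p * c" by blast
    then have "Norm x = of_nat p ^ 1 * (of_int c / of_int b)" using ab by simp
    then show False using N ZlocI[OF ab(2), of c] unfolding Zpow_def by blast
  qed
  then have inv: "1 / Norm x \<in> Zloc p" using ab ZlocI[of p a b] by simp
  \<comment> \<open>Coordinates of the inverse: the adjugate applied to the coordinates of 1,
    divided by the norm.\<close>
  define q where "q j = (\<Sum>l<n. adj_mat (L x) $$ (j, l) * \<kappa> 1 l) / Norm x" for j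
  have N0: "Norm x \<noteq> 0" using N Zpow_zero[OF p] by metis
  have adj: "adj_mat (L x) \<in> carrier_mat n n" "L x * adj_mat (L x) = Norm x \<cdot>\<^sub>m 1\<^sub>m n"
    using adj_mat[OF L_carrier] by (auto simp: Norm_def)
  have adjZ: "adj_mat (L x) $$ (j, l) \<in> Zloc p" if "j < n" "l < n" for j l
  proof -
    have "det (mat_delete (L x) l j) \<in> Zloc p"
    proof (rule detZ)
      show "mat_delete (L x) l j \<in> carrier_mat (n - 1) (n - 1)"
        by (auto simp: mat_delete_def L_def)
      show "mat_delete (L x) l j $$ (i, i') \<in> Zloc p" if "i < n - 1" "i' < n - 1" for i i'
        using that LZ L_carrier[of x] by (auto simp: mat_delete_def)
    qed
    then show ?thesis using that L_carrier[of x]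
      by (auto simp: adj_mat_def cofactor_def intro!: Zloc_intros[OF p])
  qed
  have qZ: "q j \<in> Zloc p" if "j < n" for j
  proof -
    have "(\<Sum>l<n. adj_mat (L x) $$ (j, l) * \<kappa> 1 l) * (1 / Norm x) \<in> Zloc p"
      using adjZ that by (intro Zloc_intros(3)[OF p] inv Zloc_intros(8)[OF p] \<kappa>_Zloc R_intros) auto
    then show ?thesis by (simp add: q_def)
  qed
  have Lq: "(\<Sum>j<n. L x $$ (i, j) * q j) = \<kappa> 1 i" if i: "i < n" for i
  proof -
    have "(\<Sum>j<n. L x $$ (i, j) * q j) = (\<Sum>j<n. \<Sum>l<n. L x $$ (i, j) * adj_mat (L x) $$ (j, l) * \<kappa> 1 l) / Norm x"
      by (simp add: q_def sum_distrib_left sum_divide_distrib mult.assoc)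
    also have "(\<Sum>j<n. \<Sum>l<n. L x $$ (i, j) * adj_mat (L x) $$ (j, l) * \<kappa> 1 l)
        = (\<Sum>l<n. (L x * adj_mat (L x)) $$ (i, l) * \<kappa> 1 l)"
      using i L_carrier[of x] adj(1)
      by (subst sum.swap) (simp add: scalar_prod_def sum_distrib_right atLeast0LessThan)
    also have "\<dots> = (\<Sum>l<n. if i = l then Norm x * \<kappa> 1 l else 0)"
      unfolding adj(2) using i by (intro sum.cong) auto
    also have "\<dots> = Norm x * \<kappa> 1 i" using i by simp
    finally show ?thesis using N0 by simp
  qed
  \<comment> \<open>The \<open>q j\<close> lie only in \<open>Zloc p\<close>, whereas elements of
    \<open>R\<close> are formed from integral combinations of the \<open>e j\<close>. Rounding
    modulo \<open>p\<close> is harmless, because only an inverse modulo \<open>p\<close> is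
    wanted.\<close>
  have "\<exists>a. j < n \<longrightarrow> q j - of_int a \<in> Zpow p 1" for j
    using Zloc_residue[OF p qZ[of j]] by blast
  then obtain y0 where y0: "\<And>j. j < n \<Longrightarrow> q j - of_int (y0 j) \<in> Zpow p 1"
    by metis
  define y where "y = (\<Sum>j<n. of_int (y0 j) * e j)"
  have yR: "y \<in> R" unfolding y_def using e by (auto intro!: R_intros)
  have \<kappa>y: "\<kappa> (y * x) i = (\<Sum>j<n. of_int (y0 j) * \<kappa> (x * e j) i)" for i
  proof -
    have "y * x = (\<Sum>j<n. of_int (y0 j) * (x * e j))" by (simp add: y_def sum_distrib_left mult_ac)
    moreover have "\<kappa> (\<Sum>j<n. of_int (y0 j) * (x * e j)) i = (\<Sum>j<n. \<kappa> (of_int (y0 j) * (x * e j)) i)"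
      using e x by (intro \<kappa>_sum R_intros) auto
    moreover have "\<dots> = (\<Sum>j<n. of_int (y0 j) * \<kappa> (x * e j) i)"
      using e x by (intro sum.cong) (auto simp: \<kappa>_of_int R_intros)
    ultimately show ?thesis by simp
  qed
  have "\<kappa> (x * y - 1) i \<in> Zpow p 1" for i
  proof (cases "i < n")
    case True
    have "\<kappa> (x * y - 1) i = \<kappa> (y * x) i - \<kappa> 1 i" using x yR by (simp add: \<kappa>_diff R_intros mult.commute)
    also have "\<dots> = - (\<Sum>j<n. L x $$ (i, j) * (q j - of_int (y0 j)))"
      unfolding \<kappa>y Lq[OF True, symmetric] using True
      by (simp add: L_def left_diff_distrib sum_subtractf mult.commute)
    also have "\<dots> \<in> Zpow p 1"
      using y0 LZ True by (auto intro!: Zpow_uminus[OF p] Zpow_sum[OF p] Zpow_mult_left[OF p])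
    finally show ?thesis .
  next
    case False
    then show ?thesis using x yR by (simp add: \<kappa>_outside R_intros Zpow_zero[OF p])
  qed
  then have "unit_mod x" using x yR by (auto simp: unit_mod_def pz_def intro!: R_intros)
  then show False using assms by simp
qed

definition coords :: "('i \<Rightarrow> 'a) \<Rightarrow> 'i \<times> nat \<Rightarrow> rat" where "coords s = (\<lambda>(i, l). \<kappa> (s i) l)"

lemma coords_Zloc: "(\<And>i. s i \<in> R) \<Longrightarrow> coords s j \<in> Zloc p"
  by (cases j) (simp add: coords_def \<kappa>_Zloc)

lemmas PZ_intros = polyfun_intros[OF is_subring_Zloc[OF p]]

text \<open>Restriction of scalars: the structure constants \<kappa>(\<open>e a * e b\<close>) turn
  a polynomial function over \<open>R\<close> into polynomial functions of the rational coordinates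
  of its arguments.\<close>

lemma polyfun_coords:
  fixes f :: "('i \<Rightarrow> 'a) \<Rightarrow> 'a"
  assumes "f \<in> polyfun R"
  shows "\<exists>g. (\<forall>l. g l \<in> polyfun (Zloc p)) \<and> (\<forall>s l. (\<forall>i. s i \<in> R) \<longrightarrow> \<kappa> (f s) l = g l (coords s))"
  using assms
proof induction
  case (polyfun_const c)
  then show ?case
    by (intro exI[of _ "\<lambda>l _. \<kappa> c l"]) (auto intro: polyfun.intros \<kappa>_Zloc)
next
  case (polyfun_var i)
  show ?case
    by (intro exI[of _ "\<lambda>l t. t (i, l)"]) (auto intro: polyfun.intros simp: coords_def)
next
  case (polyfun_add f g)
  from polyfun_add.IH obtain f' g' where *: "\<And>l. f' l \<in> polyfun (Zloc p)" "\<And>l. g' l \<in> polyfun (Zloc p)"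
    "\<And>s l. (\<And>i. s i \<in> R) \<Longrightarrow> \<kappa> (f s) l = f' l (coords s)"
    "\<And>s l. (\<And>i. s i \<in> R) \<Longrightarrow> \<kappa> (g s) l = g' l (coords s)" by blast
  show ?case
  proof (intro exI conjI allI impI)
    show "(\<lambda>t. f' l t + g' l t) \<in> polyfun (Zloc p)" for l using * by (intro PZ_intros)
    show "\<kappa> (f s + g s) l = f' l (coords s) + g' l (coords s)" if s: "\<forall>i. s i \<in> R" for s l
      using polyfun_values[OF _ R, of _ s] polyfun_add.hyps s by (simp add: \<kappa>_add *(3,4))
  qed
next
  case (polyfun_mult f g)
  from polyfun_mult.IH obtain f' g' where *: "\<And>l. f' l \<in> polyfun (Zloc p)" "\<And>l. g' l \<in> polyfun (Zloc p)"
    "\<And>s l. (\<And>i. s i \<in> R) \<Longrightarrow> \<kappa> (f s) l = f' l (coords s)"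
    "\<And>s l. (\<And>i. s i \<in> R) \<Longrightarrow> \<kappa> (g s) l = g' l (coords s)" by blast
  show ?case
  proof (intro exI conjI allI impI)
    show "(\<lambda>t. \<Sum>a<n. \<Sum>b<n. f' a t * g' b t * \<kappa> (e a * e b) l) \<in> polyfun (Zloc p)" for l
      using * e by (intro PZ_intros \<kappa>_Zloc R_intros) auto
    show "\<kappa> (f s * g s) l = (\<Sum>a<n. \<Sum>b<n. f' a (coords s) * g' b (coords s) * \<kappa> (e a * e b) l)"
      if s: "\<forall>i. s i \<in> R" for s l
      using polyfun_values[OF _ R, of _ s] polyfun_mult.hyps s by (simp add: \<kappa>_mult2 *(3,4))
  qed
qed

lemma polyfun_Norm:
  fixes f :: "('i \<Rightarrow> 'a) \<Rightarrow> 'a"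
  assumes f: "f \<in> polyfun R"
  shows "\<exists>g\<in>polyfun (Zloc p). \<forall>s. (\<forall>i. s i \<in> R) \<longrightarrow> Norm (f s) = g (coords s)"
proof -
  obtain f' where f': "\<And>l. f' l \<in> polyfun (Zloc p)"
    "\<And>s l. (\<And>i. s i \<in> R) \<Longrightarrow> \<kappa> (f s) l = f' l (coords s)"
    using polyfun_coords[OF f] by blast
  define ent where "ent i j t = (\<Sum>l<n. f' l t * \<kappa> (e l * e j) i)" for i j t
  have ent: "(\<lambda>t. ent i j t) \<in> polyfun (Zloc p)" if "j < n" for i j
    unfolding ent_def using that f'(1) e by (intro PZ_intros \<kappa>_Zloc R_intros) auto
  have "Norm (f s) = (\<Sum>q | q permutes {0..<n}. signof q * (\<Prod>i = 0..<n. ent i (q i) (coords s)))"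
    if s: "\<forall>i. s i \<in> R" for s
  proof -
    have fs: "f s \<in> R" using polyfun_values[OF f R] s by blast
    have "L (f s) $$ (i, j) = ent i j (coords s)" if "i < n" "j < n" for i j
      using that fs e s by (simp add: L_def ent_def \<kappa>_mult[OF fs] f'(2))
    then have "(\<Prod>i = 0..<n. L (f s) $$ (i, q i)) = (\<Prod>i = 0..<n. ent i (q i) (coords s))"
      if "q permutes {0..<n}" for q
      using permutes_in_image[OF that] by (intro prod.cong) auto
    then show ?thesis
      unfolding Norm_def det_def'[OF L_carrier] by (intro sum.cong) auto
  qed
  moreover have "(\<lambda>t. \<Sum>q | q permutes {0..<n}. signof q * (\<Prod>i = 0..<n. ent i (q i) t)) \<in> polyfun (Zloc p)"
  proof (rule polyfun_sum[OF is_subring_Zloc[OF p]])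
    fix q assume "q \<in> {q. q permutes {0..<n}}"
    then have q: "q i < n" if "i < n" for i using permutes_in_image[of q "{0..<n}" i] that by simp
    have "(\<lambda>t. \<Prod>i = 0..<n. ent i (q i) t) \<in> polyfun (Zloc p)"
      using q by (intro polyfun_prod[OF is_subring_Zloc[OF p]] ent) auto
    moreover have "signof q \<in> Zloc p" by (simp add: sign_def Zloc_intros[OF p])
    ultimately show "(\<lambda>t. signof q * (\<Prod>i = 0..<n. ent i (q i) t)) \<in> polyfun (Zloc p)"
      by (intro polyfun_mult polyfun_const)
  qed
  ultimately show ?thesis
    by (intro bexI[where x = "\<lambda>t. \<Sum>q | q permutes {0..<n}. signof q * (\<Prod>i = 0..<n. ent i (q i) t)"]) auto
qed

end

section \<open>Heights of specialized elements\<close>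

context coord_sys
begin

text \<open>One number bounds the denominator and the entries of the multiplication matrix together.
  The sum of absolute values of the entries is submultiplicative, so sizes add under products.
  Raising \<open>k\<close> by one costs a factor \<open>\<bar>G\<bar>\<close> for the denominator
  and leaves a factor 2, just what a sum of two elements needs.\<close>

definition size_le :: "nat \<Rightarrow> 'k \<Rightarrow> bool" where
  "size_le k x \<longleftrightarrow> x \<in> R \<and> (\<forall>i<n. \<forall>j<n. of_int G ^ k * \<kappa> (x * e j) i \<in> \<int>) \<and>
    (\<Sum>i<n. \<Sum>j<n. \<bar>of_int G ^ k * \<kappa> (x * e j) i\<bar>) \<le> (2 * \<bar>of_int G\<bar>) ^ k"

lemma size_le_exists:
  assumes x: "x \<in> R" shows "\<exists>k. size_le k x"
proof -
  have "\<exists>k. \<forall>k'\<ge>k. of_int G ^ k' * \<kappa> (x * e j) i \<in> \<int>" if "j < n" for i j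
    using x e that by (intro Zinv_clear[OF \<kappa>_Zinv G] R_intros) auto
  then have "\<forall>i j. \<exists>k. j < n \<longrightarrow> (\<forall>k'\<ge>k. of_int G ^ k' * \<kappa> (x * e j) i \<in> \<int>)" by blast
  then obtain k where k: "\<forall>i j. j < n \<longrightarrow> (\<forall>k'\<ge>k i j. of_int G ^ k' * \<kappa> (x * e j) i \<in> \<int>)"
    by metis
  define S where "S = (\<Sum>i<n. \<Sum>j<n. \<bar>\<kappa> (x * e j) i\<bar>)"
  obtain k0 :: nat where k0: "S < 2 ^ k0"
    using real_arch_pow[of 2 "real_of_rat S"] by (metis of_rat_less of_rat_numeral_eq of_rat_power one_less_numeral_iff semiring_norm(76))
  define K where "K = k0 + (\<Sum>i<n. \<Sum>j<n. k i j)"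
  have le: "k i j \<le> K" if "i < n" "j < n" for i j
  proof -
    have "k i j \<le> (\<Sum>j<n. k i j)" using that by (intro member_le_sum) auto
    also have "\<dots> \<le> (\<Sum>i<n. \<Sum>j<n. k i j)"
      using that by (intro member_le_sum[of i _ "\<lambda>i. \<Sum>j<n. k i j"]) auto
    finally show ?thesis by (simp add: K_def)
  qed
  have "(\<Sum>i<n. \<Sum>j<n. \<bar>of_int G ^ K * \<kappa> (x * e j) i\<bar>) = \<bar>of_int G\<bar> ^ K * S"
    by (simp add: S_def abs_mult power_abs sum_distrib_left)
  also have "\<dots> \<le> \<bar>of_int G\<bar> ^ K * 2 ^ K"
  proof (rule mult_left_mono)
    have "(2::rat) ^ k0 \<le> 2 ^ K" by (intro power_increasing) (auto simp: K_def)
    then show "S \<le> 2 ^ K" using k0 by linarith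
  qed simp
  finally show ?thesis using x k le by (intro exI[of _ K]) (auto simp: size_le_def power_mult_distrib mult.commute)
qed

lemma size_le_mono:
  assumes "size_le k x" "k \<le> k'" shows "size_le k' x"
proof -
  have G': "(of_int G :: rat) ^ k' = of_int G ^ (k' - k) * of_int G ^ k" using assms(2) by (simp flip: power_add)
  have "(\<Sum>i<n. \<Sum>j<n. \<bar>of_int G ^ k' * \<kappa> (x * e j) i\<bar>)
      = \<bar>of_int G\<bar> ^ (k' - k) * (\<Sum>i<n. \<Sum>j<n. \<bar>of_int G ^ k * \<kappa> (x * e j) i\<bar>)"
    by (simp add: G' abs_mult power_abs sum_distrib_left mult.assoc)
  also have "\<dots> \<le> (2 * \<bar>of_int G\<bar>) ^ (k' - k) * (2 * \<bar>of_int G\<bar>) ^ k"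
    using assms(1) by (intro mult_mono power_mono) (auto simp: size_le_def intro!: sum_nonneg)
  also have "\<dots> = (2 * \<bar>of_int G\<bar>) ^ k'" unfolding power_add[symmetric] using assms(2) by simp
  finally show ?thesis using assms(1) by (auto simp: size_le_def G' mult.assoc)
qed

lemma size_le_add:
  assumes "size_le k x" "size_le k y" shows "size_le (Suc k) (x + y)"
proof -
  have xy: "x \<in> R" "y \<in> R" using assms by (auto simp: size_le_def)
  have split: "of_int G ^ Suc k * \<kappa> ((x + y) * e j) i
      = of_int G * (of_int G ^ k * \<kappa> (x * e j) i + of_int G ^ k * \<kappa> (y * e j) i)" if "j < n" for i j
    using xy e[OF that] by (simp add: distrib_right \<kappa>_add R_intros algebra_simps)
  have "(\<Sum>i<n. \<Sum>j<n. \<bar>of_int G ^ Suc k * \<kappa> ((x + y) * e j) i\<bar>)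
      \<le> (\<Sum>i<n. \<Sum>j<n. \<bar>of_int G\<bar> * (\<bar>of_int G ^ k * \<kappa> (x * e j) i\<bar> + \<bar>of_int G ^ k * \<kappa> (y * e j) i\<bar>))"
    by (intro sum_mono)
      (simp only: split lessThan_iff abs_mult, intro mult_left_mono abs_triangle_ineq[THEN order_trans] add_mono,
        auto simp: abs_mult)
  also have "\<dots> = \<bar>of_int G\<bar> * ((\<Sum>i<n. \<Sum>j<n. \<bar>of_int G ^ k * \<kappa> (x * e j) i\<bar>)
      + (\<Sum>i<n. \<Sum>j<n. \<bar>of_int G ^ k * \<kappa> (y * e j) i\<bar>))"
    by (simp add: sum_distrib_left sum.distrib distrib_left)
  also have "\<dots> \<le> \<bar>of_int G\<bar> * ((2 * \<bar>of_int G\<bar>) ^ k + (2 * \<bar>of_int G\<bar>) ^ k)"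
    using assms by (intro mult_left_mono add_mono) (auto simp: size_le_def)
  finally show ?thesis using assms xy
    by (auto simp: size_le_def split R_intros simp del: power_Suc) (simp add: algebra_simps)
qed

lemma size_le_mult:
  assumes "size_le k x" "size_le l y" shows "size_le (k + l) (x * y)"
proof -
  have xy: "x \<in> R" "y \<in> R" using assms by (auto simp: size_le_def)
  let ?a = "\<lambda>i j. of_int G ^ k * \<kappa> (x * e j) i" and ?b = "\<lambda>i j. of_int G ^ l * \<kappa> (y * e j) i"
  have prod: "of_int G ^ (k + l) * \<kappa> (x * y * e j) i = (\<Sum>h<n. ?a i h * ?b h j)" if "j < n" for i j
  proof -
    have "\<kappa> (x * y * e j) i = (\<Sum>h<n. \<kappa> (y * e j) h * \<kappa> (e h * x) i)"
      using \<kappa>_mult[of "y * e j" x i] xy e[OF that] by (simp add: R_intros mult_ac)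
    then show ?thesis by (simp add: sum_distrib_left power_add mult_ac)
  qed
  have "(\<Sum>i<n. \<Sum>j<n. \<bar>of_int G ^ (k + l) * \<kappa> (x * y * e j) i\<bar>)
      \<le> (\<Sum>i<n. \<Sum>j<n. \<Sum>h<n. \<bar>?a i h\<bar> * \<bar>?b h j\<bar>)"
    by (intro sum_mono) (auto simp: prod intro!: order_trans[OF sum_abs] simp: abs_mult)
  also have "\<dots> = (\<Sum>i<n. \<Sum>h<n. \<bar>?a i h\<bar> * (\<Sum>j<n. \<bar>?b h j\<bar>))"
  proof (rule sum.cong[OF refl])
    fix i
    show "(\<Sum>j<n. \<Sum>h<n. \<bar>?a i h\<bar> * \<bar>?b h j\<bar>) = (\<Sum>h<n. \<bar>?a i h\<bar> * (\<Sum>j<n. \<bar>?b h j\<bar>))"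
      unfolding sum_distrib_left by (rule sum.swap)
  qed
  also have "\<dots> \<le> (\<Sum>i<n. \<Sum>h<n. \<bar>?a i h\<bar> * (\<Sum>h<n. \<Sum>j<n. \<bar>?b h j\<bar>))"
    by (intro sum_mono mult_left_mono member_le_sum[of _ _ "\<lambda>h. \<Sum>j<n. \<bar>?b h j\<bar>"])
      (auto intro!: sum_nonneg)
  also have "\<dots> = (\<Sum>i<n. \<Sum>h<n. \<bar>?a i h\<bar>) * (\<Sum>h<n. \<Sum>j<n. \<bar>?b h j\<bar>)"
    by (simp only: sum_distrib_right)
  also have "\<dots> \<le> (2 * \<bar>of_int G\<bar>) ^ k * (2 * \<bar>of_int G\<bar>) ^ l"
    using assms by (intro mult_mono) (auto simp: size_le_def intro!: sum_nonneg)
  also have "\<dots> = (2 * \<bar>of_int G\<bar>) ^ (k + l)" by (simp add: power_add)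
  finally have norm: "(\<Sum>i<n. \<Sum>j<n. \<bar>of_int G ^ (k + l) * \<kappa> (x * y * e j) i\<bar>) \<le> (2 * \<bar>of_int G\<bar>) ^ (k + l)" .
  have "of_int G ^ (k + l) * \<kappa> (x * y * e j) i \<in> \<int>" if "i < n" "j < n" for i j
    unfolding prod[OF that(2)]
  proof (intro Ints_sum Ints_mult[of "?a _ _"])
    fix h assume "h \<in> {..<n}"
    then show "?a i h \<in> \<int>" "?b h j \<in> \<int>" using assms that by (simp_all add: size_le_def)
  qed
  then show ?thesis using norm xy R_intros(3) by (simp add: size_le_def)
qed

text \<open>Liouville's inequality.\<close>

lemma Norm_height:
  assumes p: "prime p" "\<not> int p dvd G" and sz: "size_le k x" and N: "Norm x \<noteq> 0" "Norm x \<in> Zpow p v"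
  shows "of_nat p ^ v \<le> (fact n * ((2 * \<bar>of_int G\<bar>) ^ k) ^ n :: rat)"
proof -
  define A where "A = of_int G ^ k \<cdot>\<^sub>m L x"
  have A: "A \<in> carrier_mat n n" by (simp add: A_def L_carrier)
  have ent: "A $$ (i, j) = of_int G ^ k * \<kappa> (x * e j) i" if "i < n" "j < n" for i j
    using that by (simp add: A_def L_def)
  have detA: "det A = of_int (G ^ k) ^ n * Norm x"
    using L_carrier[of x] by (simp add: A_def Norm_def)
  have bound: "\<bar>A $$ (i, j)\<bar> \<le> (2 * \<bar>of_int G\<bar>) ^ k" if "i < n" "j < n" for i j
  proof -
    have "\<bar>A $$ (i, j)\<bar> \<le> (\<Sum>j<n. \<bar>A $$ (i, j)\<bar>)" using that by (intro member_le_sum) auto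
    also have "\<dots> \<le> (\<Sum>i<n. \<Sum>j<n. \<bar>A $$ (i, j)\<bar>)"
      using that by (intro member_le_sum[of i _ "\<lambda>i. \<Sum>j<n. \<bar>A $$ (i, j)\<bar>"]) (auto intro!: sum_nonneg)
    also have "\<dots> \<le> (2 * \<bar>of_int G\<bar>) ^ k" using sz by (simp add: ent size_le_def)
    finally show ?thesis .
  qed
  have "\<bar>det A\<bar> \<le> (\<Sum>q | q permutes {0..<n}. \<bar>signof q * (\<Prod>i = 0..<n. A $$ (i, q i))\<bar>)"
    unfolding det_def'[OF A] by (rule sum_abs)
  also have "\<dots> \<le> (\<Sum>q | q permutes {0..<n}. ((2 * \<bar>of_int G\<bar>) ^ k) ^ n)"
  proof (rule sum_mono)
    fix q assume q: "q \<in> {q. q permutes {0..<n}}"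
    have "\<bar>signof q * (\<Prod>i = 0..<n. A $$ (i, q i))\<bar> = (\<Prod>i = 0..<n. \<bar>A $$ (i, q i)\<bar>)"
      by (simp add: abs_mult sign_def abs_prod)
    also have "\<dots> \<le> (\<Prod>i = 0..<n. (2 * \<bar>of_int G\<bar>) ^ k)"
      using q bound by (intro prod_mono) (auto simp: permutes_in_image[of _ "{0..<n}"])
    finally show "\<bar>signof q * (\<Prod>i = 0..<n. A $$ (i, q i))\<bar> \<le> ((2 * \<bar>of_int G\<bar>) ^ k) ^ n" by simp
  qed
  also have "\<dots> = fact n * ((2 * \<bar>of_int G\<bar>) ^ k) ^ n"
    by (simp add: card_permutations[of "{0..<n}" n])
  finally have upper: "\<bar>det A\<bar> \<le> fact n * ((2 * \<bar>of_int G\<bar>) ^ k) ^ n" .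
  \<comment> \<open>A nonzero integer divisible by \<open>p ^ v\<close> is at least
    \<open>p ^ v\<close> in absolute value.\<close>
  have "det A \<in> \<int>" unfolding det_def'[OF A]
    using sz by (intro Ints_sum Ints_mult Ints_prod)
      (auto simp: sign_def ent size_le_def permutes_in_image[of _ "{0..<n}"])
  then obtain D where D: "det A = of_int D" by (rule Ints_cases)
  have "of_int D \<in> Zpow p v"
    unfolding D[symmetric] detA using N(2)
    by (intro Zpow_mult_left[OF p(1)]) (auto intro!: Zloc_intros[OF p(1)])
  then have "int p ^ v dvd D" by (simp add: Zpow_of_int_iff[OF p(1)])
  moreover have "D \<noteq> 0" using D detA N(1) G by auto
  ultimately have "int p ^ v \<le> \<bar>D\<bar>" using dvd_imp_le_int[of D "int p ^ v"] by simp
  then have "(of_int (int p ^ v) :: rat) \<le> of_int \<bar>D\<bar>" by (simp only: of_int_le_iff)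
  then show ?thesis using upper D by simp
qed

end

section \<open>Pseudo-division over a subring\<close>

definition coeffs_in :: "'a::zero set \<Rightarrow> 'a poly \<Rightarrow> bool" where
  "coeffs_in R C \<longleftrightarrow> (\<forall>i. coeff C i \<in> R)"

context
  fixes R :: "'k::field_char_0 set"
  assumes R: "is_subring R"
begin

lemma coeffs_in_0: "coeffs_in R 0"
  by (simp add: coeffs_in_def subring_zero[OF R])

lemma coeffs_in_const: "c \<in> R \<Longrightarrow> coeffs_in R [:c:]"
  by (auto simp: coeffs_in_def coeff_pCons subring_zero[OF R] split: nat.splits)

lemma coeffs_in_monom: "c \<in> R \<Longrightarrow> coeffs_in R (monom c j)"
  by (auto simp: coeffs_in_def subring_zero[OF R])

lemma coeffs_in_add: "coeffs_in R C \<Longrightarrow> coeffs_in R D \<Longrightarrow> coeffs_in R (C + D)"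
  by (auto simp: coeffs_in_def intro: subring_intros[OF R])

lemma coeffs_in_diff: "coeffs_in R C \<Longrightarrow> coeffs_in R D \<Longrightarrow> coeffs_in R (C - D)"
  by (auto simp: coeffs_in_def intro: subring_intros[OF R])

lemma coeffs_in_mult: "coeffs_in R C \<Longrightarrow> coeffs_in R D \<Longrightarrow> coeffs_in R (C * D)"
  by (auto simp: coeffs_in_def coeff_mult intro: subring_intros[OF R])

lemma coeffs_in_smult: "c \<in> R \<Longrightarrow> coeffs_in R D \<Longrightarrow> coeffs_in R (smult c D)"
  by (auto simp: coeffs_in_def intro: subring_intros[OF R])

lemmas coeffs_in_intros = coeffs_in_0 coeffs_in_const coeffs_in_monom coeffs_in_add coeffs_in_diff
  coeffs_in_mult coeffs_in_smult

text \<open>The dividend is allowed to have coefficients in an ideal \<open>I\<close>, because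
  multiplying by the leading coefficient and subtracting multiples of \<open>Q\<close> stay inside
  \<open>I\<close>. With \<open>I\<close> a kernel this shows later that the extended coordinates
  vanish on an ideal.\<close>

lemma pseudo_division:
  assumes Q: "coeffs_in R Q" "Q \<noteq> 0"
    and I: "I \<subseteq> R" "0 \<in> I" "\<And>x y. x \<in> I \<Longrightarrow> y \<in> I \<Longrightarrow> x - y \<in> I" "\<And>x y. x \<in> R \<Longrightarrow> y \<in> I \<Longrightarrow> x * y \<in> I"
    and E: "coeffs_in I E"
  shows "\<exists>k B C. smult (lead_coeff Q ^ k) E = B * Q + C \<and> coeffs_in R B \<and> coeffs_in I C \<and>
    (C = 0 \<or> degree C < degree Q)"
  using E
proof (induction "degree E" arbitrary: E rule: less_induct)
  case less
  show ?case
  proof (cases "E = 0 \<or> degree E < degree Q")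
    case True
    then show ?thesis
      using less.prems by (intro exI[of _ 0] exI[of _ 0] exI[of _ E]) (auto simp: coeffs_in_intros)
  next
    case False
    then have E0: "E \<noteq> 0" "degree Q \<le> degree E" by auto
    have lc: "lead_coeff E \<in> I" using less.prems by (simp add: coeffs_in_def)
    then have lcR: "lead_coeff E \<in> R" using I(1) by blast
    define T where "T = monom (lead_coeff E) (degree E - degree Q)"
    define E' where "E' = smult (lead_coeff Q) E - T * Q"
    have "coeff (T * Q) i \<in> I" for i
    proof -
      have "coeff (T * Q) i = (if degree E - degree Q \<le> i then coeff Q (i - (degree E - degree Q)) * lead_coeff E else 0)"
        unfolding T_def coeff_monom_mult by (simp add: mult.commute)
      then show ?thesis using I(2,4) lc Q(1) by (auto simp: coeffs_in_def)
    qed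
    then have E': "coeffs_in I E'"
      using less.prems I Q(1) by (auto simp: coeffs_in_def E'_def)
    have lead: "coeff E' (degree E) = 0"
    proof -
      have "coeff (T * Q) (degree E) = lead_coeff E * lead_coeff Q"
        using E0 by (simp add: T_def coeff_monom_mult)
      then show ?thesis by (simp add: E'_def)
    qed
    have "degree E' \<le> degree E"
    proof -
      have "degree (T * Q) \<le> degree E"
        using degree_mult_le[of T Q] degree_monom_le[of "lead_coeff E" "degree E - degree Q"] E0(2)
        by (simp add: T_def)
      then show ?thesis unfolding E'_def by (intro degree_diff_le) (auto intro: order_trans[OF degree_smult_le])
    qed
    then have "E' = 0 \<or> degree E' < degree E"
      using lead by (metis le_neq_implies_less leading_coeff_0_iff)
    then have "\<exists>k B C. smult (lead_coeff Q ^ k) E' = B * Q + C \<and> coeffs_in R B \<and> coeffs_in I C \<and>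
        (C = 0 \<or> degree C < degree Q)"
    proof
      assume "E' = 0"
      then show ?thesis using I by (intro exI[of _ 0]) (auto simp: coeffs_in_0 coeffs_in_def)
    qed (use less.hyps E' in blast)
    then obtain k B C where *: "smult (lead_coeff Q ^ k) E' = B * Q + C" "coeffs_in R B" "coeffs_in I C"
      "C = 0 \<or> degree C < degree Q" by blast
    have lQ: "lead_coeff Q ^ k \<in> R" using Q(1) by (auto simp: coeffs_in_def intro: subring_intros[OF R])
    have "smult (lead_coeff Q ^ Suc k) E = smult (lead_coeff Q ^ k) E' + smult (lead_coeff Q ^ k) (T * Q)"
      by (simp add: E'_def smult_diff_right mult.commute)
    also have "\<dots> = (B + smult (lead_coeff Q ^ k) T) * Q + C"
      by (simp add: *(1) algebra_simps)
    finally show ?thesis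
      using * lQ lcR by (intro exI[of _ "Suc k"] exI[of _ "B + smult (lead_coeff Q ^ k) T"] exI[of _ C])
        (auto simp: T_def intro!: coeffs_in_intros)
  qed
qed

end

text \<open>\<open>int_specializable R\<close> and \<open>specializable R\<close> say that \<open>R\<close> has many homomorphisms to \<open>\<int>\<close>, resp.
  to orders in products of number fields, all of them well-behaved at one fixed prime \<open>p\<close>.\<close>

definition int_hom :: "'k::field_char_0 set \<Rightarrow> ('k \<Rightarrow> int) \<Rightarrow> bool" where
  "int_hom R \<sigma> \<longleftrightarrow> (\<forall>x\<in>R. \<forall>y\<in>R. \<sigma> (x + y) = \<sigma> x + \<sigma> y \<and> \<sigma> (x * y) = \<sigma> x * \<sigma> y) \<and> \<sigma> 1 = 1"

definition int_specializable :: "'k::field_char_0 set \<Rightarrow> bool" where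
  "int_specializable R \<longleftrightarrow> is_subring R \<and> (\<forall>g\<in>R - {0}. \<forall>b. \<exists>p>b. prime p \<and>
    (\<forall>c\<in>R - {0}. \<exists>\<sigma>. int_hom R \<sigma> \<and> \<not> int p dvd \<sigma> g \<and> \<sigma> c \<noteq> 0))"

text \<open>Nonvanishing, or being prime to \<open>p\<close>, of an image is expressed by dividing
  an integer scalar. This form passes to an algebraic extension without computing a relative
  norm.\<close>

definition divides_scalar :: "'k::field_char_0 set \<Rightarrow> ('k \<Rightarrow> nat \<Rightarrow> rat) \<Rightarrow> 'k \<Rightarrow> int \<Rightarrow> bool" where
  "divides_scalar R \<kappa> g M \<longleftrightarrow> (\<exists>y\<in>R. \<forall>i. \<kappa> (g * y) i = of_int M * \<kappa> 1 i)"

text \<open>The prime \<open>p\<close> and the rank \<open>n\<close> precede \<open>c\<close>: they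
  determine the period of the residue classes, which must not depend on the value to be detected.
  Only the coordinates may depend on \<open>c\<close>.\<close>

definition specializable_at :: "'k::field_char_0 set \<Rightarrow> nat \<Rightarrow> 'k \<Rightarrow> nat \<Rightarrow> bool" where
  "specializable_at R n g p \<longleftrightarrow> (\<forall>c\<in>R - {0}. \<exists>G \<kappa> e. coord_sys R n G \<kappa> e \<and> \<not> int p dvd G \<and>
    (\<exists>M. divides_scalar R \<kappa> g M \<and> \<not> int p dvd M) \<and> (\<exists>M. divides_scalar R \<kappa> c M \<and> M \<noteq> 0))"

definition specializable :: "'k::field_char_0 set \<Rightarrow> bool" where
  "specializable R \<longleftrightarrow> is_subring R \<and>
    (\<exists>n. \<forall>g\<in>R - {0}. \<forall>b. \<exists>p>b. prime p \<and> specializable_at R n g p)"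

lemma int_specializable_Ints: "int_specializable (\<int> :: 'k::field_char_0 set)"
  unfolding int_specializable_def
proof (intro conjI ballI allI)
  show "is_subring (\<int> :: 'k set)" by (auto simp: is_subring_def)
  fix g :: 'k and b :: nat assume g: "g \<in> \<int> - {0}"
  then obtain a where a: "g = of_int a" "a \<noteq> 0" by (auto elim: Ints_cases)
  obtain p where p: "prime p" "max b (nat \<bar>a\<bar>) < p" using bigger_prime by blast
  define \<sigma> :: "'k \<Rightarrow> int" where "\<sigma> = the_inv of_int"
  have \<sigma>: "\<sigma> (of_int m) = m" for m by (simp add: \<sigma>_def the_inv_f_f inj_on_def)
  have "\<not> int p dvd a"
    using p(2) a(2) dvd_imp_le_int[of a "int p"] by auto
  then have "int_hom \<int> \<sigma> \<and> \<not> int p dvd \<sigma> g \<and> \<sigma> c \<noteq> 0" if "c \<in> \<int> - {0}" for c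
    using that \<sigma> \<sigma>[of 1] a(1) unfolding int_hom_def
    by (auto elim!: Ints_cases simp flip: of_int_add of_int_mult)
  then show "\<exists>p>b. prime p \<and> (\<forall>c\<in>\<int> - {0}. \<exists>\<sigma>. int_hom \<int> \<sigma> \<and> \<not> int p dvd \<sigma> g \<and> \<sigma> c \<noteq> 0)"
    using p by (intro exI[of _ p]) auto
qed

section \<open>Adjoining transcendental elements\<close>

definition adjoin :: "'k::field_char_0 set \<Rightarrow> 'k \<Rightarrow> 'k set" where
  "adjoin R t = {poly C t | C. coeffs_in R C}"

lemma is_subring_adjoin:
  assumes R: "is_subring R" shows "is_subring (adjoin R t)"
  unfolding is_subring_def
proof (intro conjI ballI)
  show "1 \<in> adjoin R t"
    unfolding adjoin_def using coeffs_in_const[OF R subring_one[OF R]] by (intro CollectI exI[of _ "[:1:]"]) simp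
  fix x y assume "x \<in> adjoin R t" "y \<in> adjoin R t"
  then obtain C D where *: "x = poly C t" "coeffs_in R C" "y = poly D t" "coeffs_in R D"
    by (auto simp: adjoin_def)
  show "x - y \<in> adjoin R t" unfolding adjoin_def
    using * by (intro CollectI exI[of _ "C - D"]) (auto intro: coeffs_in_intros[OF R])
  show "x * y \<in> adjoin R t" unfolding adjoin_def
    using * by (intro CollectI exI[of _ "C * D"]) (auto intro: coeffs_in_intros[OF R])
qed

lemma adjoin_superset:
  assumes R: "is_subring R" shows "R \<subseteq> adjoin R t" "t \<in> adjoin R t"
proof -
  show "R \<subseteq> adjoin R t"
  proof
    fix c assume "c \<in> R"
    then show "c \<in> adjoin R t" unfolding adjoin_def
      by (intro CollectI exI[of _ "[:c:]"]) (auto intro: coeffs_in_intros[OF R])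
  qed
  show "t \<in> adjoin R t" unfolding adjoin_def
    by (intro CollectI exI[of _ "monom 1 1"]) (auto intro!: coeffs_in_intros[OF R] subring_intros[OF R] simp: poly_monom)
qed

definition algebraic_over :: "'k::field_char_0 set \<Rightarrow> 'k \<Rightarrow> bool" where
  "algebraic_over R a \<longleftrightarrow> (\<exists>Q. coeffs_in R Q \<and> Q \<noteq> 0 \<and> poly Q a = 0)"

lemma finite_roots_bound:
  fixes q :: "int poly"
  assumes "q \<noteq> 0" "finite A" "card A > degree q"
  shows "\<exists>x\<in>A. poly q x \<noteq> 0"
proof (rule ccontr)
  assume "\<not> ?thesis"
  then have "A \<subseteq> {x. poly q x = 0}" by auto
  then have "card A \<le> card {x. poly q x = 0}" by (intro card_mono poly_roots_finite assms)
  also have "\<dots> \<le> degree q" using assms(1) by (rule card_poly_roots_bound)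
  finally show False using assms(3) by simp
qed

text \<open>Lagrange's bound for roots modulo \<open>p\<close>: after splitting off one root by
  synthetic division, the differences \<open>b - a\<close> are invertible modulo \<open>p\<close>,
  so the remaining roots pass to the quotient.\<close>

lemma prime_dvd_lead_coeff:
  fixes q :: "int poly"
  assumes p: "prime p" and A: "finite A" "card A > degree q"
    and distinct: "\<And>a b. a \<in> A \<Longrightarrow> b \<in> A \<Longrightarrow> a \<noteq> b \<Longrightarrow> \<not> p dvd b - a"
    and roots: "\<And>a. a \<in> A \<Longrightarrow> p dvd poly q a"
  shows "p dvd lead_coeff q"
  using A distinct roots
proof (induction "degree q" arbitrary: q A)
  case 0
  then obtain c where c: "q = [:c:]" by (metis degree_0_id)
  obtain a where "a \<in> A" using 0 by (metis card_gt_0_iff ex_in_conv)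
  with 0(5) show ?case by (simp add: c)
next
  case (Suc d)
  obtain a where a: "a \<in> A" using Suc.prems by fastforce
  define s where "s = synthetic_div q a"
  have q: "q = [:- a, 1:] * s + [:poly q a:]" by (simp only: s_def synthetic_div_correct')
  have deg: "degree s = d" using Suc.hyps(2) by (simp add: s_def degree_synthetic_div)
  have "p dvd poly s b" if b: "b \<in> A - {a}" for b
  proof -
    have "poly q b = (b - a) * poly s b + poly q a"
      by (subst q) (simp add: algebra_simps)
    then have "(b - a) * poly s b = poly q b - poly q a" by simp
    then have "p dvd (b - a) * poly s b" using Suc.prems(4) a b by simp
    then show ?thesis using p Suc.prems(3)[of a b] a b by (auto simp: prime_dvd_mult_iff)
  qed
  then have "p dvd lead_coeff s"
    using Suc.prems a deg Suc.hyps(2) by (intro Suc.hyps(1)[of s "A - {a}"]) auto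
  moreover have "lead_coeff q = lead_coeff s"
  proof -
    have "coeff q (Suc d) = coeff ([:- a, 1:] * s + [:poly q a:]) (Suc d)" using q by simp
    also have "\<dots> = coeff s d" using deg by (simp add: coeff_eq_0)
    finally show ?thesis using deg Suc.hyps(2) by simp
  qed
  ultimately show ?case by simp
qed

lemma nonroot_mod_prime:
  fixes q :: "int poly"
  assumes "prime p" "degree q < p" "\<not> int p dvd lead_coeff q"
  shows "\<exists>x. \<not> int p dvd poly q x"
proof (rule ccontr)
  assume "\<not> ?thesis"
  moreover have "\<not> int p dvd b - a" if "a \<in> {0..<int p}" "b \<in> {0..<int p}" "a \<noteq> b" for a b
    using that by (auto simp flip: mod_eq_dvd_iff)
  ultimately have "int p dvd lead_coeff q"
    using assms by (intro prime_dvd_lead_coeff[of "int p" "{0..<int p}"]) auto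
  then show False using assms by simp
qed

text \<open>The transcendental element is sent to an integer \<tau>. Its residue modulo
  \<open>p\<close> is chosen so that the image of \<open>g\<close> stays prime to \<open>p\<close>;
  within that residue class \<tau> is moved until the image of \<open>c\<close> is nonzero. The
  induction is applied to the leading coefficients, which is why the definition carries an element
  \<open>g\<close>.\<close>

lemma int_specializable_adjoin:
  fixes R :: "'k::field_char_0 set"
  assumes R: "int_specializable R" and t: "\<not> algebraic_over R t"
  shows "int_specializable (adjoin R t)"
  unfolding int_specializable_def
proof (intro conjI ballI allI)
  have sR: "is_subring R" using R by (simp add: int_specializable_def)
  show "is_subring (adjoin R t)" by (rule is_subring_adjoin[OF sR])
  have unique: "C = D" if "coeffs_in R C" "coeffs_in R D" "poly C t = poly D t" for C D
    using t that coeffs_in_diff[OF sR that(1,2)] by (auto simp: algebraic_over_def)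
  fix g :: 'k and b :: nat assume "g \<in> adjoin R t - {0}"
  then obtain Cg where Cg: "g = poly Cg t" "coeffs_in R Cg" "Cg \<noteq> 0" unfolding adjoin_def by force
  then have "lead_coeff Cg \<in> R - {0}" by (auto simp: coeffs_in_def)
  \<comment> \<open>A polynomial whose leading coefficient is prime to \<open>p\<close> has a
    nonroot modulo \<open>p\<close> once its degree is less than \<open>p\<close>.\<close>
  then obtain p where p: "prime p" "max b (degree Cg) < p"
    and \<sigma>s: "\<forall>c\<in>R - {0}. \<exists>\<sigma>. int_hom R \<sigma> \<and> \<not> int p dvd \<sigma> (lead_coeff Cg) \<and> \<sigma> c \<noteq> 0"
    using R unfolding int_specializable_def by blast
  have "\<exists>\<sigma>. int_hom (adjoin R t) \<sigma> \<and> \<not> int p dvd \<sigma> g \<and> \<sigma> c \<noteq> 0" if c: "c \<in> adjoin R t - {0}" for c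
  proof -
    obtain Cc where Cc: "c = poly Cc t" "coeffs_in R Cc" "Cc \<noteq> 0" using c unfolding adjoin_def by force
    then have "lead_coeff Cc \<in> R - {0}" by (auto simp: coeffs_in_def)
    with \<sigma>s obtain \<sigma> where \<sigma>: "int_hom R \<sigma>" and g: "\<not> int p dvd \<sigma> (lead_coeff Cg)" and c: "\<sigma> (lead_coeff Cc) \<noteq> 0"
      by blast
    have add: "\<sigma> (x + y) = \<sigma> x + \<sigma> y" and mult: "\<sigma> (x * y) = \<sigma> x * \<sigma> y" if "x \<in> R" "y \<in> R" for x y
      using \<sigma> that by (auto simp: int_hom_def)
    have one: "\<sigma> 1 = 1" using \<sigma> by (simp add: int_hom_def)
    have zero: "\<sigma> 0 = 0" using add[of 0 0] subring_zero[OF sR] by simp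
    have sum: "\<sigma> (sum f I) = (\<Sum>i\<in>I. \<sigma> (f i))" if "\<And>i. i \<in> I \<Longrightarrow> f i \<in> R" for f and I :: "nat set"
      using that by (induction I rule: infinite_finite_induct) (auto simp: zero add subring_intros[OF sR])
    let ?m = "map_poly \<sigma>"
    have cm: "coeff (?m C) i = \<sigma> (coeff C i)" for C i by (simp add: coeff_map_poly zero)
    have m_add: "?m (C + D) = ?m C + ?m D" if "coeffs_in R C" "coeffs_in R D" for C D
      using that by (intro poly_eqI) (simp add: cm add coeffs_in_def)
    have m_mult: "?m (C * D) = ?m C * ?m D" if "coeffs_in R C" "coeffs_in R D" for C D
      using that by (intro poly_eqI) (simp add: cm coeff_mult sum mult coeffs_in_def subring_mult[OF sR])
    have "degree (?m C) = degree C" if "\<sigma> (lead_coeff C) \<noteq> 0" for C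
      using that by (intro antisym degree_le le_degree) (simp_all add: cm coeff_eq_0 zero)
    then have "degree (?m Cg) = degree Cg" "degree (?m Cc) = degree Cc"
      using g c by (metis dvd_0_right, metis)
    then have lg: "lead_coeff (?m Cg) = \<sigma> (lead_coeff Cg)" and lc: "lead_coeff (?m Cc) = \<sigma> (lead_coeff Cc)"
      by (simp_all add: cm)
    obtain \<tau>0 where \<tau>0: "\<not> int p dvd poly (?m Cg) \<tau>0"
      using nonroot_mod_prime[of p "?m Cg"] p g lg \<open>degree (?m Cg) = degree Cg\<close> by auto
    \<comment> \<open>One more candidate in the residue class than the degree, so that not all of
      them are roots.\<close>
    have "\<exists>x\<in>(\<lambda>j. \<tau>0 + int p * int j) ` {..degree (?m Cc)}. poly (?m Cc) x \<noteq> 0"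
    proof (rule finite_roots_bound)
      show "?m Cc \<noteq> 0" using lc c by auto
      show "degree (?m Cc) < card ((\<lambda>j. \<tau>0 + int p * int j) ` {..degree (?m Cc)})"
        using p by (subst card_image) (auto simp: inj_on_def prime_gt_0_nat)
    qed simp
    then obtain j where j: "poly (?m Cc) (\<tau>0 + int p * int j) \<noteq> 0" by blast
    define \<tau> where "\<tau> = \<tau>0 + int p * int j"
    have \<tau>: "int p dvd \<tau> - \<tau>0" "poly (?m Cc) \<tau> \<noteq> 0" using j by (simp_all add: \<tau>_def)
    define sd where "sd = synthetic_div (?m Cg) \<tau>0"
    have "?m Cg = [:- \<tau>0, 1:] * sd + [:poly (?m Cg) \<tau>0:]"
      by (simp only: synthetic_div_correct' sd_def)
    then have "poly (?m Cg) \<tau> = poly ([:- \<tau>0, 1:] * sd + [:poly (?m Cg) \<tau>0:]) \<tau>"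
      by (rule arg_cong)
    also have "\<dots> = (\<tau> - \<tau>0) * poly sd \<tau> + poly (?m Cg) \<tau>0" by (simp add: algebra_simps)
    finally have "poly (?m Cg) \<tau> = (\<tau> - \<tau>0) * poly sd \<tau> + poly (?m Cg) \<tau>0" .
    then have g\<tau>: "\<not> int p dvd poly (?m Cg) \<tau>"
      using \<tau>0 \<tau>(1) by (metis dvd_add_right_iff dvd_mult2)
    \<comment> \<open>The choice is harmless: as \<open>t\<close> is transcendental over
      \<open>R\<close>, an element of \<open>adjoin R t\<close> has only one representing
      polynomial.\<close>
    define \<sigma>' where "\<sigma>' x = poly (?m (SOME C. coeffs_in R C \<and> x = poly C t)) \<tau>" for x
    have \<sigma>': "\<sigma>' (poly C t) = poly (?m C) \<tau>" if "coeffs_in R C" for C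
    proof -
      have "(SOME C'. coeffs_in R C' \<and> poly C t = poly C' t) = C"
        using that unique by (intro some_equality) auto
      then show ?thesis by (simp add: \<sigma>'_def)
    qed
    show ?thesis
      unfolding int_hom_def
    proof (intro exI[of _ \<sigma>'] conjI ballI)
      fix x y assume "x \<in> adjoin R t" "y \<in> adjoin R t"
      then obtain C D where *: "x = poly C t" "coeffs_in R C" "y = poly D t" "coeffs_in R D"
        by (auto simp: adjoin_def)
      show "\<sigma>' (x + y) = \<sigma>' x + \<sigma>' y"
        using * \<sigma>'[OF coeffs_in_add[OF sR *(2,4)]] by (simp add: \<sigma>' m_add)
      show "\<sigma>' (x * y) = \<sigma>' x * \<sigma>' y"
        using * \<sigma>'[OF coeffs_in_mult[OF sR *(2,4)]] by (simp add: \<sigma>' m_mult)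
    next
      show "\<sigma>' 1 = 1"
        using \<sigma>'[OF coeffs_in_const[OF sR subring_one[OF sR]]] by (simp add: map_poly_pCons one zero)
    qed (use \<sigma>' Cg Cc g\<tau> \<tau> in auto)
  qed
  then show "\<exists>p>b. prime p \<and>
      (\<forall>c\<in>adjoin R t - {0}. \<exists>\<sigma>. int_hom (adjoin R t) \<sigma> \<and> \<not> int p dvd \<sigma> g \<and> \<sigma> c \<noteq> 0)"
    using p by (intro exI[of _ p] conjI ballI) auto
qed

lemma algebraic_over_mono: "R \<subseteq> R' \<Longrightarrow> algebraic_over R a \<Longrightarrow> algebraic_over R' a"
  by (auto simp: algebraic_over_def coeffs_in_def)

lemma algebraic_over_member:
  assumes R: "is_subring R" and a: "a \<in> R" shows "algebraic_over R a"
  unfolding algebraic_over_def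
proof (intro exI conjI)
  show "coeffs_in R (monom 1 1 - [:a:])"
    using a by (intro coeffs_in_intros[OF R] subring_one[OF R])
  have "coeff (monom 1 1 - [:a:]) 1 = 1" by simp
  then show "monom 1 1 - [:a:] \<noteq> 0" by (metis coeff_0 zero_neq_one)
  show "poly (monom 1 1 - [:a:]) a = 0" by (simp add: poly_monom)
qed

text \<open>An element is adjoined only if it is transcendental over the ring reached so far; this
  selects a transcendence basis from \<open>A\<close>, over which the rest is algebraic.\<close>

lemma int_specializable_cover:
  fixes A :: "'k::field_char_0 set"
  assumes "finite A"
  shows "\<exists>R. int_specializable R \<and> (\<forall>a\<in>A. algebraic_over R a)"
  using assms
proof induction
  case empty
  then show ?case using int_specializable_Ints by blast
next
  case (insert a A)
  then obtain R where R: "int_specializable R" "\<forall>a\<in>A. algebraic_over R a" by blast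
  have sR: "is_subring R" using R(1) by (simp add: int_specializable_def)
  show ?case
  proof (cases "algebraic_over R a")
    case False
    have "algebraic_over (adjoin R a) a"
      by (rule algebraic_over_member[OF is_subring_adjoin[OF sR] adjoin_superset(2)[OF sR]])
    then show ?thesis
      using int_specializable_adjoin[OF R(1) False] R(2) algebraic_over_mono[OF adjoin_superset(1)[OF sR]]
      by (intro exI[of _ "adjoin R a"]) auto
  qed (use R in auto)
qed

lemma int_specializable_imp_specializable:
  fixes R :: "'k::field_char_0 set"
  assumes "int_specializable R" shows "specializable R"
proof -
  have sR: "is_subring R" using assms by (simp add: int_specializable_def)
  have "\<exists>p>b. prime p \<and> specializable_at R 1 g p" if g: "g \<in> R - {0}" for g :: 'k and b
  proof -
    from g obtain p where p: "prime p" "b < p"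
    and \<sigma>s: "\<forall>c\<in>R - {0}. \<exists>\<sigma>. int_hom R \<sigma> \<and> \<not> int p dvd \<sigma> g \<and> \<sigma> c \<noteq> 0"
    using assms unfolding int_specializable_def by blast
  have *: "\<exists>G \<kappa> e. coord_sys R 1 G \<kappa> e \<and> \<not> int p dvd G \<and>
    (\<exists>M. divides_scalar R \<kappa> g M \<and> \<not> int p dvd M) \<and> (\<exists>M. divides_scalar R \<kappa> c M \<and> M \<noteq> 0)"
    if c: "c \<in> R - {0}" for c
  proof -
    from \<sigma>s c obtain \<sigma> where \<sigma>: "int_hom R \<sigma>" and g': "\<not> int p dvd \<sigma> g" and c': "\<sigma> c \<noteq> 0"
      by blast
    have add: "\<sigma> (x + y) = \<sigma> x + \<sigma> y" and mult: "\<sigma> (x * y) = \<sigma> x * \<sigma> y" if "x \<in> R" "y \<in> R" for x y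
      using \<sigma> that by (auto simp: int_hom_def)
    have one: "\<sigma> 1 = 1" using \<sigma> by (simp add: int_hom_def)
    define \<kappa> :: "'k \<Rightarrow> nat \<Rightarrow> rat" where "\<kappa> x i = (if i = 0 then of_int (\<sigma> x) else 0)" for x i
    have "coord_sys R 1 1 \<kappa> (\<lambda>_. 1)"
    proof
      show "\<kappa> x i \<in> Zinv 1" for x i 
        using Zinv_of_int[of 0 1] Zinv_of_int[of "\<sigma> x" 1] by (cases "i = 0") (simp_all add: \<kappa>_def)
      show "\<kappa> (x * y) i = 0" if "x \<in> R" "y \<in> R" "\<And>i. \<kappa> x i = 0" for x y i
        using that(3)[of 0] mult[OF that(1,2)] by (auto simp: \<kappa>_def)
    qed (auto simp: sR add one \<kappa>_def subring_one[OF sR])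
    moreover have "\<not> int p dvd 1" using prime_gt_1_nat[OF p(1)] by simp
    moreover have "divides_scalar R \<kappa> x (\<sigma> x)" for x
      using subring_one[OF sR] by (auto simp: divides_scalar_def \<kappa>_def one intro!: bexI[of _ 1])
    ultimately show ?thesis using g' c' by blast
  qed
  have "specializable_at R 1 g p"
    unfolding specializable_at_def by (intro ballI) (rule *)
  then show ?thesis using p by blast
  qed
  then show ?thesis using sR unfolding specializable_def by blast
qed

section \<open>Adjoining algebraic elements\<close>

locale alg_ext =
  fixes R :: "'k::field_char_0 set" and a :: 'k and Q :: "'k poly"
  assumes R: "is_subring R" and Q: "coeffs_in R Q" "Q \<noteq> 0" "poly Q a = 0"
    and minimal: "coeffs_in R C \<Longrightarrow> C \<noteq> 0 \<Longrightarrow> poly C a = 0 \<Longrightarrow> degree Q \<le> degree C"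
begin

definition "d = degree Q"
definition "g = lead_coeff Q"

definition repr :: "'k \<Rightarrow> nat \<Rightarrow> 'k poly \<Rightarrow> bool" where
  "repr x i C \<longleftrightarrow> coeffs_in R C \<and> degree C < d \<and> g ^ i * x = poly C a"

text \<open>\<open>R'\<close> is the ring generated over \<open>R\<close> by \<open>a\<close> and
  \<open>1 / g\<close>. Inverting the leading coefficient \<open>g\<close> makes \<open>Q\<close>
  monic up to a unit, so \<open>R'\<close> is free over \<open>R\<close> with \<open>g\<close>
  inverted, with basis the powers of \<open>a\<close> below \<open>d\<close>; \<open>repr\<close> is
  the expansion over a common denominator \<open>g ^ i\<close>.\<close>

definition R' :: "'k set" where "R' = {x. \<exists>i C. repr x i C}"

lemma g: "g \<in> R" "g \<noteq> 0"
  using Q by (auto simp: g_def coeffs_in_def)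

lemma small_zero: "coeffs_in R C \<Longrightarrow> degree C < d \<Longrightarrow> poly C a = 0 \<Longrightarrow> C = 0"
  using minimal[of C] by (auto simp: d_def)

lemma d: "d \<ge> 1"
proof (rule ccontr)
  assume "\<not> d \<ge> 1"
  then have "degree Q = 0" by (simp add: d_def)
  then obtain c where "Q = [:c:]" by (metis degree_0_id)
  then show False using Q by simp
qed

lemmas R_intros = subring_intros[OF R]
lemmas coeffs_intros = coeffs_in_intros[OF R]

lemma reduce:
  assumes I: "I \<subseteq> R" "0 \<in> I" "\<And>x y. x \<in> I \<Longrightarrow> y \<in> I \<Longrightarrow> x - y \<in> I" "\<And>x y. x \<in> R \<Longrightarrow> y \<in> I \<Longrightarrow> x * y \<in> I"
    and E: "coeffs_in I E"
  shows "\<exists>k C. coeffs_in I C \<and> degree C < d \<and> g ^ k * poly E a = poly C a"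
proof -
  obtain k B C where *: "smult (lead_coeff Q ^ k) E = B * Q + C" "coeffs_in I C" "C = 0 \<or> degree C < degree Q"
    using pseudo_division[OF R Q(1,2) I E] by blast
  have "g ^ k * poly E a = poly (smult (lead_coeff Q ^ k) E) a" by (simp add: g_def)
  also have "\<dots> = poly C a" by (simp add: *(1) Q(3))
  finally show ?thesis using * d by (intro exI[of _ k] exI[of _ C]) (auto simp: d_def)
qed

lemma reduce_R: "coeffs_in R E \<Longrightarrow> \<exists>k C. repr (poly E a) k C"
  using reduce[of R E] by (auto simp: repr_def R_intros)

lemma poly_in_R': "coeffs_in R E \<Longrightarrow> poly E a \<in> R'"
  using reduce_R by (auto simp: R'_def)

lemma R_subset: "R \<subseteq> R'"
  using poly_in_R'[OF coeffs_intros(2)] by auto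

lemma a_in: "a \<in> R'"
  using poly_in_R'[OF coeffs_intros(3)[of 1 1]] by (simp add: poly_monom R_intros)

lemma repr_raise: "repr x i C \<Longrightarrow> repr x (j + i) (smult (g ^ j) C)"
  using g by (auto simp: repr_def power_add intro!: coeffs_intros R_intros intro: le_less_trans[OF degree_smult_le])

lemma repr_diff: "repr x i C \<Longrightarrow> repr y i D \<Longrightarrow> repr (x - y) i (C - D)"
  by (auto simp: repr_def right_diff_distrib intro!: coeffs_intros degree_diff_less)

lemma repr_add: "repr x i C \<Longrightarrow> repr y i D \<Longrightarrow> repr (x + y) i (C + D)"
  by (auto simp: repr_def distrib_left intro!: coeffs_intros degree_add_less)

lemma repr_mult_reduce:
  assumes "repr x i C" "repr y j D" "repr' = (\<lambda>k E. degree E < d \<and> g ^ k * poly (C * D) a = poly E a)"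
    "repr' k E" "coeffs_in R E"
  shows "repr (x * y) (k + i + j) E"
  using assms by (simp add: repr_def power_add) (metis (no_types, opaque_lifting) mult.assoc mult.commute)

lemma R'_subring: "is_subring R'"
  unfolding is_subring_def
proof (intro conjI ballI)
  show "1 \<in> R'" using R_subset R_intros by blast
  fix x y assume "x \<in> R'" "y \<in> R'"
  then obtain i C j D where *: "repr x i C" "repr y j D" by (auto simp: R'_def)
  have "repr y (i + j) (smult (g ^ i) D)" "repr x (i + j) (smult (g ^ j) C)"
    using repr_raise[OF *(1), of j] repr_raise[OF *(2), of i] by (simp_all add: add.commute)
  then show "x - y \<in> R'" using repr_diff unfolding R'_def by blast
  have "coeffs_in R (C * D)" using * by (auto simp: repr_def intro: coeffs_intros)
  from reduce_R[OF this] obtain k E where "repr (poly (C * D) a) k E" by blast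
  then have "repr (x * y) (k + i + j) E"
    by (intro repr_mult_reduce[OF * refl]) (auto simp: repr_def)
  then show "x * y \<in> R'" unfolding R'_def by blast
qed

text \<open>Euclid's algorithm, with minimality of \<open>Q\<close> in place of irreducibility: a
  vanishing remainder would make the quotient \<open>B\<close>, of degree less than
  \<open>d\<close>, vanish at \<open>a\<close>.\<close>

lemma bezout:
  assumes "coeffs_in R C" "C \<noteq> 0" "degree C < d"
  shows "\<exists>U r. coeffs_in R U \<and> r \<in> R \<and> r \<noteq> 0 \<and> poly U a * poly C a = r"
  using assms
proof (induction "degree C" arbitrary: C rule: less_induct)
  case less
  show ?case
  proof (cases "degree C = 0")
    case True
    then obtain c where c: "C = [:c:]" by (metis degree_0_id)
    then have "c \<in> R" using less.prems by (auto simp: coeffs_in_def dest: spec[of _ 0])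
    then show ?thesis using c less.prems
      by (intro exI[of _ "[:1:]"] exI[of _ c]) (auto intro: coeffs_intros R_intros)
  next
    case False
    obtain k B C2 where *: "smult (lead_coeff C ^ k) Q = B * C + C2" "coeffs_in R B" "coeffs_in R C2"
      "C2 = 0 \<or> degree C2 < degree C"
      using pseudo_division[OF R less.prems(1,2) subset_refl _ _ _ Q(1)] R_intros by blast
    have Ca: "poly C a \<noteq> 0" using small_zero less.prems by blast
    have "poly (smult (lead_coeff C ^ k) Q) a = 0" by (simp add: Q(3))
    then have eq: "poly B a * poly C a + poly C2 a = 0" by (simp add: *(1))
    have "C2 \<noteq> 0"
    proof
      assume C2: "C2 = 0"
      then have "poly B a = 0" using eq Ca by simp
      moreover have BC: "B * C \<noteq> 0" using *(1) C2 Q(2) less.prems(2) by auto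
      moreover have "degree B + degree C = d"
        using BC *(1) C2 less.prems(2) by (simp add: d_def degree_mult_eq flip: degree_smult_eq)
          (metis degree_mult_eq degree_smult_eq leading_coeff_0_iff mult_eq_0_iff power_not_zero)
      ultimately show False using small_zero[OF *(2)] False by auto
    qed
    then obtain U r where U: "coeffs_in R U" "r \<in> R" "r \<noteq> 0" "poly U a * poly C2 a = r"
      using less.hyps[of C2] * less.prems by auto
    have "poly (- (U * B)) a * poly C a = poly U a * - (poly B a * poly C a)" by simp
    also have "- (poly B a * poly C a) = poly C2 a" using eq by (rule minus_unique)
    finally have "poly (0 - U * B) a * poly C a = r" using U by simp
    moreover have "coeffs_in R (0 - U * B)" using U * by (intro coeffs_intros)
    ultimately show ?thesis using U by blast
  qed
qed

text \<open>Moves questions of nonvanishing from \<open>R'\<close> down to \<open>R\<close>, where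
  coordinates are already available.\<close>

lemma divides_base:
  assumes "x \<in> R'" "x \<noteq> 0" shows "\<exists>y\<in>R'. x * y \<in> R \<and> x * y \<noteq> 0"
proof -
  obtain i C where C: "repr x i C" using assms by (auto simp: R'_def)
  then have "C \<noteq> 0" using assms(2) g by (auto simp: repr_def)
  with C obtain U r where U: "coeffs_in R U" "r \<in> R" "r \<noteq> 0" "poly U a * poly C a = r"
    using bezout[of C] unfolding repr_def by blast
  have "x * (g ^ i * poly U a) = poly U a * poly C a" 
  proof -
    have "x * (g ^ i * poly U a) = poly U a * (g ^ i * x)" by (simp add: mult_ac)
    also have "g ^ i * x = poly C a" using C by (simp add: repr_def)
    finally show ?thesis .
  qed
  moreover have "g ^ i * poly U a \<in> R'"
    using g R_subset R_intros(7)[OF g(1)] subring_mult[OF R'_subring _ poly_in_R'[OF U(1)]] by blast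
  ultimately show ?thesis using U by metis
qed

end

locale alg_ext_coord = alg_ext R a Q + coord_sys R n G \<kappa> e
  for R :: "'k::field_char_0 set" and a Q n G \<kappa> e +
  fixes y :: 'k and M :: int
  assumes y: "y \<in> R" and M: "M \<noteq> 0" and gy: "\<And>i. \<kappa> (g * y) i = of_int M * \<kappa> 1 i"
begin

lemma \<kappa>_gy: "z \<in> R \<Longrightarrow> \<kappa> (z * (g * y) ^ k) l = of_int M ^ k * \<kappa> z l"
proof (induction k)
  case (Suc k)
  have "\<kappa> (g * y * (z * (g * y) ^ k)) l = of_int M * \<kappa> (z * (g * y) ^ k) l"
    using Suc.prems g y by (intro \<kappa>_scalar gy R_intros)
  then show ?case using Suc by (simp add: mult_ac)
qed simp

text \<open>Position \<open>q\<close> encodes the pair of the power \<open>q div n\<close> of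
  \<open>a\<close> and the old coordinate \<open>q mod n\<close>. Since the image of
  \<open>g * y\<close> is the scalar \<open>M\<close>, division by \<open>g ^ i\<close> becomes
  multiplication by \<open>y ^ i\<close> and division by \<open>M ^ i\<close>.\<close>

definition val :: "nat \<Rightarrow> 'k poly \<Rightarrow> nat \<Rightarrow> rat" where
  "val i C q = (if q < d * n then \<kappa> (coeff C (q div n) * y ^ i) (q mod n) / of_int M ^ i else 0)"

definition \<kappa>' :: "'k \<Rightarrow> nat \<Rightarrow> rat" where
  "\<kappa>' x = (SOME v. \<exists>i C. repr x i C \<and> v = val i C)"

lemma val_smult:
  assumes "coeffs_in R C" shows "val (j + i) (smult (g ^ j) C) q = val i C q"
proof -
  have c: "coeff C l \<in> R" for l using assms by (simp add: coeffs_in_def)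
  have "\<kappa> (g ^ j * coeff C l * y ^ (j + i)) h = of_int M ^ j * \<kappa> (coeff C l * y ^ i) h" for l h
    using \<kappa>_gy[of "coeff C l * y ^ i" j h] c y by (simp add: R_intros power_mult_distrib power_add mult_ac)
  then show ?thesis using M by (simp add: val_def power_add)
qed

text \<open>Two representations agree after multiplication by powers of \<open>g\<close>: their
  difference has degree less than \<open>d\<close> and vanishes at \<open>a\<close>, hence is 0 by
  minimality of \<open>Q\<close>.\<close>

lemma \<kappa>'_eq: assumes "repr x i C" shows "\<kappa>' x q = val i C q"
proof -
  have "\<exists>i C. repr x i C \<and> \<kappa>' x = val i C"
    unfolding \<kappa>'_def
    using someI[of "\<lambda>v. \<exists>i C. repr x i C \<and> v = val i C" "val i C"] assms by blast
  then obtain i' C' where C': "repr x i' C'" "\<kappa>' x = val i' C'" by blast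
  have 1: "repr x (i' + i) (smult (g ^ i') C)" using repr_raise[OF assms] .
  have 2: "repr x (i' + i) (smult (g ^ i) C')" using repr_raise[OF C'(1), of i] by (simp add: add.commute)
  have "repr 0 (i' + i) (smult (g ^ i') C - smult (g ^ i) C')" using repr_diff[OF 1 2] by simp
  then have "smult (g ^ i') C - smult (g ^ i) C' = 0" by (intro small_zero) (simp_all add: repr_def)
  then have "smult (g ^ i') C = smult (g ^ i) C'" by simp
  then have "val (i' + i) (smult (g ^ i') C) q = val (i + i') (smult (g ^ i) C') q" by (simp add: add.commute)
  then show ?thesis using val_smult assms C' by (simp add: repr_def)
qed

lemma repr_R: "r \<in> R \<Longrightarrow> repr r 0 [:r:]"
  using d by (simp add: repr_def coeffs_intros)

lemma \<kappa>'_scalar: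
  assumes "r \<in> R" "\<And>i. \<kappa> r i = of_int K * \<kappa> 1 i" shows "\<kappa>' r q = of_int K * \<kappa>' 1 q"
  using \<kappa>'_eq[OF repr_R[OF assms(1)], of q] \<kappa>'_eq[OF repr_R[OF R_intros(1)], of q] assms(2)
  by (auto simp: val_def coeff_pCons \<kappa>_zero split: nat.splits)

lemma val_index: "j < d \<Longrightarrow> l < n \<Longrightarrow> val i C (j * n + l) = \<kappa> (coeff C j * y ^ i) l / of_int M ^ i"
proof -
  assume "j < d" "l < n"
  have "j * n + l < (j + 1) * n" using \<open>l < n\<close> by simp
  also have "\<dots> \<le> d * n" using \<open>j < d\<close> by (intro mult_le_mono1) simp
  finally show ?thesis using \<open>l < n\<close> by (simp add: val_def)
qed

lemma coord_sys': "coord_sys R' (d * n) (G * M) \<kappa>' (\<lambda>q. e (q mod n) * a ^ (q div n))"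
proof
  show "is_subring R'" by (rule R'_subring)
  show "1 \<le> d * n" using d n by (simp add: Suc_le_eq)
  show "G * M \<noteq> 0" using G M by simp
next
  fix x x' q assume "x \<in> R'" "x' \<in> R'"
  then obtain i C i' C' where *: "repr x i C" "repr x' i' C'" by (auto simp: R'_def)
  have 1: "repr x (i' + i) (smult (g ^ i') C)" using repr_raise[OF *(1)] .
  have 2: "repr x' (i' + i) (smult (g ^ i) C')" using repr_raise[OF *(2), of i] by (simp add: add.commute)
  have "val j (D + D') q = val j D q + val j D' q" if "coeffs_in R D" "coeffs_in R D'" for j D D'
    using that y by (simp add: val_def coeffs_in_def distrib_right \<kappa>_add R_intros add_divide_distrib)
  then show "\<kappa>' (x + x') q = \<kappa>' x q + \<kappa>' x' q"
    unfolding \<kappa>'_eq[OF repr_add[OF 1 2]] \<kappa>'_eq[OF 1] \<kappa>'_eq[OF 2] using 1 2 by (simp add: repr_def)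
next
  fix x q assume "x \<in> R'"
  then obtain i C where C: "repr x i C" by (auto simp: R'_def)
  have "z / of_int M ^ i \<in> Zinv (G * M)" if "z \<in> Zinv G" for z
  proof -
    obtain b k where "z = of_int b / of_int G ^ k" using \<open>z \<in> Zinv G\<close> by (auto simp: Zinv_def)
    then have "z / of_int M ^ i = of_int (b * G ^ i * M ^ k) / of_int (G * M) ^ (k + i)"
      using G M by (simp add: field_simps power_add)
    then show ?thesis by (metis Zinv_I)
  qed
  moreover have "\<kappa> (coeff C (q div n) * y ^ i) (q mod n) \<in> Zinv G"
    using C y by (intro \<kappa>_Zinv R_intros) (auto simp: repr_def coeffs_in_def)
  ultimately show "\<kappa>' x q \<in> Zinv (G * M)"
    using Zinv_of_int[of 0 "G * M"] by (simp add: \<kappa>'_eq[OF C] val_def)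
  show "\<kappa>' x q = 0" if "d * n \<le> q" using that by (simp add: \<kappa>'_eq[OF C] val_def)
next
  fix q assume q: "q < d * n"
  then have lt: "q div n < d" "q mod n < n" using n by (auto simp: less_mult_imp_div_less)
  show "e (q mod n) * a ^ (q div n) \<in> R'"
    using e[OF lt(2)] R_subset by (intro subring_mult[OF R'_subring] subring_power[OF R'_subring] a_in) auto
  fix q'
  have "repr (e (q mod n) * a ^ (q div n)) 0 (monom (e (q mod n)) (q div n))"
    using lt e[OF lt(2)] by (auto simp: repr_def poly_monom intro!: coeffs_intros le_less_trans[OF degree_monom_le])
  then have "\<kappa>' (e (q mod n) * a ^ (q div n)) q' = val 0 (monom (e (q mod n)) (q div n)) q'"
    by (rule \<kappa>'_eq)
  also have "\<dots> = (if q' = q then 1 else 0)"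
  proof (cases "q' < d * n")
    case True
    have "q' = q \<longleftrightarrow> q' div n = q div n \<and> q' mod n = q mod n" by (metis div_mult_mod_eq)
    then show ?thesis using True lt by (auto simp: val_def \<kappa>_zero \<kappa>_e)
  qed (use q in \<open>auto simp: val_def\<close>)
  finally show "\<kappa>' (e (q mod n) * a ^ (q div n)) q' = (if q' = q then 1 else 0)" .
next
  fix x x' q assume x: "x \<in> R'" "x' \<in> R'" and zero: "\<And>q. \<kappa>' x q = 0"
  obtain i C i' C' where *: "repr x i C" "repr x' i' C'" using x by (auto simp: R'_def)
  \<comment> \<open>The elements of \<open>R\<close> whose quotient by \<open>g ^ i\<close> has zero
    image. The coefficients of \<open>x\<close> lie in this ideal, hence those of the product with
    \<open>x'\<close>, and so do those of its pseudo-remainder.\<close>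
  define I where "I = {r \<in> R. \<forall>l. \<kappa> (r * y ^ i) l = 0}"
  have yi: "y ^ k \<in> R" for k using y by (intro R_intros)
  have I: "I \<subseteq> R" "0 \<in> I" "\<And>x y. x \<in> I \<Longrightarrow> y \<in> I \<Longrightarrow> x - y \<in> I"
    using yi by (auto simp: I_def R_intros \<kappa>_zero left_diff_distrib \<kappa>_diff)
  have I_mult: "s * r \<in> I" if "s \<in> R" "r \<in> I" for s r
  proof -
    have r: "r * y ^ i \<in> R" "\<And>l. \<kappa> (r * y ^ i) l = 0" using that yi by (auto simp: I_def R_intros)
    have "\<kappa> (r * y ^ i * s) l = 0" for l by (rule \<kappa>_ideal[OF r(1) that(1) r(2)])
    then show ?thesis using that by (auto simp: I_def R_intros mult_ac)
  qed
  have "coeff C j \<in> I" for j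
  proof -
    have cR: "coeff C j \<in> R" using *(1) by (simp add: repr_def coeffs_in_def)
    have "\<kappa> (coeff C j * y ^ i) l = 0" for l
    proof (cases "j < d \<and> l < n")
      case True
      then show ?thesis using zero[of "j * n + l"] M \<kappa>'_eq[OF *(1)] val_index by simp
    next
      case False
      show ?thesis
      proof (cases "j < d")
        case True
        then show ?thesis using False cR yi by (intro \<kappa>_outside R_intros(3)) auto
      next
        case False
        then have "coeff C j = 0" using *(1) by (intro coeff_eq_0) (simp add: repr_def)
        then show ?thesis by (simp add: \<kappa>_zero)
      qed
    qed
    then show ?thesis using cR by (simp add: I_def)
  qed
  moreover have I_add: "u + v \<in> I" if "u \<in> I" "v \<in> I" for u v
    using I(3)[OF that(1) I(3)[OF I(2) that(2)]] by simp
  moreover have "sum f S \<in> I" if "\<And>k. k \<in> S \<Longrightarrow> f k \<in> I" for f and S :: "nat set"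
    using that by (induction S rule: infinite_finite_induct) (auto intro: I(2) I_add)
  ultimately have "coeffs_in I (C * C')"
    using *(2) I_mult by (auto simp: coeffs_in_def coeff_mult repr_def mult.commute)
  from reduce[OF I I_mult this] obtain k E where E: "coeffs_in I E" "degree E < d" "g ^ k * poly (C * C') a = poly E a"
    by blast
  have "repr (x * x') (k + i + i') E"
    by (rule repr_mult_reduce[OF * refl]) (use E I(1) in \<open>auto simp: coeffs_in_def\<close>)
  then have "\<kappa>' (x * x') q = val (k + i + i') E q" by (rule \<kappa>'_eq)
  moreover have "\<kappa> (coeff E j * y ^ (k + i + i')) l = 0" for j l
  proof -
    have r: "coeff E j * y ^ i \<in> R" "\<And>l. \<kappa> (coeff E j * y ^ i) l = 0"
      using E yi by (auto simp: coeffs_in_def I_def R_intros)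
    have "\<kappa> (coeff E j * y ^ i * y ^ (k + i')) l = 0" by (rule \<kappa>_ideal[OF r(1) yi r(2)])
    then show ?thesis by (simp add: power_add mult_ac)
  qed
  ultimately show "\<kappa>' (x * x') q = 0" by (simp add: val_def)
qed

lemma divides_scalar':
  assumes "x \<in> R'" "z \<in> R'" "x * z \<in> R" "divides_scalar R \<kappa> (x * z) K"
  shows "divides_scalar R' \<kappa>' x K"
proof -
  obtain w where w: "w \<in> R" "\<And>i. \<kappa> (x * z * w) i = of_int K * \<kappa> 1 i"
    using assms(4) by (auto simp: divides_scalar_def)
  have "\<kappa>' (x * (z * w)) q = of_int K * \<kappa>' 1 q" for q
    using \<kappa>'_scalar[OF R_intros(3)[OF assms(3) w(1)] w(2), of q] by (simp only: mult.assoc)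
  moreover have "z * w \<in> R'" using assms w R_subset by (intro subring_mult[OF R'_subring]) auto
  ultimately show ?thesis by (auto simp: divides_scalar_def)
qed

end

lemma specializable_algebraic:
  fixes R :: "'k::field_char_0 set"
  assumes spec: "specializable R" and alg: "algebraic_over R a"
  shows "\<exists>R'. R \<subseteq> R' \<and> a \<in> R' \<and> specializable R'"
proof -
  have sR: "is_subring R" using spec by (simp add: specializable_def)
  obtain Q where Q: "coeffs_in R Q \<and> Q \<noteq> 0 \<and> poly Q a = 0"
    "\<And>C. coeffs_in R C \<and> C \<noteq> 0 \<and> poly C a = 0 \<Longrightarrow> degree Q \<le> degree C"
    using ex_has_least_nat[of "\<lambda>C. coeffs_in R C \<and> C \<noteq> 0 \<and> poly C a = 0" _ degree] alg
    unfolding algebraic_over_def by blast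
  interpret alg_ext R a Q by unfold_locales (use Q sR in auto)
  obtain n where n: "\<forall>g\<in>R - {0}. \<forall>b. \<exists>p>b. prime p \<and> specializable_at R n g p"
    using spec unfolding specializable_def by (elim conjE exE)
  have "\<exists>p>b. prime p \<and> specializable_at R' (d * n) g' p" if g': "g' \<in> R' - {0}" for g' b
  proof -
    obtain z where z: "z \<in> R'" "g' * z \<in> R" "g' * z \<noteq> 0" using divides_base[of g'] g' by auto
    \<comment> \<open>The prime must avoid both \<open>g\<close>, which has been inverted, and a
      multiple of \<open>g'\<close> that lies in \<open>R\<close>.\<close>
    have "g * (g' * z) \<in> R - {0}" using g z by (auto intro: R_intros)
    with n obtain p where p: "p > b" "prime p" "specializable_at R n (g * (g' * z)) p" by blast
    have "specializable_at R' (d * n) g' p"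
      unfolding specializable_at_def
    proof (intro ballI)
      fix c assume c: "c \<in> R' - {0}"
      obtain w where w: "w \<in> R'" "c * w \<in> R" "c * w \<noteq> 0" using divides_base[of c] c by auto
      then obtain G \<kappa> e M K where *: "coord_sys R n G \<kappa> e" "\<not> int p dvd G"
        "divides_scalar R \<kappa> (g * (g' * z)) M" "\<not> int p dvd M" "divides_scalar R \<kappa> (c * w) K" "K \<noteq> 0"
        using p(3) unfolding specializable_at_def by blast
      then obtain v where v: "v \<in> R" "\<And>i. \<kappa> (g * (g' * z) * v) i = of_int M * \<kappa> 1 i"
        by (auto simp: divides_scalar_def)
      interpret coord_sys R n G \<kappa> e by fact
      interpret E: alg_ext_coord R a Q n G \<kappa> e "g' * z * v" M
      proof
        show "g' * z * v \<in> R" using v(1) z(2) by (rule R_intros(3)[rotated])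
        show "\<kappa> (g * (g' * z * v)) i = of_int M * \<kappa> 1 i" for i using v(2) by (simp only: mult.assoc)
        show "M \<noteq> 0" using * by auto
      qed
      have "divides_scalar R \<kappa> (g' * z) M"
        unfolding divides_scalar_def using v g by (intro bexI[of _ "g * v"]) (auto simp: R_intros mult_ac)
      then have "divides_scalar R' E.\<kappa>' g' M" using z g' by (intro E.divides_scalar'[of g' z]) auto
      moreover have "divides_scalar R' E.\<kappa>' c K" using w c * by (intro E.divides_scalar'[of c w]) auto
      moreover have "\<not> int p dvd G * M" using * p by (simp add: prime_dvd_mult_iff)
      ultimately show "\<exists>G \<kappa> e. coord_sys R' (d * n) G \<kappa> e \<and> \<not> int p dvd G \<and>
          (\<exists>M. divides_scalar R' \<kappa> g' M \<and> \<not> int p dvd M) \<and> (\<exists>M. divides_scalar R' \<kappa> c M \<and> M \<noteq> 0)"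
        using E.coord_sys' * by blast
    qed
    then show ?thesis using p by blast
  qed
  then have "specializable R'" unfolding specializable_def using R'_subring by blast
  then show ?thesis using R_subset a_in by blast
qed

theorem specializable_cover:
  fixes A :: "'k::field_char_0 set"
  assumes "finite A"
  shows "\<exists>R. A \<subseteq> R \<and> specializable R"
proof -
  obtain R0 where R0: "int_specializable R0" "\<forall>a\<in>A. algebraic_over R0 a"
    using int_specializable_cover[OF assms] by blast
  have "\<exists>R. B \<subseteq> R \<and> R0 \<subseteq> R \<and> specializable R" if "finite B" "B \<subseteq> A" for B
    using that
  proof induction
    case empty
    then show ?case using int_specializable_imp_specializable[OF R0(1)] by blast
  next
    case (insert b B)
    then obtain R where R: "B \<subseteq> R" "R0 \<subseteq> R" "specializable R" by auto
    have "algebraic_over R b" using R0(2) insert.prems algebraic_over_mono[OF R(2)] by auto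
    from specializable_algebraic[OF R(3) this] obtain R' where "R \<subseteq> R'" "b \<in> R'" "specializable R'"
      by blast
    with R show ?case by (intro exI[of _ R']) auto
  qed
  from this[OF assms subset_refl] show ?thesis by blast
qed

lemma exp_beats_square: "\<exists>N1. \<forall>N\<ge>N1. c * (N + 1) ^ 2 < (2 :: nat) ^ N"
proof (intro exI allI impI)
  \<comment> \<open>The constants make \<open>16 * c\<close> less than \<open>N div 4\<close>; a
    fourth power of \<open>k + 1\<close> then dominates.\<close>
  fix N assume N: "64 * c + 4 \<le> N"
  define k where "k = N div 4"
  have mod: "N = 4 * k + N mod 4" "N mod 4 < 4" by (simp_all add: k_def)
  have k: "16 * c < k" using N mod by linarith
  have k': "N + 1 \<le> 4 * (k + 1)" "4 * k \<le> N" using mod by simp_all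
  have "k + 1 \<le> 2 ^ k" using less_exp[of k] by linarith
  have "c * (N + 1) ^ 2 \<le> c * (4 * (k + 1)) ^ 2" using k'(1) by (intro mult_left_mono power_mono) auto
  also have "\<dots> = 16 * c * (k + 1) ^ 2" by (simp add: power2_eq_square algebra_simps)
  also have "\<dots> < (k + 1) ^ 2 * (k + 1) ^ 2"
  proof (rule mult_strict_right_mono)
    have "16 * c < k + 1" using k by simp
    also have "k + 1 \<le> (k + 1) ^ 2" by (simp add: power2_eq_square)
    finally show "16 * c < (k + 1) ^ 2" .
  qed simp
  also have "\<dots> = (k + 1) ^ 4" by (simp flip: power_add)
  also have "\<dots> \<le> (2 ^ k) ^ 4" using \<open>k + 1 \<le> 2 ^ k\<close> by (rule power_mono) simp
  also have "\<dots> = 2 ^ (4 * k)" by (simp add: mult.commute flip: power_mult)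
  also have "\<dots> \<le> 2 ^ N" using k'(2) by (intro power_increasing) auto
  finally show "c * (N + 1) ^ 2 < 2 ^ N" .
qed

context coord_sys
begin

lemma size_le_zero: "size_le k 0"
  using R_intros e by (simp add: size_le_def \<kappa>_zero)

lemma size_le_sum:
  "finite I \<Longrightarrow> (\<And>i. i \<in> I \<Longrightarrow> size_le k (f i)) \<Longrightarrow> size_le (k + card I) (sum f I)"
proof (induction I rule: finite_induct)
  case (insert i I)
  have "size_le (Suc (k + card I)) (f i + sum f I)"
  proof (rule size_le_add)
    show "size_le (k + card I) (f i)" by (rule size_le_mono[of k]) (use insert in auto)
    show "size_le (k + card I) (sum f I)" using insert by auto
  qed
  then show ?case using insert by simp
qed (simp add: size_le_zero)

lemma size_le_common:
  assumes "finite I" "\<And>i. i \<in> I \<Longrightarrow> f i \<in> R" shows "\<exists>k. \<forall>i\<in>I. size_le k (f i)"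
  using assms
proof (induction I rule: finite_induct)
  case (insert i I)
  then obtain k where k: "\<forall>i\<in>I. size_le k (f i)" by auto
  obtain k' where k': "size_le k' (f i)" using size_le_exists insert.prems by blast
  show ?case
    using k k' by (intro exI[of _ "max k k'"]) (auto intro: size_le_mono)
qed simp

text \<open>The constant \<delta> depends on the function alone: the logarithmic height grows by at
  most a fixed factor.\<close>

lemma size_le_polyfun:
  assumes "f \<in> polyfun R"
  shows "\<exists>\<delta>. \<forall>k s. (\<forall>i. size_le k (s i)) \<longrightarrow> size_le (\<delta> * (k + 1)) (f s)"
  using assms
proof induction
  case (polyfun_const c)
  obtain k0 where "size_le k0 c" using size_le_exists polyfun_const by blast
  then show ?case by (intro exI[of _ k0]) (auto elim!: size_le_mono)
next
  case (polyfun_var i)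
  show ?case by (intro exI[of _ 1]) (auto elim!: size_le_mono allE[of _ i])
next
  case (polyfun_add f g)
  then obtain a b where a: "\<forall>k s. (\<forall>i. size_le k (s i)) \<longrightarrow> size_le (a * (k + 1)) (f s)"
    and b: "\<forall>k s. (\<forall>i. size_le k (s i)) \<longrightarrow> size_le (b * (k + 1)) (g s)" by blast
  have "size_le ((a + b + 1) * (k + 1)) (f s + g s)" if "\<forall>i. size_le k (s i)" for k s
  proof (rule size_le_mono)
    have "size_le (a * (k + 1)) (f s)" "size_le (b * (k + 1)) (g s)" using a b that by blast+
    then have "size_le ((a + b) * (k + 1)) (f s)" "size_le ((a + b) * (k + 1)) (g s)"
      by (auto elim!: size_le_mono simp del: mult_Suc_right)
    then show "size_le (Suc ((a + b) * (k + 1))) (f s + g s)" by (rule size_le_add)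
  qed (simp add: algebra_simps)
  then show ?case by blast
next
  case (polyfun_mult f g)
  then obtain a b where a: "\<forall>k s. (\<forall>i. size_le k (s i)) \<longrightarrow> size_le (a * (k + 1)) (f s)"
    and b: "\<forall>k s. (\<forall>i. size_le k (s i)) \<longrightarrow> size_le (b * (k + 1)) (g s)" by blast
  have "size_le ((a + b) * (k + 1)) (f s * g s)" if "\<forall>i. size_le k (s i)" for k s
    using size_le_mult[of "a * (k + 1)" "f s" "b * (k + 1)" "g s"] a b that
    unfolding distrib_right[of a b] by blast
  then show ?case by blast
qed

end

section \<open>Zeros of norms along etale orbits over \<open>R\<close>\<close>

context coord_sys_prime
begin

lemma Norm_Zloc: assumes "x \<in> R" shows "Norm x \<in> Zloc p"
proof -
  obtain q where q: "q \<in> polyfun (Zloc p)" "\<forall>s. (\<forall>i. s i \<in> R) \<longrightarrow> Norm (s ()) = q (coords s)"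
    using polyfun_Norm[OF polyfun_var[of "()"]] by blast
  have "q (coords (\<lambda>_. x)) \<in> Zloc p"
    using assms by (intro polyfun_values[OF q(1) is_subring_Zloc[OF p]] coords_Zloc)
  then show ?thesis using q(2)[rule_format, of "\<lambda>_. x"] assms by simp
qed

lemma Norm_one: "Norm 1 = 1"
proof -
  have "L 1 = 1\<^sub>m n" by (intro eq_matI) (auto simp: L_def \<kappa>_e)
  then show ?thesis by (simp add: Norm_def)
qed

lemma Norm_power: "x \<in> R \<Longrightarrow> Norm (x ^ k) = Norm x ^ k"
  by (induction k) (auto simp: Norm_one Norm_mult R_intros)

lemma Zpow_power: "x \<in> Zpow p 1 \<Longrightarrow> x ^ k \<in> Zpow p k"
  using Zpow_mult[OF p, of x 1] by (induction k) (auto simp: Zpow_0[OF p] Zloc_intros[OF p])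

lemma polyfun_pz_cong:
  assumes "f \<in> polyfun R" and s: "\<And>i. s i \<in> R" "\<And>i. s' i \<in> R" "\<And>i. pz b (s i - s' i)"
  shows "pz b (f s - f s')"
  using assms(1)
proof induction
  case (polyfun_const c)
  then show ?case by (simp add: pz_def \<kappa>_zero Zpow_zero[OF p] R_intros)
next
  case (polyfun_add f g)
  then have "pz b ((f s - f s') + (g s - g s'))" by (intro pz_add)
  then show ?case by (simp add: algebra_simps)
next
  case (polyfun_mult f g)
  moreover have "g s \<in> R" "f s' \<in> R"
    using polyfun_values[OF polyfun_mult.hyps(2) R s(1)] polyfun_values[OF polyfun_mult.hyps(1) R s(2)] .
  ultimately have "pz b ((f s - f s') * g s + (g s - g s') * f s')"
    by (intro pz_add pz_mult_right)
  then show ?case by (simp add: algebra_simps)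
qed (rule s)

text \<open>Each of the \<open>D + 1\<close> variables is replaced by its \<open>n\<close> rational
  coordinates, which explains the exponent in \<open>P\<close>. Both the map and the norm of
  \<open>f\<close> become polynomial over \<open>Zloc p\<close>, so \<open>zeros_on_class\<close>
  applies.\<close>

lemma etale_zeros:
  fixes \<Psi> :: "(nat \<Rightarrow> 'a) \<Rightarrow> nat \<Rightarrow> 'a" and s0 :: "nat \<Rightarrow> 'a"
  assumes p3: "p \<ge> 3"
    and \<Psi>: "\<And>i. (\<lambda>s. \<Psi> s i) \<in> polyfun R" "\<And>s i. i > D \<Longrightarrow> \<Psi> s i = 0"
    and s0: "\<And>i. s0 i \<in> R" "\<And>i. i > D \<Longrightarrow> s0 i = 0"
    and etale: "\<And>k s s' i. (\<And>i. s i \<in> R) \<Longrightarrow> (\<And>i. s' i \<in> R) \<Longrightarrow>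
      (\<And>i. i > D \<Longrightarrow> s i = 0) \<Longrightarrow> (\<And>i. i > D \<Longrightarrow> s' i = 0) \<Longrightarrow>
      (\<And>i. pz 1 (s i - (\<Psi> ^^ k) s0 i)) \<Longrightarrow> (\<And>i. pz 1 (s' i - (\<Psi> ^^ k) s0 i)) \<Longrightarrow>
      (\<And>i. pz 2 (\<Psi> s i - \<Psi> s' i)) \<Longrightarrow> pz 2 (s i - s' i)"
    and P: "P = p ^ ((D + 1) * n)" "P \<le> a" and K: "K = fact P * fact P"
    and f: "f \<in> polyfun R" and inf: "infinite {j. Norm (f ((\<Psi> ^^ (a + j * K)) s0)) = 0}"
  shows "Norm (f ((\<Psi> ^^ (a + j * K)) s0)) = 0"
proof -
  define X where "X = {..D} \<times> {..<n}"
  have "\<forall>i. \<exists>g. (\<forall>l. g l \<in> polyfun (Zloc p)) \<and> (\<forall>s l. (\<forall>i. s i \<in> R) \<longrightarrow> \<kappa> (\<Psi> s i) l = g l (coords s))"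
    using polyfun_coords[OF \<Psi>(1)] by blast
  then obtain g where g: "\<And>i l. g i l \<in> polyfun (Zloc p)"
    "\<And>i s l. (\<And>i. s i \<in> R) \<Longrightarrow> \<kappa> (\<Psi> s i) l = g i l (coords s)"
    by metis
  define F where "F t = (\<lambda>(i, l). if (i, l) \<in> X then g i l t else 0)" for t
  have \<Psi>R: "\<Psi> s i \<in> R" if "\<And>i. s i \<in> R" for s i
    using polyfun_values[OF \<Psi>(1) R, of s i] that by simp
  have F: "F (coords s) = coords (\<Psi> s)" if sR: "\<And>i. s i \<in> R" for s
  proof
    fix il :: "nat \<times> nat" obtain i l where il: "il = (i, l)" by fastforce
    have "\<kappa> (\<Psi> s i) l = 0" if "(i, l) \<notin> X"
      using that \<Psi>(2)[of i s] \<kappa>_outside[OF \<Psi>R[OF sR]]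
      by (cases "i \<le> D") (auto simp: X_def \<kappa>_zero)
    then show "F (coords s) il = coords (\<Psi> s) il"
      using g(2)[of s i l] sR by (auto simp: F_def coords_def il)
  qed
  have orbR: "(\<Psi> ^^ k) s0 i \<in> R" for k i
    by (induction k arbitrary: i) (auto intro: s0 \<Psi>R)
  have orb0: "(\<Psi> ^^ k) s0 i = 0" if "i > D" for k i
    using that s0 \<Psi> by (cases k) auto
  have orbit: "(F ^^ k) (coords s0) = coords ((\<Psi> ^^ k) s0)" for k
    by (induction k) (auto simp: F orbR)
  interpret E: etale_orbit p X F "coords s0" P
  proof
    show "prime p" "3 \<le> p" by (fact p, fact p3)
    show "finite X" "P = p ^ card X" by (simp_all add: X_def P)
    show "(\<lambda>s. F s i) \<in> polyfun (Zloc p)" for i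
    proof (cases i)
      case (Pair j l)
      then show ?thesis
        using g(1)[of j l] polyfun_const[OF Zloc_intros(4)[OF p]] by (cases "i \<in> X") (simp_all add: F_def)
    qed
    show "F s i = 0" if "i \<notin> X" for s i using that by (cases i) (auto simp: F_def)
    show "coords s0 i \<in> Zloc p" for i by (rule coords_Zloc[OF s0(1)])
    show "coords s0 i = 0" if "i \<notin> X" for i
      using that s0 \<kappa>_outside by (cases i) (auto simp: X_def coords_def \<kappa>_zero not_le not_less)
    fix k and y y' :: "nat \<times> nat \<Rightarrow> int"
    assume y: "\<And>i. i \<notin> X \<Longrightarrow> y i = 0" "\<And>i. i \<notin> X \<Longrightarrow> y' i = 0"
      and eq: "Zeq p 2 (F (\<lambda>i. (F ^^ k) (coords s0) i + of_nat p * of_int (y i)))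
        (F (\<lambda>i. (F ^^ k) (coords s0) i + of_nat p * of_int (y' i)))"
    \<comment> \<open>Lifts an integral displacement of the coordinates, scaled by \<open>p\<close>,
      to elements of \<open>R\<close>, so that the injectivity assumption over \<open>R\<close> can
      be applied.\<close>
    define pert where "pert y i = (if i \<le> D then (\<Psi> ^^ k) s0 i + (\<Sum>l<n. of_int (int p * y (i, l)) * e l) else 0)"
      for y :: "nat \<times> nat \<Rightarrow> int" and i
    have sumR: "(\<Sum>l<n. of_int (int p * y (i, l)) * e l) \<in> R" for y :: "nat \<times> nat \<Rightarrow> int" and i
      using e by (intro R_intros) auto
    have pertR: "pert y i \<in> R" for y i using orbR sumR by (auto simp: pert_def intro: R_intros)
    have pert0: "pert y i = 0" if "i > D" for y i using that by (simp add: pert_def)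
    have sum\<kappa>: "\<kappa> (\<Sum>l<n. of_int (int p * y (i, l)) * e l) l = (if l < n then of_nat p * of_int (y (i, l)) else 0)"
      for y :: "nat \<times> nat \<Rightarrow> int" and i l
    proof -
      have "\<kappa> (\<Sum>l<n. of_int (int p * y (i, l)) * e l) l = (\<Sum>j<n. \<kappa> (of_int (int p * y (i, j)) * e j) l)"
        using e by (intro \<kappa>_sum R_intros) auto
      also have "\<dots> = (\<Sum>j<n. if l = j then of_nat p * of_int (y (i, j)) else 0)"
        using e by (intro sum.cong refl, subst \<kappa>_of_int) (auto simp: \<kappa>_e)
      finally show ?thesis by simp
    qed
    have diffR: "pert y i - (\<Psi> ^^ k) s0 i \<in> R" for y i using pertR orbR by (intro R_intros)
    have pert\<kappa>: "\<kappa> (pert y i) l = \<kappa> ((\<Psi> ^^ k) s0 i) l + of_nat p * of_int (y (i, l))"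
      if "\<And>i. i \<notin> X \<Longrightarrow> y i = 0" for y i l
    proof (cases "i \<le> D")
      case True
      have "\<kappa> (pert y i) l = \<kappa> ((\<Psi> ^^ k) s0 i) l + (if l < n then of_nat p * of_int (y (i, l)) else 0)"
        using True by (simp only: pert_def if_True \<kappa>_add[OF orbR sumR] sum\<kappa>)
      then show ?thesis using that[of "(i, l)"] by (cases "l < n") (simp_all add: X_def)
    next
      case False
      then show ?thesis using that[of "(i, l)"] orb0[of i] by (simp add: pert_def \<kappa>_zero X_def)
    qed
    have coords_pert: "(\<lambda>i. (F ^^ k) (coords s0) i + of_nat p * of_int (y i)) = coords (pert y)"
      if "\<And>i. i \<notin> X \<Longrightarrow> y i = 0" for y
      unfolding orbit by (rule ext) (auto simp: coords_def pert\<kappa>[OF that])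
    have near: "pz 1 (pert y i - (\<Psi> ^^ k) s0 i)" if "\<And>i. i \<notin> X \<Longrightarrow> y i = 0" for y i
    proof -
      have "of_nat p * (of_int (y (i, l)) :: rat) \<in> Zpow p 1" for l
        using Zpow_p_mult[OF p, of "of_int (y (i, l))" 0] by (simp add: Zpow_0[OF p] Zloc_intros[OF p])
      then show ?thesis using diffR pertR orbR by (simp add: pz_def \<kappa>_diff pert\<kappa>[OF that])
    qed
    have 1: "(\<lambda>i. (F ^^ k) (coords s0) i + of_nat p * of_int (y i)) = coords (pert y)"
      by (rule coords_pert) (rule y)
    have 2: "(\<lambda>i. (F ^^ k) (coords s0) i + of_nat p * of_int (y' i)) = coords (pert y')"
      by (rule coords_pert) (rule y)
    have "Zeq p 2 (coords (\<Psi> (pert y))) (coords (\<Psi> (pert y')))"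
      using eq unfolding 1 2 by (simp add: F pertR)
    then have "pz 2 (\<Psi> (pert y) i - \<Psi> (pert y') i)" for i
      using \<Psi>R[of "pert y", OF pertR] \<Psi>R[of "pert y'", OF pertR]
      by (auto simp: pz_def Zeq_def coords_def \<kappa>_diff R_intros)
    then have "pz 2 (pert y i - pert y' i)" for i
    proof (rule etale[rotated -1])
      show "pz 1 (pert y i - (\<Psi> ^^ k) s0 i)" "pz 1 (pert y' i - (\<Psi> ^^ k) s0 i)" for i
        by (rule near, rule y, assumption)+
    qed (rule pertR pert0, assumption?)+
    then have "of_nat p * (of_int (y (i, l)) - of_int (y' (i, l)) :: rat) \<in> Zpow p (Suc 1)" for i l
      using pertR by (simp add: pz_def \<kappa>_diff pert\<kappa>[OF y(1)] pert\<kappa>[OF y(2)] right_diff_distrib numeral_2_eq_2)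
    then show "Zeq p 1 (\<lambda>i. of_int (y i)) (\<lambda>i. of_int (y' i))"
      unfolding Zpow_p_mult_iff[OF p] by (auto simp: Zeq_def)
  qed
  obtain q where q: "q \<in> polyfun (Zloc p)" "\<And>s. (\<And>i. s i \<in> R) \<Longrightarrow> Norm (f s) = q (coords s)"
    using polyfun_Norm[OF f] by blast
  have "q ((F ^^ (a + j * K)) (coords s0)) = Norm (f ((\<Psi> ^^ (a + j * K)) s0))" for j
    by (simp add: orbit q(2) orbR)
  then show ?thesis using E.zeros_on_class[OF P(2) q(1)] inf unfolding K by simp
qed

end

section \<open>Zeros along orbits of rescaled skew products\<close>

text \<open>The state \<open>(u, w, \<lambda>)\<close> has its coordinates at the indices below \<open>m\<close>, from \<open>m\<close> to \<open>D - 1\<close>, and at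
  \<open>D = m + r\<close>. It represents the point \<open>(u, \<lambda> w)\<close>: the scalar \<open>\<lambda>\<close> collects the values of \<open>\<rho>\<close> along
  the orbit, so that \<open>(u, w)\<close> moves by an automorphism.\<close>

locale skew_system =
  fixes R :: "'k::field_char_0 set" and m r :: nat
    and A :: "nat \<Rightarrow> nat \<Rightarrow> 'k" and b :: "nat \<Rightarrow> 'k" and W :: "nat \<Rightarrow> nat \<Rightarrow> (nat \<Rightarrow> 'k) \<Rightarrow> 'k"
    and G' :: "nat \<Rightarrow> (nat \<Rightarrow> 'k) \<Rightarrow> 'k" and J :: nat and \<rho> :: "nat \<Rightarrow> (nat \<Rightarrow> 'k) \<Rightarrow> 'k"
    and t0 :: "nat \<Rightarrow> 'k" and G Rho hh H and D l c :: nat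
  assumes D_def: "D = m + r"
    and G_def: "G = (\<lambda>s i. if i < m then b i + (\<Sum>j<m. A i j * s j) else if i < D then \<Sum>j<r. W (i - m) j s * s (m + j) else 0)"
    and Rho_def: "Rho = (\<lambda>s. \<Sum>j<J. s D ^ (j + 1) * \<rho> j s)"
    and hh_def: "hh = (\<lambda>s. \<Sum>j<J. of_nat (j + 2) * s D ^ (j + 1) * \<rho> j s)"
    and H_def: "H = (\<lambda>s. (G s)(D := s D * Rho s))"
    and spec: "specializable R"
    and A: "\<And>i j. i < m \<Longrightarrow> j < m \<Longrightarrow> A i j \<in> R" and b: "\<And>i. i < m \<Longrightarrow> b i \<in> R"
    and W: "\<And>i j. i < r \<Longrightarrow> j < r \<Longrightarrow> W i j \<in> polyfun R"
    and W_dep: "\<And>i j s s'. i < r \<Longrightarrow> j < r \<Longrightarrow> (\<And>k. k < m \<Longrightarrow> s k = s' k) \<Longrightarrow> W i j s = W i j s'"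
    and G': "\<And>i. i < D \<Longrightarrow> G' i \<in> polyfun R" and G'_inv: "\<And>i s c. i < D \<Longrightarrow> G' i ((G s)(D := c)) = s i"
    and \<rho>: "\<And>j. \<rho> j \<in> polyfun R" and \<rho>_dep: "\<And>j s s'. (\<And>k. k < D \<Longrightarrow> s k = s' k) \<Longrightarrow> \<rho> j s = \<rho> j s'"
    and t0: "\<And>i. t0 i \<in> R" "t0 D = 1" "\<And>i. i > D \<Longrightarrow> t0 i = 0"
    and cert: "\<And>n. \<exists>a\<in>R. hh ((H ^^ n) t0) * a = (\<Prod>i<l. Rho ((H ^^ (n + i)) t0)) ^ c"
begin

text \<open>The automorphism of (u, w) with \<lambda> frozen. Its orbit \<open>t\<close> agrees with
  \<open>s\<close> below \<open>D\<close> but keeps \<lambda> = 1, so its heights are free of the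
  doubly exponential growth that \<lambda> may show.\<close>

definition "K s = (G s)(D := s D)" for s :: "nat \<Rightarrow> 'k"

lemma sR: "is_subring R"
  using spec by (simp add: specializable_def)

lemmas R_intros = subring_intros[OF sR]
lemmas PF_intros = polyfun_intros[OF sR]

lemma G_polyfun: "(\<lambda>s. G s i) \<in> polyfun R"
proof -
  consider "i < m" | "\<not> i < m" "i < D" | "\<not> i < m" "\<not> i < D" by blast
  then show ?thesis
  proof cases
    case 1
    then show ?thesis using A b by (auto simp: G_def intro!: PF_intros)
  next
    case 2
    then have "i - m < r" by (simp add: D_def)
    then have "(\<lambda>s. \<Sum>j<r. W (i - m) j s * s (m + j)) \<in> polyfun R" using W by (intro PF_intros) auto
    then show ?thesis using 2 by (simp add: G_def)
  qed (simp add: G_def polyfun_const R_intros)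
qed

lemma Rho_polyfun: "Rho \<in> polyfun R"
  unfolding Rho_def using \<rho> by (intro PF_intros)

lemma hh_polyfun: "hh \<in> polyfun R"
  unfolding hh_def using \<rho> by (intro PF_intros R_intros)

lemma H_polyfun: "(\<lambda>s. H s i) \<in> polyfun R"
  using G_polyfun Rho_polyfun by (cases "i = D") (auto simp: H_def intro!: PF_intros)

lemma K_polyfun: "(\<lambda>s. K s i) \<in> polyfun R"
  using G_polyfun by (cases "i = D") (auto simp: K_def intro!: PF_intros)

lemma K_apply: "K s i = (if i = D then s D else G s i)"
  by (simp add: K_def)

lemma H_outside: "i > D \<Longrightarrow> H s i = 0"
  by (auto simp: H_def G_def D_def)

lemma K_outside: "i > D \<Longrightarrow> K s i = 0"
  by (simp only: K_apply) (simp add: G_def D_def)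

abbreviation "s n \<equiv> (H ^^ n) t0"
abbreviation "t n \<equiv> (K ^^ n) t0"

lemma s_R: "s n i \<in> R"
proof (induction n arbitrary: i)
  case (Suc n)
  then show ?case using polyfun_values[OF H_polyfun sR, of "s n" i] by simp
qed (simp add: t0)

lemma t_R: "t n i \<in> R"
proof (induction n arbitrary: i)
  case (Suc n)
  then show ?case using polyfun_values[OF K_polyfun sR, of "t n" i] by simp
qed (simp add: t0)

lemma G_dep: "(\<And>k. k < D \<Longrightarrow> x k = y k) \<Longrightarrow> G x = G y"
proof (rule ext)
  fix i assume *: "\<And>k. k < D \<Longrightarrow> x k = y k"
  show "G x i = G y i"
  proof (cases "i < m")
    case True
    have "(\<Sum>j<m. A i j * x j) = (\<Sum>j<m. A i j * y j)" by (intro sum.cong) (auto simp: * D_def)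
    then show ?thesis using True by (simp add: G_def)
  next
    case False
    show ?thesis
    proof (cases "i < D")
      case True
      then have "i - m < r" using False by (simp add: D_def)
      then have "(\<Sum>j<r. W (i - m) j x * x (m + j)) = (\<Sum>j<r. W (i - m) j y * y (m + j))"
        by (intro sum.cong refl arg_cong2[of _ _ _ _ "(*)"] W_dep) (auto simp: * D_def)
      then show ?thesis using True False by (simp add: G_def)
    qed (use False in \<open>simp add: G_def\<close>)
  qed
qed

lemma s_eq_t: "i < D \<Longrightarrow> s n i = t n i"
proof (induction n arbitrary: i)
  case (Suc n)
  have "H x i = K y i" if "G x = G y" for x y using that Suc.prems by (simp add: H_def K_def)
  from this[OF G_dep[OF Suc.IH]] show ?case by simp
qed simp

lemma t_D: "t n D = 1"
  by (induction n) (auto simp: K_def t0)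

lemma K_u: "i < m \<Longrightarrow> K x i = b i + (\<Sum>j<m. A i j * x j)"
  by (simp only: K_apply) (simp add: G_def D_def)

lemma K_w: "i < r \<Longrightarrow> K x (m + i) = (\<Sum>j<r. W i j x * x (m + j))"
  by (simp only: K_apply) (simp add: G_def D_def)

lemma s_D_Suc: "s (Suc n) D = s n D * Rho (s n)"
  by (simp add: H_def)

lemma Rho_multiple: "\<exists>y\<in>R. Rho (s n) = s n D * y"
proof (rule bexI)
  show "Rho (s n) = s n D * (\<Sum>j<J. s n D ^ j * \<rho> j (s n))"
    by (simp add: Rho_def sum_distrib_left mult.assoc)
  show "(\<Sum>j<J. s n D ^ j * \<rho> j (s n)) \<in> R"
    by (intro R_intros s_R polyfun_values[OF \<rho> sR])
qed

text \<open>As \<lambda> divides \<open>Rho\<close>, the next value of \<lambda> is a multiple of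
  its square, so the exponent doubles in each step.\<close>

lemma s_D_power: "\<exists>y\<in>R. s (n + k) D = s n D ^ (2 ^ k) * y"
proof (induction k)
  case 0
  then show ?case using R_intros by (intro bexI[of _ 1]) auto
next
  case (Suc k)
  then obtain y where y: "y \<in> R" "s (n + k) D = s n D ^ (2 ^ k) * y" by blast
  obtain z where z: "z \<in> R" "Rho (s (n + k)) = s (n + k) D * z" using Rho_multiple by blast
  have "s (n + Suc k) D = s n D ^ (2 ^ k) * s n D ^ (2 ^ k) * (y * y * z)"
    using s_D_Suc[of "n + k"] by (simp only: z y add_Suc_right) (simp add: mult_ac)
  then have "s (n + Suc k) D = s n D ^ (2 ^ Suc k) * (y * y * z)"
    by (simp add: mult_2 flip: power_add)
  then show ?case using y z R_intros(3) by blast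
qed

lemma power_taylor:
  assumes "x \<in> R" "\<delta> \<in> R"
  shows "\<exists>q\<in>R. (x + \<delta>) ^ Suc k = x ^ Suc k + of_nat (Suc k) * x ^ k * \<delta> + \<delta> ^ 2 * q"
proof (induction k)
  case 0
  then show ?case using R_intros by (intro bexI[of _ 0]) auto
next
  case (Suc k)
  then obtain q where q: "q \<in> R" "(x + \<delta>) ^ Suc k = x ^ Suc k + of_nat (Suc k) * x ^ k * \<delta> + \<delta> ^ 2 * q"
    by blast
  have "(x + \<delta>) ^ Suc (Suc k) = (x + \<delta>) * (x ^ Suc k + of_nat (Suc k) * x ^ k * \<delta> + \<delta> ^ 2 * q)"
    unfolding q(2)[symmetric] by simp
  also have "\<dots> = x ^ Suc (Suc k) + of_nat (Suc (Suc k)) * x ^ Suc k * \<delta>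
      + \<delta> ^ 2 * (of_nat (Suc k) * x ^ k + x * q + \<delta> * q)"
    by (simp add: algebra_simps power2_eq_square)
  finally show ?case using q assms by (auto intro!: bexI R_intros)
qed

text \<open>The factor \<open>hh\<close> is the derivative in \<lambda> of \<lambda> times
  \<open>Rho\<close>. The quadratic remainder is kept inside \<open>R\<close>, so that it vanishes
  modulo \<open>p ^ 2\<close> when \<delta> vanishes modulo \<open>p\<close>.\<close>

lemma H_D_taylor:
  assumes x: "\<And>i. x i \<in> R" and \<delta>: "\<delta> \<in> R"
  shows "\<exists>q\<in>R. H (x(D := x D + \<delta>)) D = H x D + \<delta> * hh x + \<delta> ^ 2 * q"
proof -
  have "\<forall>j. \<exists>q\<in>R. (x D + \<delta>) ^ Suc (j + 1) = x D ^ Suc (j + 1) + of_nat (Suc (j + 1)) * x D ^ (j + 1) * \<delta> + \<delta> ^ 2 * q"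
    using power_taylor x \<delta> by blast
  then obtain q where q: "\<And>j. q j \<in> R"
    "\<And>j. (x D + \<delta>) ^ Suc (j + 1) = x D ^ Suc (j + 1) + of_nat (Suc (j + 1)) * x D ^ (j + 1) * \<delta> + \<delta> ^ 2 * q j"
    by metis
  have dep: "\<rho> j (x(D := x D + \<delta>)) = \<rho> j x" for j by (rule \<rho>_dep) auto
  have "H (x(D := x D + \<delta>)) D = (\<Sum>j<J. (x D + \<delta>) ^ Suc (j + 1) * \<rho> j x)"
    by (simp add: H_def Rho_def dep sum_distrib_left mult.assoc)
  also have "\<dots> = (\<Sum>j<J. x D ^ Suc (j + 1) * \<rho> j x + \<delta> * (of_nat (j + 2) * x D ^ (j + 1) * \<rho> j x) + \<delta> ^ 2 * (q j * \<rho> j x))"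
    unfolding q(2) by (intro sum.cong refl) (simp add: algebra_simps)
  also have "\<dots> = H x D + \<delta> * hh x + \<delta> ^ 2 * (\<Sum>j<J. q j * \<rho> j x)"
    by (simp add: sum.distrib sum_distrib_left H_def Rho_def hh_def mult.assoc)
  finally show ?thesis using q(1) polyfun_values[OF \<rho> sR, of x] x by (auto intro!: bexI R_intros)
qed

context
  fixes n :: nat and Gd :: int and \<kappa> :: "'k \<Rightarrow> nat \<Rightarrow> rat" and e :: "nat \<Rightarrow> 'k" and p P N :: nat
  assumes cs: "coord_sys_prime R n Gd \<kappa> e p" and p3: "p \<ge> 3"
    and P: "P = p ^ ((D + 1) * n)" and N: "N = fact P * fact P"
begin

interpretation coord_sys_prime R n Gd \<kappa> e p by (rule cs)

text \<open>\<open>G'\<close> is a polynomial left inverse over \<open>R\<close> of the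
  automorphism, so congruences pass from images back to points.\<close>

lemma base_pz:
  assumes "\<And>i. x i \<in> R" "\<And>i. y i \<in> R" "\<And>i. pz a (((G x)(D := u)) i - ((G y)(D := v)) i)"
    "u \<in> R" "v \<in> R" "i < D"
  shows "pz a (x i - y i)"
proof -
  have "((G z)(D := w)) j \<in> R" if "\<And>i. z i \<in> R" "w \<in> R" for z w j
    using polyfun_values[OF G_polyfun sR, of z j] that by simp
  then have "pz a (G' i ((G x)(D := u)) - G' i ((G y)(D := v)))"
    using assms(1-5) by (intro polyfun_pz_cong[OF G'[OF assms(6)]]) blast+
  then show ?thesis using assms(6) by (simp add: G'_inv)
qed

lemma zeros_base:
  assumes f: "f \<in> polyfun R" and a: "P \<le> a" and inf: "infinite {j. Norm (f (t (a + j * N))) = 0}"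
  shows "Norm (f (t (a + j * N))) = 0"
proof (rule etale_zeros[OF p3 K_polyfun K_outside _ _ _ P a N f inf])
  show "t0 i \<in> R" "D < i \<Longrightarrow> t0 i = 0" for i by (rule t0)+
  fix k x y i
  assume x: "\<And>i. x i \<in> R" "\<And>i. i > D \<Longrightarrow> x i = 0" and y: "\<And>i. y i \<in> R" "\<And>i. i > D \<Longrightarrow> y i = 0"
    and eq: "\<And>i. pz 2 (K x i - K y i)"
  consider "i < D" | "i = D" | "i > D" by linarith
  then show "pz 2 (x i - y i)"
  proof cases
    case 1
    then show ?thesis using base_pz[OF x(1) y(1) eq[unfolded K_def]] x y by simp
  next
    case 2
    then show ?thesis using eq[of D] by (simp add: K_def)
  next
    case 3
    then show ?thesis using x y by (simp add: pz_def \<kappa>_zero Zpow_zero[OF p] R_intros)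
  qed
qed

text \<open>The coordinates (u, w) are recovered by the inverse automorphism. For \<lambda> the
  Taylor expansion leaves \<delta> times \<open>hh\<close>, and \<open>hh\<close> is a unit modulo
  \<open>p\<close>: by \<open>cert\<close> it divides a power of a product of values of
  \<open>Rho\<close>, each of which is a unit.\<close>

lemma zeros_etale:
  assumes unit: "\<And>n. unit_mod (s n D)"
    and f: "f \<in> polyfun R" and a: "P \<le> a" and inf: "infinite {j. Norm (f (s (a + j * N))) = 0}"
  shows "Norm (f (s (a + j * N))) = 0"
proof (rule etale_zeros[OF p3 H_polyfun H_outside _ _ _ P a N f inf])
  show "t0 i \<in> R" "D < i \<Longrightarrow> t0 i = 0" for i by (rule t0)+
  fix k x y i
  assume x: "\<And>i. x i \<in> R" "\<And>i. i > D \<Longrightarrow> x i = 0" "\<And>i. pz 1 (x i - s k i)"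
    and y: "\<And>i. y i \<in> R" "\<And>i. i > D \<Longrightarrow> y i = 0" "\<And>i. pz 1 (y i - s k i)"
    and eq: "\<And>i. pz 2 (H x i - H y i)"
  have HR: "H z i \<in> R" if "\<And>i. z i \<in> R" for z i
    using polyfun_values[OF H_polyfun sR, of z i] that by simp
  have HD: "H x D \<in> R" "H y D \<in> R" using HR x(1) y(1) by blast+
  have below: "pz 2 (x i - y i)" if "i < D" for i
    using base_pz[OF x(1) y(1) eq[unfolded H_def] _ _ that] HD by (simp add: H_def)
  have pz0: "pz 2 0" by (simp add: pz_def \<kappa>_zero Zpow_zero[OF p] R_intros)
  define \<delta> where "\<delta> = y D - x D"
  have \<delta>: "pz 1 \<delta>" "\<delta> \<in> R"
    using pz_diff[OF y(3)[of D] x(3)[of D]] x(1) y(1) by (simp_all add: \<delta>_def R_intros)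
  obtain q where q: "q \<in> R" "H (x(D := x D + \<delta>)) D = H x D + \<delta> * hh x + \<delta> ^ 2 * q"
    using H_D_taylor[of x \<delta>] x(1) \<delta>(2) by blast
  \<comment> \<open>Replacing only \<lambda> in \<open>x\<close> gives a point congruent to
    \<open>y\<close> modulo \<open>p ^ 2\<close>, because the other coordinates already agree; this
    isolates the dependence on \<lambda>.\<close>
  have "pz 2 ((x(D := x D + \<delta>)) i - y i)" for i
    using below x y pz0 by (cases i D rule: linorder_cases) (auto simp: \<delta>_def)
  then have "pz 2 (H (x(D := x D + \<delta>)) D - H y D)"
    using x(1) y(1) \<delta> by (intro polyfun_pz_cong[OF H_polyfun]) (auto intro: R_intros)
  from pz_diff[OF this eq[of D]] have "pz 2 (\<delta> * hh x + \<delta> ^ 2 * q)" by (simp add: q(2))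
  moreover have "pz 2 (\<delta> ^ 2 * q)"
    using pz_mult_right[OF pz_mult[OF \<delta>(1) \<delta>(1)] q(1)] by (simp add: power2_eq_square numeral_2_eq_2)
  ultimately have "pz 2 (\<delta> * hh x)" using pz_diff by fastforce
  moreover have "unit_mod (hh x)"
  proof -
    have hhR: "hh z \<in> R" if "\<And>i. z i \<in> R" for z using polyfun_values[OF hh_polyfun sR, of z] that by simp
    have RhoR: "Rho z \<in> R" if "\<And>i. z i \<in> R" for z using polyfun_values[OF Rho_polyfun sR, of z] that by simp
    \<comment> \<open>\<open>Rho (s n)\<close> is a factor of the next \<lambda>, which is a unit
      modulo \<open>p\<close>.\<close>
    have "unit_mod (Rho (s n))" for n
      using unit[of "Suc n"] unit_mod_factor[of "Rho (s n)" "s n D"] RhoR[of "s n"] s_R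
      by (simp only: s_D_Suc mult.commute)
    then have "unit_mod ((\<Prod>i<l. Rho (s (k + i))) ^ c)" by (intro unit_mod_power unit_mod_prod)
    moreover obtain a where "a \<in> R" "hh (s k) * a = (\<Prod>i<l. Rho (s (k + i))) ^ c" using cert by blast
    ultimately have "unit_mod (hh (s k))"
      using unit_mod_factor[of "hh (s k)" a] hhR[of "s k"] s_R by simp
    moreover have "pz 1 (hh x - hh (s k))"
      by (rule polyfun_pz_cong[OF hh_polyfun]) (rule x s_R)+
    ultimately show ?thesis by (rule unit_mod_cong[OF _ _ hhR[OF x(1)]])
  qed
  ultimately have "pz 2 \<delta>" using pz_cancel_unit[OF \<delta>(1)] by blast
  then have D: "pz 2 (x D - y D)" using pz_diff[OF pz0] by (fastforce simp: \<delta>_def)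
  show "pz 2 (x i - y i)"
    using below D x(2) y(2) pz0 by (cases i D rule: linorder_cases) auto
qed

text \<open>Since \<open>T\<close> is affine, each step adds a bounded amount to the size of u,
  which is therefore linear in time. The matrix depends on u alone and w enters linearly, so each
  step adds an amount linear in time to the size of w, whence the square.\<close>

lemma base_height: "\<exists>C. \<forall>n i. size_le (C * (n + 1) ^ 2) (t n i)"
proof -
  obtain kA where kA: "\<forall>ij\<in>{..<m} \<times> {..<m}. size_le kA (A (fst ij) (snd ij))"
    using size_le_common[of "{..<m} \<times> {..<m}" "\<lambda>ij. A (fst ij) (snd ij)"] A by auto
  obtain kb where kb: "\<forall>i\<in>{..<m}. size_le kb (b i)"
    using size_le_common[of "{..<m}" b] b by auto
  obtain k0 where k0: "\<forall>i\<in>{..D}. size_le k0 (t0 i)"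
    using size_le_common[of "{..D}" t0] t0 by auto
  define \<beta> where "\<beta> = kA + kb + k0 + m + 1"
  have u: "size_le (\<beta> * (n + 1)) (t n i)" if "i < m" for n i
    using that
  proof (induction n arbitrary: i)
    case 0
    then show ?case using k0 by (auto simp: \<beta>_def D_def intro: size_le_mono[of k0])
  next
    case (Suc n)
    have "size_le (kA + \<beta> * (n + 1)) (A i j * t n j)" if "j < m" for j
      using size_le_mult[of kA "A i j" "\<beta> * (n + 1)" "t n j"] kA Suc that by simp
    then have "size_le (kA + \<beta> * (n + 1) + card {..<m}) (\<Sum>j<m. A i j * t n j)"
      by (intro size_le_sum) auto
    then have 1: "size_le (kA + kb + \<beta> * (n + 1) + m) (\<Sum>j<m. A i j * t n j)"
      by (rule size_le_mono) simp
    have 2: "size_le (kA + kb + \<beta> * (n + 1) + m) (b i)"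
      by (rule size_le_mono[of kb]) (use kb Suc.prems in auto)
    have "size_le (\<beta> * (Suc n + 1)) (b i + (\<Sum>j<m. A i j * t n j))"
      by (rule size_le_mono[OF size_le_add[OF 2 1]]) (simp add: \<beta>_def)
    then show ?case using Suc.prems by (simp only: K_u funpow.simps comp_apply)
  qed
  have "\<exists>\<delta>. \<forall>k x. (\<forall>i. size_le k (x i)) \<longrightarrow> size_le (\<delta> * (k + 1)) (W i j x)" if "i < r" "j < r" for i j
    by (rule size_le_polyfun[OF W[OF that]])
  then have "\<forall>i j. \<exists>\<delta>. i < r \<longrightarrow> j < r \<longrightarrow> (\<forall>k x. (\<forall>i. size_le k (x i)) \<longrightarrow> size_le (\<delta> * (k + 1)) (W i j x))"
    by blast
  then obtain \<delta>0 where \<delta>0: "\<And>i j k x. i < r \<Longrightarrow> j < r \<Longrightarrow> (\<And>i. size_le k (x i)) \<Longrightarrow> size_le (\<delta>0 i j * (k + 1)) (W i j x)"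
    by metis
  define \<delta> where "\<delta> = (\<Sum>i<r. \<Sum>j<r. \<delta>0 i j) * (\<beta> + 1)"
  have Wsize: "size_le (\<delta> * (n + 1)) (W i j (t n))" if ij: "i < r" "j < r" for n i j
  proof -
    \<comment> \<open>The linear bound is known only for u. As \<open>W\<close> ignores w, the
      remaining coordinates are set to 0, which makes the bound hold for the whole state.\<close>
    define x where "x k = (if k < m then t n k else 0)" for k
    have "size_le (\<beta> * (n + 1)) (x k)" for k using u by (auto simp: x_def size_le_zero)
    from \<delta>0[OF ij this] have "size_le (\<delta>0 i j * (\<beta> * (n + 1) + 1)) (W i j x)" .
    moreover have "W i j x = W i j (t n)" using ij by (intro W_dep) (auto simp: x_def)
    moreover have "\<delta>0 i j * (\<beta> * (n + 1) + 1) \<le> \<delta> * (n + 1)"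
    proof -
      have "\<delta>0 i j \<le> (\<Sum>j<r. \<delta>0 i j)" using ij by (intro member_le_sum) auto
      also have "\<dots> \<le> (\<Sum>i<r. \<Sum>j<r. \<delta>0 i j)"
        using ij by (intro member_le_sum[of i _ "\<lambda>i. \<Sum>j<r. \<delta>0 i j"]) auto
      finally have "\<delta>0 i j * ((\<beta> + 1) * (n + 1)) \<le> (\<Sum>i<r. \<Sum>j<r. \<delta>0 i j) * ((\<beta> + 1) * (n + 1))"
        by (rule mult_le_mono1)
      moreover have "\<delta>0 i j * (\<beta> * (n + 1) + 1) \<le> \<delta>0 i j * ((\<beta> + 1) * (n + 1))"
        by (intro mult_le_mono2) (simp add: algebra_simps)
      ultimately show ?thesis by (simp only: \<delta>_def mult.assoc)
    qed
    ultimately show ?thesis by (metis size_le_mono)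
  qed
  define \<gamma> where "\<gamma> = \<delta> + r + k0 + \<beta>"
  have w: "size_le (\<gamma> * (n + 1) ^ 2) (t n (m + i))" if "i < r" for n i
    using that
  proof (induction n arbitrary: i)
    case 0
    then show ?case using k0 by (auto simp: \<gamma>_def D_def intro: size_le_mono[of k0])
  next
    case (Suc n)
    have "size_le (\<delta> * (n + 1) + \<gamma> * (n + 1) ^ 2) (W i j (t n) * t n (m + j))" if "j < r" for j
      using Wsize[OF Suc.prems that] Suc.IH[OF that] by (rule size_le_mult)
    then have "size_le (\<delta> * (n + 1) + \<gamma> * (n + 1) ^ 2 + card {..<r}) (\<Sum>j<r. W i j (t n) * t n (m + j))"
      by (intro size_le_sum) auto
    moreover have "\<delta> * (n + 1) + \<gamma> * (n + 1) ^ 2 + card {..<r} \<le> \<gamma> * (Suc n + 1) ^ 2"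
    proof -
      have "\<delta> * (n + 1) + r \<le> \<gamma> * (2 * n + 3)" by (simp add: \<gamma>_def algebra_simps)
      moreover have "\<gamma> * (Suc n + 1) ^ 2 = \<gamma> * (n + 1) ^ 2 + \<gamma> * (2 * n + 3)"
        by (simp add: power2_eq_square algebra_simps)
      ultimately show ?thesis by simp
    qed
    ultimately have "size_le (\<gamma> * (Suc n + 1) ^ 2) (\<Sum>j<r. W i j (t n) * t n (m + j))"
      by (rule size_le_mono)
    then show ?case using Suc.prems by (simp only: K_w funpow.simps comp_apply)
  qed
  have "size_le (\<gamma> * (n + 1) ^ 2) (t n i)" for n i
  proof -
    consider "i < m" | j where "i = m + j" "j < r" | "i = D" | "i > D"
      unfolding D_def by (metis add_diff_inverse_nat linorder_neqE_nat nat_add_left_cancel_less)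
    then show ?thesis
    proof cases
      case 1
      have "\<beta> * (n + 1) \<le> \<gamma> * (n + 1) ^ 2"
        by (intro mult_mono) (auto simp: \<gamma>_def power2_eq_square)
      then show ?thesis using u[OF 1] size_le_mono by blast
    next
      case 2
      then show ?thesis using w by simp
    next
      case 3
      have "size_le k0 1" using k0 t0(2) by force
      moreover have "k0 * 1 \<le> \<gamma> * (n + 1) ^ 2" by (intro mult_mono) (auto simp: \<gamma>_def)
      ultimately show ?thesis using 3 size_le_mono by (simp add: t_D)
    next
      case 4
      then have "t n i = 0" using t0 K_outside by (cases n) auto
      then show ?thesis by (simp add: size_le_zero)
    qed
  qed
  then show ?thesis by blast
qed

text \<open>Where \<open>\<lambda>\<close> has been attracted to \<open>0\<close> modulo \<open>p\<close>, it decays doubly exponentially, which beats the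
  growth \<open>exp (O n\<^sup>2)\<close> of the heights along the orbit of the automorphism.\<close>

lemma attracted_zero:
  assumes f: "f \<in> polyfun R" and n1: "\<not> unit_mod (s n1 D)"
  shows "\<exists>n2. \<forall>n\<ge>n2. \<forall>y\<in>R. f (t n) = s n D * y \<longrightarrow> Norm (f (t n)) = 0"
proof -
  obtain C where C: "\<And>n i. size_le (C * (n + 1) ^ 2) (t n i)" using base_height by blast
  obtain \<delta> where \<delta>: "\<forall>k x. (\<forall>i. size_le k (x i)) \<longrightarrow> size_le (\<delta> * (k + 1)) (f x)"
    using size_le_polyfun[OF f] by blast
  define C' where "C' = \<delta> * (C + 1)"
  have fsize: "size_le (C' * (k + 1) ^ 2) (f (t k))" for k
  proof -
    have "size_le (\<delta> * (C * (k + 1) ^ 2 + 1)) (f (t k))" using \<delta> C by blast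
    moreover have "\<delta> * (C * (k + 1) ^ 2 + 1) \<le> C' * (k + 1) ^ 2"
      unfolding C'_def mult.assoc by (intro mult_le_mono2) (simp add: algebra_simps)
    ultimately show ?thesis by (rule size_le_mono)
  qed
  define g where "g = nat (2 * \<bar>Gd\<bar>)"
  have g: "(2 * \<bar>of_int Gd\<bar> :: rat) = of_nat g" by (simp add: g_def)
  \<comment> \<open>Collects the exponents after the crude bounds of \<open>fact n\<close> and
    \<open>g\<close> by powers of 2.\<close>
  define E where "E = fact n + g * C' * n"
  \<comment> \<open>The factor \<open>2 ^ n1\<close> compensates for the decay starting only at time
    \<open>n1\<close>: the exponent is \<open>2 ^ h\<close> with \<open>h = k - n1\<close>.\<close>
  obtain n2 where n2: "\<And>k. k \<ge> n2 \<Longrightarrow> 2 ^ n1 * E * (k + 1) ^ 2 < (2 :: nat) ^ k"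
    using exp_beats_square[of "2 ^ n1 * E"] by blast
  show ?thesis
  proof (intro exI[of _ "n1 + n2"] allI impI ballI)
    fix k y assume k: "n1 + n2 \<le> k" and y: "y \<in> R" "f (t k) = s k D * y"
    obtain h where h: "k = n1 + h" using k le_add_diff_inverse by (metis add_leD1)
    obtain z where z: "z \<in> R" "s k D = s n1 D ^ (2 ^ h) * z" using s_D_power[of n1 h] h by blast
    \<comment> \<open>A nonunit has norm divisible by \<open>p\<close>; multiplicativity turns the
      power \<open>2 ^ h\<close> of \<lambda> into divisibility of the norm by
      \<open>p ^ 2 ^ h\<close>.\<close>
    have "Norm (s n1 D) \<in> Zpow p 1" by (rule Norm_nonunit[OF s_R n1])
    then have "Norm (s n1 D) ^ (2 ^ h) * Norm (z * y) \<in> Zpow p (2 ^ h)"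
      by (intro Zpow_mult_right[OF p] Zpow_power Norm_Zloc R_intros y z)
    then have div: "Norm (f (t k)) \<in> Zpow p (2 ^ h)"
      using y z s_R by (simp add: Norm_mult Norm_power R_intros mult.assoc)
    show "Norm (f (t k)) = 0"
    proof (rule ccontr)
      assume "Norm (f (t k)) \<noteq> 0"
      from Norm_height[OF p pG fsize this div]
      have "of_nat (p ^ 2 ^ h) \<le> (of_nat (fact n * (g ^ (C' * (k + 1) ^ 2)) ^ n) :: rat)"
        by (simp add: g)
      then have "p ^ 2 ^ h \<le> fact n * (g ^ (C' * (k + 1) ^ 2)) ^ n" by (simp only: of_nat_le_iff)
      also have "\<dots> = fact n * g ^ (C' * n * (k + 1) ^ 2)" by (simp add: mult_ac flip: power_mult)
      also have "\<dots> \<le> 2 ^ fact n * (2 ^ g) ^ (C' * n * (k + 1) ^ 2)"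
        by (intro mult_mono power_mono) (auto intro: less_imp_le[OF less_exp])
      also have "\<dots> = 2 ^ (fact n + g * C' * n * (k + 1) ^ 2)"
        by (simp add: power_add mult.assoc flip: power_mult)
      also have "\<dots> \<le> 2 ^ (E * (k + 1) ^ 2)"
        by (intro power_increasing) (auto simp: E_def algebra_simps)
      finally have le: "p ^ 2 ^ h \<le> 2 ^ (E * (k + 1) ^ 2)" .
      have "2 ^ n1 * (E * (k + 1) ^ 2) < 2 ^ n1 * 2 ^ h"
        using n2[of k] k by (simp add: h power_add mult.assoc)
      then have "E * (k + 1) ^ 2 < 2 ^ h" by simp
      then have "(2 :: nat) ^ (E * (k + 1) ^ 2) < 2 ^ 2 ^ h" by (intro power_strict_increasing) auto
      also have "\<dots> \<le> p ^ 2 ^ h" using p3 by (intro power_mono) auto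
      finally show False using le by simp
    qed
  qed
qed

end

text \<open>\<open>n0\<close> and \<open>N\<close> are fixed before the coefficient functions
  \<open>fs\<close>; the specialization is chosen afterwards, so as to see the particular nonzero
  values that are to lead to a contradiction.\<close>

theorem zeros_on_classes:
  "\<exists>n0 N. N > 0 \<and> (\<forall>J' fs. (\<forall>j. fs j \<in> polyfun R) \<longrightarrow>
    (\<forall>j x y. (\<forall>k<D. x k = y k) \<longrightarrow> fs j x = fs j y) \<longrightarrow>
    (\<forall>a\<ge>n0. infinite {k. (\<Sum>j<J'. s (a + k * N) D ^ j * fs j (s (a + k * N))) = 0} \<longrightarrow>
      (\<forall>k. (\<Sum>j<J'. s (a + k * N) D ^ j * fs j (s (a + k * N))) = 0)))"
proof -
  obtain n where n: "\<forall>g\<in>R - {0}. \<forall>b. \<exists>p>b. prime p \<and> specializable_at R n g p"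
    using spec unfolding specializable_def by blast
  \<comment> \<open>Only \<open>p \<ge> 3\<close> is asked of the prime here; whether \<lambda>
    stays a unit modulo \<open>p\<close> is settled later by a case distinction.\<close>
  have "(1::'k) \<in> R - {0}" using R_intros by simp
  with n obtain p where p: "p > 2" "prime p" "specializable_at R n 1 p" by blast
  then have p3: "3 \<le> p" by simp
  define P where "P = p ^ ((D + 1) * n)"
  define N :: nat where "N = fact P * fact P"
  have coord: "\<exists>G \<kappa> e. coord_sys_prime R n G \<kappa> e p \<and> coord_sys.Norm n \<kappa> e c \<noteq> 0" if c: "c \<in> R" "c \<noteq> 0" for c
  proof -
    obtain G \<kappa> e M where *: "coord_sys R n G \<kappa> e" "\<not> int p dvd G" "divides_scalar R \<kappa> c M" "M \<noteq> 0"
      using bspec[OF p(3)[unfolded specializable_at_def], of c] c by blast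
    interpret coord_sys R n G \<kappa> e by fact
    have "Norm c \<noteq> 0" using * c Norm_nonzero by (auto simp: divides_scalar_def)
    moreover have "coord_sys_prime R n G \<kappa> e p" by unfold_locales (use p * in auto)
    ultimately show ?thesis by blast
  qed
  show ?thesis
  proof (cases "\<exists>j0. s j0 D = 0")
    case True
    then obtain j0 where j0: "s j0 D = 0" by blast
    \<comment> \<open>Once \<lambda> vanishes it stays 0, and from then on only the coefficient
      \<open>fs 0\<close> contributes, evaluated along the automorphism.\<close>
    have zero: "s k D = 0" if "j0 \<le> k" for k
      using s_D_power[of j0 "k - j0"] that j0 by auto
    show ?thesis
    proof (rule exI[of _ "P + j0"], rule exI[of _ N], intro conjI allI impI)
      show "N > 0" by (simp add: N_def)
      fix J' :: nat and fs :: "nat \<Rightarrow> (nat \<Rightarrow> 'k) \<Rightarrow> 'k" and a k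
      assume fs: "\<forall>j. fs j \<in> polyfun R" "\<forall>j x y. (\<forall>k<D. x k = y k) \<longrightarrow> fs j x = fs j y"
        and a: "P + j0 \<le> a"
        and inf: "infinite {k. (\<Sum>j<J'. s (a + k * N) D ^ j * fs j (s (a + k * N))) = 0}"
      have eq: "(\<Sum>j<J'. s (a + k * N) D ^ j * fs j (s (a + k * N))) = (if J' = 0 then 0 else fs 0 (t (a + k * N)))" for k
      proof (cases J')
        case (Suc J)
        have "fs 0 (s (a + k * N)) = fs 0 (t (a + k * N))" using fs(2) s_eq_t by blast
        then show ?thesis using zero[of "a + k * N"] a Suc by (simp add: sum.lessThan_Suc_shift del: sum.lessThan_Suc)
      qed simp
      show "(\<Sum>j<J'. s (a + k * N) D ^ j * fs j (s (a + k * N))) = 0"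
      proof (rule ccontr)
        assume nz: "\<not> ?thesis"
        then have J': "J' \<noteq> 0" "fs 0 (t (a + k * N)) \<noteq> 0" by (simp_all add: eq split: if_splits)
        have "fs 0 (t (a + k * N)) \<in> R" by (rule polyfun_values[OF fs(1)[rule_format] sR t_R])
        then obtain G \<kappa> e where *: "coord_sys_prime R n G \<kappa> e p" "coord_sys.Norm n \<kappa> e (fs 0 (t (a + k * N))) \<noteq> 0"
          using coord J' by blast
        interpret coord_sys_prime R n G \<kappa> e p by fact
        have "{k. (\<Sum>j<J'. s (a + k * N) D ^ j * fs j (s (a + k * N))) = 0} \<subseteq> {k. Norm (fs 0 (t (a + k * N))) = 0}"
          using J' Norm_zero_coords[OF R_intros(4)] by (auto simp: eq \<kappa>_zero)
        then have "infinite {k. Norm (fs 0 (t (a + k * N))) = 0}" using inf infinite_super by blast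
        then have "Norm (fs 0 (t (a + k * N))) = 0"
          using zeros_base[OF *(1) p3 P_def N_def fs(1)[rule_format]] a by simp
        then show False using * by simp
      qed
    qed
  next
    case False
    then have nz: "s k D \<noteq> 0" for k by blast
    show ?thesis
    proof (rule exI[of _ P], rule exI[of _ N], intro conjI allI impI)
      show "N > 0" by (simp add: N_def)
      fix J' :: nat and fs :: "nat \<Rightarrow> (nat \<Rightarrow> 'k) \<Rightarrow> 'k" and a k
      assume fs: "\<forall>j. fs j \<in> polyfun R" "\<forall>j x y. (\<forall>k<D. x k = y k) \<longrightarrow> fs j x = fs j y"
        and a: "P \<le> a"
      let ?f = "\<lambda>x. \<Sum>j<J'. x D ^ j * fs j x"
      assume inf: "infinite {k. ?f (s (a + k * N)) = 0}"
      have fst: "fs j (s i) = fs j (t i)" for i j using fs(2) s_eq_t by blast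
      have fsR: "fs j (t i) \<in> R" for i j by (rule polyfun_values[OF fs(1)[rule_format] sR t_R])
      have f: "?f \<in> polyfun R" using fs(1) by (intro PF_intros) auto
      have fR: "?f (s i) \<in> R" for i using polyfun_values[OF f sR, of "s i"] s_R by simp
      show "?f (s (a + k * N)) = 0"
      proof (rule ccontr)
        assume fk: "?f (s (a + k * N)) \<noteq> 0"
        define Pj where "Pj j \<longleftrightarrow> j < J' \<and> (\<exists>i. fs j (t (a + i * N)) \<noteq> 0)" for j
        have "\<exists>j. Pj j"
        proof (rule ccontr)
          assume "\<nexists>j. Pj j"
          then have "?f (s (a + k * N)) = 0" by (intro sum.neutral) (auto simp: Pj_def fst)
          then show False using fk by simp
        qed
        define j where "j = (LEAST j. Pj j)"
        have j: "Pj j" and minimal: "\<And>i. i < j \<Longrightarrow> \<not> Pj i"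
          unfolding j_def by (rule LeastI_ex[OF \<open>\<exists>j. Pj j\<close>], rule not_less_Least)
        then obtain i0 where i0: "fs j (t (a + i0 * N)) \<noteq> 0" "j < J'" by (auto simp: Pj_def)
        \<comment> \<open>A single specialization must keep both values nonzero: which of them is
          contradicted depends on whether \<lambda> stays a unit, and this is known only after
          specializing.\<close>
        define c where "c = ?f (s (a + k * N)) * fs j (t (a + i0 * N))"
        have "c \<in> R" "c \<noteq> 0" using fk i0 fR fsR by (auto simp: c_def intro: R_intros)
        then obtain G \<kappa> e where *: "coord_sys_prime R n G \<kappa> e p" "coord_sys.Norm n \<kappa> e c \<noteq> 0"
          using coord by blast
        interpret coord_sys_prime R n G \<kappa> e p by fact
        have N0: "Norm 0 = 0" by (rule Norm_zero_coords) (auto simp: R_intros \<kappa>_zero)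
        have Nc: "Norm (?f (s (a + k * N))) \<noteq> 0" "Norm (fs j (t (a + i0 * N))) \<noteq> 0"
          using *(2) fR fsR by (auto simp: c_def Norm_mult)
        show False
        proof (cases "\<forall>n. unit_mod (s n D)")
          case True
          have "{k. ?f (s (a + k * N)) = 0} \<subseteq> {k. Norm (?f (s (a + k * N))) = 0}" using N0 by auto
          then have "infinite {k. Norm (?f (s (a + k * N))) = 0}" using inf infinite_super by blast
          then have "Norm (?f (s (a + k * N))) = 0"
            using zeros_etale[OF *(1) p3 P_def N_def _ f a, of k] True by simp
          then show False using Nc by simp
        next
          case False
          then obtain n1 where n1: "\<not> unit_mod (s n1 D)" by blast
          obtain n2 where n2: "\<forall>n\<ge>n2. \<forall>y\<in>R. fs j (t n) = s n D * y \<longrightarrow> Norm (fs j (t n)) = 0"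
            using attracted_zero[OF *(1) p3 P_def N_def fs(1)[rule_format] n1] by blast
          have "Norm (fs j (t (a + i * N))) = 0" if i: "?f (s (a + i * N)) = 0" "n2 \<le> i" for i
          proof -
            let ?z = "s (a + i * N) D" and ?x = "t (a + i * N)"
            have "N \<ge> 1" by (simp add: N_def)
            then have "i \<le> i * N" by simp
            then have le: "n2 \<le> a + i * N" using i(2) by linarith
            have split: "{..<J'} = {..<j} \<union> {j} \<union> {j<..<J'}" using i0(2) by auto
            have "(\<Sum>h<J'. ?z ^ h * fs h ?x) = (\<Sum>h\<in>{..<j} \<union> {j}. ?z ^ h * fs h ?x) + (\<Sum>h\<in>{j<..<J'}. ?z ^ h * fs h ?x)"
              unfolding split by (rule sum.union_disjoint) auto
            moreover have "(\<Sum>h\<in>{..<j} \<union> {j}. ?z ^ h * fs h ?x) = (\<Sum>h\<in>{..<j}. ?z ^ h * fs h ?x) + ?z ^ j * fs j ?x"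
              by (subst sum.union_disjoint) auto
            moreover have "(\<Sum>h\<in>{..<j}. ?z ^ h * fs h ?x) = 0"
              using minimal i0(2) by (intro sum.neutral) (auto simp: Pj_def)
            moreover have "(\<Sum>h\<in>{j<..<J'}. ?z ^ h * fs h ?x) = ?z ^ j * (?z * (\<Sum>h\<in>{j<..<J'}. ?z ^ (h - Suc j) * fs h ?x))"
            proof -
              have "?z ^ h = ?z ^ j * (?z * ?z ^ (h - Suc j))" if "j < h" for h
              proof -
                have "h = j + Suc (h - Suc j)" using that by simp
                then show ?thesis by (metis power_Suc power_add)
              qed
              then show ?thesis unfolding sum_distrib_left by (intro sum.cong refl) simp
            qed
            ultimately have "?z ^ j * (fs j ?x + ?z * (\<Sum>h\<in>{j<..<J'}. ?z ^ (h - Suc j) * fs h ?x)) = 0"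
              using i(1) by (simp add: fst distrib_left)
            \<comment> \<open>In this branch \<lambda> is never 0 in the field, so its
              \<open>j\<close>-th power cancels. What remains exhibits \<open>fs j\<close> as
              \<lambda> times an element of \<open>R\<close>, the form required by
              \<open>attracted_zero\<close>.\<close>
            then have "fs j ?x = ?z * - (\<Sum>h\<in>{j<..<J'}. ?z ^ (h - Suc j) * fs h ?x)"
              using nz[of "a + i * N"] by (simp add: eq_neg_iff_add_eq_0)
            moreover have "- (\<Sum>h\<in>{j<..<J'}. ?z ^ (h - Suc j) * fs h ?x) \<in> R"
              using fsR s_R by (intro R_intros)
            ultimately show ?thesis using n2 le by blast
          qed
          then have "{k. ?f (s (a + k * N)) = 0} - {..<n2} \<subseteq> {k. Norm (fs j (t (a + k * N))) = 0}" by auto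
          moreover have "infinite ({k. ?f (s (a + k * N)) = 0} - {..<n2})" using inf by simp
          ultimately have "infinite {k. Norm (fs j (t (a + k * N))) = 0}" using infinite_super by blast
          then have "Norm (fs j (t (a + i0 * N))) = 0"
            using zeros_base[OF *(1) p3 P_def N_def fs(1)[rule_format] a] by simp
          then show False using Nc by simp
        qed
      qed
    qed
  qed
qed

end

section \<open>The Nullstellensatz for a hypersurface\<close>

inductive homogeneous :: "nat \<Rightarrow> (('i \<Rightarrow> 'a::idom) \<Rightarrow> 'a) \<Rightarrow> bool" where
  "homogeneous 0 (\<lambda>_. c)"
| "homogeneous j (\<lambda>_. 0)"
| "homogeneous 1 (\<lambda>s. s i)"
| "homogeneous j f \<Longrightarrow> homogeneous j g \<Longrightarrow> homogeneous j (\<lambda>s. f s + g s)"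
| "homogeneous j f \<Longrightarrow> homogeneous k g \<Longrightarrow> homogeneous (j + k) (\<lambda>s. f s * g s)"

lemma homogeneous_sum: "(\<And>i. i \<in> I \<Longrightarrow> homogeneous j (f i)) \<Longrightarrow> homogeneous j (\<lambda>s. \<Sum>i\<in>I. f i s)"
  by (induction I rule: infinite_finite_induct) (auto intro: homogeneous.intros)

lemma homogeneous_decomposition:
  assumes "f \<in> polyfun UNIV"
  shows "\<exists>d F. (\<forall>j. homogeneous j (F j)) \<and> (\<forall>j>d. F j = (\<lambda>_. 0)) \<and> (\<forall>s. f s = (\<Sum>j\<le>d. F j s))"
  using assms
proof induction
  case (polyfun_const c)
  show ?case
    by (intro exI[of _ 0] exI[of _ "\<lambda>j. if j = 0 then (\<lambda>_. c) else (\<lambda>_. 0)"])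
      (auto intro: homogeneous.intros)
next
  case (polyfun_var i)
  show ?case
    by (intro exI[of _ 1] exI[of _ "\<lambda>j. if j = 1 then (\<lambda>s. s i) else (\<lambda>_. 0)"])
      (auto intro: homogeneous.intros(2) homogeneous.intros(3)[unfolded One_nat_def])
next
  case (polyfun_add f g)
  then obtain d F e E where F: "\<forall>j. homogeneous j (F j)" "\<forall>j>d. F j = (\<lambda>_. 0)" "\<forall>s. f s = (\<Sum>j\<le>d. F j s)"
    and E: "\<forall>j. homogeneous j (E j)" "\<forall>j>e. E j = (\<lambda>_. 0)" "\<forall>s. g s = (\<Sum>j\<le>e. E j s)" by blast
  have "f s = (\<Sum>j\<le>max d e. F j s)" for s
    unfolding F(3)[rule_format] using F(2) by (intro sum.mono_neutral_left) auto
  moreover have "g s = (\<Sum>j\<le>max d e. E j s)" for s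
    unfolding E(3)[rule_format] using E(2) by (intro sum.mono_neutral_left) auto
  ultimately show ?case using F E
    by (intro exI[of _ "max d e"] exI[of _ "\<lambda>j s. F j s + E j s"])
      (auto intro: homogeneous.intros simp: sum.distrib)
next
  case (polyfun_mult f g)
  then obtain d F e E where F: "\<forall>j. homogeneous j (F j)" "\<forall>j>d. F j = (\<lambda>_. 0)" "\<forall>s. f s = (\<Sum>j\<le>d. F j s)"
    and E: "\<forall>j. homogeneous j (E j)" "\<forall>j>e. E j = (\<lambda>_. 0)" "\<forall>s. g s = (\<Sum>j\<le>e. E j s)" by blast
  have hom: "homogeneous k (\<lambda>s. F i s * E (k - i) s)" if "i \<le> k" for i k
    using homogeneous.intros(5)[of i "F i" "k - i" "E (k - i)"] F E that by simp
  have "f s * g s = (\<Sum>k\<le>d + e. \<Sum>i\<le>k. F i s * E (k - i) s)" for s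
    using polynomial_product[of d "\<lambda>i. F i s" e "\<lambda>i. E i s" 1] F E by simp
  moreover have "homogeneous k (\<lambda>s. \<Sum>i\<le>k. F i s * E (k - i) s)" for k
    using hom by (intro homogeneous_sum) auto
  moreover have "(\<lambda>s. \<Sum>i\<le>k. F i s * E (k - i) s) = (\<lambda>_. 0)" if "k > d + e" for k
  proof
    fix s show "(\<Sum>i\<le>k. F i s * E (k - i) s) = 0"
    proof (intro sum.neutral ballI)
      fix i
      have "d < i \<or> e < k - i" using that by linarith
      then show "F i s * E (k - i) s = 0" using F E by auto
    qed
  qed
  ultimately show ?case
    by (intro exI[of _ "d + e"] exI[of _ "\<lambda>k s. \<Sum>i\<le>k. F i s * E (k - i) s"]) auto
qed

text \<open>Families of polynomials in one variable \<open>t\<close> depending polynomially on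
  \<open>X\<close>: restrictions of functions to parallel lines in a fixed direction.\<close>

definition polyfun_coeffs :: "(('i \<Rightarrow> 'a) \<Rightarrow> 'a::idom poly) \<Rightarrow> bool" where
  "polyfun_coeffs \<Lambda> \<longleftrightarrow> (\<forall>i. (\<lambda>X. coeff (\<Lambda> X) i) \<in> polyfun UNIV)"

lemma polyfun_coeffs_const: "polyfun_coeffs (\<lambda>_. q)"
  by (simp add: polyfun_coeffs_def polyfun_const)

lemma polyfun_coeffs_add: "polyfun_coeffs \<Lambda> \<Longrightarrow> polyfun_coeffs M \<Longrightarrow> polyfun_coeffs (\<lambda>X. \<Lambda> X + M X)"
  by (auto simp: polyfun_coeffs_def intro: polyfun_add)

lemma polyfun_coeffs_diff: "polyfun_coeffs \<Lambda> \<Longrightarrow> polyfun_coeffs M \<Longrightarrow> polyfun_coeffs (\<lambda>X. \<Lambda> X - M X)"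
  by (auto simp: polyfun_coeffs_def intro: polyfun_diff[OF is_subring_UNIV])

lemma polyfun_coeffs_mult: "polyfun_coeffs \<Lambda> \<Longrightarrow> polyfun_coeffs M \<Longrightarrow> polyfun_coeffs (\<lambda>X. \<Lambda> X * M X)"
  by (auto simp: polyfun_coeffs_def coeff_mult intro!: polyfun_sum[OF is_subring_UNIV] polyfun_mult)

lemma polyfun_coeffs_power: "polyfun_coeffs \<Lambda> \<Longrightarrow> polyfun_coeffs (\<lambda>X. \<Lambda> X ^ n)"
  by (induction n) (auto intro: polyfun_coeffs_const polyfun_coeffs_mult)

lemma polyfun_coeffs_sum: "(\<And>j. j \<in> I \<Longrightarrow> polyfun_coeffs (\<Lambda> j)) \<Longrightarrow> polyfun_coeffs (\<lambda>X. \<Sum>j\<in>I. \<Lambda> j X)"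
  by (induction I rule: infinite_finite_induct) (auto intro: polyfun_coeffs_const polyfun_coeffs_add)

lemma polyfun_coeffs_monom:
  assumes "c \<in> polyfun UNIV" shows "polyfun_coeffs (\<lambda>X. monom (c X) n)"
  unfolding polyfun_coeffs_def
proof
  fix i show "(\<lambda>X. coeff (monom (c X) n) i) \<in> polyfun UNIV"
    using assms by (cases "n = i") (simp_all add: polyfun_const)
qed

lemma coeff_mult_top:
  fixes p q :: "'a::comm_semiring_0 poly"
  assumes "degree p \<le> i" "degree q \<le> j" shows "coeff (p * q) (i + j) = coeff p i * coeff q j"
proof -
  have "coeff p k * coeff q (i + j - k) = 0" if "k \<noteq> i" "k \<le> i + j" for k
  proof (cases "k < i")
    case True
    then have "degree q < i + j - k" using assms by linarith
    then show ?thesis by (simp add: coeff_eq_0)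
  next
    case False
    then have "degree p < k" using assms that by linarith
    then show ?thesis by (simp add: coeff_eq_0)
  qed
  then have "(\<Sum>k\<le>i + j. coeff p k * coeff q (i + j - k)) = (\<Sum>k\<in>{i}. coeff p k * coeff q (i + j - k))"
    by (intro sum.mono_neutral_right) auto
  then show ?thesis by (simp add: coeff_mult)
qed

text \<open>The coefficient of \<open>t ^ j\<close> does not depend on \<open>X\<close>, which later
  allows the restriction to be made monic for all \<open>X\<close> at once.\<close>

lemma homogeneous_line:
  fixes v :: "'i \<Rightarrow> 'a::idom"
  assumes "homogeneous j f"
  shows "\<exists>\<Lambda>. polyfun_coeffs \<Lambda> \<and> (\<forall>X. degree (\<Lambda> X) \<le> j \<and> coeff (\<Lambda> X) j = f v) \<and>
    (\<forall>X t. poly (\<Lambda> X) t = f (\<lambda>i. X i + t * v i))"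
  using assms
proof induction
  case (1 c)
  show ?case by (intro exI[of _ "\<lambda>_. [:c:]"]) (simp add: polyfun_coeffs_const)
next
  case (2 j)
  show ?case by (intro exI[of _ "\<lambda>_. 0"]) (simp add: polyfun_coeffs_const)
next
  case (3 i)
  have "(\<lambda>X. coeff [:X i, v i:] k) \<in> polyfun UNIV" for k
  proof -
    consider "k = 0" | "k = 1" | k' where "k = Suc (Suc k')" by (metis One_nat_def not0_implies_Suc)
    then show ?thesis by cases (simp_all add: polyfun_const polyfun_var)
  qed
  then show ?case
    by (intro exI[of _ "\<lambda>X. [:X i, v i:]"]) (auto simp: polyfun_coeffs_def)
next
  case (4 j f g)
  then obtain \<Lambda> M where "polyfun_coeffs \<Lambda>" "\<forall>X. degree (\<Lambda> X) \<le> j \<and> coeff (\<Lambda> X) j = f v"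
    "\<forall>X t. poly (\<Lambda> X) t = f (\<lambda>i. X i + t * v i)" "polyfun_coeffs M"
    "\<forall>X. degree (M X) \<le> j \<and> coeff (M X) j = g v" "\<forall>X t. poly (M X) t = g (\<lambda>i. X i + t * v i)" by blast
  then show ?case
    by (intro exI[of _ "\<lambda>X. \<Lambda> X + M X"]) (auto intro: polyfun_coeffs_add degree_add_le)
next
  case (5 j f k g)
  then obtain \<Lambda> M where *: "polyfun_coeffs \<Lambda>" "\<forall>X. degree (\<Lambda> X) \<le> j \<and> coeff (\<Lambda> X) j = f v"
    "\<forall>X t. poly (\<Lambda> X) t = f (\<lambda>i. X i + t * v i)" "polyfun_coeffs M"
    "\<forall>X. degree (M X) \<le> k \<and> coeff (M X) k = g v" "\<forall>X t. poly (M X) t = g (\<lambda>i. X i + t * v i)" by blast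
  have "degree (\<Lambda> X * M X) \<le> j + k" for X
    using degree_mult_le[of "\<Lambda> X" "M X"] * by (meson add_mono order_trans)
  then show ?case using *
    by (intro exI[of _ "\<lambda>X. \<Lambda> X * M X"]) (auto intro: polyfun_coeffs_mult simp: coeff_mult_top)
qed

lemma polyfun_line:
  fixes v :: "'i \<Rightarrow> 'a::idom"
  assumes F: "\<forall>j. homogeneous j (F j)"
  shows "\<exists>\<Lambda>. polyfun_coeffs \<Lambda> \<and> (\<forall>X. degree (\<Lambda> X) \<le> d \<and> coeff (\<Lambda> X) d = F d v) \<and>
    (\<forall>X t. poly (\<Lambda> X) t = (\<Sum>j\<le>d. F j (\<lambda>i. X i + t * v i)))"
proof -
  have "\<forall>j. \<exists>\<Lambda>. polyfun_coeffs \<Lambda> \<and> (\<forall>X. degree (\<Lambda> X) \<le> j \<and> coeff (\<Lambda> X) j = F j v) \<and>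
    (\<forall>X t. poly (\<Lambda> X) t = F j (\<lambda>i. X i + t * v i))"
    using homogeneous_line F by blast
  from choice[OF this] obtain \<Lambda> where \<Lambda>: "\<And>j. polyfun_coeffs (\<Lambda> j)"
    "\<And>j X. degree (\<Lambda> j X) \<le> j" "\<And>j X. coeff (\<Lambda> j X) j = F j v"
    "\<And>j X t. poly (\<Lambda> j X) t = F j (\<lambda>i. X i + t * v i)" by blast
  have "coeff (\<Sum>j\<le>d. \<Lambda> j X) d = F d v" for X
  proof -
    have "coeff (\<Lambda> j X) d = 0" if "j < d" for j
      using \<Lambda>(2)[of j X] that by (simp add: coeff_eq_0)
    then have "(\<Sum>j<d. coeff (\<Lambda> j X) d) = 0" by (intro sum.neutral) auto
    then show ?thesis by (simp add: coeff_sum \<Lambda>(3) flip: lessThan_Suc_atMost)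
  qed
  moreover have "degree (\<Sum>j\<le>d. \<Lambda> j X) \<le> d" for X
    using \<Lambda>(2) by (intro degree_sum_le) (auto intro: order_trans)
  ultimately show ?thesis
    using \<Lambda>(1,4) by (intro exI[of _ "\<lambda>X. \<Sum>j\<le>d. \<Lambda> j X"]) (auto intro: polyfun_coeffs_sum simp: poly_sum)
qed

lemma polyfun_monic_division:
  fixes B Hm :: "('i \<Rightarrow> 'a::idom) \<Rightarrow> 'a poly"
  assumes H: "polyfun_coeffs Hm" "\<And>X. degree (Hm X) \<le> d" "\<And>X. coeff (Hm X) d = 1" "d > 0"
    and B: "polyfun_coeffs B" "\<And>X. degree (B X) \<le> n"
  shows "\<exists>Q T. polyfun_coeffs Q \<and> (\<forall>X. B X = Q X * Hm X + T X \<and> degree (T X) < d)"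
  using B
proof (induction n arbitrary: B rule: less_induct)
  case (less n)
  show ?case
  proof (cases "n < d")
    case True
    then show ?thesis using less.prems
      by (intro exI[of _ "\<lambda>_. 0"] exI[of _ B]) (auto simp: polyfun_coeffs_const intro: le_less_trans)
  next
    case False
    define M where "M X = monom (coeff (B X) n) (n - d)" for X
    have M: "polyfun_coeffs M"
      unfolding M_def using less.prems(1) by (intro polyfun_coeffs_monom) (simp add: polyfun_coeffs_def)
    define B' where "B' X = B X - M X * Hm X" for X
    have MX: "degree (M X) \<le> n - d" for X unfolding M_def by (rule degree_monom_le)
    have "degree (B' X) \<le> n" for X
    proof -
      have "degree (M X * Hm X) \<le> (n - d) + d"
        using degree_mult_le[of "M X" "Hm X"] MX[of X] H(2)[of X] by linarith
      then show ?thesis unfolding B'_def using False less.prems(2) by (intro degree_diff_le) auto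
    qed
    moreover have "coeff (B' X) n = 0" for X
    proof -
      have "coeff (M X * Hm X) (n - d + d) = coeff (M X) (n - d) * coeff (Hm X) d"
        by (rule coeff_mult_top[OF MX H(2)])
      then show ?thesis using False H(3) by (simp add: B'_def M_def)
    qed
    ultimately have deg: "degree (B' X) \<le> n - 1" for X
    proof (intro degree_le allI impI)
      fix i assume "n - 1 < i"
      then have "i = n \<or> n < i" by linarith
      then show "coeff (B' X) i = 0"
        using \<open>degree (B' X) \<le> n\<close> \<open>coeff (B' X) n = 0\<close> by (auto intro: coeff_eq_0)
    qed
    have "polyfun_coeffs B'" unfolding B'_def using less.prems H M
      by (intro polyfun_coeffs_diff polyfun_coeffs_mult)
    from less.IH[OF _ this deg] obtain Q T where
      QT: "polyfun_coeffs Q" "\<forall>X. B' X = Q X * Hm X + T X \<and> degree (T X) < d"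
      using False H(4) by auto
    have "B X = (Q X + M X) * Hm X + T X \<and> degree (T X) < d" for X
      using QT(2)[rule_format, of X] by (simp add: B'_def algebra_simps)
    then show ?thesis using polyfun_coeffs_add[OF QT(1) M] by blast
  qed
qed

text \<open>Roots are split off one at a time; no multiplicity exceeds
  \<open>degree p\<close>.\<close>

lemma alg_closed_dvd_power:
  fixes p q :: "'a::alg_closed_field poly"
  assumes "p \<noteq> 0" "\<And>t. poly p t = 0 \<Longrightarrow> poly q t = 0"
  shows "p dvd q ^ degree p"
  using assms
proof (induction "degree p" arbitrary: p)
  case 0
  then show ?case by (metis is_unit_iff_degree power_0)
next
  case (Suc n)
  then obtain a where a: "poly p a = 0" using alg_closed_imp_poly_has_root[of p] by auto
  then obtain p' where p': "p = [:-a, 1:] * p'" by (metis poly_eq_0_iff_dvd dvdE)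
  have "poly q a = 0" using Suc.prems a by blast
  then have q: "[:-a, 1:] dvd q" by (simp add: poly_eq_0_iff_dvd)
  have "p' \<noteq> 0" using p' Suc.prems by auto
  then have deg: "degree p = Suc (degree p')" unfolding p' by (subst degree_mult_eq) auto
  then have "p' dvd q ^ degree p'"
    using Suc.hyps Suc.prems(2) p' \<open>p' \<noteq> 0\<close> by (intro Suc.hyps(1)) auto
  with q have "[:-a, 1:] * p' dvd q * q ^ degree p'" by (rule mult_dvd_mono)
  then show ?case by (simp only: deg power_Suc p'[symmetric])
qed

text \<open>Choose \<open>v\<close> at which the leading form of \<open>h\<close> does not vanish.
  Along \<open>X + t * v\<close> the function \<open>h\<close> is then a polynomial in
  \<open>t\<close> with constant leading coefficient, and \<open>g ^ d\<close> can be divided by it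
  with quotient polynomial in \<open>X\<close>. For each fixed \<open>X\<close> the one-variable
  statement kills the remainder, and \<open>t = 0\<close> gives the identity.\<close>

theorem hypersurface_nullstellensatz:
  fixes h g :: "('i \<Rightarrow> 'a::alg_closed_field) \<Rightarrow> 'a"
  assumes h: "h \<in> polyfun UNIV" and g: "g \<in> polyfun UNIV" and V: "\<And>X. h X = 0 \<Longrightarrow> g X = 0"
  shows "\<exists>a\<in>polyfun UNIV. \<exists>n. \<forall>X. h X * a X = g X ^ n"
proof (cases "\<forall>X. h X = 0")
  case True
  then show ?thesis using V by (intro bexI[of _ "\<lambda>_. 0"] exI[of _ 1]) (auto intro: polyfun_const)
next
  case False
  obtain d0 F where F: "\<forall>j. homogeneous j (F j)" "\<forall>j>d0. F j = (\<lambda>_. 0)" "\<forall>s. h s = (\<Sum>j\<le>d0. F j s)"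
    using homogeneous_decomposition[OF h] by blast
  have ex: "\<exists>j. F j \<noteq> (\<lambda>_. 0)" using False F(3) by (metis (no_types, lifting) sum.neutral)
  have bound: "\<forall>j. F j \<noteq> (\<lambda>_. 0) \<longrightarrow> j \<le> d0" using F(2) not_less by blast
  define d where "d = (GREATEST j. F j \<noteq> (\<lambda>_. 0))"
  have d: "F d \<noteq> (\<lambda>_. 0)" "\<And>j. F j \<noteq> (\<lambda>_. 0) \<Longrightarrow> j \<le> d"
    unfolding d_def using GreatestI_ex_nat[OF ex, of d0] Greatest_le_nat[of "\<lambda>j. F j \<noteq> (\<lambda>_. 0)" _ d0] bound
    by blast+
  then obtain v where v: "F d v \<noteq> 0" by blast
  have hF: "h s = (\<Sum>j\<le>d. F j s)" for s
  proof -
    have "F j = (\<lambda>_. 0)" if "j > d" for j using d(2)[of j] that by force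
    moreover have "d \<le> d0" using bound d by blast
    ultimately show ?thesis unfolding F(3)[rule_format] by (intro sum.mono_neutral_right) auto
  qed
  obtain \<Lambda> where \<Lambda>: "polyfun_coeffs \<Lambda>" "\<And>X. degree (\<Lambda> X) \<le> d" "\<And>X. coeff (\<Lambda> X) d = F d v"
    "\<And>X t. poly (\<Lambda> X) t = h (\<lambda>i. X i + t * v i)"
    using polyfun_line[OF F(1), where d = d] unfolding hF by blast
  show ?thesis
  proof (cases "d = 0")
    case True
    then have "\<Lambda> X = [:F 0 v:]" for X using \<Lambda>(2,3) by (metis degree_0_id le_zero_eq)
    then have "h X = F 0 v" for X using \<Lambda>(4)[of X 0] by simp
    then show ?thesis using v True
      by (intro bexI[of _ "\<lambda>_. 1 / F 0 v"] exI[of _ 0]) (auto intro: polyfun_const)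
  next
    case False
    define Hm where "Hm X = smult (1 / F d v) (\<Lambda> X)" for X
    have Hm: "polyfun_coeffs Hm" "degree (Hm X) \<le> d" "coeff (Hm X) d = 1"
      "poly (Hm X) t = h (\<lambda>i. X i + t * v i) / F d v" for X t
    proof -
      have "(\<lambda>X. 1 / F d v * coeff (\<Lambda> X) i) \<in> polyfun UNIV" for i
        using \<Lambda>(1) unfolding polyfun_coeffs_def by (intro polyfun_mult polyfun_const) blast+
      then show "polyfun_coeffs Hm" by (simp add: Hm_def polyfun_coeffs_def)
    qed (use \<Lambda> v in \<open>auto simp: Hm_def\<close>)
    have degH: "degree (Hm X) = d" for X
      using Hm(2,3)[of X] by (metis le_antisym le_degree zero_neq_one)
    obtain eg E where E: "\<forall>j. homogeneous j (E j)" "\<forall>s. g s = (\<Sum>j\<le>eg. E j s)"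
      using homogeneous_decomposition[OF g] by blast
    obtain M where M: "polyfun_coeffs M" "\<And>X. degree (M X) \<le> eg"
      "\<And>X t. poly (M X) t = g (\<lambda>i. X i + t * v i)"
      using polyfun_line[OF E(1), where d = eg and v = v] E(2) by metis
    have "degree (M X ^ d) \<le> eg * d" for X
      using degree_power_le[of "M X" d] M(2)[of X] by (meson mult_le_mono1 order_trans)
    then obtain Q T where Q: "polyfun_coeffs Q" "\<And>X. M X ^ d = Q X * Hm X + T X" "\<And>X. degree (T X) < d"
      using polyfun_monic_division[OF Hm(1-3) _ polyfun_coeffs_power[OF M(1), of d]] False by blast
    have T: "T X = 0" for X
    proof -
      have "Hm X \<noteq> 0" using degH[of X] False by auto
      then have "Hm X dvd M X ^ d"
        using alg_closed_dvd_power[of "Hm X" "M X"] V v by (simp add: Hm(4) M(3) degH)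
      then have "Hm X dvd T X" unfolding Q(2) by (simp add: dvd_add_right_iff)
      then show ?thesis using Q(3)[of X] degH[of X] dvd_imp_degree_le[of "Hm X" "T X"] by force
    qed
    have "h X * (coeff (Q X) 0 / F d v) = g X ^ d" for X
    proof -
      have "poly (M X ^ d) 0 = poly (Q X * Hm X) 0" by (simp add: Q(2) T)
      then have "g X ^ d = poly (Q X) 0 * (h X / F d v)" by (simp only: poly_power poly_mult M(3) Hm(4)) simp
      then show ?thesis by (simp add: poly_0_coeff_0)
    qed
    moreover have "(\<lambda>X. coeff (Q X) 0 * (1 / F d v)) \<in> polyfun UNIV"
      using Q(1) by (intro polyfun_mult polyfun_const) (auto simp: polyfun_coeffs_def)
    ultimately show ?thesis by (intro bexI[of _ "\<lambda>X. coeff (Q X) 0 * (1 / F d v)"] exI[of _ d]) auto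
  qed
qed

section \<open>Linear endomorphisms on their stable image\<close>

text \<open>The value of \<open>q\<close> at the matrix \<open>L\<close>, by Horner's rule.\<close>

definition matpoly :: "'k::field mat \<Rightarrow> 'k poly \<Rightarrow> 'k mat" where
  "matpoly L q = fold_coeffs (\<lambda>c M. c \<cdot>\<^sub>m 1\<^sub>m (dim_row L) + L * M) q (0\<^sub>m (dim_row L) (dim_row L))"

context
  fixes L :: "'k::field mat" and m :: nat
  assumes L: "L \<in> carrier_mat m m"
begin

lemma matpoly_0: "matpoly L 0 = 0\<^sub>m m m"
  using L by (simp add: matpoly_def)

lemma matpoly_pCons: "matpoly L (pCons c q) = c \<cdot>\<^sub>m 1\<^sub>m m + L * matpoly L q"
proof (cases "c = 0 \<and> q = 0")
  case True
  then show ?thesis using L by (auto simp: matpoly_0 intro!: eq_matI)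
next
  case False
  then show ?thesis using L by (auto simp: matpoly_def fold_coeffs_def cCons_def)
qed

lemma matpoly_carrier: "matpoly L q \<in> carrier_mat m m"
  using L by (induction q) (auto simp: matpoly_0 matpoly_pCons)

lemma matpoly_add: "matpoly L (p + q) = matpoly L p + matpoly L q"
proof (induction p arbitrary: q)
  case 0
  then show ?case using matpoly_carrier by (simp add: matpoly_0)
next
  case (pCons a p)
  obtain b q' where q: "q = pCons b q'" by (rule pCons_cases)
  note c = matpoly_carrier[of p] matpoly_carrier[of q'] mult_carrier_mat[OF L matpoly_carrier]
  have "matpoly L (pCons a p + q) = (a + b) \<cdot>\<^sub>m 1\<^sub>m m + L * (matpoly L p + matpoly L q')"
    by (simp add: q matpoly_pCons pCons.IH)
  also have "\<dots> = (a \<cdot>\<^sub>m 1\<^sub>m m + L * matpoly L p) + (b \<cdot>\<^sub>m 1\<^sub>m m + L * matpoly L q')"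
    unfolding mult_add_distrib_mat[OF L c(1,2)]
    by (rule eq_matI) (use c L in \<open>auto simp: algebra_simps\<close>)
  finally show ?case by (simp add: q matpoly_pCons)
qed

lemma matpoly_smult: "matpoly L (smult c q) = c \<cdot>\<^sub>m matpoly L q"
proof (induction q)
  case (pCons a q)
  have "L * (c \<cdot>\<^sub>m matpoly L q) = c \<cdot>\<^sub>m (L * matpoly L q)"
    using L matpoly_carrier by (intro mult_smult_distrib)
  then show ?case using mult_carrier_mat[OF L matpoly_carrier, of q] L matpoly_carrier[of q]
    by (auto simp: matpoly_pCons pCons.IH algebra_simps intro!: eq_matI)
qed (simp add: matpoly_0)

lemma matpoly_mult: "matpoly L (p * q) = matpoly L p * matpoly L q"
proof (induction p)
  case 0
  then show ?case using matpoly_carrier[of q] by (auto simp: matpoly_0 intro!: eq_matI)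
next
  case (pCons a p)
  have "matpoly L (pCons a p * q) = a \<cdot>\<^sub>m matpoly L q + (0 \<cdot>\<^sub>m 1\<^sub>m m + L * (matpoly L p * matpoly L q))"
    by (simp add: matpoly_add matpoly_smult matpoly_pCons pCons.IH)
  also have "0 \<cdot>\<^sub>m 1\<^sub>m m + L * (matpoly L p * matpoly L q) = L * matpoly L p * matpoly L q"
    using mult_carrier_mat[OF mult_carrier_mat[OF L matpoly_carrier] matpoly_carrier, of p q]
      L matpoly_carrier[of q]
    by (subst assoc_mult_mat[OF L matpoly_carrier matpoly_carrier, symmetric]) (auto intro!: eq_matI)
  also have "a \<cdot>\<^sub>m matpoly L q + L * matpoly L p * matpoly L q = (a \<cdot>\<^sub>m 1\<^sub>m m + L * matpoly L p) * matpoly L q"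
  proof -
    have "(a \<cdot>\<^sub>m 1\<^sub>m m) * matpoly L q = a \<cdot>\<^sub>m matpoly L q"
      by (subst mult_smult_assoc_mat[OF one_carrier_mat matpoly_carrier])
        (simp add: left_mult_one_mat[OF matpoly_carrier])
    then show ?thesis
      by (subst add_mult_distrib_mat[OF smult_carrier_mat[OF one_carrier_mat]
            mult_carrier_mat[OF L matpoly_carrier] matpoly_carrier]) simp
  qed
  finally show ?case by (simp add: matpoly_pCons)
qed

lemma matpoly_1: "matpoly L 1 = 1\<^sub>m m"
  using L by (auto simp: one_pCons matpoly_pCons matpoly_0 intro!: eq_matI)

lemma matpoly_X_power: "x \<in> carrier_vec m \<Longrightarrow> matpoly L ([:0, 1:] ^ n) *\<^sub>v x = ((*\<^sub>v) L ^^ n) x"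
proof (induction n)
  case (Suc n)
  have X: "matpoly L [:0, 1:] = L"
    using L by (auto simp: matpoly_pCons matpoly_0 intro!: eq_matI)
  have "matpoly L ([:0, 1:] * [:0, 1:] ^ n) *\<^sub>v x = L *\<^sub>v (matpoly L ([:0, 1:] ^ n) *\<^sub>v x)"
    unfolding matpoly_mult X by (rule assoc_mult_mat_vec[OF L matpoly_carrier Suc.prems])
  then show ?case using Suc by (simp only: power_Suc funpow.simps comp_apply)
qed (simp add: matpoly_1)

text \<open>The first \<open>m * m + 1\<close> powers of \<open>L\<close> are linearly dependent in
  the space of matrices of size \<open>m\<close>; the degree of the relation does not
  matter.\<close>

lemma matpoly_annihilator: "\<exists>q. q \<noteq> 0 \<and> matpoly L q = 0\<^sub>m m m"
proof -
  define K where "K = m * m"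
  define P where "P j = matpoly L ([:0, 1:] ^ j)" for j
  \<comment> \<open>The entries of the powers form \<open>K\<close> rows and \<open>K + 1\<close>
    columns. A zero row makes the matrix square and singular, and a kernel vector is a linear
    relation.\<close>
  define A where "A = mat (Suc K) (Suc K) (\<lambda>(i, j). if i = K then 0 else P j $$ (i div m, i mod m))"
  have A: "A \<in> carrier_mat (Suc K) (Suc K)" by (simp add: A_def)
  have "det A = (\<Sum>j<Suc K. A $$ (K, j) * cofactor A K j)"
    by (rule laplace_expansion_row[OF A]) simp
  also have "\<dots> = 0" by (simp add: A_def)
  finally obtain v where v: "v \<in> carrier_vec (Suc K)" "v \<noteq> 0\<^sub>v (Suc K)" "A *\<^sub>v v = 0\<^sub>v (Suc K)"
    using det_0_iff_vec_prod_zero_field[OF A] by blast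
  define q where "q n = (\<Sum>j<n. smult (v $ j) ([:0, 1:] ^ j))" for n
  have Pc: "P j \<in> carrier_mat m m" for j by (simp add: P_def matpoly_carrier)
  have ent: "matpoly L (q n) $$ (a, b) = (\<Sum>j<n. v $ j * P j $$ (a, b))" if "a < m" "b < m" for a b n
  proof (induction n)
    case 0
    then show ?case using that by (simp add: q_def matpoly_0)
  next
    case (Suc n)
    have "q (Suc n) = q n + smult (v $ n) ([:0, 1:] ^ n)" by (simp add: q_def)
    then have "matpoly L (q (Suc n)) = matpoly L (q n) + v $ n \<cdot>\<^sub>m P n"
      by (simp add: matpoly_add matpoly_smult P_def)
    then show ?case using Suc that Pc[of n] matpoly_carrier[of "q n"] by simp
  qed
  have "matpoly L (q (Suc K)) = 0\<^sub>m m m"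
  proof (rule eq_matI)
    fix a b assume "a < dim_row (0\<^sub>m m m :: 'k mat)" "b < dim_col (0\<^sub>m m m :: 'k mat)"
    then have ab: "a < m" "b < m" by auto
    define i where "i = a * m + b"
    have i: "i div m = a" "i mod m = b" "i < K"
    proof -
      show "i div m = a" "i mod m = b" using ab by (auto simp: i_def)
      have "i < (a + 1) * m" using ab by (simp add: i_def)
      also have "\<dots> \<le> m * m" using ab by (intro mult_le_mono1) simp
      finally show "i < K" by (simp add: K_def)
    qed
    have "(A *\<^sub>v v) $ i = (\<Sum>j<Suc K. A $$ (i, j) * v $ j)"
      using i v(1) by (simp add: A_def scalar_prod_def atLeast0LessThan del: sum.lessThan_Suc)
    also have "\<dots> = (\<Sum>j<Suc K. v $ j * P j $$ (a, b))"
      using i by (intro sum.cong) (auto simp: A_def)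
    finally show "matpoly L (q (Suc K)) $$ (a, b) = 0\<^sub>m m m $$ (a, b)"
      using v(3) i ab by (simp add: ent del: sum.lessThan_Suc)
  qed (use matpoly_carrier in auto)
  moreover have "q (Suc K) \<noteq> 0"
  proof
    assume q0: "q (Suc K) = 0"
    have "coeff (q (Suc K)) i = v $ i" if "i < Suc K" for i
    proof -
      have X: "[:0, 1:] ^ j = monom (1::'k) j" for j by (simp add: monom_altdef)
      have "coeff (q (Suc K)) i = (\<Sum>j<Suc K. if j = i then v $ j else 0)"
        by (simp add: q_def coeff_sum X if_distrib[of "\<lambda>x. _ * x"] cong: if_cong del: sum.lessThan_Suc)
      then show ?thesis using that by simp
    qed
    then have "v $ i = 0" if "i < Suc K" for i using q0 that by simp
    then show False using v by (auto intro!: eq_vecI)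
  qed
  ultimately show ?thesis by blast
qed

text \<open>With \<open>X\<^sup>a q\<close> an annihilating polynomial of \<open>L\<close> and \<open>q(0) \<noteq> 0\<close>, the endomorphism \<open>L + q(L)\<close> agrees with \<open>L\<close> on
  the image of \<open>L\<^sup>a\<close>, and it is injective because \<open>X + q\<close> is coprime to \<open>X\<^bsup>a+1\<^esup>\<close>.\<close>

lemma invertible_on_stable_image:
  "\<exists>a. \<exists>B\<in>carrier_mat m m. \<exists>B'\<in>carrier_mat m m. B * B' = 1\<^sub>m m \<and> B' * B = 1\<^sub>m m \<and>
    (\<forall>n\<ge>a. \<forall>x\<in>carrier_vec m. B *\<^sub>v ((*\<^sub>v) L ^^ n) x = L *\<^sub>v ((*\<^sub>v) L ^^ n) x)"
proof -
  obtain f where f: "f \<noteq> 0" "matpoly L f = 0\<^sub>m m m" using matpoly_annihilator by blast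
  define X :: "'k poly" where "X = [:0, 1:]"
  define a where "a = order 0 f"
  obtain q where q: "f = X ^ a * q" "\<not> X dvd q"
    using order_decomp[OF f(1), of 0] by (auto simp: X_def a_def)
  define r where "r = X + q"
  define c where "c = coeff q 0"
  have c: "c \<noteq> 0" using q(2) by (simp add: X_def c_def poly_0_coeff_0 flip: poly_eq_0_iff_dvd[of q 0, simplified])
  obtain s where s: "r = smult c (1 - X * s)"
  proof -
    have "coeff r 0 = c" by (simp add: r_def X_def c_def)
    then obtain h where h: "r = pCons c h" by (metis coeff_pCons_0 pCons_cases)
    have "r = smult c (1 - X * smult (- (1 / c)) h)"
      using c by (simp add: h X_def one_pCons)
    then show ?thesis by (rule that)
  qed
  \<comment> \<open>Since \<open>r\<close> is \<open>c\<close> times \<open>1 - X * s\<close>, the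
    truncated geometric series in \<open>X * s\<close> inverts \<open>r\<close> modulo
    \<open>X ^ Suc a\<close>.\<close>
  define u where "u = smult (1 / c) (\<Sum>i<Suc a. (X * s) ^ i)"
  have bez: "u * r + s ^ Suc a * X ^ Suc a = 1"
  proof -
    have "u * r = (1 - X * s) * (\<Sum>i<Suc a. (X * s) ^ i)" using c by (simp add: u_def s mult.commute)
    also have "\<dots> = 1 - (X * s) ^ Suc a" by (rule one_diff_power_eq[symmetric])
    finally show ?thesis by (simp add: power_mult_distrib mult_ac)
  qed
  define B where "B = matpoly L r"
  have B: "B \<in> carrier_mat m m" by (simp add: B_def matpoly_carrier)
  have act_mult: "matpoly L (p * q) *\<^sub>v x = matpoly L p *\<^sub>v (matpoly L q *\<^sub>v x)" if "x \<in> carrier_vec m" for p q x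
    unfolding matpoly_mult by (rule assoc_mult_mat_vec[OF matpoly_carrier matpoly_carrier that])
  have act_add: "matpoly L (p + q) *\<^sub>v x = matpoly L p *\<^sub>v x + matpoly L q *\<^sub>v x" if "x \<in> carrier_vec m" for p q x
    unfolding matpoly_add by (rule add_mult_distrib_mat_vec[OF matpoly_carrier matpoly_carrier that])
  have act_c: "matpoly L p *\<^sub>v x \<in> carrier_vec m" if "x \<in> carrier_vec m" for p x
    by (rule mult_mat_vec_carrier[OF matpoly_carrier that])
  have zero: "M *\<^sub>v 0\<^sub>v m = 0\<^sub>v m" if "M \<in> carrier_mat m m" for M :: "'k mat"
    using that by (auto intro!: eq_vecI)
  have zero': "(0\<^sub>m m m :: 'k mat) *\<^sub>v x = 0\<^sub>v m" if "x \<in> carrier_vec m" for x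
    using that by (auto intro!: eq_vecI)
  have "x = 0\<^sub>v m" if x: "x \<in> carrier_vec m" and Bx: "B *\<^sub>v x = 0\<^sub>v m" for x
  proof -
    \<comment> \<open>As \<open>f\<close> annihilates \<open>L\<close>, a vector killed by
      \<open>B\<close> is killed by the power \<open>a + 1\<close> of \<open>L\<close>; the Bezout
      identity \<open>bez\<close> then makes it 0.\<close>
    have "X ^ Suc a = X ^ a * r - f" by (simp add: r_def q algebra_simps)
    then have "X ^ Suc a + f = X ^ a * r" by simp
    then have "matpoly L (X ^ Suc a) *\<^sub>v x + matpoly L f *\<^sub>v x = matpoly L (X ^ a) *\<^sub>v (B *\<^sub>v x)"
      unfolding B_def by (metis act_add[OF x] act_mult[OF x])
    then have "matpoly L (X ^ Suc a) *\<^sub>v x = 0\<^sub>v m"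
      using x by (simp add: Bx zero f(2) zero' matpoly_carrier act_c del: power_Suc)
    moreover have "x = matpoly L (u * r + s ^ Suc a * X ^ Suc a) *\<^sub>v x"
      using x by (simp add: bez matpoly_1 del: power_Suc)
    ultimately show ?thesis
      using x Bx by (simp add: act_add act_mult zero matpoly_carrier B_def del: power_Suc)
  qed
  then have d: "det B \<noteq> 0" using det_0_iff_vec_prod_zero_field[OF B] by blast
  define B' where "B' = (1 / det B) \<cdot>\<^sub>m adj_mat B"
  have adj: "adj_mat B \<in> carrier_mat m m" "B * adj_mat B = det B \<cdot>\<^sub>m 1\<^sub>m m" "adj_mat B * B = det B \<cdot>\<^sub>m 1\<^sub>m m"
    using adj_mat[OF B] by auto
  have "B' \<in> carrier_mat m m" using adj by (simp add: B'_def)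
  moreover have "B * B' = 1\<^sub>m m"
    using d adj B by (auto simp: B'_def mult_smult_distrib[OF B adj(1)] intro!: eq_matI)
  moreover have "B' * B = 1\<^sub>m m"
    using d adj B by (auto simp: B'_def mult_smult_assoc_mat[OF adj(1) B] intro!: eq_matI)
  moreover have "B *\<^sub>v ((*\<^sub>v) L ^^ n) x = L *\<^sub>v ((*\<^sub>v) L ^^ n) x" if n: "a \<le> n" and x: "x \<in> carrier_vec m" for n x
  proof -
    have "r * X ^ n = X ^ Suc n + X ^ (n - a) * f"
    proof -
      have "X ^ n = X ^ (n - a) * X ^ a" using n by (simp flip: power_add)
      then show ?thesis by (simp add: r_def q algebra_simps)
    qed
    then have "matpoly L r *\<^sub>v (matpoly L (X ^ n) *\<^sub>v x) = matpoly L (X ^ Suc n) *\<^sub>v x + matpoly L (X ^ (n - a)) *\<^sub>v (matpoly L f *\<^sub>v x)"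
      by (metis act_add[OF x] act_mult[OF x])
    then have "B *\<^sub>v (matpoly L (X ^ n) *\<^sub>v x) = matpoly L (X ^ Suc n) *\<^sub>v x"
      using x by (simp add: B_def f(2) zero zero' matpoly_carrier act_c del: power_Suc)
    then show ?thesis unfolding X_def matpoly_X_power[OF x] by simp
  qed
  ultimately show ?thesis using B by blast
qed

end

section \<open>Evaluation and derivatives of polynomials\<close>

definition monomial_at :: "(nat \<Rightarrow> 'k::comm_ring_1) \<Rightarrow> (nat \<Rightarrow>\<^sub>0 nat) \<Rightarrow> 'k" where
  "monomial_at s a = (\<Prod>i\<in>Poly_Mapping.keys a. s i ^ Poly_Mapping.lookup a i)"

lemma monomial_at_extend:
  assumes "finite I" "Poly_Mapping.keys a \<subseteq> I"
  shows "monomial_at s a = (\<Prod>i\<in>I. s i ^ Poly_Mapping.lookup a i)"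
  unfolding monomial_at_def using assms by (intro prod.mono_neutral_left) (auto simp: in_keys_iff)

lemma monomial_at_add: "monomial_at s (a + b) = monomial_at s a * monomial_at s b"
proof -
  let ?I = "Poly_Mapping.keys a \<union> Poly_Mapping.keys b"
  have "monomial_at s (a + b) = (\<Prod>i\<in>?I. s i ^ Poly_Mapping.lookup (a + b) i)"
    by (rule monomial_at_extend) (auto simp: Poly_Mapping.keys_add)
  also have "\<dots> = (\<Prod>i\<in>?I. s i ^ Poly_Mapping.lookup a i) * (\<Prod>i\<in>?I. s i ^ Poly_Mapping.lookup b i)"
    by (simp add: lookup_add power_add prod.distrib)
  also have "\<dots> = monomial_at s a * monomial_at s b"
    by (simp add: monomial_at_extend[of ?I])
  finally show ?thesis .
qed

lemma monomial_at_0: "monomial_at s 0 = 1"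
  by (simp add: monomial_at_def)

lemma monomial_at_single: "monomial_at s (Poly_Mapping.single i n) = s i ^ n"
  using monomial_at_extend[of "{i}" "Poly_Mapping.single i n" s] by simp

lemma monomial_at_cong: "(\<And>i. i \<in> Poly_Mapping.keys a \<Longrightarrow> s i = t i) \<Longrightarrow> monomial_at s a = monomial_at t a"
  by (simp add: monomial_at_def)

lemma mpoly_eval_monomials: "mpoly_eval x p = (\<Sum>a\<in>Poly_Mapping.keys p. Poly_Mapping.lookup p a * monomial_at (($) x) a)"
  by (simp add: mpoly_eval_def monomial_at_def)

lemma mpoly_eval_extend:
  assumes "finite S" "Poly_Mapping.keys p \<subseteq> S"
  shows "mpoly_eval x p = (\<Sum>a\<in>S. Poly_Mapping.lookup p a * monomial_at (($) x) a)"
  unfolding mpoly_eval_monomials using assms by (intro sum.mono_neutral_left) (auto simp: in_keys_iff)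

lemma mpoly_eval_0: "mpoly_eval x 0 = 0"
  by (simp add: mpoly_eval_monomials)

lemma mpoly_eval_single: "mpoly_eval x (Poly_Mapping.single a c) = c * monomial_at (($) x) a"
  by (subst mpoly_eval_extend[of "{a}"]) auto

lemma mpoly_eval_1: "mpoly_eval x 1 = 1"
  using mpoly_eval_single[of x 0 1] by (simp add: monomial_at_0)

lemma mpoly_eval_add: "mpoly_eval x (p + q) = mpoly_eval x p + mpoly_eval x q"
proof -
  let ?S = "Poly_Mapping.keys p \<union> Poly_Mapping.keys q"
  have "mpoly_eval x (p + q) = (\<Sum>a\<in>?S. Poly_Mapping.lookup (p + q) a * monomial_at (($) x) a)"
    by (rule mpoly_eval_extend) (auto simp: Poly_Mapping.keys_add)
  also have "\<dots> = mpoly_eval x p + mpoly_eval x q"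
    by (simp add: mpoly_eval_extend[of ?S] lookup_add distrib_right sum.distrib)
  finally show ?thesis .
qed

lemma mpoly_eval_sum: "mpoly_eval x (sum f I) = (\<Sum>i\<in>I. mpoly_eval x (f i))"
  by (induction I rule: infinite_finite_induct) (auto simp: mpoly_eval_0 mpoly_eval_add)

lemma mpoly_as_sum: "p = (\<Sum>a\<in>Poly_Mapping.keys p. Poly_Mapping.single a (Poly_Mapping.lookup p a))"
proof (rule poly_mapping_eqI)
  fix b
  have "(\<Sum>a\<in>Poly_Mapping.keys p. Poly_Mapping.lookup (Poly_Mapping.single a (Poly_Mapping.lookup p a)) b)
      = (\<Sum>a\<in>Poly_Mapping.keys p. if a = b then Poly_Mapping.lookup p a else 0)"
    by (intro sum.cong) (auto simp: lookup_single when_def)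
  also have "\<dots> = Poly_Mapping.lookup p b" by (simp add: in_keys_iff)
  finally show "Poly_Mapping.lookup p b = Poly_Mapping.lookup (\<Sum>a\<in>Poly_Mapping.keys p. Poly_Mapping.single a (Poly_Mapping.lookup p a)) b"
    by (simp add: lookup_sum)
qed

lemma mpoly_eval_mult: "mpoly_eval x (p * q) = mpoly_eval x p * mpoly_eval x q"
proof -
  have "p * q = (\<Sum>a\<in>Poly_Mapping.keys p. \<Sum>b\<in>Poly_Mapping.keys q.
      Poly_Mapping.single (a + b) (Poly_Mapping.lookup p a * Poly_Mapping.lookup q b))"
    by (subst mpoly_as_sum[of p], subst mpoly_as_sum[of q]) (simp add: sum_product mult_single)
  then show ?thesis
    by (simp add: mpoly_eval_sum mpoly_eval_single monomial_at_add mpoly_eval_monomials[of x p]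
        mpoly_eval_monomials[of x q] sum_product mult_ac)
qed

lemma mpoly_eval_hom: "comm_ring_hom (mpoly_eval x)"
  by unfold_locales (auto simp: mpoly_eval_0 mpoly_eval_1 mpoly_eval_add mpoly_eval_mult)

lemma mpoly_eval_mvar: "mpoly_eval x (mvar i) = x $ i"
  by (simp add: mvar_def mpoly_eval_single monomial_at_single)

lemma polys_keys: "p \<in> polys n \<Longrightarrow> a \<in> Poly_Mapping.keys p \<Longrightarrow> i \<in> Poly_Mapping.keys a \<Longrightarrow> i < n"
  by (auto simp: polys_def)

lemma polys_mono: "m \<le> n \<Longrightarrow> p \<in> polys m \<Longrightarrow> p \<in> polys n"
  by (force simp: polys_def)

lemma polys_add: "p \<in> polys n \<Longrightarrow> q \<in> polys n \<Longrightarrow> p + q \<in> polys n"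
  using Poly_Mapping.keys_add[of p q] by (auto simp: polys_def)

lemma polys_0: "0 \<in> polys n"
  by (simp add: polys_def)

lemma polys_sum: "(\<And>i. i \<in> I \<Longrightarrow> f i \<in> polys n) \<Longrightarrow> sum f I \<in> polys n"
  by (induction I rule: infinite_finite_induct) (auto intro: polys_add polys_0)

lemma polys_mult:
  assumes "p \<in> polys n" "q \<in> polys n" shows "p * q \<in> polys n"
  unfolding polys_def
proof (intro CollectI ballI)
  fix c assume "c \<in> Poly_Mapping.keys (p * q)"
  then obtain a b where "c = a + b" "a \<in> Poly_Mapping.keys p" "b \<in> Poly_Mapping.keys q"
    using keys_mult[of p q] by auto
  then show "Poly_Mapping.keys c \<subseteq> {..<n}"
    using assms Poly_Mapping.keys_add[of a b] unfolding polys_def by blast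
qed

lemma polys_mvar: "i < n \<Longrightarrow> mvar i \<in> polys n"
  by (auto simp: polys_def mvar_def split: if_splits)

lemma mpoly_eval_cong:
  assumes "p \<in> polys n" "\<And>i. i < n \<Longrightarrow> x $ i = y $ i"
  shows "mpoly_eval x p = mpoly_eval y p"
  unfolding mpoly_eval_monomials
  using assms polys_keys[OF assms(1)] by (intro sum.cong arg_cong2[of _ _ _ _ "(*)"] monomial_at_cong) auto

lemma monomial_at_polyfun:
  assumes R: "is_subring R" and Z: "\<And>i. i \<in> Poly_Mapping.keys a \<Longrightarrow> (\<lambda>s. Z s i) \<in> polyfun R"
  shows "(\<lambda>s. monomial_at (Z s) a) \<in> polyfun R"
  unfolding monomial_at_def using Z by (intro polyfun_intros[OF R])

lemma mpoly_eval_polyfun: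
  assumes R: "is_subring R" and p: "p \<in> polys n" "\<And>a. Poly_Mapping.lookup p a \<in> R"
    and Z: "\<And>i. i < n \<Longrightarrow> (\<lambda>s. Z s $ i) \<in> polyfun R"
  shows "(\<lambda>s. mpoly_eval (Z s) p) \<in> polyfun R"
  unfolding mpoly_eval_monomials
  using Z polys_keys[OF p(1)] p(2)
  by (intro polyfun_sum[OF R] polyfun_mult polyfun_const monomial_at_polyfun[OF R]) auto

definition z_degree :: "nat \<Rightarrow> nat \<Rightarrow> (nat \<Rightarrow>\<^sub>0 nat) \<Rightarrow> nat" where
  "z_degree m r a = (\<Sum>j<r. Poly_Mapping.lookup a (m + j))"

lemma monomial_at_scale:
  assumes a: "Poly_Mapping.keys a \<subseteq> {..<m + r}"
    and s: "\<And>i. i < m \<Longrightarrow> t i = s i" "\<And>j. j < r \<Longrightarrow> t (m + j) = c * s (m + j)"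
  shows "monomial_at t a = c ^ z_degree m r a * monomial_at s a"
proof -
  have split: "(\<Prod>i\<in>{..<m + r}. f i) = (\<Prod>i<m. f i) * (\<Prod>j<r. f (m + j))" for f :: "nat \<Rightarrow> 'a"
  proof -
    have "(\<Prod>i\<in>{0..<m + r}. f i) = (\<Prod>i\<in>{0..<m}. f i) * (\<Prod>i\<in>{m..<m + r}. f i)"
      by (rule prod.atLeastLessThan_concat[symmetric]) auto
    also have "(\<Prod>i\<in>{m..<m + r}. f i) = (\<Prod>j\<in>{0..<r}. f (m + j))"
      using prod.shift_bounds_nat_ivl[of f 0 m r] by (simp add: add.commute)
    finally show ?thesis by (simp add: atLeast0LessThan)
  qed
  have "monomial_at t a = (\<Prod>i<m. t i ^ Poly_Mapping.lookup a i) * (\<Prod>j<r. t (m + j) ^ Poly_Mapping.lookup a (m + j))"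
    by (subst monomial_at_extend[OF _ a]) (auto simp: split)
  also have "(\<Prod>i<m. t i ^ Poly_Mapping.lookup a i) = (\<Prod>i<m. s i ^ Poly_Mapping.lookup a i)" by (simp add: s)
  also have "(\<Prod>j<r. t (m + j) ^ Poly_Mapping.lookup a (m + j))
      = c ^ z_degree m r a * (\<Prod>j<r. s (m + j) ^ Poly_Mapping.lookup a (m + j))"
    by (simp add: s power_mult_distrib prod.distrib z_degree_def power_sum)
  finally have "monomial_at t a = c ^ z_degree m r a * ((\<Prod>i<m. s i ^ Poly_Mapping.lookup a i) * (\<Prod>j<r. s (m + j) ^ Poly_Mapping.lookup a (m + j)))"
    by (simp add: mult_ac)
  also have "(\<Prod>i<m. s i ^ Poly_Mapping.lookup a i) * (\<Prod>j<r. s (m + j) ^ Poly_Mapping.lookup a (m + j)) = monomial_at s a"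
    by (subst monomial_at_extend[OF _ a]) (auto simp: split)
  finally show ?thesis .
qed

lemma monomial_at_diff_single:
  assumes "Poly_Mapping.lookup a i > 0"
  shows "monomial_at s (a - Poly_Mapping.single i 1) * s i = monomial_at s a"
proof -
  have "a = (a - Poly_Mapping.single i 1) + Poly_Mapping.single i 1"
    by (rule poly_mapping_eqI) (use assms in \<open>auto simp: lookup_add lookup_minus lookup_single when_def\<close>)
  then show ?thesis using monomial_at_add[of s "a - Poly_Mapping.single i 1" "Poly_Mapping.single i 1"]
    by (simp add: monomial_at_single)
qed

lemma mpoly_deriv_euler:
  "mpoly_eval x (mpoly_deriv i p) * x $ i =
    (\<Sum>a\<in>Poly_Mapping.keys p. of_nat (Poly_Mapping.lookup a i) * (Poly_Mapping.lookup p a * monomial_at (($) x) a))"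
proof -
  have "of_nat (Poly_Mapping.lookup a i) * c * monomial_at (($) x) (a - Poly_Mapping.single i 1) * x $ i
      = of_nat (Poly_Mapping.lookup a i) * (c * monomial_at (($) x) a)" for a c
  proof (cases "Poly_Mapping.lookup a i = 0")
    case False
    then show ?thesis using monomial_at_diff_single[of a i "($) x"] by (simp add: mult.assoc)
  qed simp
  then show ?thesis
    by (simp add: mpoly_deriv_def mpoly_eval_sum mpoly_eval_single sum_distrib_right)
qed

lemma z_euler:
  "(\<Sum>j<r. mpoly_eval x (mpoly_deriv (m + j) p) * x $ (m + j)) =
    (\<Sum>a\<in>Poly_Mapping.keys p. of_nat (z_degree m r a) * (Poly_Mapping.lookup p a * monomial_at (($) x) a))"
  unfolding mpoly_deriv_euler
  by (subst sum.swap) (simp add: z_degree_def sum_distrib_right)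

text \<open>The polynomial \<open>p\<close>(u, c z) in the scalar \<open>c\<close>. Its derivative
  at \<open>c = 1\<close> is the radial derivative of \<open>z_euler\<close>, so the product rule is
  taken from one-variable polynomials instead of being proved for
  \<open>mpoly_deriv\<close>.\<close>

definition z_line :: "nat \<Rightarrow> nat \<Rightarrow> 'k::comm_ring_1 vec \<Rightarrow> 'k mpoly \<Rightarrow> 'k poly" where
  "z_line m r x p = (\<Sum>a\<in>Poly_Mapping.keys p. monom (Poly_Mapping.lookup p a * monomial_at (($) x) a) (z_degree m r a))"

lemma poly_z_line:
  assumes "p \<in> polys (m + r)"
  shows "poly (z_line m r x p) c = mpoly_eval (vec (m + r) (\<lambda>i. if i < m then x $ i else c * x $ i)) p"
proof -
  have "monomial_at (($) (vec (m + r) (\<lambda>i. if i < m then x $ i else c * x $ i))) a = c ^ z_degree m r a * monomial_at (($) x) a"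
    if "a \<in> Poly_Mapping.keys p" for a
    using assms that by (intro monomial_at_scale) (auto simp: polys_def)
  then show ?thesis
    by (simp add: z_line_def poly_sum poly_monom mpoly_eval_monomials mult_ac)
qed

lemma pderiv_z_line:
  fixes x :: "'k::{comm_ring_1,idom} vec"
  shows "poly (pderiv (z_line m r x p)) 1 =
    (\<Sum>a\<in>Poly_Mapping.keys p. of_nat (z_degree m r a) * (Poly_Mapping.lookup p a * monomial_at (($) x) a))"
proof -
  have "pderiv (sum f I) = (\<Sum>i\<in>I. pderiv (f i))" for f :: "(nat \<Rightarrow>\<^sub>0 nat) \<Rightarrow> 'k poly" and I
    by (induction I rule: infinite_finite_induct) (auto simp: pderiv_add)
  then show ?thesis by (simp add: z_line_def poly_sum pderiv_monom poly_monom)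
qed

text \<open>Each residue class from \<open>n0\<close> on lies in \<open>X\<close> or meets it in a
  finite set. The finitely many remaining elements are progressions with difference 0.\<close>

lemma finite_union_arith_progs:
  fixes X :: "nat set"
  assumes K: "K > 0" and cls: "\<And>a. n0 \<le> a \<Longrightarrow> infinite {k. a + k * K \<in> X} \<Longrightarrow> \<forall>k. a + k * K \<in> X"
  shows "\<exists>\<A>. finite \<A> \<and> (\<forall>A\<in>\<A>. arith_prog A) \<and> X = \<Union>\<A>"
proof -
  define cl where "cl a = range (\<lambda>k. a + k * K)" for a
  define full where "full = {a \<in> {n0..<n0 + K}. cl a \<subseteq> X}"
  define rest where "rest = X - \<Union>(cl ` full)"
  have cover: "\<exists>a\<in>{n0..<n0 + K}. n \<in> cl a" if "n0 \<le> n" for n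
  proof -
    have "n = n0 + (n - n0) mod K + (n - n0) div K * K" using that by simp
    then have "n \<in> cl (n0 + (n - n0) mod K)" unfolding cl_def by (metis rangeI)
    moreover have "n0 + (n - n0) mod K \<in> {n0..<n0 + K}" using K by simp
    ultimately show ?thesis by blast
  qed
  have "finite (cl a \<inter> X)" if "a \<in> {n0..<n0 + K} - full" for a
  proof -
    have "finite {k. a + k * K \<in> X}" using cls[of a] that by (auto simp: full_def cl_def)
    then have "finite ((\<lambda>k. a + k * K) ` {k. a + k * K \<in> X})" by (rule finite_imageI)
    moreover have "cl a \<inter> X \<subseteq> (\<lambda>k. a + k * K) ` {k. a + k * K \<in> X}" by (auto simp: cl_def)
    ultimately show ?thesis by (rule rev_finite_subset)
  qed
  moreover have "rest \<subseteq> {..<n0} \<union> (\<Union>a\<in>{n0..<n0 + K} - full. cl a \<inter> X)"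
  proof
    fix n assume n: "n \<in> rest"
    show "n \<in> {..<n0} \<union> (\<Union>a\<in>{n0..<n0 + K} - full. cl a \<inter> X)"
    proof (cases "n < n0")
      case False
      then obtain a where a: "a \<in> {n0..<n0 + K}" "n \<in> cl a" using cover[of n] by auto
      then show ?thesis using n by (auto simp: rest_def)
    qed simp
  qed
  ultimately have "finite rest" by (meson finite_Diff finite_UN_I finite_Un finite_atLeastLessThan finite_lessThan finite_subset)
  then have "finite ((\<lambda>n. {n}) ` rest \<union> cl ` full)" by (simp add: full_def)
  moreover have "arith_prog {n}" for n
    unfolding arith_prog_def by (intro exI[of _ n] exI[of _ 0]) auto
  moreover have "arith_prog (cl a)" for a
    unfolding arith_prog_def cl_def by (intro exI[of _ a] exI[of _ K]) (auto simp: mult.commute)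
  moreover have "X = \<Union>((\<lambda>n. {n}) ` rest \<union> cl ` full)" by (auto simp: rest_def full_def)
  ultimately show ?thesis by (intro exI[of _ "(\<lambda>n. {n}) ` rest \<union> cl ` full"]) auto
qed

text \<open>A maximal subfamily of \<open>C\<close> independent over \<open>R\<close> is selected,
  and \<Delta> is a common denominator for expressing the rest. An equation with arbitrary
  coefficients thereby becomes finitely many equations over \<open>R\<close> at points with
  coordinates in \<open>R\<close>.\<close>

lemma independent_expansion:
  fixes R C :: "'k::field set"
  assumes R: "is_subring R" and "finite C"
  shows "\<exists>(n::nat) e \<Delta>. \<Delta> \<in> R \<and> \<Delta> \<noteq> 0 \<and>
    (\<forall>q. (\<forall>j<n. q j \<in> R) \<longrightarrow> (\<Sum>j<n. q j * e j) = 0 \<longrightarrow> (\<forall>j<n. q j = 0)) \<and>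
    (\<forall>c\<in>C. \<exists>q. (\<forall>j<n. q j \<in> R) \<and> \<Delta> * c = (\<Sum>j<n. q j * e j))"
  using assms(2)
proof induction
  case empty
  show ?case
    by (rule exI[of _ "0::nat"], rule exI[of _ "\<lambda>_. 0"], rule exI[of _ "1::'k"]) (simp add: subring_one[OF R])
next
  case (insert c C)
  from insert.IH obtain n :: nat and e \<Delta> where \<Delta>: "\<Delta> \<in> R" "\<Delta> \<noteq> 0"
    and indep: "\<forall>q. (\<forall>j<n. q j \<in> R) \<longrightarrow> (\<Sum>j<n. q j * e j) = 0 \<longrightarrow> (\<forall>j<n. q j = 0)"
    and exp: "\<forall>c\<in>C. \<exists>q. (\<forall>j<n. q j \<in> R) \<and> \<Delta> * c = (\<Sum>j<n. q j * e j)"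
    by (elim exE conjE)
  show ?case
  proof (cases "\<exists>q s. (\<forall>j<n. q j \<in> R) \<and> s \<in> R \<and> s \<noteq> 0 \<and> s * c = (\<Sum>j<n. q j * e j)")
    case True
    then obtain q s where q: "\<forall>j<n. q j \<in> R" "s \<in> R" "s \<noteq> 0" "s * c = (\<Sum>j<n. q j * e j)" by blast
    have "\<exists>q. (\<forall>j<n. q j \<in> R) \<and> \<Delta> * s * c' = (\<Sum>j<n. q j * e j)" if c': "c' \<in> insert c C" for c'
    proof (cases "c' = c")
      case True
      then show ?thesis using q \<Delta>
        by (intro exI[of _ "\<lambda>j. \<Delta> * q j"]) (auto simp: mult.assoc subring_mult[OF R] simp flip: sum_distrib_left)
    next
      case False
      then obtain q' where q': "\<forall>j<n. q' j \<in> R" "\<Delta> * c' = (\<Sum>j<n. q' j * e j)" using exp c' by blast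
      have "\<Delta> * s * c' = s * (\<Delta> * c')" by (simp add: mult_ac)
      then show ?thesis using q q' 
        by (intro exI[of _ "\<lambda>j. s * q' j"]) (auto simp: mult.assoc subring_mult[OF R] simp flip: sum_distrib_left)
    qed
    then have exp': "\<forall>c'\<in>insert c C. \<exists>q. (\<forall>j<n. q j \<in> R) \<and> \<Delta> * s * c' = (\<Sum>j<n. q j * e j)" ..
    have \<Delta>s: "\<Delta> * s \<in> R" "\<Delta> * s \<noteq> 0" using q \<Delta> subring_mult[OF R] by auto
    show ?thesis
      by (rule exI[of _ n], rule exI[of _ e], rule exI[of _ "\<Delta> * s"], intro conjI exp' indep \<Delta>s)
  next
    case False
    define e' where "e' = e(n := c)"
    have e': "(\<Sum>j<n. f j * e' j) = (\<Sum>j<n. f j * e j)" for f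
      by (intro sum.cong) (auto simp: e'_def)
    have indep': "\<forall>j<Suc n. q j = 0" if q: "\<And>j. j < Suc n \<Longrightarrow> q j \<in> R" "(\<Sum>j<Suc n. q j * e' j) = 0" for q
    proof -
      have sum: "(\<Sum>j<n. q j * e j) + q n * c = 0"
        using q(2) e'[of q] unfolding sum.lessThan_Suc by (simp add: e'_def)
      have "q n = 0"
      proof (rule ccontr)
        assume "q n \<noteq> 0"
        moreover have "q n * c = (\<Sum>j<n. - q j * e j)"
          using sum by (simp add: sum_negf eq_neg_iff_add_eq_0 add.commute)
        moreover have "\<forall>j<n. - q j \<in> R" "q n \<in> R" using q(1) subring_uminus[OF R] by auto
        ultimately have ex: "(\<forall>j<n. (\<lambda>j. - q j) j \<in> R) \<and> q n \<in> R \<and> q n \<noteq> 0 \<and> q n * c = (\<Sum>j<n. (\<lambda>j. - q j) j * e j)"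
          by blast
        have "\<exists>q' s. (\<forall>j<n. q' j \<in> R) \<and> s \<in> R \<and> s \<noteq> 0 \<and> s * c = (\<Sum>j<n. q' j * e j)"
          by (rule exI[where x="\<lambda>j. - q j"], rule exI[where x="q n"], rule ex)
        then show False using False by contradiction
      qed
      moreover have "\<forall>j<n. q j = 0"
      proof (rule mp[OF mp[OF spec[OF indep, of q]]])
        show "\<forall>j<n. q j \<in> R" using q(1) less_SucI by blast
        show "(\<Sum>j<n. q j * e j) = 0" using sum \<open>q n = 0\<close> by simp
      qed
      ultimately show ?thesis by (simp add: less_Suc_eq)
    qed
    have exp': "\<exists>q. (\<forall>j<Suc n. q j \<in> R) \<and> \<Delta> * c' = (\<Sum>j<Suc n. q j * e' j)" if c': "c' \<in> insert c C" for c'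
    proof (cases "c' = c")
      case True
      then show ?thesis using \<Delta> subring_zero[OF R]
        by (intro exI[of _ "\<lambda>j. if j = n then \<Delta> else 0"]) (auto simp: e'_def)
    next
      case False
      then obtain q' where q': "\<forall>j<n. q' j \<in> R" "\<Delta> * c' = (\<Sum>j<n. q' j * e j)" using exp c' by blast
      have "(\<Sum>j<n. (q'(n := 0)) j * e' j) = (\<Sum>j<n. q' j * e j)"
        by (intro sum.cong) (auto simp: e'_def)
      then show ?thesis using q' subring_zero[OF R]
        by (intro exI[of _ "q'(n := 0)"]) (auto simp: less_Suc_eq)
    qed
    show ?thesis
    proof (rule exI[of _ "Suc n"], rule exI[of _ e'], rule exI[of _ \<Delta>], intro conjI \<Delta>)
      show "\<forall>q. (\<forall>j<Suc n. q j \<in> R) \<longrightarrow> (\<Sum>j<Suc n. q j * e' j) = 0 \<longrightarrow> (\<forall>j<Suc n. q j = 0)"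
      proof (rule allI, rule impI, rule impI)
        fix q assume "\<forall>j<Suc n. q j \<in> R" "(\<Sum>j<Suc n. q j * e' j) = 0"
        then show "\<forall>j<Suc n. q j = 0" by (intro indep') iprover+
      qed
      show "\<forall>c'\<in>insert c C. \<exists>q. (\<forall>j<Suc n. q j \<in> R) \<and> \<Delta> * c' = (\<Sum>j<Suc n. q j * e' j)"
        by (rule ballI, rule exp')
    qed
  qed
qed

lemma sum_group_power:
  fixes x :: "'a::comm_semiring_1"
  assumes "finite S" "\<And>a. a \<in> S \<Longrightarrow> k a < J"
  shows "(\<Sum>a\<in>S. x ^ k a * v a) = (\<Sum>j<J. x ^ j * (\<Sum>a\<in>{a \<in> S. k a = j}. v a))"
proof -
  have "(\<Sum>a\<in>S. x ^ k a * v a) = (\<Sum>j<J. \<Sum>a\<in>{a \<in> S. k a = j}. x ^ k a * v a)"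
    using assms by (intro sum.group[symmetric]) auto
  then show ?thesis by (simp add: sum_distrib_left)
qed

section \<open>Skew products with radial critical locus\<close>

locale skew_setup =
  fixes m r N l :: nat and T :: "'k::{alg_closed_field, field_char_0} vec \<Rightarrow> 'k vec"
    and M M' :: "'k mpoly mat" and \<rho> :: "'k mpoly" and F and S C :: "'k vec set" and L :: "'k mat" and b :: "'k vec" and D :: nat
  assumes D_def: "D = m + r"
    and L: "L \<in> carrier_mat m m" and b: "b \<in> carrier_vec m"
    and T: "\<And>u. u \<in> carrier_vec m \<Longrightarrow> T u = L *\<^sub>v u + b"
    and S: "S = (T ^^ N) ` carrier_vec m" "S = (T ^^ (N + 1)) ` carrier_vec m"
    and M: "M \<in> carrier_mat r r" "\<And>i j. i < r \<Longrightarrow> j < r \<Longrightarrow> M $$ (i, j) \<in> polys m"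
    and M': "M' \<in> carrier_mat r r" "\<And>i j. i < r \<Longrightarrow> j < r \<Longrightarrow> M' $$ (i, j) \<in> polys m"
    and M'M: "M' * M = 1\<^sub>m r"
    and \<rho>: "\<rho> \<in> polys D" "\<And>a. a \<in> Poly_Mapping.keys \<rho> \<Longrightarrow> 1 \<le> z_degree m r a"
    and F: "F = skew_map m r T \<rho> M"
    and C: "C = {u @\<^sub>v z | u z. u \<in> S \<and> z \<in> carrier_vec r \<and>
               mpoly_eval (u @\<^sub>v z) (det (z_jacobian m r (fiber_polys m r \<rho> M))) = 0}"
    and l: "l \<ge> 1"
    and crit: "(F ^^ l) ` C \<subseteq> {u @\<^sub>v 0\<^sub>v r | u. u \<in> S}"
begin

lemma T_carrier: "u \<in> carrier_vec m \<Longrightarrow> T u \<in> carrier_vec m"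
  using L b by (simp add: T)

lemma T_pow_carrier: "u \<in> carrier_vec m \<Longrightarrow> (T ^^ n) u \<in> carrier_vec m"
  by (induction n) (auto intro: T_carrier)

lemma T_index: "u \<in> carrier_vec m \<Longrightarrow> i < m \<Longrightarrow> T u $ i = (\<Sum>j<m. L $$ (i, j) * u $ j) + b $ i"
  using L b by (simp add: T scalar_prod_def atLeast0LessThan)

lemma fiber_index:
  "i < r \<Longrightarrow> fiber_polys m r \<rho> M $ i = \<rho> * (\<Sum>j<r. M $$ (i, j) * mvar (m + j))"
  using M(1) by (simp add: fiber_polys_def scalar_prod_def atLeast0LessThan)

lemma dim_fiber: "dim_vec (fiber_polys m r \<rho> M) = r"
  using M(1) by (simp add: fiber_polys_def)

lemma fiber_polys_in: "i < r \<Longrightarrow> fiber_polys m r \<rho> M $ i \<in> polys D"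
  unfolding fiber_index using \<rho>(1) M(2) polys_mono[of m D]
  by (intro polys_mult polys_sum polys_mvar) (auto simp: D_def)

lemma fiber_eval:
  "i < r \<Longrightarrow> mpoly_eval x (fiber_polys m r \<rho> M $ i) = mpoly_eval x \<rho> * (\<Sum>j<r. mpoly_eval x (M $$ (i, j)) * x $ (m + j))"
  by (simp add: fiber_index mpoly_eval_mult mpoly_eval_sum mpoly_eval_mvar)

lemma F_first: "vec_first (F x) m = T (vec_first x m)"
proof -
  have "T (vec_first x m) \<in> carrier_vec m" by (rule T_carrier) simp
  then show ?thesis by (intro eq_vecI) (auto simp: F skew_map_def vec_first_def)
qed

lemma F_carrier: "F x \<in> carrier_vec D"
proof -
  have "T (vec_first x m) \<in> carrier_vec m" by (rule T_carrier) simp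
  then show ?thesis by (auto simp: F skew_map_def D_def dim_fiber intro!: carrier_vecI)
qed

lemma F_pow_carrier: "x \<in> carrier_vec D \<Longrightarrow> (F ^^ n) x \<in> carrier_vec D"
  by (cases n) (auto intro: F_carrier)

lemma F_pow_first: "vec_first ((F ^^ n) x) m = (T ^^ n) (vec_first x m)"
  by (induction n) (auto simp: F_first)

lemma first_index: "i < m \<Longrightarrow> vec_first x m $ i = x $ i"
  by (simp add: vec_first_def)

lemma F_u: "i < m \<Longrightarrow> F x $ i = T (vec_first x m) $ i"
  using F_first[of x] first_index[of i "F x"] by simp

lemma F_z:
  assumes "i < r"
  shows "F x $ (m + i) = mpoly_eval x \<rho> * (\<Sum>j<r. mpoly_eval x (M $$ (i, j)) * x $ (m + j))"
proof -
  have "T (vec_first x m) \<in> carrier_vec m" by (rule T_carrier) simp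
  then have "F x $ (m + i) = mpoly_eval x (fiber_polys m r \<rho> M $ i)"
    using assms by (simp add: F skew_map_def dim_fiber)
  then show ?thesis using assms by (simp add: fiber_eval)
qed

lemma M_inverse:
  assumes "k < r"
  shows "(\<Sum>i<r. mpoly_eval x (M' $$ (k, i)) * (\<Sum>j<r. mpoly_eval x (M $$ (i, j)) * w j)) = w k"
proof -
  have "(\<Sum>i<r. mpoly_eval x (M' $$ (k, i)) * mpoly_eval x (M $$ (i, j))) = (if k = j then 1 else 0)" if "j < r" for j
  proof -
    have "(M' * M) $$ (k, j) = (\<Sum>i<r. M' $$ (k, i) * M $$ (i, j))"
      using M(1) M'(1) assms that by (simp add: scalar_prod_def atLeast0LessThan)
    then have "mpoly_eval x ((M' * M) $$ (k, j)) = (\<Sum>i<r. mpoly_eval x (M' $$ (k, i)) * mpoly_eval x (M $$ (i, j)))"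
      by (simp add: mpoly_eval_sum mpoly_eval_mult)
    then show ?thesis using assms that by (cases "k = j") (simp_all add: M'M mpoly_eval_0 mpoly_eval_1)
  qed
  then have "(\<Sum>j<r. (\<Sum>i<r. mpoly_eval x (M' $$ (k, i)) * mpoly_eval x (M $$ (i, j))) * w j) = (\<Sum>j<r. if k = j then w j else 0)"
    by (intro sum.cong) auto
  then have "(\<Sum>j<r. (\<Sum>i<r. mpoly_eval x (M' $$ (k, i)) * mpoly_eval x (M $$ (i, j))) * w j) = w k"
    using assms by simp
  moreover have "(\<Sum>i<r. mpoly_eval x (M' $$ (k, i)) * (\<Sum>j<r. mpoly_eval x (M $$ (i, j)) * w j))
      = (\<Sum>j<r. (\<Sum>i<r. mpoly_eval x (M' $$ (k, i)) * mpoly_eval x (M $$ (i, j))) * w j)"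
    by (simp only: sum_distrib_left sum_distrib_right mult.assoc) (rule sum.swap)
  ultimately show ?thesis by simp
qed

text \<open>The value of \<open>\<rho> + z \<cdot> \<nabla>\<^sub>z \<rho>\<close>, the derivative of \<open>c \<rho>(u, c z)\<close> at \<open>c = 1\<close>.\<close>

definition hz :: "'k vec \<Rightarrow> 'k" where
  "hz x = (\<Sum>a\<in>Poly_Mapping.keys \<rho>. of_nat (Suc (z_degree m r a)) * (Poly_Mapping.lookup \<rho> a * monomial_at (($) x) a))"

text \<open>Along the ray through z the fiber map is \<open>c\<close> times \<rho>(u, c z) times the
  vector M(u) z, because \<open>M\<close> depends on u only. Differentiating at \<open>c = 1\<close>
  gives the image of z under the Jacobian.\<close>

lemma jacobian_radial:
  assumes "i < r"
  shows "(\<Sum>j<r. mpoly_eval x (mpoly_deriv (m + j) (fiber_polys m r \<rho> M $ i)) * x $ (m + j))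
    = hz x * (\<Sum>j<r. mpoly_eval x (M $$ (i, j)) * x $ (m + j))"
proof -
  define w where "w = (\<Sum>j<r. mpoly_eval x (M $$ (i, j)) * x $ (m + j))"
  have "z_line m r x (fiber_polys m r \<rho> M $ i) = smult w ([:0, 1:] * z_line m r x \<rho>)"
  proof (rule poly_eq_poly_eq_iff[THEN iffD1], rule ext)
    fix c
    define y where "y = vec (m + r) (\<lambda>i. if i < m then x $ i else c * x $ i)"
    have "mpoly_eval y (M $$ (i, j)) = mpoly_eval x (M $$ (i, j))" if "j < r" for j
      by (rule mpoly_eval_cong[OF M(2)[OF assms that]]) (simp add: y_def)
    then have "(\<Sum>j<r. mpoly_eval y (M $$ (i, j)) * y $ (m + j)) = c * w"
      by (simp add: w_def sum_distrib_left y_def mult_ac)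
    moreover have "poly (z_line m r x (fiber_polys m r \<rho> M $ i)) c = mpoly_eval y (fiber_polys m r \<rho> M $ i)"
      using fiber_polys_in[OF assms] by (simp add: poly_z_line y_def D_def)
    moreover have "poly (z_line m r x \<rho>) c = mpoly_eval y \<rho>"
      using \<rho>(1) by (simp add: poly_z_line y_def D_def)
    ultimately show "poly (z_line m r x (fiber_polys m r \<rho> M $ i)) c = poly (smult w ([:0, 1:] * z_line m r x \<rho>)) c"
      using assms by (simp add: fiber_eval)
  qed
  then have "poly (pderiv (z_line m r x (fiber_polys m r \<rho> M $ i))) 1 = w * (poly (z_line m r x \<rho>) 1 + poly (pderiv (z_line m r x \<rho>)) 1)"
    by (simp add: pderiv_smult pderiv_mult pderiv_pCons distrib_left)
  also have "poly (z_line m r x \<rho>) 1 + poly (pderiv (z_line m r x \<rho>)) 1 = hz x"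
  proof -
    have "poly (z_line m r x \<rho>) 1 = (\<Sum>a\<in>Poly_Mapping.keys \<rho>. Poly_Mapping.lookup \<rho> a * monomial_at (($) x) a)"
      by (simp add: z_line_def poly_sum poly_monom)
    then show ?thesis unfolding pderiv_z_line by (simp add: hz_def distrib_right sum.distrib)
  qed
  finally show ?thesis unfolding z_euler pderiv_z_line[symmetric] by (simp add: w_def)
qed

lemma \<rho>_zero:
  assumes "\<And>j. j < r \<Longrightarrow> x $ (m + j) = 0" shows "mpoly_eval x \<rho> = 0"
proof -
  have "monomial_at (($) x) a = 0" if a: "a \<in> Poly_Mapping.keys \<rho>" for a
  proof -
    have "monomial_at (($) x) a = 0 ^ z_degree m r a * monomial_at (($) x) a"
      by (rule monomial_at_scale) (use a \<rho>(1) assms in \<open>auto simp: polys_def D_def\<close>)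
    then show ?thesis using \<rho>(2)[OF a] by (cases "z_degree m r a") auto
  qed
  then show ?thesis by (simp add: mpoly_eval_monomials)
qed

text \<open>If z is nonzero, it lies in the kernel of the Jacobian, so \<open>y\<close> lies in
  \<open>C\<close> and its \<open>l\<close>-th image has zero fiber part. As \<open>M\<close> is
  invertible, the fiber part can become 0 only through a zero of \<rho>. If z is 0, \<rho> vanishes
  at \<open>y\<close> itself, and \<open>l \<ge> 1\<close> puts this factor into the
  product.\<close>

lemma critical_vanish:
  assumes y: "y \<in> carrier_vec D" "vec_first y m \<in> S" and h: "hz y = 0"
  shows "(\<Prod>i<l. mpoly_eval ((F ^^ i) y) \<rho>) = 0"
proof (cases "\<forall>j<r. y $ (m + j) = 0")
  case True
  then have "mpoly_eval ((F ^^ 0) y) \<rho> = 0" using \<rho>_zero by simp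
  then show ?thesis using l by (intro prod_zero bexI[of _ 0]) auto
next
  case False
  define z where "z = vec_last y r"
  have yz: "y = vec_first y m @\<^sub>v z" using y(1) by (simp add: z_def D_def)
  have zj: "z $ j = y $ (m + j)" if "j < r" for j
    using y(1) that by (simp add: z_def vec_last_def D_def)
  have z: "z \<in> carrier_vec r" by (simp add: z_def)
  define J where "J = map_mat (mpoly_eval y) (z_jacobian m r (fiber_polys m r \<rho> M))"
  have J: "J \<in> carrier_mat r r" by (simp add: J_def z_jacobian_def)
  have "J *\<^sub>v z = 0\<^sub>v r"
  proof (rule eq_vecI)
    fix i assume "i < dim_vec (0\<^sub>v r :: 'k vec)"
    then have i: "i < r" by simp
    have "(J *\<^sub>v z) $ i = (\<Sum>j<r. mpoly_eval y (mpoly_deriv (m + j) (fiber_polys m r \<rho> M $ i)) * y $ (m + j))"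
      using i z J by (simp add: scalar_prod_def atLeast0LessThan zj) (simp add: J_def z_jacobian_def)
    then show "(J *\<^sub>v z) $ i = 0\<^sub>v r $ i" using i h by (simp add: jacobian_radial)
  qed (use J in simp)
  moreover have "z \<noteq> 0\<^sub>v r" using False zj by auto
  ultimately have "det J = 0" using det_0_iff_vec_prod_zero_field[OF J] z by blast
  then have "mpoly_eval y (det (z_jacobian m r (fiber_polys m r \<rho> M))) = 0"
    using comm_ring_hom.hom_det[OF mpoly_eval_hom, of y "z_jacobian m r (fiber_polys m r \<rho> M)"] by (simp add: J_def)
  then have "y \<in> C" unfolding C using y(2) z yz by (metis (mono_tags, lifting) mem_Collect_eq)
  then obtain u where u: "u \<in> S" "(F ^^ l) y = u @\<^sub>v 0\<^sub>v r" using crit by blast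
  have "u \<in> carrier_vec m" using u(1) S(1) T_pow_carrier by auto
  then have zero: "(F ^^ l) y $ (m + j) = 0" if "j < r" for j using u(2) that by simp
  show ?thesis
  proof (rule ccontr)
    assume "(\<Prod>i<l. mpoly_eval ((F ^^ i) y) \<rho>) \<noteq> 0"
    then have nz: "mpoly_eval ((F ^^ i) y) \<rho> \<noteq> 0" if "i < l" for i using that by auto
    have "\<exists>j<r. (F ^^ i) y $ (m + j) \<noteq> 0" if "i \<le> l" for i
      using that
    proof (induction i)
      case (Suc i)
      let ?x = "(F ^^ i) y"
      show ?case
      proof (rule ccontr)
        assume "\<not> ?case"
        then have "(\<Sum>j<r. mpoly_eval ?x (M $$ (k, j)) * ?x $ (m + j)) = 0" if "k < r" for k
          using that nz[of i] Suc.prems F_z[OF that, of ?x] by auto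
        then have "?x $ (m + k) = 0" if "k < r" for k
          using M_inverse[OF that, of ?x "\<lambda>j. ?x $ (m + j)"] by simp
        then show False using Suc by auto
      qed
    qed (use False in auto)
    then show False using zero by blast
  qed
qed

lemma T_pow_polyfun:
  assumes R: "is_subring R" "\<And>i j. i < m \<Longrightarrow> j < m \<Longrightarrow> L $$ (i, j) \<in> R" "\<And>i. i < m \<Longrightarrow> b $ i \<in> R"
  shows "i < m \<Longrightarrow> (\<lambda>s. (T ^^ n) (vec m s) $ i) \<in> polyfun R"
proof (induction n arbitrary: i)
  case 0
  then show ?case by (simp add: polyfun_var)
next
  case (Suc n)
  have "(\<lambda>s. (\<Sum>j<m. L $$ (i, j) * (T ^^ n) (vec m s) $ j) + b $ i) \<in> polyfun R"
    using Suc R by (intro polyfun_intros[OF R(1)]) auto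
  then show ?case using Suc.prems by (simp add: T_index T_pow_carrier)
qed

lemma F_polyfun:
  assumes Z: "\<And>i. i < D \<Longrightarrow> (\<lambda>s. Z s $ i) \<in> polyfun UNIV" and "i < D"
  shows "(\<lambda>s. F (Z s) $ i) \<in> polyfun UNIV"
proof (cases "i < m")
  case True
  have "(\<lambda>s. (\<Sum>j<m. L $$ (i, j) * Z s $ j) + b $ i) \<in> polyfun UNIV"
    using Z by (intro polyfun_intros[OF is_subring_UNIV]) (auto simp: D_def)
  then show ?thesis using True by (simp add: F_u T_index first_index)
next
  case False
  then obtain k where k: "i = m + k" "k < r" using assms(2) by (metis D_def add_diff_inverse_nat nat_add_left_cancel_less)
  have "(\<lambda>s. mpoly_eval (Z s) \<rho> * (\<Sum>j<r. mpoly_eval (Z s) (M $$ (k, j)) * Z s $ (m + j))) \<in> polyfun UNIV"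
    using Z \<rho>(1) M(2)[OF k(2)]
    by (intro polyfun_intros[OF is_subring_UNIV] mpoly_eval_polyfun[OF is_subring_UNIV, of _ D]) (auto simp: D_def intro: polys_mono[of m])
  then show ?thesis using k by (simp add: F_z)
qed

text \<open>Parametrizes the points over \<open>S\<close> by a full affine space, through
  \<open>T ^^ N\<close> on the base, so that the Nullstellensatz needs no coordinates on the
  subspace \<open>S\<close>.\<close>

definition lift :: "(nat \<Rightarrow> 'k) \<Rightarrow> 'k vec" where
  "lift s = vec D (\<lambda>i. if i < m then (T ^^ N) (vec m s) $ i else s i)"

lemma lift_carrier: "lift s \<in> carrier_vec D" and lift_index:
  "i < m \<Longrightarrow> lift s $ i = (T ^^ N) (vec m s) $ i" "m \<le> i \<Longrightarrow> i < D \<Longrightarrow> lift s $ i = s i"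
  unfolding lift_def by (simp_all add: D_def)

lemma lift_first: "vec_first (lift s) m = (T ^^ N) (vec m s)"
proof -
  have "(T ^^ N) (vec m s) \<in> carrier_vec m" by (rule T_pow_carrier) simp
  then show ?thesis by (intro eq_vecI) (auto simp: lift_index vec_first_def)
qed

lemma certificate:
  "\<exists>a\<in>polyfun UNIV. \<exists>c. \<forall>s. hz (lift s) * a s = (\<Prod>i<l. mpoly_eval ((F ^^ i) (lift s)) \<rho>) ^ c"
proof (rule hypersurface_nullstellensatz)
  have Z: "(\<lambda>s. lift s $ i) \<in> polyfun UNIV" if "i < D" for i
  proof (cases "i < m")
    case True
    then show ?thesis using T_pow_polyfun[OF is_subring_UNIV, of i N] by (simp add: lift_index)
  qed (use that in \<open>simp add: lift_index polyfun_var\<close>)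
  have FZ: "(\<lambda>s. (F ^^ n) (lift s) $ i) \<in> polyfun UNIV" if "i < D" for n i
    using that
  proof (induction n arbitrary: i)
    case (Suc n)
    then show ?case using F_polyfun[of "\<lambda>s. (F ^^ n) (lift s)"] by simp
  qed (simp add: Z)
  show "(\<lambda>s. hz (lift s)) \<in> polyfun UNIV"
    unfolding hz_def using Z polys_keys[OF \<rho>(1)]
    by (intro polyfun_intros[OF is_subring_UNIV] monomial_at_polyfun[OF is_subring_UNIV]) auto
  show "(\<lambda>s. \<Prod>i<l. mpoly_eval ((F ^^ i) (lift s)) \<rho>) \<in> polyfun UNIV"
    using FZ by (intro polyfun_prod[OF is_subring_UNIV] mpoly_eval_polyfun[OF is_subring_UNIV \<rho>(1)]) auto
  show "(\<Prod>i<l. mpoly_eval ((F ^^ i) (lift s)) \<rho>) = 0" if "hz (lift s) = 0" for s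
    using that by (intro critical_vanish lift_carrier) (auto simp: lift_first S(1))
qed

end

section \<open>The stable image and the scaled coordinates\<close>

context skew_setup
begin

lemma S_pow: "S = (T ^^ (N + k)) ` carrier_vec m"
proof (induction k)
  case (Suc k)
  have "(T ^^ (N + Suc k)) ` carrier_vec m = T ` ((T ^^ (N + k)) ` carrier_vec m)" by (simp add: image_image)
  also have "\<dots> = T ` ((T ^^ N) ` carrier_vec m)" using Suc S(1) by simp
  also have "\<dots> = S" using S(2) by (simp add: image_image)
  finally show ?case by simp
qed (simp add: S(1))

lemma T_pow_diff:
  assumes "u \<in> carrier_vec m" "v \<in> carrier_vec m"
  shows "(T ^^ n) u - (T ^^ n) v = ((*\<^sub>v) L ^^ n) (u - v)"
proof (induction n)
  case (Suc n)
  have c: "(T ^^ n) u \<in> carrier_vec m" "(T ^^ n) v \<in> carrier_vec m" using T_pow_carrier assms by auto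
  have "(T ^^ Suc n) u - (T ^^ Suc n) v = L *\<^sub>v ((T ^^ n) u - (T ^^ n) v)"
    using c L b by (subst mult_minus_distrib_mat_vec[OF L c]) (auto simp: T intro!: eq_vecI)
  then show ?case by (simp add: Suc)
qed (use assms in simp)

text \<open>Differences of points of \<open>S\<close> are images under arbitrarily high powers of
  \<open>L\<close>, where the invertible matrix \<open>B\<close> of
  \<open>invertible_on_stable_image\<close> acts as \<open>L\<close>. The constant \<open>c\<close>
  is fitted at one point of \<open>S\<close>.\<close>

lemma T_on_S:
  "\<exists>B\<in>carrier_mat m m. \<exists>B'\<in>carrier_mat m m. \<exists>c\<in>carrier_vec m. B' * B = 1\<^sub>m m \<and> (\<forall>u\<in>S. T u = B *\<^sub>v u + c)"
proof -
  obtain n0 B B' where B: "B \<in> carrier_mat m m" "B' \<in> carrier_mat m m" "B' * B = 1\<^sub>m m"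
    "\<And>n x. n0 \<le> n \<Longrightarrow> x \<in> carrier_vec m \<Longrightarrow> B *\<^sub>v ((*\<^sub>v) L ^^ n) x = L *\<^sub>v ((*\<^sub>v) L ^^ n) x"
    using invertible_on_stable_image[OF L] by blast
  define s where "s = (T ^^ N) (0\<^sub>v m)"
  define c where "c = T s - B *\<^sub>v s"
  have s: "s \<in> carrier_vec m" "s \<in> S" by (auto simp: s_def S(1) T_pow_carrier)
  have "T u = B *\<^sub>v u + c" if u: "u \<in> S" for u
  proof -
    have uc: "u \<in> carrier_vec m" using u S(1) T_pow_carrier by auto
    obtain v v' where v: "v \<in> carrier_vec m" "v' \<in> carrier_vec m" "u = (T ^^ (N + n0)) v" "s = (T ^^ (N + n0)) v'"
      using u s(2) S_pow[of n0] by auto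
    have "B *\<^sub>v (u - s) = L *\<^sub>v (u - s)"
      unfolding v(3,4) T_pow_diff[OF v(1,2)] using v by (intro B) auto
    then have "B *\<^sub>v u - B *\<^sub>v s = L *\<^sub>v u - L *\<^sub>v s"
      using mult_minus_distrib_mat_vec[OF B(1) uc s(1)] mult_minus_distrib_mat_vec[OF L uc s(1)] by simp
    then have eq: "(B *\<^sub>v u) $ i - (B *\<^sub>v s) $ i = (L *\<^sub>v u) $ i - (L *\<^sub>v s) $ i" if "i < m" for i
      using that B(1) L by (metis carrier_matD(1) dim_mult_mat_vec index_minus_vec(1))
    show ?thesis
    proof (rule eq_vecI)
      fix i assume "i < dim_vec (B *\<^sub>v u + c)"
      then have "i < m" using L b s uc B(1) by (simp add: c_def T)
      then show "T u $ i = (B *\<^sub>v u + c) $ i"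
        using eq[of i] L b s uc B(1) by (simp add: c_def T del: index_mult_mat_vec) (simp add: algebra_simps)
    qed (use L b s uc B(1) in \<open>simp add: c_def T\<close>)
  qed
  moreover have "c \<in> carrier_vec m" using s B(1) T_carrier by (simp add: c_def)
  ultimately show ?thesis using B by blast
qed

lemma mpoly_eval_in:
  assumes R: "is_subring R" and p: "p \<in> polys n" "\<And>a. Poly_Mapping.lookup p a \<in> R" and x: "\<And>i. i < n \<Longrightarrow> x $ i \<in> R"
  shows "mpoly_eval x p \<in> R"
proof -
  define s where "s i = (if i < n then x $ i else 0)" for i
  have "(\<lambda>s. mpoly_eval (vec n s) p) \<in> polyfun R"
    by (rule mpoly_eval_polyfun[OF R p]) (simp add: polyfun_var)
  then have "mpoly_eval (vec n s) p \<in> R"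
    by (rule polyfun_values[OF _ R]) (use x subring_zero[OF R] in \<open>simp add: s_def\<close>)
  moreover have "mpoly_eval (vec n s) p = mpoly_eval x p" by (rule mpoly_eval_cong[OF p(1)]) (simp add: s_def)
  ultimately show ?thesis by simp
qed

definition pnt :: "(nat \<Rightarrow> 'k) \<Rightarrow> 'k vec" where
  "pnt s = vec D (\<lambda>i. if i < m then s i else s D * s i)"

lemma pnt_index: "i < m \<Longrightarrow> pnt s $ i = s i" "j < r \<Longrightarrow> pnt s $ (m + j) = s D * s (m + j)"
  unfolding pnt_def by (simp_all add: D_def)

lemma pnt_monomial:
  assumes "Poly_Mapping.keys a \<subseteq> {..<D}"
  shows "monomial_at (($) (pnt s)) a = s D ^ z_degree m r a * monomial_at s a"
proof (rule monomial_at_scale)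
  show "Poly_Mapping.keys a \<subseteq> {..<m + r}" using assms unfolding D_def .
qed (simp_all add: pnt_index)

lemma pnt_sum:
  assumes "finite Q" "\<And>a. a \<in> Q \<Longrightarrow> Poly_Mapping.keys a \<subseteq> {..<D}"
  shows "(\<Sum>a\<in>Q. q a * monomial_at (($) (pnt s)) a) =
    (\<Sum>j<Suc (\<Sum>a\<in>Q. z_degree m r a). s D ^ j * (\<Sum>a\<in>{a\<in>Q. z_degree m r a = j}. q a * monomial_at s a))"
proof -
  have "(\<Sum>a\<in>Q. q a * monomial_at (($) (pnt s)) a) = (\<Sum>a\<in>Q. s D ^ z_degree m r a * (q a * monomial_at s a))"
    using assms(2) by (intro sum.cong) (auto simp: pnt_monomial mult_ac)
  also have "\<dots> = (\<Sum>j<Suc (\<Sum>a\<in>Q. z_degree m r a). s D ^ j * (\<Sum>a\<in>{a\<in>Q. z_degree m r a = j}. q a * monomial_at s a))"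
    using assms(1) by (intro sum_group_power) (auto simp: less_Suc_eq_le intro!: member_le_sum)
  finally show ?thesis .
qed

definition "Jb = Suc (\<Sum>a\<in>Poly_Mapping.keys \<rho>. z_degree m r a)"

text \<open>The part of \<rho> of z-degree \<open>j + 1\<close>. The shift reflects that there is no
  part of degree 0 and exhibits the factor \<lambda>.\<close>

definition \<rho>s :: "nat \<Rightarrow> (nat \<Rightarrow> 'k) \<Rightarrow> 'k" where
  "\<rho>s j s = (\<Sum>a\<in>{a\<in>Poly_Mapping.keys \<rho>. z_degree m r a = Suc j}. Poly_Mapping.lookup \<rho> a * monomial_at s a)"

lemma \<rho>_keys: "a \<in> Poly_Mapping.keys \<rho> \<Longrightarrow> Poly_Mapping.keys a \<subseteq> {..<D}"
  using \<rho>(1) by (auto simp: polys_def)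

text \<open>Weight 1 gives \<rho>, and the weight \<open>k + 1\<close> in z-degree \<open>k\<close>
  gives \<open>hz\<close>; both expansions are thus obtained at once.\<close>

lemma weighted_\<rho>:
  "(\<Sum>a\<in>Poly_Mapping.keys \<rho>. w (z_degree m r a) * (Poly_Mapping.lookup \<rho> a * monomial_at (($) (pnt s)) a)) =
    (\<Sum>j<Jb. w (Suc j) * s D ^ (j + 1) * \<rho>s j s)"
proof -
  let ?K = "Poly_Mapping.keys \<rho>"
  have "w (z_degree m r a) * (Poly_Mapping.lookup \<rho> a * monomial_at (($) (pnt s)) a)
      = s D ^ (z_degree m r a - 1) * (s D * w (Suc (z_degree m r a - 1)) * (Poly_Mapping.lookup \<rho> a * monomial_at s a))"
    if a: "a \<in> ?K" for a
  proof -
    obtain k where "z_degree m r a = Suc k" using \<rho>(2)[OF a] by (cases "z_degree m r a") auto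
    then show ?thesis using pnt_monomial[OF \<rho>_keys[OF a], of s] by (simp add: mult_ac)
  qed
  then have "(\<Sum>a\<in>?K. w (z_degree m r a) * (Poly_Mapping.lookup \<rho> a * monomial_at (($) (pnt s)) a))
      = (\<Sum>a\<in>?K. s D ^ (z_degree m r a - 1) * (s D * w (Suc (z_degree m r a - 1)) * (Poly_Mapping.lookup \<rho> a * monomial_at s a)))"
    by (intro sum.cong) auto
  also have "\<dots> = (\<Sum>j<Jb. s D ^ j * (\<Sum>a\<in>{a\<in>?K. z_degree m r a - 1 = j}. s D * w (Suc (z_degree m r a - 1)) * (Poly_Mapping.lookup \<rho> a * monomial_at s a)))"
  proof (rule sum_group_power)
    fix a assume "a \<in> ?K"
    then have "z_degree m r a \<le> (\<Sum>a\<in>?K. z_degree m r a)" by (intro member_le_sum) auto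
    then show "z_degree m r a - 1 < Jb" by (simp add: Jb_def)
  qed simp
  also have "\<dots> = (\<Sum>j<Jb. w (Suc j) * s D ^ (j + 1) * \<rho>s j s)"
  proof (intro sum.cong refl)
    fix j
    have "{a\<in>?K. z_degree m r a - 1 = j} = {a\<in>?K. z_degree m r a = Suc j}"
      using \<rho>(2) by force
    then have "(\<Sum>a\<in>{a\<in>?K. z_degree m r a - 1 = j}. s D * w (Suc (z_degree m r a - 1)) * (Poly_Mapping.lookup \<rho> a * monomial_at s a))
        = (\<Sum>a\<in>{a\<in>?K. z_degree m r a = Suc j}. s D * w (Suc j) * (Poly_Mapping.lookup \<rho> a * monomial_at s a))"
      (is "?x = ?y") by (intro sum.cong) auto
    also have "?y = s D * w (Suc j) * \<rho>s j s" unfolding \<rho>s_def sum_distrib_left ..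
    finally have x: "?x = s D * w (Suc j) * \<rho>s j s" .
    then show "s D ^ j * ?x = w (Suc j) * s D ^ (j + 1) * \<rho>s j s" unfolding x by (simp add: mult_ac)
  qed
  finally show ?thesis .
qed

lemma eval_\<rho>: "mpoly_eval (pnt s) \<rho> = (\<Sum>j<Jb. s D ^ (j + 1) * \<rho>s j s)"
  using weighted_\<rho>[of "\<lambda>_. 1" s] by (simp add: mpoly_eval_monomials)

lemma eval_hz: "hz (pnt s) = (\<Sum>j<Jb. of_nat (j + 2) * s D ^ (j + 1) * \<rho>s j s)"
  using weighted_\<rho>[of "\<lambda>k. of_nat (Suc k)" s] by (simp add: hz_def)

end

section \<open>Descent of the equations to \<open>R\<close> and the theorem on orbits\<close>

context skew_setup
begin

text \<open>The ring \<open>R\<close> is fixed before \<open>f\<close>, whose coefficients may lie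
  outside it. Expanding them by \<open>independent_expansion\<close> and sorting monomials by
  z-degree gives polynomials in \<lambda> with coefficient functions over \<open>R\<close>.\<close>

lemma eval_components:
  assumes R: "is_subring R" and f: "f \<in> polys D"
  shows "\<exists>(n::nat) J' fs. (\<forall>j i. fs j i \<in> polyfun R) \<and>
    (\<forall>j i x y. (\<forall>k<D. x k = y k) \<longrightarrow> fs j i x = fs j i y) \<and>
    (\<forall>s. (\<forall>i. s i \<in> R) \<longrightarrow> (mpoly_eval (pnt s) f = 0 \<longleftrightarrow> (\<forall>j<n. (\<Sum>i<J'. s D ^ i * fs j i s) = 0)))"
proof -
  let ?K = "Poly_Mapping.keys f"
  have keys: "Poly_Mapping.keys a \<subseteq> {..<D}" if "a \<in> ?K" for a using f that by (auto simp: polys_def)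
  have "finite (Poly_Mapping.lookup f ` ?K)" by simp
  from independent_expansion[OF R this]
  obtain n :: nat and e \<Delta> where \<Delta>: "\<Delta> \<noteq> 0"
    and indep: "\<forall>q. (\<forall>j<n. q j \<in> R) \<longrightarrow> (\<Sum>j<n. q j * e j) = 0 \<longrightarrow> (\<forall>j<n. q j = 0)"
    and exp: "\<forall>c\<in>Poly_Mapping.lookup f ` ?K. \<exists>q. (\<forall>j<n. q j \<in> R) \<and> \<Delta> * c = (\<Sum>j<n. q j * e j)"
    by (elim exE conjE)
  have "\<forall>a\<in>?K. \<exists>q. (\<forall>j<n. q j \<in> R) \<and> \<Delta> * Poly_Mapping.lookup f a = (\<Sum>j<n. q j * e j)"
    using exp by simp
  from bchoice[OF this] obtain q where
    q: "\<forall>a\<in>?K. (\<forall>j<n. q a j \<in> R) \<and> \<Delta> * Poly_Mapping.lookup f a = (\<Sum>j<n. q a j * e j)" ..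
  define fs where "fs j i s = (\<Sum>a\<in>{a\<in>?K. z_degree m r a = i}. (if j < n then q a j else 0) * monomial_at s a)" for j i s
  define J' where "J' = Suc (\<Sum>a\<in>?K. z_degree m r a)"
  have fs_pf: "fs j i \<in> polyfun R" for j i
    unfolding fs_def using q subring_zero[OF R]
    by (intro polyfun_sum[OF R] polyfun_mult polyfun_const monomial_at_polyfun[OF R] polyfun_var) auto
  have fs_dep: "fs j i x = fs j i y" if "\<forall>k<D. x k = y k" for j i x y
    unfolding fs_def using keys that
    by (intro sum.cong arg_cong2[of _ _ _ _ "(*)"] refl monomial_at_cong) blast
  have fs_eval: "mpoly_eval (pnt s) f = 0 \<longleftrightarrow> (\<forall>j<n. (\<Sum>i<J'. s D ^ i * fs j i s) = 0)" if s: "\<forall>i. s i \<in> R" for s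
  proof -
    define g where "g j = (\<Sum>i<J'. s D ^ i * fs j i s)" for j
    have g: "g j = (\<Sum>a\<in>?K. q a j * monomial_at (($) (pnt s)) a)" if "j < n" for j
      using pnt_sum[of ?K "\<lambda>a. q a j" s] keys that by (simp add: g_def fs_def J'_def)
    have fs_R: "fs j i s \<in> R" for j i by (rule polyfun_values[OF fs_pf R]) (use s in simp)
    have g_R: "g j \<in> R" for j
      unfolding g_def by (rule subring_sum[OF R], rule subring_mult[OF R subring_power[OF R] fs_R]) (use s in simp)
    have "\<Delta> * mpoly_eval (pnt s) f = (\<Sum>a\<in>?K. (\<Delta> * Poly_Mapping.lookup f a) * monomial_at (($) (pnt s)) a)"
      by (simp add: mpoly_eval_monomials sum_distrib_left mult.assoc)
    also have "\<dots> = (\<Sum>a\<in>?K. \<Sum>j<n. q a j * monomial_at (($) (pnt s)) a * e j)"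
      using q by (intro sum.cong) (auto simp: sum_distrib_left mult_ac)
    also have "\<dots> = (\<Sum>j<n. g j * e j)"
      by (subst sum.swap) (simp add: g sum_distrib_right)
    finally have eq: "\<Delta> * mpoly_eval (pnt s) f = (\<Sum>j<n. g j * e j)" .
    show ?thesis
      unfolding g_def[symmetric]
    proof
      assume "mpoly_eval (pnt s) f = 0"
      then have "(\<Sum>j<n. g j * e j) = 0" using eq by simp
      with indep g_R show "\<forall>j<n. g j = 0" by iprover
    next
      assume "\<forall>j<n. g j = 0"
      then have "\<Delta> * mpoly_eval (pnt s) f = 0" using eq by simp
      then show "mpoly_eval (pnt s) f = 0" using \<Delta> by simp
    qed
  qed
  show ?thesis
  proof (rule exI[of _ n], rule exI[of _ J'], rule exI[of _ fs], intro conjI)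
    show "\<forall>j i. fs j i \<in> polyfun R" using fs_pf by iprover
    show "\<forall>j i x y. (\<forall>k<D. x k = y k) \<longrightarrow> fs j i x = fs j i y"
      by (rule allI, rule allI, rule allI, rule allI, rule impI, rule fs_dep)
    show "\<forall>s. (\<forall>i. s i \<in> R) \<longrightarrow> (mpoly_eval (pnt s) f = 0 \<longleftrightarrow> (\<forall>j<n. (\<Sum>i<J'. s D ^ i * fs j i s) = 0))"
      by (rule allI, rule impI, rule fs_eval)
  qed
qed

lemma pnt_first: "vec_first (pnt s) m = vec m s"
  by (intro eq_vecI) (auto simp: vec_first_def pnt_index)

lemma pnt_carrier: "pnt s \<in> carrier_vec D"
  by (simp add: pnt_def)

lemma \<rho>s_polyfun:
  assumes "is_subring R" "\<And>a. Poly_Mapping.lookup \<rho> a \<in> R"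
  shows "\<rho>s j \<in> polyfun R"
  unfolding \<rho>s_def using assms
  by (intro polyfun_sum polyfun_mult polyfun_const monomial_at_polyfun polyfun_var)

lemma \<rho>s_dep: "(\<And>k. k < D \<Longrightarrow> s k = s' k) \<Longrightarrow> \<rho>s j s = \<rho>s j s'"
  unfolding \<rho>s_def using \<rho>_keys
  by (intro sum.cong arg_cong2[of _ _ _ _ "(*)"] refl monomial_at_cong) blast

text \<open>Base coordinates are taken at time \<open>n\<close>, because \<open>lift\<close> applies
  \<open>T ^^ N\<close> to them, and fiber coordinates at time \<open>N + n\<close>. The certificate
  is thus evaluated at coordinates of orbit points, which lie in \<open>R\<close>.\<close>

lemma lift_orbit:
  assumes "x \<in> carrier_vec D"
  shows "lift (\<lambda>i. if i < m then (F ^^ n) x $ i else if i < D then (F ^^ (N + n)) x $ i else 0) = (F ^^ (N + n)) x"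
    (is "lift ?X = _")
proof (rule eq_vecI)
  have "vec m ?X = vec_first ((F ^^ n) x) m" by (intro eq_vecI) (auto simp: vec_first_def)
  then have first: "(T ^^ N) (vec m ?X) = vec_first ((F ^^ (N + n)) x) m"
    by (simp add: F_pow_first funpow_add)
  fix i assume "i < dim_vec ((F ^^ (N + n)) x)"
  then have "i < D" using F_pow_carrier[OF assms, of "N + n"] by simp
  then show "lift ?X $ i = (F ^^ (N + n)) x $ i"
    by (cases "i < m") (simp_all add: lift_index first first_index)
qed (use F_pow_carrier[OF assms, of "N + n"] lift_carrier[of ?X] in simp)

theorem orbit_zeros_on_classes:
  assumes x0: "x0 \<in> carrier_vec D"
  shows "\<exists>n0 K. K > 0 \<and> (\<forall>f\<in>polys D. \<forall>a\<ge>n0.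
    infinite {k. mpoly_eval ((F ^^ (a + k * K)) x0) f = 0} \<longrightarrow> (\<forall>k. mpoly_eval ((F ^^ (a + k * K)) x0) f = 0))"
proof -
  obtain B B' c where B: "B \<in> carrier_mat m m" "B' \<in> carrier_mat m m" "c \<in> carrier_vec m" "B' * B = 1\<^sub>m m"
    and TS: "\<And>u. u \<in> S \<Longrightarrow> T u = B *\<^sub>v u + c"
    using T_on_S by blast
  obtain \<alpha> cc where \<alpha>: "\<alpha> \<in> polyfun UNIV"
    "\<And>s. hz (lift s) * \<alpha> s = (\<Prod>i<l. mpoly_eval ((F ^^ i) (lift s)) \<rho>) ^ cc"
    using certificate by blast
  obtain A\<alpha> where A\<alpha>: "finite A\<alpha>" "\<alpha> \<in> polyfun A\<alpha>" using polyfun_finite_consts[OF \<alpha>(1)] by blast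
  \<comment> \<open>Everything that defines the lifted system, its inverse, the starting point and
    the certificate. The equations of the subvariety are absent, so the resulting period serves all
    of them.\<close>
  define Cs where "Cs = A\<alpha> \<union> ($) x0 ` {..<D} \<union> Poly_Mapping.lookup \<rho> ` Poly_Mapping.keys \<rho>
    \<union> (\<lambda>ij. L $$ ij) ` ({..<m} \<times> {..<m}) \<union> (\<lambda>ij. B $$ ij) ` ({..<m} \<times> {..<m}) \<union> (\<lambda>ij. B' $$ ij) ` ({..<m} \<times> {..<m})
    \<union> ($) b ` {..<m} \<union> ($) c ` {..<m}
    \<union> (\<Union>ij\<in>{..<r} \<times> {..<r}. Poly_Mapping.lookup (M $$ ij) ` Poly_Mapping.keys (M $$ ij))
    \<union> (\<Union>ij\<in>{..<r} \<times> {..<r}. Poly_Mapping.lookup (M' $$ ij) ` Poly_Mapping.keys (M' $$ ij))"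
  have "finite Cs" using A\<alpha> by (simp add: Cs_def)
  from specializable_cover[OF this] obtain R where R: "Cs \<subseteq> R" "specializable R" by blast
  have sR: "is_subring R" using R(2) by (simp add: specializable_def)
  have lookup_R: "Poly_Mapping.lookup p a \<in> R" if "Poly_Mapping.lookup p ` Poly_Mapping.keys p \<subseteq> R" for p :: "'k mpoly" and a
    using that subring_zero[OF sR] by (cases "a \<in> Poly_Mapping.keys p") (auto simp: in_keys_iff)
  have mat_R: "L $$ (i, j) \<in> R" "B $$ (i, j) \<in> R" "B' $$ (i, j) \<in> R" if "i < m" "j < m" for i j
    using R(1) that by (auto simp: Cs_def)
  have vec_R: "b $ i \<in> R" "c $ i \<in> R" if "i < m" for i
    using R(1) that by (auto simp: Cs_def)
  have \<rho>_R: "Poly_Mapping.lookup \<rho> a \<in> R" for a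
    by (rule lookup_R) (use R(1) in \<open>auto simp: Cs_def\<close>)
  have RM: "(\<Union>ij\<in>{..<r} \<times> {..<r}. Poly_Mapping.lookup (M $$ ij) ` Poly_Mapping.keys (M $$ ij)) \<subseteq> R"
    "(\<Union>ij\<in>{..<r} \<times> {..<r}. Poly_Mapping.lookup (M' $$ ij) ` Poly_Mapping.keys (M' $$ ij)) \<subseteq> R"
    using R(1) unfolding Cs_def by (simp_all only: Un_subset_iff)
  have M_R: "Poly_Mapping.lookup (M $$ (i, j)) a \<in> R" "Poly_Mapping.lookup (M' $$ (i, j)) a \<in> R" if "i < r" "j < r" for i j a
  proof -
    have ij: "(i, j) \<in> {..<r} \<times> {..<r}" using that by simp
    show "Poly_Mapping.lookup (M $$ (i, j)) a \<in> R"
      using RM(1)[unfolded UN_subset_iff, rule_format, OF ij] by (rule lookup_R)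
    show "Poly_Mapping.lookup (M' $$ (i, j)) a \<in> R"
      using RM(2)[unfolded UN_subset_iff, rule_format, OF ij] by (rule lookup_R)
  qed
  have \<alpha>_R: "\<alpha> \<in> polyfun R" by (rule polyfun_mono[OF _ A\<alpha>(2)]) (use R(1) in \<open>auto simp: Cs_def\<close>)

  define xs where "xs n = (F ^^ n) x0" for n
  have xs_carrier: "xs n \<in> carrier_vec D" for n unfolding xs_def by (rule F_pow_carrier[OF x0])
  have xs_R: "xs n $ i \<in> R" if "i < D" for n i
    using that
  proof (induction n arbitrary: i)
    case 0
    then show ?case using R(1) by (auto simp: xs_def Cs_def)
  next
    case (Suc n)
    have step: "xs (Suc n) = F (xs n)" by (simp add: xs_def)
    show ?case
    proof (cases "i < m")
      case True
      then show ?thesis unfolding step F_u[OF True] using Suc.IH mat_R vec_R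
        by (auto simp: T_index first_index D_def intro!: subring_intros[OF sR])
    next
      case False
      then obtain k where k: "i = m + k" "k < r" using Suc.prems by (metis D_def add_diff_inverse_nat nat_add_left_cancel_less)
      have "mpoly_eval (xs n) (M $$ (k, j)) \<in> R" if "j < r" for j
        by (rule mpoly_eval_in[OF sR M(2)[OF k(2) that] M_R(1)[OF k(2) that]]) (rule Suc.IH, simp add: D_def)
      moreover have "mpoly_eval (xs n) \<rho> \<in> R" by (rule mpoly_eval_in[OF sR \<rho>(1) \<rho>_R Suc.IH])
      moreover have "xs n $ (m + j) \<in> R" if "j < r" for j by (rule Suc.IH) (use that in \<open>simp add: D_def\<close>)
      ultimately show ?thesis unfolding step k(1) F_z[OF k(2)]
        by (intro subring_mult[OF sR] subring_sum[OF sR]) auto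
    qed
  qed
  have xs_S: "vec_first (xs (N + n)) m \<in> S" for n
    unfolding xs_def F_pow_first S_pow[of n] by (rule imageI) simp

  define W where "W i j s = mpoly_eval (vec m s) (M $$ (i, j))" for i j s
  \<comment> \<open>\<open>U\<close> undoes the affine map with matrix \<open>B\<close> and constant
    \<open>c\<close>; \<open>G'\<close> then recovers w by evaluating the inverse matrix
    \<open>M'\<close> at the recovered u.\<close>
  define U where "U s = vec m (\<lambda>k. \<Sum>j<m. B' $$ (k, j) * (s j - c $ j))" for s
  define G' where "G' i s = (if i < m then U s $ i else \<Sum>j<r. mpoly_eval (U s) (M' $$ (i - m, j)) * s (m + j))" for i s
  \<comment> \<open>The state starts at time \<open>N\<close>, when the base point has reached
    \<open>S\<close>, and with \<lambda> = 1, so w is the fiber part itself.\<close>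
  define t0 where "t0 i = (if i < D then xs N $ i else if i = D then 1 else 0)" for i
  define G where "G = (\<lambda>s i. if i < m then c $ i + (\<Sum>j<m. B $$ (i, j) * s j) else if i < D then \<Sum>j<r. W (i - m) j s * s (m + j) else 0)"
  define Rho where "Rho = (\<lambda>s. \<Sum>j<Jb. s D ^ (j + 1) * \<rho>s j s)"
  define hh where "hh = (\<lambda>s. \<Sum>j<Jb. of_nat (j + 2) * s D ^ (j + 1) * \<rho>s j s)"
  define H where "H = (\<lambda>s. (G s)(D := s D * Rho s))"
  have Rho: "Rho s = mpoly_eval (pnt s) \<rho>" and hh: "hh s = hz (pnt s)" for s
    by (simp_all only: eval_\<rho> eval_hz Rho_def hh_def)
  have H_u: "H s i = c $ i + (\<Sum>j<m. B $$ (i, j) * s j)" if "i < m" for s i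
    using that by (simp add: H_def G_def D_def)
  have H_w: "H s (m + i) = (\<Sum>j<r. W i j s * s (m + j))" if "i < r" for s i
    using that by (simp add: H_def G_def D_def)
  have H_D: "H s D = s D * Rho s" for s by (simp add: H_def)
  \<comment> \<open>The lift commutes with \<open>F\<close> only over \<open>S\<close>, since
    \<open>T\<close> was replaced there by an invertible affine map.\<close>
  have step: "pnt (H s) = F (pnt s)" if s: "vec m s \<in> S" for s
  proof (rule eq_vecI)
    fix i assume "i < dim_vec (F (pnt s))"
    then have i: "i < D" using F_carrier[of "pnt s"] by simp
    show "pnt (H s) $ i = F (pnt s) $ i"
    proof (cases "i < m")
      case True
      then show ?thesis using B(1,3) TS[OF s]
        by (simp add: pnt_index H_u F_u pnt_first scalar_prod_def atLeast0LessThan add.commute)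
    next
      case False
      then obtain k where k: "i = m + k" "k < r" using i by (metis D_def add_diff_inverse_nat nat_add_left_cancel_less)
      have "mpoly_eval (pnt s) (M $$ (k, j)) = W k j s" if "j < r" for j
        unfolding W_def by (rule mpoly_eval_cong[OF M(2)[OF k(2) that]]) (simp add: pnt_index)
      then have "F (pnt s) $ i = Rho s * (\<Sum>j<r. W k j s * (s D * s (m + j)))"
        using k by (simp add: F_z Rho pnt_index)
      also have "\<dots> = s D * Rho s * (\<Sum>j<r. W k j s * s (m + j))"
        by (simp add: sum_distrib_left mult_ac)
      finally show ?thesis using k by (simp add: pnt_index H_w H_D)
    qed
  qed (use F_carrier[of "pnt s"] pnt_carrier[of "H s"] in simp)
  have orbit: "pnt ((H ^^ n) t0) = xs (N + n)" for n
  proof (induction n)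
    case 0
    show ?case
    proof (rule eq_vecI)
      fix i assume "i < dim_vec (xs (N + 0))"
      then have "i < D" using xs_carrier[of N] by simp
      then show "pnt ((H ^^ 0) t0) $ i = xs (N + 0) $ i" by (simp add: pnt_def t0_def)
    qed (use xs_carrier[of N] pnt_carrier[of t0] in simp)
  next
    case (Suc n)
    have "vec m ((H ^^ n) t0) \<in> S" using xs_S[of n] by (simp add: pnt_first flip: Suc)
    then show ?case using step Suc by (simp add: xs_def)
  qed

  interpret skew_system R m r "\<lambda>i j. B $$ (i, j)" "($) c" W G' Jb \<rho>s t0 G Rho hh H D l cc
  proof (unfold_locales, rule D_def, rule G_def, rule Rho_def, rule hh_def, rule H_def, rule R(2))
    show "B $$ (i, j) \<in> R" if "i < m" "j < m" for i j by (rule mat_R that)+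
    show "c $ i \<in> R" if "i < m" for i by (rule vec_R that)+
    show "W i j \<in> polyfun R" if "i < r" "j < r" for i j
      unfolding W_def using that
      by (intro mpoly_eval_polyfun[OF sR M(2) M_R(1)]) (auto simp: polyfun_var)
    show "W i j s = W i j s'" if "i < r" "j < r" "\<And>k. k < m \<Longrightarrow> s k = s' k" for i j s s'
      unfolding W_def using that(3) by (intro mpoly_eval_cong[OF M(2)[OF that(1,2)]]) simp
    show "G' i \<in> polyfun R" if i: "i < D" for i
    proof -
      have U: "(\<lambda>s. U s $ k) \<in> polyfun R" if "k < m" for k
        using that mat_R vec_R by (auto simp: U_def intro!: polyfun_intros[OF sR])
      show ?thesis
      proof (cases "i < m")
        case True
        then have "G' i = (\<lambda>s. U s $ i)" by (intro ext) (simp add: G'_def)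
        then show ?thesis using U[OF True] by simp
      next
        case False
        then have k: "i - m < r" using i by (simp add: D_def)
        have "(\<lambda>s. \<Sum>j<r. mpoly_eval (U s) (M' $$ (i - m, j)) * s (m + j)) \<in> polyfun R"
          using U k by (intro polyfun_sum[OF sR] polyfun_mult polyfun_var mpoly_eval_polyfun[OF sR M'(2) M_R(2)]) auto
        moreover have "G' i = (\<lambda>s. \<Sum>j<r. mpoly_eval (U s) (M' $$ (i - m, j)) * s (m + j))"
          using False by (intro ext) (simp add: G'_def)
        ultimately show ?thesis by simp
      qed
    qed
    show "G' i ((G s)(D := d)) = s i" if i: "i < D" for i s d
    proof -
      let ?y = "(G s)(D := d)"
      have U: "U ?y = vec m s"
      proof (rule eq_vecI)
        fix k assume "k < dim_vec (vec m s)"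
        then have k: "k < m" by simp
        have "?y j - c $ j = (B *\<^sub>v vec m s) $ j" if "j < m" for j
          using that B(1) by (simp add: G_def D_def scalar_prod_def atLeast0LessThan)
        then have "U ?y $ k = (B' *\<^sub>v (B *\<^sub>v vec m s)) $ k"
          using k B by (simp add: U_def scalar_prod_def atLeast0LessThan del: fun_upd_apply index_mult_mat_vec)
            (simp add: scalar_prod_def atLeast0LessThan)
        also have "B' *\<^sub>v (B *\<^sub>v vec m s) = (B' * B) *\<^sub>v vec m s"
          by (rule assoc_mult_mat_vec[OF B(2,1), symmetric]) simp
        finally show "U ?y $ k = vec m s $ k" by (simp add: B(4) del: fun_upd_apply)
      qed (simp add: U_def)
      show ?thesis
      proof (cases "i < m")
        case True
        then show ?thesis by (simp add: G'_def U)
      next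
        case False
        then obtain k where k: "i = m + k" "k < r" using i by (metis D_def add_diff_inverse_nat nat_add_left_cancel_less)
        have "?y (m + j) = (\<Sum>i<r. mpoly_eval (vec m s) (M $$ (j, i)) * s (m + i))" if "j < r" for j
          using that by (simp add: G_def D_def W_def)
        then show ?thesis using k M_inverse[OF k(2), of "vec m s" "\<lambda>j. s (m + j)"] by (simp add: G'_def U)
      qed
    qed
    show "\<rho>s j \<in> polyfun R" for j by (rule \<rho>s_polyfun[OF sR \<rho>_R])
    show "\<rho>s j s = \<rho>s j s'" if "\<And>k. k < D \<Longrightarrow> s k = s' k" for j s s' by (rule \<rho>s_dep[OF that])
    show "t0 i \<in> R" "t0 D = 1" "D < i \<Longrightarrow> t0 i = 0" for i
      using xs_R subring_zero[OF sR] subring_one[OF sR] by (auto simp: t0_def)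
    show "\<exists>a\<in>R. hh ((H ^^ n) t0) * a = (\<Prod>i<l. Rho ((H ^^ (n + i)) t0)) ^ cc" for n
    proof
      define X where "X i = (if i < m then xs n $ i else if i < D then xs (N + n) $ i else 0)" for i
      have lift: "lift X = xs (N + n)" unfolding X_def[abs_def] xs_def by (rule lift_orbit[OF x0])
      have "xs (N + (n + i)) = (F ^^ i) (xs (N + n))" for i
        by (simp add: xs_def flip: funpow_add[unfolded o_def fun_eq_iff, rule_format]) (simp add: add_ac)
      then show "hh ((H ^^ n) t0) * \<alpha> X = (\<Prod>i<l. Rho ((H ^^ (n + i)) t0)) ^ cc"
        unfolding Rho hh orbit using \<alpha>(2)[of X] by (simp add: lift)
      show "\<alpha> X \<in> R"
        by (rule polyfun_values[OF \<alpha>_R sR]) (auto simp: X_def D_def xs_R subring_zero[OF sR])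
    qed
  qed

  obtain n0 K where K: "K > 0" and classes: "\<And>J' fs a k. (\<And>j. fs j \<in> polyfun R) \<Longrightarrow>
      (\<And>j x y. (\<forall>k<D. x k = y k) \<Longrightarrow> fs j x = fs j y) \<Longrightarrow> a \<ge> n0 \<Longrightarrow>
      infinite {k. (\<Sum>j<J'. (H ^^ (a + k * K)) t0 D ^ j * fs j ((H ^^ (a + k * K)) t0)) = 0} \<Longrightarrow>
      (\<Sum>j<J'. (H ^^ (a + k * K)) t0 D ^ j * fs j ((H ^^ (a + k * K)) t0)) = 0"
    using zeros_on_classes by (elim exE conjE) blast
  have "mpoly_eval ((F ^^ (a + k * K)) x0) f = 0"
    if f: "f \<in> polys D" and a: "N + n0 \<le> a" and inf: "infinite {k. mpoly_eval ((F ^^ (a + k * K)) x0) f = 0}" for f a k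
  proof -
    define a' where "a' = a - N"
    have a': "n0 \<le> a'" "a = N + a'" using a by (simp_all add: a'_def)
    from eval_components[OF sR f] obtain n :: nat and J' fs where fs: "\<And>j i. fs j i \<in> polyfun R"
      "\<And>j i x y. (\<forall>k<D. x k = y k) \<Longrightarrow> fs j i x = fs j i y"
      "\<forall>s. (\<forall>i. s i \<in> R) \<longrightarrow> (mpoly_eval (pnt s) f = 0 \<longleftrightarrow> (\<forall>j<n. (\<Sum>i<J'. s D ^ i * fs j i s) = 0))"
      by (elim exE conjE) blast
    have eval: "mpoly_eval ((F ^^ (a + k * K)) x0) f = 0 \<longleftrightarrow>
        (\<forall>j<n. (\<Sum>i<J'. (H ^^ (a' + k * K)) t0 D ^ i * fs j i ((H ^^ (a' + k * K)) t0)) = 0)" for k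
    proof -
      have "(F ^^ (a + k * K)) x0 = pnt ((H ^^ (a' + k * K)) t0)" by (simp add: orbit a' xs_def add.assoc)
      then show ?thesis using fs(3) s_R by simp
    qed
    have "(\<Sum>i<J'. (H ^^ (a' + k * K)) t0 D ^ i * fs j i ((H ^^ (a' + k * K)) t0)) = 0" if j: "j < n" for j
    proof (rule classes[OF fs(1) fs(2) a'(1)])
      show "infinite {k. (\<Sum>i<J'. (H ^^ (a' + k * K)) t0 D ^ i * fs j i ((H ^^ (a' + k * K)) t0)) = 0}"
        by (rule infinite_super[OF _ inf]) (use j in \<open>auto simp: eval\<close>)
    qed
    then show ?thesis by (simp add: eval)
  qed
  then show ?thesis using K by (rule_tac exI[of _ "N + n0"], rule_tac exI[of _ K]) blast
qed

end

theorem theorem1p3: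
  fixes m r d N l :: nat
    and T :: "'k::{alg_closed_field, field_char_0} vec \<Rightarrow> 'k vec"
    and M :: "'k mpoly mat"
    and \<rho> :: "'k mpoly"
    and F :: "'k vec \<Rightarrow> 'k vec"
    and S Z C :: "'k vec set"
  assumes "r \<ge> 1"
    and "affine_endo m T"
    and "S = (T ^^ N) ` carrier_vec m"
    and "S = (T ^^ (N + 1)) ` carrier_vec m"
    and "M \<in> GL_polys r m"
    and "d \<ge> 2"
    and "\<rho> \<noteq> 0"
    and "\<rho> \<in> z_ideal_power m r (d - 1)"
    and "F = skew_map m r T \<rho> M"
    and "Z = {u @\<^sub>v 0\<^sub>v r | u. u \<in> S}"
    and "C = {u @\<^sub>v z | u z. u \<in> S \<and> z \<in> carrier_vec r \<and>
               mpoly_eval (u @\<^sub>v z) (det (z_jacobian m r (fiber_polys m r \<rho> M))) = 0}"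
    and "l \<ge> 1"
    and "(F ^^ l) ` C \<subseteq> Z"
  shows "\<forall>x \<in> carrier_vec (m + r). \<forall>V. closed_subvariety (m + r) V \<longrightarrow>
           (\<exists>\<A>. finite \<A> \<and> (\<forall>A \<in> \<A>. arith_prog A) \<and> {n. (F ^^ n) x \<in> V} = \<Union>\<A>)"
proof (intro ballI allI impI)
  fix x :: "'k vec" and V :: "'k vec set"
  assume x: "x \<in> carrier_vec (m + r)" and V: "closed_subvariety (m + r) V"
  obtain L b where L: "L \<in> carrier_mat m m" "b \<in> carrier_vec m" "\<And>u. u \<in> carrier_vec m \<Longrightarrow> T u = L *\<^sub>v u + b"
    using assms(2) unfolding affine_endo_def by blast
  obtain M' where M: "M \<in> carrier_mat r r" "elements_mat M \<subseteq> polys m"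
    "M' \<in> carrier_mat r r" "elements_mat M' \<subseteq> polys m" "inverts_mat M' M"
    using assms(5) unfolding GL_polys_def by blast
  interpret skew_setup m r N l T M M' \<rho> F S C L b "m + r"
  proof (unfold_locales, rule refl, rule L(1), rule L(2), erule L(3), rule assms(3), rule assms(4), rule M(1))
    show "M $$ (i, j) \<in> polys m" "M' $$ (i, j) \<in> polys m" if "i < r" "j < r" for i j
      by (rule subsetD[OF M(2) elements_matI[OF M(1) that refl]], rule subsetD[OF M(4) elements_matI[OF M(3) that refl]])
    show "M' \<in> carrier_mat r r" by (rule M)
    show "M' * M = 1\<^sub>m r" using M by (simp add: inverts_mat_def)
    show "\<rho> \<in> polys (m + r)" using assms(8) by (simp add: z_ideal_power_def)
    show "1 \<le> z_degree m r a" if "a \<in> Poly_Mapping.keys \<rho>" for a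
      using assms(6,8) that by (force simp: z_ideal_power_def z_degree_def)
    show "F = skew_map m r T \<rho> M" "C = {u @\<^sub>v z | u z. u \<in> S \<and> z \<in> carrier_vec r \<and>
               mpoly_eval (u @\<^sub>v z) (det (z_jacobian m r (fiber_polys m r \<rho> M))) = 0}" "l \<ge> 1"
      "(F ^^ l) ` C \<subseteq> {u @\<^sub>v 0\<^sub>v r | u. u \<in> S}"
      using assms(9,11,12,13) unfolding assms(10) by blast+
  qed
  obtain n0 K where K: "K > 0" and zeros: "\<And>f a k. f \<in> polys (m + r) \<Longrightarrow> a \<ge> n0 \<Longrightarrow>
      infinite {k. mpoly_eval ((F ^^ (a + k * K)) x) f = 0} \<Longrightarrow> mpoly_eval ((F ^^ (a + k * K)) x) f = 0"
    using orbit_zeros_on_classes[OF x] by blast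
  obtain P where P: "P \<subseteq> polys (m + r)" "V = {x \<in> carrier_vec (m + r). \<forall>p\<in>P. mpoly_eval x p = 0}"
    using V unfolding closed_subvariety_def by blast
  show "\<exists>\<A>. finite \<A> \<and> (\<forall>A \<in> \<A>. arith_prog A) \<and> {n. (F ^^ n) x \<in> V} = \<Union>\<A>"
  proof (rule finite_union_arith_progs[OF K])
    fix a assume a: "n0 \<le> a" and inf: "infinite {k. a + k * K \<in> {n. (F ^^ n) x \<in> V}}"
    \<comment> \<open>Infinitely many visits to \<open>V\<close> give infinitely many zeros of each
      equation. As \<open>n0\<close> and \<open>K\<close> do not depend on \<open>p\<close>, the set
      \<open>P\<close> may be infinite.\<close>
    have "mpoly_eval ((F ^^ (a + k * K)) x) p = 0" if p: "p \<in> P" for k p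
      by (rule zeros[OF _ a infinite_super[OF _ inf]]) (use p P in auto)
    then show "\<forall>k. a + k * K \<in> {n. (F ^^ n) x \<in> V}" using F_pow_carrier[OF x] P(2) by auto
  qed
qed

end
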